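(* Under the assumptions on the constants $\rho,\alpha,\alpha_1,\gamma,\mu,\beta$, the delay $\tau$ and the weights $\delta_1,\delta_2$ listed in the context, for any initial datum $U_0=(v_0,v_1,p_0,p_1,g_0(\cdot,-\,\cdot\,\tau(0)))^T\in\mathcal{H}$ there exists a unique solution $U=(v,f,p,h,z)^T\in C^0([0,\infty),\mathcal{H})$ of the problem $$U_t=\mathcal{A}(t)U\quad (t>0),\qquad U(0)=U_0 .$$ Moreover, if $U_0\in D(\mathcal{A}(0))$, then $$U\in C([0,\infty),D(\mathcal{A}(0)))\cap C^1([0,\infty),\mathcal{H}).$$
   Context: Let $L>0$ and let $\rho,\alpha,\alpha_1,\gamma,\mu,\beta$ be positive constants with $\alpha=\alpha_1+\gamma^2\beta$. Assumptions on the delay: there are constants $\tau_0,\overline{\tau}>0$ and $d<1$ such that $0<\tau_0\le\tau(t)\le\overline{\tau}$ and $\tau'(t)\le d<1$ for all $t>0$, and $\tau\in W^{2,\infty}([0,T])$ for all $T>0$. Assumptions on the weights: $\delta_1:[0,\infty)\to[0,\infty)$ is non-increasing and of class $C^1$, with constants $M_1>0$, $\delta_0>0$ such that $|\delta_1'(t)/\delta_1(t)|\le M_1$ and $0<\delta_0\le\delta_1(t)$ for all $t\ge0$; $\delta_2:[0,\infty)\to\mathbb{R}$ is of class $C^1$ (not necessarily of constant sign or monotone), with $|\delta_2(t)|\le\beta_0\delta_1(t)$ and $|\delta_2'(t)|\le M_2\delta_1(t)$ for all $t$, for some constants $0<\beta_0<\sqrt{1-d}$ and $M_2>0$. The system is,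 for $x\in(0,L)$, $r\in(0,1)$, $t>0$, $$\rho v_{tt}-\alpha v_{xx}+\gamma\beta p_{xx}+\delta_1(t)v_t(x,t)+\delta_2(t)z(x,1,t)=0,$$ $$\mu p_{tt}-\beta p_{xx}+\gamma\beta v_{xx}=0,$$ $$\tau(t)z_t(x,r,t)+(1-\tau'(t)r)z_r(x,r,t)=0,$$ with boundary conditions $v(0,t)=\alpha v_x(L,t)-\gamma\beta p_x(L,t)=0$, $p(0,t)=p_x(L,t)-\gamma v_x(L,t)=0$, $z(x,0,t)=v_t(x,t)$, and initial conditions $(v,p,v_t,p_t)(x,0)=(v_0,p_0,v_1,p_1)(x)$, $z(x,r,0)=g_0(x,-r\tau(0))$. Here $z(x,r,t)=v_t(x,t-\tau(t)r)$, so this is the piezoelectric beam system with delay term $\delta_2(t)v_t(x,t-\tau(t))$. With $f=v_t$, $h=p_t$ and $U=(v,f,p,h,z)^T$ it is written as $U_t=\mathcal{A}(t)U$, $U(0)=U_0=(v_0,v_1,p_0,p_1,g_0(\cdot,-\,\cdot\,\tau(0)))^T$, where the last component of $U_0$ is the function $(x,r)\mapsto g_0(x,-r\tau(0))$. Let $H^1_*(0,L)=\{u\in H^1(0,L):u(0)=0\}$. The energy space is $$\mathcal{H}=\left(H^1_*(0,L)\times L^2(0,L)\right)^2\times L^2((0,L)\times(0,1)),$$ with the time-dependent inner product (all giving norms equivalent to the usual product norm) $$\langle M,N\rangle_t=\rho\int_0^Lf\tilde f\,dx+\mu\int_0^Lh\tilde h\,dx+\alpha_1\int_0^Lv_x\tilde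 v_x\,dx+\beta\int_0^L(\gamma v_x-p_x)(\gamma\tilde v_x-\tilde p_x)\,dx+\xi(t)\tau(t)\int_0^L\int_0^1z\tilde z\,dr\,dx$$ for $M=(v,f,p,h,z)^T$, $N=(\tilde v,\tilde f,\tilde p,\tilde h,\tilde z)^T$, where $\xi(t)=\overline{\xi}\delta_1(t)$ with a fixed constant $\overline{\xi}$ satisfying $\frac{\beta_0}{\sqrt{1-d}}<\overline{\xi}<2-\frac{\beta_0}{\sqrt{1-d}}$. The operator is $$\mathcal{A}(t)\begin{pmatrix} v \\ f \\ p \\ h \\ z \end{pmatrix}=\begin{pmatrix} f \\ \frac{\alpha}{\rho}v_{xx}-\frac{\gamma\beta}{\rho}p_{xx}-\frac{\delta_1(t)}{\rho}f-\frac{\delta_2(t)}{\rho}z(\cdot,1) \\ h \\ -\frac{\gamma\beta}{\mu}v_{xx}+\frac{\beta}{\mu}p_{xx} \\ \frac{\tau'(t)r-1}{\tau(t)}z_r \end{pmatrix},$$ with domain (independent of $t$) $$D(\mathcal{A}(t))=D(\mathcal{A}(0))=\{(v,f,p,h,z)^T\in H:\ f=z(\cdot,0)\text{ in }(0,L),\ v_x(L)=p_x(L)=0\},$$ $$H=\left((H^2(0,L)\cap H^1_*(0,L))\times H^1_*(0,L)\right)^2\times L^2((0,L);H^1(0,1)).$$ For $U_0\in D(\mathcal{A}(0))$ the equation holds classically in $\mathcal{H}$. For general $U_0\in\mathcal{H}$, a solution is understood in the usual generalized (mild) sense: $U\in C([0,\infty),\mathcal{H})$ is the limit, uniformly on bounded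 time intervals in $\mathcal{H}$, of classical solutions whose initial data in $D(\mathcal{A}(0))$ converge to $U_0$ in $\mathcal{H}$. *)

theory Defs
  imports "HOL-Analysis.Analysis"
begin

section \<open>Lebesgue and Sobolev spaces\<close>

text \<open>
  Elements of Lebesgue and Sobolev spaces are represented by functions; equality in these
  spaces is equality almost everywhere, and every notion below respects it. Membership only
  constrains a function on the set in question.
\<close>

definition L2 :: "'a::euclidean_space set \<Rightarrow> ('a \<Rightarrow> real) set" where
  "L2 S = {u \<in> borel_measurable (lebesgue_on S). integrable (lebesgue_on S) (\<lambda>x. (u x)\<^sup>2)}"

definition Linf :: "real \<Rightarrow> real \<Rightarrow> (real \<Rightarrow> real) set" where
  "Linf a b = {u \<in> borel_measurable (lebesgue_on {a<..<b}).
                 \<exists>C. AE x in lebesgue_on {a<..<b}. \<bar>u x\<bar> \<le> C}"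

definition test_functions :: "real \<Rightarrow> real \<Rightarrow> (real \<Rightarrow> real) set" where
  "test_functions a b = {\<phi>. (\<forall>n x. ((deriv ^^ n) \<phi>) differentiable (at x)) \<and>
                            compact (closure {x. \<phi> x \<noteq> 0}) \<and>
                            closure {x. \<phi> x \<noteq> 0} \<subseteq> {a<..<b}}"

text \<open>
  The Bochner integral of a non-integrable function is 0, so the next definition is only
  meaningful for locally integrable \<open>u\<close> and \<open>g\<close>; all uses are restricted to
  square integrable or essentially bounded functions.
\<close>

definition has_weak_deriv :: "real \<Rightarrow> real \<Rightarrow> (real \<Rightarrow> real) \<Rightarrow> (real \<Rightarrow> real) \<Rightarrow> bool" where
  "has_weak_deriv a b u g \<longleftrightarrow>
     (\<forall>\<phi>\<in>test_functions a b.
        (LINT x|lebesgue_on {a<..<b}. u x * deriv \<phi> x) =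
        - (LINT x|lebesgue_on {a<..<b}. g x * \<phi> x))"

definition has_L2_deriv :: "real \<Rightarrow> real \<Rightarrow> (real \<Rightarrow> real) \<Rightarrow> (real \<Rightarrow> real) \<Rightarrow> bool" where
  "has_L2_deriv a b u g \<longleftrightarrow> u \<in> L2 {a<..<b} \<and> g \<in> L2 {a<..<b} \<and> has_weak_deriv a b u g"

definition H1 :: "real \<Rightarrow> real \<Rightarrow> (real \<Rightarrow> real) set" where
  "H1 a b = {u. \<exists>g. has_L2_deriv a b u g}"

definition wderiv :: "real \<Rightarrow> real \<Rightarrow> (real \<Rightarrow> real) \<Rightarrow> real \<Rightarrow> real" where
  "wderiv a b u = (SOME g. has_L2_deriv a b u g)"

definition H2 :: "real \<Rightarrow> real \<Rightarrow> (real \<Rightarrow> real) set" where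
  "H2 a b = {u \<in> H1 a b. wderiv a b u \<in> H1 a b}"

text \<open>
  A function in \<open>H1 a b\<close> has exactly one representative that is continuous on
  the closed interval; its pointwise values, in particular the boundary values, are those of
  this representative.
\<close>

definition cont_rep :: "real \<Rightarrow> real \<Rightarrow> (real \<Rightarrow> real) \<Rightarrow> real \<Rightarrow> real" where
  "cont_rep a b u = (SOME w. continuous_on {a..b} w \<and> (AE x in lebesgue_on {a<..<b}. w x = u x))"

definition H1_star :: "real \<Rightarrow> (real \<Rightarrow> real) set" where
  "H1_star L = {u \<in> H1 0 L. cont_rep 0 L u 0 = 0}"

definition W2inf :: "real \<Rightarrow> (real \<Rightarrow> real) set" where
  "W2inf T = {u \<in> Linf 0 T. \<exists>g\<in>Linf 0 T. \<exists>h\<in>Linf 0 T.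
                has_weak_deriv 0 T u g \<and> has_weak_deriv 0 T g h}"

text \<open>
  \<open>L2_H1 L\<close> is the Bochner space of square integrable functions from \<open>(0,L)\<close> into
  \<open>H\<^sup>1(0,1)\<close>, with its elements regarded as functions of the pair \<open>(x,r)\<close>.
\<close>

definition has_L2_deriv_r :: "real \<Rightarrow> (real \<times> real \<Rightarrow> real) \<Rightarrow> (real \<times> real \<Rightarrow> real) \<Rightarrow> bool" where
  "has_L2_deriv_r L z w \<longleftrightarrow>
     z \<in> L2 ({0<..<L} \<times> {0<..<1}) \<and> w \<in> L2 ({0<..<L} \<times> {0<..<1}) \<and>
     (AE x in lebesgue_on {0<..<L}. has_L2_deriv 0 1 (\<lambda>r. z (x, r)) (\<lambda>r. w (x, r)))"

definition L2_H1 :: "real \<Rightarrow> (real \<times> real \<Rightarrow> real) set" where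
  "L2_H1 L = {z. \<exists>w. has_L2_deriv_r L z w}"

definition wderiv_r :: "real \<Rightarrow> (real \<times> real \<Rightarrow> real) \<Rightarrow> real \<times> real \<Rightarrow> real" where
  "wderiv_r L z = (SOME w. has_L2_deriv_r L z w)"

definition trace_r :: "(real \<times> real \<Rightarrow> real) \<Rightarrow> real \<Rightarrow> real \<Rightarrow> real" where
  "trace_r z c x = cont_rep 0 1 (\<lambda>r. z (x, r)) c"


section \<open>The energy space and the operator\<close>

text \<open>A state is a tuple \<open>(v, f, p, h, z)\<close>.\<close>

type_synonym state =
  "(real \<Rightarrow> real) \<times> (real \<Rightarrow> real) \<times> (real \<Rightarrow> real) \<times> (real \<Rightarrow> real) \<times> (real \<times> real \<Rightarrow> real)"

fun state_scale :: "real \<Rightarrow> state \<Rightarrow> state" where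
  "state_scale c (v, f, p, h, z) =
     (\<lambda>x. c * v x, \<lambda>x. c * f x, \<lambda>x. c * p x, \<lambda>x. c * h x, \<lambda>y. c * z y)"

fun state_eq :: "real \<Rightarrow> state \<Rightarrow> state \<Rightarrow> bool" where
  "state_eq L (v, f, p, h, z) (v', f', p', h', z') \<longleftrightarrow>
     (AE x in lebesgue_on {0<..<L}. v x = v' x \<and> f x = f' x \<and> p x = p' x \<and> h x = h' x) \<and>
     (AE y in lebesgue_on ({0<..<L} \<times> {0<..<1}). z y = z' y)"

definition energy_space :: "real \<Rightarrow> state set" where
  "energy_space L =
     H1_star L \<times> L2 {0<..<L} \<times> H1_star L \<times> L2 {0<..<L} \<times> L2 ({0<..<L} \<times> {0<..<1})"

fun energy_inner ::
  "real \<Rightarrow> real \<Rightarrow> real \<Rightarrow> real \<Rightarrow> real \<Rightarrow> real \<Rightarrow> (real \<Rightarrow> real) \<Rightarrow> (real \<Rightarrow> real) \<Rightarrow>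
   real \<Rightarrow> state \<Rightarrow> state \<Rightarrow> real" where
  "energy_inner L \<rho> \<alpha>\<^sub>1 \<gamma> \<mu> \<beta> \<xi> \<tau> t (v, f, p, h, z) (v', f', p', h', z') =
     \<rho> * (LINT x|lebesgue_on {0<..<L}. f x * f' x) +
     \<mu> * (LINT x|lebesgue_on {0<..<L}. h x * h' x) +
     \<alpha>\<^sub>1 * (LINT x|lebesgue_on {0<..<L}. wderiv 0 L v x * wderiv 0 L v' x) +
     \<beta> * (LINT x|lebesgue_on {0<..<L}.
            (\<gamma> * wderiv 0 L v x - wderiv 0 L p x) * (\<gamma> * wderiv 0 L v' x - wderiv 0 L p' x)) +
     \<xi> t * \<tau> t * (LINT y|lebesgue_on ({0<..<L} \<times> {0<..<1}). z y * z' y)"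

definition energy_norm ::
  "real \<Rightarrow> real \<Rightarrow> real \<Rightarrow> real \<Rightarrow> real \<Rightarrow> real \<Rightarrow> (real \<Rightarrow> real) \<Rightarrow> (real \<Rightarrow> real) \<Rightarrow>
   real \<Rightarrow> state \<Rightarrow> real" where
  "energy_norm L \<rho> \<alpha>\<^sub>1 \<gamma> \<mu> \<beta> \<xi> \<tau> t M = sqrt (energy_inner L \<rho> \<alpha>\<^sub>1 \<gamma> \<mu> \<beta> \<xi> \<tau> t M M)"

definition beam_domain :: "real \<Rightarrow> state set" where
  "beam_domain L = {(v, f, p, h, z).
     v \<in> H2 0 L \<inter> H1_star L \<and> f \<in> H1_star L \<and> p \<in> H2 0 L \<inter> H1_star L \<and> h \<in> H1_star L \<and>
     z \<in> L2_H1 L \<and>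
     (AE x in lebesgue_on {0<..<L}. f x = trace_r z 0 x) \<and>
     cont_rep 0 L (wderiv 0 L v) L = 0 \<and> cont_rep 0 L (wderiv 0 L p) L = 0}"

text \<open>In \<open>beam_op\<close>, \<open>\<tau>'\<close> is the derivative of the delay \<open>\<tau>\<close>.\<close>

fun beam_op ::
  "real \<Rightarrow> real \<Rightarrow> real \<Rightarrow> real \<Rightarrow> real \<Rightarrow> real \<Rightarrow> (real \<Rightarrow> real) \<Rightarrow> (real \<Rightarrow> real) \<Rightarrow>
   (real \<Rightarrow> real) \<Rightarrow> (real \<Rightarrow> real) \<Rightarrow> real \<Rightarrow> state \<Rightarrow> state" where
  "beam_op L \<rho> \<alpha> \<gamma> \<mu> \<beta> \<delta>\<^sub>1 \<delta>\<^sub>2 \<tau> \<tau>' t (v, f, p, h, z) =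
     (let v_xx = wderiv 0 L (wderiv 0 L v); p_xx = wderiv 0 L (wderiv 0 L p) in
      (f,
       \<lambda>x. \<alpha> / \<rho> * v_xx x - \<gamma> * \<beta> / \<rho> * p_xx x - \<delta>\<^sub>1 t / \<rho> * f x - \<delta>\<^sub>2 t / \<rho> * trace_r z 1 x,
       h,
       \<lambda>x. - (\<gamma> * \<beta> / \<mu>) * v_xx x + \<beta> / \<mu> * p_xx x,
       \<lambda>(x, r). (\<tau>' t * r - 1) / \<tau> t * wderiv_r L z (x, r)))"


section \<open>Solutions of the evolution equation\<close>

text \<open>
  \<open>N\<close> is the (semi)norm on states and \<open>X\<close> the space in which the curve lives.
  Subtraction of states is the library's componentwise and pointwise one.
\<close>

definition C_curve :: "state set \<Rightarrow> (state \<Rightarrow> real) \<Rightarrow> (real \<Rightarrow> state) \<Rightarrow> bool" where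
  "C_curve X N U \<longleftrightarrow>
     (\<forall>t\<ge>0. U t \<in> X \<and> ((\<lambda>s. N (U s - U t)) \<longlongrightarrow> 0) (at t within {0..}))"

definition has_curve_deriv :: "(state \<Rightarrow> real) \<Rightarrow> (real \<Rightarrow> state) \<Rightarrow> state \<Rightarrow> real \<Rightarrow> bool" where
  "has_curve_deriv N U W t \<longleftrightarrow>
     ((\<lambda>s. N (state_scale (1 / (s - t)) (U s - U t) - W)) \<longlongrightarrow> 0) (at t within {0..})"

definition C1_curve :: "state set \<Rightarrow> (state \<Rightarrow> real) \<Rightarrow> (real \<Rightarrow> state) \<Rightarrow> bool" where
  "C1_curve X N U \<longleftrightarrow>
     C_curve X N U \<and> (\<exists>W. C_curve X N W \<and> (\<forall>t\<ge>0. has_curve_deriv N U (W t) t))"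

definition graph_norm :: "(state \<Rightarrow> real) \<Rightarrow> (state \<Rightarrow> state) \<Rightarrow> state \<Rightarrow> real" where
  "graph_norm N A M = N M + N (A M)"

definition classical_solution ::
  "real \<Rightarrow> (state \<Rightarrow> real) \<Rightarrow> (real \<Rightarrow> state \<Rightarrow> state) \<Rightarrow> state \<Rightarrow> (real \<Rightarrow> state) \<Rightarrow> bool" where
  "classical_solution L N A U\<^sub>0 U \<longleftrightarrow>
     C_curve (energy_space L) N U \<and>
     (\<forall>t\<ge>0. U t \<in> beam_domain L) \<and>
     (\<forall>t>0. has_curve_deriv N U (A t (U t)) t) \<and>
     state_eq L (U 0) U\<^sub>0"

definition mild_solution ::
  "real \<Rightarrow> (state \<Rightarrow> real) \<Rightarrow> (real \<Rightarrow> state \<Rightarrow> state) \<Rightarrow> state \<Rightarrow> (real \<Rightarrow> state) \<Rightarrow> bool" where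
  "mild_solution L N A U\<^sub>0 U \<longleftrightarrow>
     C_curve (energy_space L) N U \<and> state_eq L (U 0) U\<^sub>0 \<and>
     (\<exists>V\<^sub>0 V.
        (\<forall>n. V\<^sub>0 n \<in> beam_domain L \<and> classical_solution L N A (V\<^sub>0 n) (V n)) \<and>
        (\<lambda>n. N (V\<^sub>0 n - U\<^sub>0)) \<longlonglongrightarrow> 0 \<and>
        (\<forall>T>0. uniform_limit {0..T} (\<lambda>n t. N (V n t - U t)) (\<lambda>_. 0) sequentially))"

end

theory Submission
  imports Defs
begin

text \<open>In the scaled variables $(\sqrt\rho\,f, \sqrt\mu\,h, \sqrt{\alpha_1}\,v_x,
\sqrt\beta\,(\gamma v_x - p_x), \sqrt\rho\,z)$ the beam is a first order system on a closed
subspace of a power of $L^2$. Every state in the domain is obtained by integrating arbitrary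
square integrable derivatives from the end where the boundary condition holds, so the domain is
the range of one bounded operator $B$, and the generator at $B y$ is $C(t) y$ with $C(t)$ bounded
and locally Lipschitz in $t$. The form $\langle B y, C(t) y\rangle$ is at most
$\kappa \|B y\|^2$, because the outgoing trace of $z$ is damped with weight $1 - \tau' \ge 1 - d > 0$
and absorbs the delay term. This gives uniqueness and, applied to difference quotients, a bound of
$y(t)$ by $y(0)$, so it suffices to solve the problem for a dense set of $y(0)$. For the modes
$\sin((k + 1/2) \pi x / L)$ with a polynomial history the system reduces to an ordinary delay
equation, and these modes span a dense subspace. Weak derivatives enter only at the end: by the
du Bois-Reymond lemma a function is in $H^1$ iff it is a primitive of a square integrable function.\<close>

section \<open>Square integrable functions on the plane\<close>

text \<open>The domain is the same at all times, so coordinates $y$ can be fixed once; the price is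
  an implicit equation $(B y)' = C(t) y$ in which $y$ has no derivative of its own. The energy form
  controls only $B y$. Control of $y$ has to come from the time derivative of $B y$: it equals $C(t)
  y$, and $C(t)$ is bounded below on the space. Differencing in time produces $(C(t + h) - C(t)) y$,
  and there the second derivative of the delay is spent. Since $\<kappa>$ may be any constant, one
  fixed inner product serves all times; the energy norms enter only through equivalence with it, and
  the solution curve is chosen before any of them. The frequencies $(k + 1/2) \<pi> / L$ are those
  for which the sine vanishes at $0$ and its derivative at $L$. Within a mode the given history and
  the computed profile may have different slopes at time 0; this kink moves along $r = t /
  \<tau>(t)$, where $z_r$ jumps, yet $z_r$ stays continuous in time with values in $L^2$.\<close>

definition sq_int :: "'a measure => ('a => real) set" where
 "sq_int M = {f \<in> borel_measurable M. integrable M (\<lambda>x. (f x)\<^sup>2)}"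

abbreviation sqi :: "('a::euclidean_space => real) set" where "sqi \<equiv> sq_int lborel"

abbreviation borel_fun :: "('a::topological_space => 'b::topological_space) set" where
 "borel_fun \<equiv> borel_measurable borel"

abbreviation ind :: "real => real => real" where "ind l \<equiv> indicator {0<..<l}"

lemmas lint_cong = Bochner_Integration.integral_cong[OF refl]

abbreviation at0 :: "real => real filter" where "at0 t \<equiv> at t within {0..}"

lemma continuous_abs_bounded:
 fixes f :: "real => real"
 assumes "continuous_on {a..b} f"
 shows "\<exists>C. \<forall>x\<in>{a..b}. \<bar>f x\<bar> \<le> C"
proof -
 have "bounded (f ` {a..b})" by (intro compact_imp_bounded compact_continuous_image assms) simp
 then show ?thesis by (simp add: bounded_iff)
qed

lemma sq_intI: "f \<in> borel_measurable M ==> integrable M (\<lambda>x. (f x)\<^sup>2) ==> f \<in> sq_int M"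
 by (simp add: sq_int_def)

lemma sq_int_measurable: "f \<in> sq_int M ==> f \<in> borel_measurable M"
 by (simp add: sq_int_def)

lemma sq_int_integrable_sq: "f \<in> sq_int M ==> integrable M (\<lambda>x. (f x)\<^sup>2)"
 by (simp add: sq_int_def)

lemma sq_int_integrable_mult:
 assumes f: "f \<in> sq_int M" and g: "g \<in> sq_int M"
 shows "integrable M (\<lambda>x. f x * g x)"
proof (rule Bochner_Integration.integrable_bound)
 show "integrable M (\<lambda>x. (f x)\<^sup>2 + (g x)\<^sup>2)"
  using f g by (auto simp: sq_int_def)
 show "(\<lambda>x. f x * g x) \<in> borel_measurable M"
  using f g by (auto simp: sq_int_def)
 have "\<bar>x * y\<bar> \<le> x\<^sup>2 + y\<^sup>2" for x y :: real
 proof -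
  have "2 * (\<bar>x\<bar> * \<bar>y\<bar>) \<le> x\<^sup>2 + y\<^sup>2"
   using sum_squares_bound[of "\<bar>x\<bar>" "\<bar>y\<bar>"] by simp
  moreover have "0 \<le> \<bar>x\<bar> * \<bar>y\<bar>" by simp
  ultimately show ?thesis unfolding abs_mult by linarith
 qed
 then show "AE x in M. norm (f x * g x) \<le> norm ((f x)\<^sup>2 + (g x)\<^sup>2)"
  by (auto simp: real_norm_def)
qed

lemma sq_int_bound:
 assumes g: "g \<in> sq_int M" and f: "f \<in> borel_measurable M" and le: "AE x in M. \<bar>f x\<bar> \<le> \<bar>g x\<bar>"
 shows "f \<in> sq_int M"
proof (rule sq_intI[OF f])
 show "integrable M (\<lambda>x. (f x)\<^sup>2)"
 proof (rule Bochner_Integration.integrable_bound[OF sq_int_integrable_sq[OF g]])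
  show "AE x in M. norm ((f x)\<^sup>2) \<le> norm ((g x)\<^sup>2)"
   using le by eventually_elim (simp add: abs_le_square_iff)
 qed (use f in measurable)
qed

lemma sq_int_add:
 assumes f: "f \<in> sq_int M" and g: "g \<in> sq_int M"
 shows "(\<lambda>x. f x + g x) \<in> sq_int M"
proof (rule sq_intI)
 show "(\<lambda>x. f x + g x) \<in> borel_measurable M"
  using f g by (auto simp: sq_int_def)
 have "integrable M (\<lambda>x. (f x)\<^sup>2 + (g x)\<^sup>2 + 2 * (f x * g x))"
  using f g sq_int_integrable_mult[OF f g] by (auto simp: sq_int_def)
 then show "integrable M (\<lambda>x. (f x + g x)\<^sup>2)"
  by (simp add: power2_sum algebra_simps)
qed

lemma sq_int_scale: "f \<in> sq_int M ==> (\<lambda>x. c * f x) \<in> sq_int M"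
 by (auto simp: sq_int_def power_mult_distrib)

lemma sq_int_uminus: "f \<in> sq_int M ==> (\<lambda>x. - f x) \<in> sq_int M"
 by (auto simp: sq_int_def)

lemma sq_int_diff: "f \<in> sq_int M ==> g \<in> sq_int M ==> (\<lambda>x. f x - g x) \<in> sq_int M"
 using sq_int_add[OF _ sq_int_uminus, of f M g] by simp

lemma sq_int_zero: "(\<lambda>x. 0) \<in> sq_int M"
 by (auto simp: sq_int_def)

lemma integral_sq_eq_0_iff:
 assumes "f \<in> sq_int M"
 shows "(LINT x|M. f x * f x) = 0 \<longleftrightarrow> (AE x in M. f x = 0)"
 using integral_nonneg_eq_0_iff_AE[OF sq_int_integrable_mult[OF assms assms]] by auto

\<comment> \<open>The Hilbert space of square integrable functions on the plane\<close>
quotient_type l2 = "real \<times> real => real" / partial: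
 "\<lambda>f g. f \<in> sqi \<and> g \<in> sqi \<and> (AE x in lborel. f x = g x)"
proof (rule part_equivpI)
 show "\<exists>x. x \<in> sqi \<and> x \<in> sqi \<and> (AE y in lborel. x y = x y)"
  using sq_int_zero by auto
next
 show "symp (\<lambda>f g. f \<in> sqi \<and> g \<in> sqi \<and> (AE x in lborel. f x = g x))"
  by (auto simp: symp_def elim: eventually_mono)
next
 show "transp (\<lambda>f g. f \<in> sqi \<and> g \<in> sqi \<and> (AE x in lborel. f x = g x))"
  by (auto simp: transp_def elim: eventually_elim2)
qed

instantiation l2 :: real_inner
begin

lift_definition zero_l2 :: l2 is "\<lambda>x. 0" by (simp add: sq_int_zero)

lift_definition plus_l2 :: "l2 => l2 => l2" is "\<lambda>f g x. f x + g x"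
 by (auto simp: sq_int_add elim: eventually_elim2)

lift_definition minus_l2 :: "l2 => l2 => l2" is "\<lambda>f g x. f x - g x"
 by (auto simp: sq_int_diff elim: eventually_elim2)

lift_definition uminus_l2 :: "l2 => l2" is "\<lambda>f x. - f x"
 by (auto simp: sq_int_uminus)

lift_definition scaleR_l2 :: "real => l2 => l2" is "\<lambda>c f x. c * f x"
 by (auto simp: sq_int_scale elim: eventually_mono)

lift_definition inner_l2 :: "l2 => l2 => real" is "\<lambda>f g. LINT x|lborel. f x * g x"
proof -
 fix f f' g g' :: "real \<times> real => real"
 assume *: "f \<in> sqi \<and> f' \<in> sqi \<and> (AE x in lborel. f x = f' x)"
  "g \<in> sqi \<and> g' \<in> sqi \<and> (AE x in lborel. g x = g' x)"
 then have "AE x in lborel. f x = f' x" "AE x in lborel. g x = g' x" by auto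
 then have "AE x in lborel. f x * g x = f' x * g' x" by eventually_elim simp
 moreover have "f \<in> borel_measurable lborel" "g \<in> borel_measurable lborel"
  "f' \<in> borel_measurable lborel" "g' \<in> borel_measurable lborel"
  using * by (auto simp: sq_int_def)
 ultimately show "(LINT x|lborel. f x * g x) = (LINT x|lborel. f' x * g' x)"
  by (intro integral_cong_AE) auto
qed

definition norm_l2 :: "l2 => real" where "norm_l2 x = sqrt (inner x x)"
definition dist_l2 :: "l2 => l2 => real" where "dist_l2 x y = norm (x - y)"
definition sgn_l2 :: "l2 => l2" where "sgn_l2 x = scaleR (inverse (norm x)) x"
definition uniformity_l2 :: "(l2 \<times> l2) filter" where
 "uniformity_l2 = (INF e\<in>{0<..}. principal {(x, y). dist x y < e})"
definition open_l2 :: "l2 set => bool" where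
 "open_l2 U \<longleftrightarrow> (\<forall>x\<in>U. eventually (\<lambda>(x', y). x' = x --> y \<in> U) uniformity)"

instance
proof
 fix a b c :: l2 and r s :: real
 show "a + b + c = a + (b + c)"
  by transfer (auto intro!: sq_int_add sq_int_diff sq_int_scale sq_int_uminus sq_int_zero simp: algebra_simps)
 show "a + b = b + a"
  by transfer (auto intro!: sq_int_add sq_int_diff sq_int_scale sq_int_uminus sq_int_zero simp: algebra_simps)
 show "0 + a = a"
  by transfer (auto intro!: sq_int_add sq_int_diff sq_int_scale sq_int_uminus sq_int_zero simp: algebra_simps)
 show "- a + a = 0"
  by transfer (auto intro!: sq_int_add sq_int_diff sq_int_scale sq_int_uminus sq_int_zero simp: algebra_simps)
 show "a - b = a + - b"
  by transfer (auto intro!: sq_int_add[of _ _ "\<lambda>x. - _ x"] sq_int_diff sq_int_scale sq_int_uminus sq_int_zero simp: algebra_simps)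
 show "r *\<^sub>R (a + b) = r *\<^sub>R a + r *\<^sub>R b"
  by transfer (auto intro!: sq_int_add sq_int_scale simp: distrib_left)
 show "(r + s) *\<^sub>R a = r *\<^sub>R a + s *\<^sub>R a"
  by transfer (auto intro!: sq_int_add sq_int_scale simp: distrib_right)
 show "r *\<^sub>R s *\<^sub>R a = (r * s) *\<^sub>R a"
  by transfer (auto intro!: sq_int_add sq_int_scale simp: mult.assoc)
 show "1 *\<^sub>R a = a"
  by transfer (auto intro!: sq_int_add sq_int_scale)
 show "dist a b = norm (a - b)" by (fact dist_l2_def)
 show "sgn a = inverse (norm a) *\<^sub>R a" by (fact sgn_l2_def)
 show "uniformity = (INF e\<in>{0<..}. principal {(x :: l2, y). dist x y < e})"
  by (fact uniformity_l2_def)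
 show "open U \<longleftrightarrow> (\<forall>x\<in>U. eventually (\<lambda>(x', y). x' = x --> y \<in> U) uniformity)" for U :: "l2 set"
  by (fact open_l2_def)
 show "inner a b = inner b a"
  by transfer (simp add: mult.commute)
 show "inner (a + b) c = inner a c + inner b c"
  by transfer (auto simp: distrib_right sq_int_integrable_mult)
 show "inner (r *\<^sub>R a) b = r * inner a b"
  by transfer (auto simp: mult.assoc)
 show "0 \<le> inner a a"
  by transfer auto
 show "inner a a = 0 \<longleftrightarrow> a = 0"
  by transfer (auto simp: integral_sq_eq_0_iff sq_int_zero)
 show "norm a = sqrt (inner a a)" by (fact norm_l2_def)
qed

end

definition cls :: "(real \<times> real => real) => l2" where "cls = abs_l2"

text \<open>Each class gets an actual Borel function, so that sections
  \<open>\<lambda>s. rep e (x, s)\<close> can be formed; for almost every \<open>x\<close> the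
  section is determined by \<open>e\<close> up to a null set.\<close>

definition rep :: "l2 => (real \<times> real => real)" where "rep = rep_l2"

lemma rep_sq_int [simp]: "rep e \<in> sqi"
 using Quotient3_rep_reflp[OF Quotient3_l2] by (auto simp: rep_def)

lemma cls_rep [simp]: "cls (rep e) = e"
 by (simp add: cls_def rep_def Quotient3_abs_rep[OF Quotient3_l2])

lemma rep_measurable [measurable]: "rep e \<in> borel_fun"
 using sq_int_measurable[OF rep_sq_int] by simp

lemma cls_eq_iff:
 "f \<in> sqi ==> g \<in> sqi ==> cls f = cls g \<longleftrightarrow> (AE x in lborel. f x = g x)"
 unfolding cls_def using Quotient3_rel[OF Quotient3_l2, of f g] by auto

lemma rep_cls: "f \<in> sqi ==> AE x in lborel. rep (cls f) x = f x"
 using cls_eq_iff[of "rep (cls f)" f] by simp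

lemma cls_add: "f \<in> sqi ==> g \<in> sqi ==> cls f + cls g = cls (\<lambda>x. f x + g x)"
 unfolding cls_def by (simp add: plus_l2.abs_eq)

lemma cls_diff: "f \<in> sqi ==> g \<in> sqi ==> cls f - cls g = cls (\<lambda>x. f x - g x)"
 unfolding cls_def by (simp add: minus_l2.abs_eq)

lemma cls_scale: "f \<in> sqi ==> c *\<^sub>R cls f = cls (\<lambda>x. c * f x)"
 unfolding cls_def by (simp add: scaleR_l2.abs_eq)

lemma cls_zero: "cls (\<lambda>x. 0) = 0"
 unfolding cls_def by (simp add: zero_l2_def)

lemma inner_cls: "f \<in> sqi ==> g \<in> sqi ==> inner (cls f) (cls g) = (LINT x|lborel. f x * g x)"
 unfolding cls_def by (simp add: inner_l2.abs_eq)

lemma norm_cls: "f \<in> sqi ==> (norm (cls f))\<^sup>2 = (LINT x|lborel. (f x)\<^sup>2)"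
 by (simp only: power2_norm_eq_inner inner_cls) (simp add: power2_eq_square)

lemma norm_cls_nn:
 assumes "f \<in> sqi"
 shows "ennreal ((norm (cls f))\<^sup>2) = (\<integral>\<^sup>+x. ennreal ((f x)\<^sup>2) \<partial>lborel)"
 unfolding norm_cls[OF assms]
 by (rule nn_integral_eq_integral[symmetric]) (use assms in \<open>auto simp: sq_int_def\<close>)

lemma sq_int_nnI:
 assumes "f \<in> borel_measurable M" "(\<integral>\<^sup>+x. ennreal ((f x)\<^sup>2) \<partial>M) < \<infinity>"
 shows "f \<in> sq_int M"
 using assms by (intro sq_intI integrableI_bounded) auto

lemma norm_l2_nn: "ennreal ((norm e)\<^sup>2) = (\<integral>\<^sup>+x. ennreal ((rep e x)\<^sup>2) \<partial>lborel)"
 using norm_cls_nn[of "rep e"] by simp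

lemma rep_diff: "AE x in lborel. rep (a - b) x = rep a x - rep b x"
 using cls_diff[of "rep a" "rep b"] rep_cls[OF sq_int_diff[OF rep_sq_int rep_sq_int], of a b] by simp

text \<open>The weights \<open>2 ^ n\<close> make the series of squares finite almost everywhere and force
 geometric decay of the increments pointwise.\<close>

lemma l2_fast_Cauchy_limit:
 fixes X :: "nat => l2"
 assumes fast: "\<And>n. norm (X (Suc n) - X n) \<le> (1/2) ^ n"
 shows "\<exists>f \<in> borel_measurable lborel. AE x in lborel. (\<lambda>n. rep (X n) x) \<longlonglongrightarrow> f x"
proof -
 define d where "d n x = rep (X (Suc n)) x - rep (X n) x" for n x
 have [measurable]: "d n \<in> borel_fun" for n
  unfolding d_def by measurable
 have sq: "d n \<in> sqi" for n
  unfolding d_def by (intro sq_int_diff rep_sq_int)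
 have cls_d: "cls (d n) = X (Suc n) - X n" for n
  using cls_diff[of "rep (X (Suc n))" "rep (X n)"] by (simp add: d_def[abs_def])
 \<comment> \<open>The square of the assumed decay beats the weight:
   \<open>2 ^ n * ((1/2) ^ n)\<^sup>2 = (1/2) ^ n\<close>, which is still summable.\<close>
 have nd: "(\<integral>\<^sup>+x. ennreal (2 ^ n * (d n x)\<^sup>2) \<partial>lborel) \<le> ennreal ((1/2) ^ n)" for n
 proof -
  have "(\<integral>\<^sup>+x. ennreal (2 ^ n * (d n x)\<^sup>2) \<partial>lborel) = ennreal (2 ^ n) * (\<integral>\<^sup>+x. ennreal ((d n x)\<^sup>2) \<partial>lborel)"
   by (subst nn_integral_cmult[symmetric]) (auto simp: ennreal_mult)
  also have "\<dots> = ennreal (2 ^ n * (norm (X (Suc n) - X n))\<^sup>2)"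
   by (simp add: norm_cls_nn[OF sq, symmetric] cls_d ennreal_mult)
  also have "\<dots> \<le> ennreal (2 ^ n * ((1/2) ^ n)\<^sup>2)"
   by (intro ennreal_leI mult_left_mono power_mono fast) auto
  also have "2 ^ n * ((1/2::real) ^ n)\<^sup>2 = (1/2) ^ n"
   by (simp add: power2_eq_square power_mult_distrib[symmetric] mult.assoc[symmetric])
  finally show ?thesis .
 qed
 have "(\<integral>\<^sup>+x. (\<Sum>n. ennreal (2 ^ n * (d n x)\<^sup>2)) \<partial>lborel) = (\<Sum>n. (\<integral>\<^sup>+x. ennreal (2 ^ n * (d n x)\<^sup>2) \<partial>lborel))"
  by (rule nn_integral_suminf) auto
 also have "\<dots> \<le> (\<Sum>n. ennreal ((1/2) ^ n))"
  by (intro suminf_le nd) auto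
 also have "\<dots> = ennreal (\<Sum>n. (1/2) ^ n)"
  by (rule suminf_ennreal2) auto
 finally have "(\<integral>\<^sup>+x. (\<Sum>n. ennreal (2 ^ n * (d n x)\<^sup>2)) \<partial>lborel) \<noteq> \<infinity>"
  by (auto simp: top_unique)
 then have "AE x in lborel. (\<Sum>n. ennreal (2 ^ n * (d n x)\<^sup>2)) \<noteq> \<infinity>"
  by (intro nn_integral_noteq_infinite) auto
 then have conv: "AE x in lborel. convergent (\<lambda>n. rep (X n) x)"
 proof eventually_elim
  case (elim x)
  then have sm: "summable (\<lambda>n. 2 ^ n * (d n x)\<^sup>2)"
   by (intro summable_suminf_not_top) auto
  have "summable (\<lambda>n. \<bar>d n x\<bar>)"
  proof (rule summable_comparison_test')
   show "summable (\<lambda>n. 2 ^ n * (d n x)\<^sup>2 + (1/2) ^ n)"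
    by (intro summable_add sm) auto
   fix n :: nat
   \<comment> \<open>The inequality \<open>a \<le> a\<^sup>2 + 1\<close> with
     \<open>a = \<bar>d n x\<bar> * 2 ^ n\<close>, divided by \<open>2 ^ n\<close>: the increment is
     dominated by a weighted square plus a geometric term.\<close>
   have "2 * (\<bar>d n x\<bar> * 2 ^ n) * 1 \<le> (\<bar>d n x\<bar> * 2 ^ n)\<^sup>2 + 1\<^sup>2"
    using sum_squares_bound[of "\<bar>d n x\<bar> * 2 ^ n" 1] by simp
   moreover have "0 \<le> \<bar>d n x\<bar> * 2 ^ n" by simp
   ultimately have "\<bar>d n x\<bar> * 2 ^ n \<le> (\<bar>d n x\<bar> * 2 ^ n)\<^sup>2 + 1"
    unfolding one_power2 by linarith
   then have "\<bar>d n x\<bar> * 2 ^ n / 2 ^ n \<le> ((\<bar>d n x\<bar> * 2 ^ n)\<^sup>2 + 1) / 2 ^ n"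
    by (intro divide_right_mono) auto
   then show "norm \<bar>d n x\<bar> \<le> 2 ^ n * (d n x)\<^sup>2 + (1/2) ^ n"
    by (simp add: power_mult_distrib add_divide_distrib power_divide power2_eq_square mult.commute)
     (simp add: mult_ac)
  qed
  then have "summable (\<lambda>n. d n x)" by (rule summable_rabs_cancel)
  then have "convergent (\<lambda>n. \<Sum>i<n. d i x)" by (simp add: summable_iff_convergent)
  moreover have "(\<Sum>i<n. d i x) = rep (X n) x - rep (X 0) x" for n
   unfolding d_def by (rule sum_lessThan_telescope)
  ultimately have "convergent (\<lambda>n. rep (X n) x - rep (X 0) x)" by simp
  then show ?case
   using convergent_diff_const_right_iff by blast
 qed
 show ?thesis
 proof (intro bexI)
  show "(\<lambda>x. lim (\<lambda>n. rep (X n) x)) \<in> borel_measurable lborel" by measurable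
  show "AE x in lborel. (\<lambda>n. rep (X n) x) \<longlonglongrightarrow> lim (\<lambda>n. rep (X n) x)"
   using conv by eventually_elim (simp add: convergent_LIMSEQ_iff)
 qed
qed

text \<open>Fatou's lemma for the squares. It yields membership of the limit and its bound together;
  the bound is asked for only from \<open>N\<close> on because it will be applied to the tail of a
  Cauchy sequence.\<close>

lemma norm_le_liminf:
 fixes Y :: "nat => l2"
 assumes "f \<in> borel_measurable lborel" "AE x in lborel. (\<lambda>n. rep (Y n) x) \<longlonglongrightarrow> f x"
  and "\<And>n. n \<ge> N ==> norm (Y n) \<le> C"
 shows "f \<in> sqi \<and> norm (cls f) \<le> C"
proof -
 have C: "C \<ge> 0" using assms(3)[of N] norm_ge_zero order_trans by blast
 have "(\<integral>\<^sup>+x. ennreal ((f x)\<^sup>2) \<partial>lborel) = (\<integral>\<^sup>+x. liminf (\<lambda>n. ennreal ((rep (Y n) x)\<^sup>2)) \<partial>lborel)"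
 proof (rule nn_integral_cong_AE)
  show "AE x in lborel. ennreal ((f x)\<^sup>2) = liminf (\<lambda>n. ennreal ((rep (Y n) x)\<^sup>2))"
   using assms(2)
  proof eventually_elim
   case (elim x)
   then have "(\<lambda>n. ennreal ((rep (Y n) x)\<^sup>2)) \<longlonglongrightarrow> ennreal ((f x)\<^sup>2)"
    by (intro tendsto_ennrealI tendsto_intros)
   then show ?case by (intro lim_imp_Liminf[symmetric]) auto
  qed
 qed
 also have "\<dots> \<le> liminf (\<lambda>n. (\<integral>\<^sup>+x. ennreal ((rep (Y n) x)\<^sup>2) \<partial>lborel))"
  by (rule nn_integral_liminf) auto
 also have "\<dots> \<le> ennreal (C\<^sup>2)"
 proof (rule Liminf_le)
  show "\<forall>\<^sub>F n in sequentially. (\<integral>\<^sup>+x. ennreal ((rep (Y n) x)\<^sup>2) \<partial>lborel) \<le> ennreal (C\<^sup>2)"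
   unfolding norm_l2_nn[symmetric]
   using assms(3) by (intro eventually_sequentiallyI[of N] ennreal_leI power_mono) auto
 qed simp
 finally have le: "(\<integral>\<^sup>+x. ennreal ((f x)\<^sup>2) \<partial>lborel) \<le> ennreal (C\<^sup>2)" .
 then have f: "f \<in> sqi"
  using assms(1) by (intro sq_int_nnI) (auto simp: less_top[symmetric] top_unique)
 have "(norm (cls f))\<^sup>2 \<le> C\<^sup>2"
  using le unfolding norm_cls_nn[OF f, symmetric] by (simp add: ennreal_le_iff)
 then show ?thesis using f C by (simp add: power2_le_iff_abs_le)
qed

lemma l2_Cauchy_subseq:
 fixes X :: "nat => 'a::metric_space"
 assumes "Cauchy X"
 shows "\<exists>r. strict_mono (r :: nat => nat) \<and> (\<forall>n. dist (X (r (Suc n))) (X (r n)) \<le> (1/2) ^ n)"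
proof -
 have ex: "\<exists>N. \<forall>m\<ge>N. \<forall>k\<ge>N. dist (X m) (X k) < (1/2) ^ n" for n :: nat
  using assms unfolding Cauchy_def by simp
 define N where "N n = (SOME N. \<forall>m\<ge>N. \<forall>k\<ge>N. dist (X m) (X k) < (1/2) ^ n)" for n :: nat
 have N: "m \<ge> N n ==> k \<ge> N n ==> dist (X m) (X k) < (1/2) ^ n" for m n k
  using someI_ex[OF ex[of n]] unfolding N_def by blast
 \<comment> \<open>The summand \<open>n\<close> makes \<open>r\<close> strictly increasing; the
   partial sum makes \<open>r n\<close> at least the threshold \<open>N n\<close>.\<close>
 define r where "r n = n + (\<Sum>i\<le>n. N i)" for n
 have "strict_mono r" unfolding strict_mono_Suc_iff r_def by auto
 moreover have "N n \<le> r n" for n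
  unfolding r_def by (rule trans_le_add2, rule member_le_sum) auto
 moreover have "r n \<le> r (Suc n)" for n using \<open>strict_mono r\<close> by (simp add: strict_mono_leD)
 ultimately show ?thesis
  by (intro exI[of _ r] conjI allI less_imp_le[OF N]) (auto intro: order_trans)
qed

text \<open>Riesz-Fischer. A fast subsequence has a pointwise limit \<open>f\<close>; for each fixed
  late \<open>n\<close>, Fatou along the subsequence bounds the distance of \<open>X n\<close> from
  \<open>f\<close>, so the full sequence converges directly.\<close>

instance l2 :: banach
proof
 fix X :: "nat => l2"
 assume "Cauchy X"
 from l2_Cauchy_subseq[OF this] obtain r :: "nat => nat" where r: "strict_mono r"
  and fast: "\<And>n. dist (X (r (Suc n))) (X (r n)) \<le> (1/2) ^ n" by auto
 have "\<And>n. norm ((X \<circ> r) (Suc n) - (X \<circ> r) n) \<le> (1/2) ^ n"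
  using fast by (simp add: dist_norm)
 from l2_fast_Cauchy_limit[OF this] obtain f where fm: "f \<in> borel_measurable lborel"
  and lim: "AE x in lborel. (\<lambda>n. rep ((X \<circ> r) n) x) \<longlonglongrightarrow> f x" by auto
 have key: "\<exists>M. \<forall>n\<ge>M. (\<lambda>x. f x - rep (X n) x) \<in> sqi \<and> norm (cls (\<lambda>x. f x - rep (X n) x)) \<le> e" if "e > 0" for e
 proof -
  from \<open>Cauchy X\<close> that obtain M where M: "\<And>m n. m \<ge> M ==> n \<ge> M ==> dist (X m) (X n) < e"
   unfolding Cauchy_def by blast
  have "(\<lambda>x. f x - rep (X n) x) \<in> sqi \<and> norm (cls (\<lambda>x. f x - rep (X n) x)) \<le> e" if "n \<ge> M" for n
  proof (rule norm_le_liminf[where Y = "\<lambda>k. X (r k) - X n" and N = M])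
   show "(\<lambda>x. f x - rep (X n) x) \<in> borel_measurable lborel" using fm by measurable
   have "AE x in lborel. \<forall>k. rep (X (r k) - X n) x = rep (X (r k)) x - rep (X n) x"
    unfolding AE_all_countable by (intro allI rep_diff)
   with lim show "AE x in lborel. (\<lambda>k. rep (X (r k) - X n) x) \<longlonglongrightarrow> f x - rep (X n) x"
    by eventually_elim (auto intro!: tendsto_intros)
   fix k assume "k \<ge> M"
   then have "r k \<ge> M" using seq_suble[OF r, of k] by simp
   then show "norm (X (r k) - X n) \<le> e" using M[of "r k" n] that by (simp add: dist_norm)
  qed
  then show ?thesis by blast
 qed
 from key[of 1] obtain M where "(\<lambda>x. f x - rep (X M) x) \<in> sqi" by auto
 from sq_int_add[OF this rep_sq_int[of "X M"]] have f: "f \<in> sqi" by simp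
 have "X \<longlonglongrightarrow> cls f"
 proof (rule metric_LIMSEQ_I)
  fix e :: real assume "e > 0"
  with key[of "e/2"] obtain M where M: "\<forall>n\<ge>M. norm (cls (\<lambda>x. f x - rep (X n) x)) \<le> e/2" by auto
  have "cls (\<lambda>x. f x - rep (X n) x) = cls f - X n" for n
   using cls_diff[OF f rep_sq_int[of "X n"]] by simp
  with M have "\<forall>n\<ge>M. dist (X n) (cls f) \<le> e/2" by (simp add: dist_norm norm_minus_commute)
  with \<open>e > 0\<close> show "\<exists>M. \<forall>n\<ge>M. dist (X n) (cls f) < e" by (intro exI[of _ M]) fastforce
 qed
 then show "convergent X" by (auto simp: convergent_def)
qed

text \<open>Dominated convergence for \<open>(g n x - f x)\<^sup>2\<close>, with majorant
  \<open>(2 * w x)\<^sup>2\<close>.\<close>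

lemma cls_tendsto:
 fixes g :: "nat => real \<times> real => real"
 assumes meas: "\<And>s. g s \<in> borel_fun" and f: "f \<in> borel_fun"
  and lim: "AE x in lborel. (\<lambda>n. g n x) \<longlonglongrightarrow> f x"
  and dom: "\<And>n. AE x in lborel. \<bar>g n x\<bar> \<le> w x" and w: "w \<in> sqi"
 shows "f \<in> sqi \<and> (\<lambda>n. cls (g n)) \<longlonglongrightarrow> cls f"
proof -
 have g_sq: "g n \<in> sqi" for n
  by (rule sq_int_bound[OF w]) (use meas dom[of n] in \<open>auto elim: eventually_mono\<close>)
 have "AE x in lborel. \<forall>n. \<bar>g n x\<bar> \<le> w x" using dom by (simp add: AE_all_countable)
 with lim have fw: "AE x in lborel. \<bar>f x\<bar> \<le> w x"
 proof eventually_elim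
  case (elim x)
  from tendsto_rabs[OF elim(1)] show ?case by (rule LIMSEQ_le_const2) (use elim(2) in auto)
 qed
 have f_sq: "f \<in> sqi"
  by (rule sq_int_bound[OF w]) (use f fw in \<open>auto elim: eventually_mono\<close>)
 have "(\<lambda>n. LINT x|lborel. (g n x - f x)\<^sup>2) \<longlonglongrightarrow> (LINT x|(lborel :: (real \<times> real) measure). 0)"
 proof (rule integral_dominated_convergence[where w = "\<lambda>x. (2 * w x)\<^sup>2" and s = "\<lambda>n x. (g n x - f x)\<^sup>2"])
  show "integrable lborel (\<lambda>x. (2 * w x)\<^sup>2)" using sq_int_scale[OF w, of 2] by (rule sq_int_integrable_sq)
  show "AE x in lborel. (\<lambda>n. (g n x - f x)\<^sup>2) \<longlonglongrightarrow> 0"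
   using lim by eventually_elim (auto intro!: tendsto_eq_intros)
  fix n
  show "AE x in lborel. norm ((g n x - f x)\<^sup>2) \<le> (2 * w x)\<^sup>2"
   using dom[of n] fw
  proof eventually_elim
   case (elim x)
   then have "\<bar>g n x - f x\<bar> \<le> \<bar>2 * w x\<bar>" by linarith
   then have "(g n x - f x)\<^sup>2 \<le> (2 * w x)\<^sup>2" by (simp only: abs_le_square_iff)
   then show ?case by simp
  qed
 qed (use meas f in auto)
 then have "(\<lambda>n. (norm (cls (g n) - cls f))\<^sup>2) \<longlonglongrightarrow> 0"
  by (simp add: cls_diff[OF g_sq f_sq] norm_cls[OF sq_int_diff[OF g_sq f_sq]])
 from tendsto_real_sqrt[OF this] have "(\<lambda>n. norm (cls (g n) - cls f)) \<longlonglongrightarrow> 0" by simp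
 then have "(\<lambda>n. cls (g n) - cls f) \<longlonglongrightarrow> 0" by (rule tendsto_norm_zero_cancel)
 then show ?thesis using f_sq by (simp add: LIM_zero_iff)
qed

section \<open>Iterated integrals and sections\<close>

lemma lborel_AE_pair:
 fixes Q :: "'a::euclidean_space \<times> 'b::euclidean_space => bool"
 assumes "AE p in lborel. Q p"
 shows "AE x in lborel. AE y in lborel. Q (x, y)"
 using lborel_pair.AE_pair[of Q] assms unfolding lborel_prod by blast

text \<open>From sections back to the plane, Fubini for null sets needs the exceptional set to be
  measurable; hence the Borel hypothesis.\<close>

lemma lborel_AE_pair_iff:
 fixes P :: "'a::euclidean_space \<times> 'b::euclidean_space => bool"
 assumes "{p. P p} \<in> sets borel"
 shows "(AE p in lborel. P p) \<longleftrightarrow> (AE x in lborel. AE y in lborel. P (x, y))"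
proof
 assume "AE x in lborel. AE y in lborel. P (x, y)"
 then have "AE p in (lborel :: 'a measure) \<Otimes>\<^sub>M (lborel :: 'b measure). P p"
  using lborel_pair.AE_pair_measure[of P] assms
  by (simp add: borel_prod[symmetric] space_pair_measure)
 then show "AE p in lborel. P p" unfolding lborel_prod .
qed (rule lborel_AE_pair)

lemma lborel_nn_integral_pair:
 fixes f :: "'a::euclidean_space \<times> 'b::euclidean_space => ennreal"
 assumes "f \<in> borel_fun"
 shows "(\<integral>\<^sup>+p. f p \<partial>lborel) = (\<integral>\<^sup>+x. \<integral>\<^sup>+y. f (x, y) \<partial>lborel \<partial>lborel)"
 using lborel.nn_integral_fst[of f lborel] assms by (simp add: lborel_prod)

lemma lborel_integral_pair:
 fixes f :: "'a::euclidean_space \<times> 'b::euclidean_space => real"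
 assumes "integrable lborel f"
 shows "(LINT p|lborel. f p) = (LINT x|lborel. LINT y|lborel. f (x, y))"
 using lborel_pair.integral_fst'[of f] assms by (simp add: lborel_prod)

lemma lborel_AE_integrable_pair:
 fixes f :: "'a::euclidean_space \<times> 'b::euclidean_space => real"
 assumes "integrable lborel f"
 shows "AE x in lborel. integrable lborel (\<lambda>y. f (x, y))"
 using lborel_pair.AE_integrable_fst'[of f] assms by (simp add: lborel_prod)

lemma lborel_integrable_pair:
 fixes f :: "'a::euclidean_space \<times> 'b::euclidean_space => real"
 assumes "integrable lborel f"
 shows "integrable lborel (\<lambda>x. LINT y|lborel. f (x, y))"
 using lborel_pair.integrable_fst'[of f] assms by (simp add: lborel_prod)

lemma sq_int_slice:
 fixes f :: "real \<times> real => real"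
 assumes f: "f \<in> sqi"
 shows "AE x in lborel. (\<lambda>s. f (x, s)) \<in> sqi"
proof -
 have [measurable]: "f \<in> borel_fun" using f by (simp add: sq_int_def)
 show ?thesis
  using lborel_AE_integrable_pair[OF sq_int_integrable_sq[OF f]]
  by eventually_elim (auto simp: sq_int_def)
qed

text \<open>Stated for measurable functions in general: the right side may be infinite, and if the
  product is not integrable its Bochner integral is 0.\<close>

lemma cauchy_schwarz_integral_sq:
 fixes f g :: "'a => real"
 assumes [measurable]: "f \<in> borel_measurable M" "g \<in> borel_measurable M"
 shows "ennreal ((LINT x|M. f x * g x)\<^sup>2) \<le> (\<integral>\<^sup>+x. ennreal ((f x)\<^sup>2) \<partial>M) * (\<integral>\<^sup>+x. ennreal ((g x)\<^sup>2) \<partial>M)"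
proof (cases "integrable M (\<lambda>x. f x * g x)")
 case True
 have "ennreal \<bar>LINT x|M. f x * g x\<bar> \<le> (\<integral>\<^sup>+x. ennreal \<bar>f x\<bar> * ennreal \<bar>g x\<bar> \<partial>M)"
  using integral_norm_bound_ennreal[OF True] by (simp add: abs_mult ennreal_mult)
 then have "ennreal \<bar>LINT x|M. f x * g x\<bar> ^ 2 \<le> (\<integral>\<^sup>+x. ennreal \<bar>f x\<bar> * ennreal \<bar>g x\<bar> \<partial>M) ^ 2"
  by (rule power_mono) simp
 also have "\<dots> \<le> (\<integral>\<^sup>+x. ennreal \<bar>f x\<bar> ^ 2 \<partial>M) * (\<integral>\<^sup>+x. ennreal \<bar>g x\<bar> ^ 2 \<partial>M)"
  by (rule Cauchy_Schwarz_nn_integral) auto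
 finally show ?thesis by (simp add: ennreal_power)
next
 case False
 then show ?thesis by (simp add: not_integrable_integral_eq)
qed

text \<open>Linearity is only required almost everywhere: the integral of a non-integrable slice
 is 0.\<close>

locale l2_op =
 fixes T :: "(real \<times> real => real) => real \<times> real => real" and C :: real
 assumes nonneg: "0 \<le> C"
  and sq: "f \<in> sqi ==> T f \<in> sqi"
  and bound: "f \<in> sqi ==> norm (cls (T f)) \<le> C * norm (cls f)"
  and lin: "f \<in> sqi ==> g \<in> sqi ==>
   AE p in lborel. T (\<lambda>p. f p + c * g p) p = T f p + c * T g p"
begin

definition ap :: "l2 => l2" where "ap e = cls (T (rep e))"

lemma cls_lin:
 assumes f: "f \<in> sqi" and g: "g \<in> sqi"
 shows "cls (T (\<lambda>p. f p + c * g p)) = cls (T f) + c *\<^sub>R cls (T g)"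
 using lin[OF f g, of c] sq[OF sq_int_add[OF f sq_int_scale[OF g, of c]]]
 by (simp add: cls_scale[OF sq[OF g]] cls_add[OF sq[OF f] sq_int_scale[OF sq[OF g]]]
   cls_eq_iff sq_int_add sq_int_scale sq f g)

text \<open>Compatibility with equality almost everywhere is not an axiom of the locale: it follows
  from the norm bound applied to \<open>f - g\<close>, whose class is 0.\<close>

lemma cls_cong:
 assumes f: "f \<in> sqi" and g: "g \<in> sqi" and eq: "AE p in lborel. f p = g p"
 shows "cls (T f) = cls (T g)"
proof -
 have d: "(\<lambda>p. f p + (-1) * g p) \<in> sqi" by (intro sq_int_add sq_int_scale f g)
 have "cls (\<lambda>p. f p + (-1) * g p) = cls (\<lambda>p. 0)"
  unfolding cls_eq_iff[OF d sq_int_zero] using eq by eventually_elim simp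
 then have "norm (cls (T (\<lambda>p. f p + (-1) * g p))) \<le> 0"
  using bound[OF d] by (simp add: cls_zero)
 then have "cls (T f) + (-1) *\<^sub>R cls (T g) = 0" unfolding cls_lin[OF f g] by simp
 then show ?thesis by simp
qed

lemma ap_cls: "f \<in> sqi ==> ap (cls f) = cls (T f)"
 unfolding ap_def by (rule cls_cong) (auto simp: rep_cls)

lemma ap_add_scale: "ap (a + c *\<^sub>R b) = ap a + c *\<^sub>R ap b"
proof -
 have "a + c *\<^sub>R b = cls (\<lambda>p. rep a p + c * rep b p)"
  using cls_add[OF rep_sq_int[of a] sq_int_scale[OF rep_sq_int[of b], of c]] cls_scale[OF rep_sq_int[of b], of c]
  by simp
 moreover have "ap (cls (\<lambda>p. rep a p + c * rep b p)) = ap a + c *\<^sub>R ap b"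
  by (subst ap_cls) (auto simp: cls_lin ap_def intro!: sq_int_add sq_int_scale)
 ultimately show ?thesis by simp
qed

lemma norm_ap: "norm (ap e) \<le> C * norm e"
 using bound[OF rep_sq_int[of e]] by (simp add: ap_def)

lemma bounded_linear_ap: "bounded_linear ap"
proof (rule bounded_linear_intro)
 have "ap 0 = 0" using norm_ap[of 0] by simp
 then show "ap (c *\<^sub>R a) = c *\<^sub>R ap a" for c a using ap_add_scale[of 0 c a] by simp
 show "ap (a + b) = ap a + ap b" for a b using ap_add_scale[of a 1 b] by simp
 show "norm (ap a) \<le> norm a * C" for a using norm_ap[of a] by (simp add: mult.commute)
qed

end

section \<open>Multiplication, exchange of coordinates and kernel operators\<close>

definition mul_fun :: "(real \<times> real => real) => (real \<times> real => real) => real \<times> real => real" where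
 "mul_fun g f p = g p * f p"

definition swap_fun :: "(real \<times> real => real) => real \<times> real => real" where
 "swap_fun f p = f (snd p, fst p)"

definition ker_fun :: "(real => real => real) => (real \<times> real => real) => real \<times> real => real" where
 "ker_fun k f p = (LINT s|lborel. k (snd p) s * f (fst p, s))"

text \<open>A bound by the indicator of the square of side \<open>l\<close> gives an operator of
  norm at most \<open>l\<close> by Cauchy-Schwarz, and it is symmetric in both variables, so
  transposes are again of this kind.\<close>

definition bdd_kernel :: "real => (real => real => real) => bool" where
 "bdd_kernel l k \<longleftrightarrow> 0 < l \<and> (\<lambda>p. k (fst p) (snd p)) \<in> borel_fun \<and>
  (\<forall>r s. \<bar>k r s\<bar> \<le> ind l r * ind l s)"

lemma l2_op_mul:
 assumes g: "g \<in> borel_fun" "\<And>p. \<bar>g p\<bar> \<le> C"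
 shows "l2_op (mul_fun g) C"
proof
 show C: "0 \<le> C" using g(2)[of undefined] abs_ge_zero order_trans by blast
 fix f :: "real \<times> real => real" assume f: "f \<in> sqi"
 have m: "mul_fun g f \<in> borel_measurable lborel"
  using f g(1) unfolding mul_fun_def[abs_def] by (auto simp: sq_int_def)
 have le: "\<bar>mul_fun g f p\<bar> \<le> \<bar>C * f p\<bar>" for p
  using g(2)[of p] C unfolding mul_fun_def abs_mult by (intro mult_right_mono) auto
 show s: "mul_fun g f \<in> sqi"
  by (rule sq_int_bound[OF sq_int_scale[OF f, of C] m]) (use le in auto)
 have "(norm (cls (mul_fun g f)))\<^sup>2 \<le> (LINT p|lborel. (C * f p)\<^sup>2)"
  unfolding norm_cls[OF s]
 proof (rule integral_mono)
  show "(mul_fun g f p)\<^sup>2 \<le> (C * f p)\<^sup>2" for p using le[of p] by (simp only: abs_le_square_iff)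
 qed (use sq_int_integrable_sq[OF s] sq_int_integrable_sq[OF sq_int_scale[OF f, of C]] in auto)
 also have "\<dots> = (C * norm (cls f))\<^sup>2"
  by (simp add: power_mult_distrib norm_cls[OF f])
 finally show "norm (cls (mul_fun g f)) \<le> C * norm (cls f)"
  by (rule power2_le_imp_le) (use C in auto)
next
 fix f h c
 show "AE p in lborel. mul_fun g (\<lambda>p. f p + c * h p) p = mul_fun g f p + c * mul_fun g h p"
  by (simp add: mul_fun_def algebra_simps)
qed

lemma swap_measurable [measurable]: "(\<lambda>p :: real \<times> real. (snd p, fst p)) \<in> borel_fun"
 by (intro borel_measurable_continuous_onI continuous_intros)

lemma swap_fun_measurable: "f \<in> borel_fun ==> swap_fun f \<in> borel_fun"
 unfolding swap_fun_def[abs_def] by (rule measurable_compose[OF swap_measurable])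

lemma lborel_distr_swap: "distr lborel borel (\<lambda>p. (snd p, fst p)) = (lborel :: (real \<times> real) measure)"
proof -
 have "distr (lborel \<Otimes>\<^sub>M lborel) (lborel \<Otimes>\<^sub>M lborel) (\<lambda>(x, y). (y, x)) = (lborel \<Otimes>\<^sub>M lborel :: (real \<times> real) measure)"
  using lborel_pair.distr_pair_swap by (rule sym)
 then have "distr lborel lborel (\<lambda>(x, y). (y, x)) = (lborel :: (real \<times> real) measure)"
  by (simp add: lborel_prod)
 also have "(\<lambda>(x, y). (y, x)) = (\<lambda>p :: real \<times> real. (snd p, fst p))" by auto
 finally show ?thesis by (simp add: distr_cong[of lborel lborel borel lborel])
qed

lemma integral_swap_fun:
 assumes [measurable]: "f \<in> borel_fun"
 shows "(LINT p|lborel. swap_fun f p) = (LINT p|lborel. f p)"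
proof -
 have "(LINT p|lborel. f p) = (LINT p|distr lborel borel (\<lambda>p. (snd p, fst p)). f p)"
  by (simp only: lborel_distr_swap)
 also have "\<dots> = (LINT p|lborel. swap_fun f p)"
  by (subst integral_distr) (auto simp: swap_fun_def[abs_def])
 finally show ?thesis by simp
qed

lemma integrable_swap_fun:
 assumes [measurable]: "f \<in> borel_fun"
 shows "integrable lborel (swap_fun f) \<longleftrightarrow> integrable lborel f"
proof -
 have "integrable lborel f \<longleftrightarrow> integrable (distr lborel borel (\<lambda>p. (snd p, fst p))) f"
  by (simp only: lborel_distr_swap)
 also have "\<dots> \<longleftrightarrow> integrable lborel (swap_fun f)"
  by (subst integrable_distr_eq) (auto simp: swap_fun_def[abs_def])
 finally show ?thesis by simp
qed

lemma swap_fun_sq_int: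
 assumes "f \<in> sqi" shows "swap_fun f \<in> sqi"
proof -
 have "f \<in> borel_fun" "integrable lborel (\<lambda>p. (f p)\<^sup>2)" using assms by (auto simp: sq_int_def)
 moreover have "swap_fun (\<lambda>p. (f p)\<^sup>2) = (\<lambda>p. (swap_fun f p)\<^sup>2)" by (simp add: swap_fun_def fun_eq_iff)
 ultimately show ?thesis
  using integrable_swap_fun[of "\<lambda>p. (f p)\<^sup>2"] swap_fun_measurable[of f] by (auto simp: sq_int_def)
qed

lemma l2_op_swap: "l2_op swap_fun 1"
proof
 fix f :: "real \<times> real => real" assume f: "f \<in> sqi"
 show s: "swap_fun f \<in> sqi" by (rule swap_fun_sq_int[OF f])
 have "(norm (cls (swap_fun f)))\<^sup>2 = (LINT p|lborel. swap_fun (\<lambda>p. (f p)\<^sup>2) p)"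
  unfolding norm_cls[OF s] by (simp add: swap_fun_def)
 also have "\<dots> = (norm (cls f))\<^sup>2"
  unfolding norm_cls[OF f] by (rule integral_swap_fun) (use f in \<open>auto simp: sq_int_def\<close>)
 finally show "norm (cls (swap_fun f)) \<le> 1 * norm (cls f)"
  by (simp add: power2_eq_iff_nonneg)
qed (auto simp: swap_fun_def)

lemma bdd_kernel_measurable:
 "bdd_kernel l k ==> (\<lambda>p. k (fst p) (snd p)) \<in> borel_fun"
 by (simp add: bdd_kernel_def)

lemma bdd_kernel_measurable':
 assumes "bdd_kernel l k"
 shows "k r \<in> borel_fun"
proof -
 have "(\<lambda>s. (\<lambda>p. k (fst p) (snd p)) (r, s)) \<in> borel_fun"
  by (rule measurable_compose[OF _ bdd_kernel_measurable[OF assms]])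
   (intro borel_measurable_continuous_onI continuous_intros)
 then show ?thesis by simp
qed

lemma bdd_kernel_transpose:
 assumes "bdd_kernel l k"
 shows "bdd_kernel l (\<lambda>r s. k s r)"
proof -
 have "(\<lambda>q. (\<lambda>p. k (fst p) (snd p)) (snd q, fst q)) \<in> borel_fun"
  by (rule measurable_compose[OF _ bdd_kernel_measurable[OF assms]]) measurable
 moreover have "\<bar>k s r\<bar> \<le> ind l r * ind l s" for r s
  using assms unfolding bdd_kernel_def by (metis mult.commute)
 ultimately show ?thesis using assms by (simp add: bdd_kernel_def)
qed

lemma indicator_Ioo_sq_int: "(indicator {a<..<b} :: real => real) \<in> sqi"
proof (rule sq_intI)
 have "integrable lborel (indicator {a<..<b} :: real => real)"
  by (intro integrable_real_indicator emeasure_bounded_finite) auto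
 moreover have "(\<lambda>x. (indicator {a<..<b} x)\<^sup>2 :: real) = indicator {a<..<b}"
  by (auto split: split_indicator)
 ultimately show "integrable lborel (\<lambda>x. (indicator {a<..<b} x)\<^sup>2 :: real)" by simp
qed simp

lemma bdd_kernel_integrable:
 assumes k: "bdd_kernel l k" and f: "f \<in> sqi"
 shows "integrable lborel (\<lambda>s. k r s * f s)"
proof (rule sq_int_integrable_mult[OF _ f])
 note [measurable] = bdd_kernel_measurable'[OF k]
 show "k r \<in> sqi"
 proof (rule sq_int_bound[OF indicator_Ioo_sq_int[of 0 l]])
  have "\<bar>k r s\<bar> \<le> ind l s" for s
  proof -
   have "\<bar>k r s\<bar> \<le> ind l r * ind l s"
    using k by (simp add: bdd_kernel_def)
   also have "\<dots> \<le> ind l s" by (simp split: split_indicator)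
   finally show ?thesis .
  qed
  then show "AE s in lborel. \<bar>k r s\<bar> \<le> \<bar>ind l s\<bar>" by simp
 qed simp
qed

lemma ker_fun_measurable:
 assumes k: "bdd_kernel l k" and f[measurable]: "f \<in> borel_fun"
 shows "ker_fun k f \<in> borel_fun"
proof -
 have m1: "(\<lambda>q :: (real \<times> real) \<times> real. (\<lambda>p. k (fst p) (snd p)) (snd (fst q), snd q)) \<in> borel_measurable (borel \<Otimes>\<^sub>M lborel)"
  by (rule measurable_compose[OF _ bdd_kernel_measurable[OF k]]) (simp add: borel_prod[symmetric] cong: measurable_cong_sets)
 have m2: "(\<lambda>q :: (real \<times> real) \<times> real. f (fst (fst q), snd q)) \<in> borel_measurable (borel \<Otimes>\<^sub>M lborel)"
  by (rule measurable_compose[OF _ f]) (simp add: borel_prod[symmetric] cong: measurable_cong_sets)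
 have "(\<lambda>p. LINT s|lborel. (\<lambda>q. k (snd (fst q)) (snd q) * f (fst (fst q), snd q)) (p, s)) \<in> borel_fun"
  by (rule lborel.borel_measurable_lebesgue_integral) (simp add: case_prod_beta' borel_measurable_times m1[simplified] m2)
 then show ?thesis by (simp add: ker_fun_def[abs_def])
qed

text \<open>On a section, Cauchy-Schwarz bounds the squared value at \<open>r\<close> by
  \<open>l\<close> times the integral of the squared section; integrating over
  \<open>0 < r < l\<close> gives the second factor \<open>l\<close>. Linearity holds on square
  integrable sections, hence almost everywhere.\<close>

lemma l2_op_ker:
 assumes k: "bdd_kernel l k"
 shows "l2_op (ker_fun k) l"
proof
 note [measurable] = bdd_kernel_measurable'[OF k]
 show l: "0 \<le> l" using k by (simp add: bdd_kernel_def)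
 fix f :: "real \<times> real => real" assume f: "f \<in> sqi"
 then have [measurable]: "f \<in> borel_fun" by (simp add: sq_int_def)
 have [measurable]: "ker_fun k f \<in> borel_fun"
  by (rule ker_fun_measurable[OF k]) measurable
 have kb: "\<bar>k r s\<bar> \<le> indicator {0<..<l} r * indicator {0<..<l} s" for r s
  using k by (simp add: bdd_kernel_def)
 have pt: "ennreal ((ker_fun k f (x, r))\<^sup>2) \<le> ennreal l * indicator {0<..<l} r * (\<integral>\<^sup>+s. ennreal ((f (x, s))\<^sup>2) \<partial>lborel)" for x r
 proof -
  have "(\<integral>\<^sup>+s. ennreal ((k r s)\<^sup>2) \<partial>lborel) \<le> (\<integral>\<^sup>+s. indicator {0<..<l} r * indicator {0<..<l} s \<partial>lborel)"
  proof (rule nn_integral_mono)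
   fix s
   have "(k r s)\<^sup>2 \<le> (indicator {0<..<l} r * indicator {0<..<l} s)\<^sup>2"
    by (subst abs_le_square_iff[symmetric]) (use kb[of r s] in simp)
   also have "\<dots> = indicator {0<..<l} r * indicator {0<..<l} s" by (simp split: split_indicator)
   finally have "ennreal ((k r s)\<^sup>2) \<le> ennreal (indicator {0<..<l} r * indicator {0<..<l} s)" by (rule ennreal_leI)
   then show "ennreal ((k r s)\<^sup>2) \<le> indicator {0<..<l} r * indicator {0<..<l} s"
    by (simp split: split_indicator split_indicator_asm)
  qed
  also have "\<dots> = ennreal l * indicator {0<..<l} r"
   using l by (subst nn_integral_cmult) (auto simp: mult.commute)
  finally have 1: "(\<integral>\<^sup>+s. ennreal ((k r s)\<^sup>2) \<partial>lborel) \<le> ennreal l * indicator {0<..<l} r" .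
  have "ennreal ((ker_fun k f (x, r))\<^sup>2) \<le> (\<integral>\<^sup>+s. ennreal ((k r s)\<^sup>2) \<partial>lborel) * (\<integral>\<^sup>+s. ennreal ((f (x, s))\<^sup>2) \<partial>lborel)"
   unfolding ker_fun_def fst_conv snd_conv by (rule cauchy_schwarz_integral_sq) measurable
  also have "\<dots> \<le> ennreal l * indicator {0<..<l} r * (\<integral>\<^sup>+s. ennreal ((f (x, s))\<^sup>2) \<partial>lborel)"
   by (intro mult_right_mono 1) simp
  finally show ?thesis .
 qed
 have "(\<integral>\<^sup>+p. ennreal ((ker_fun k f p)\<^sup>2) \<partial>lborel) = (\<integral>\<^sup>+x. \<integral>\<^sup>+r. ennreal ((ker_fun k f (x, r))\<^sup>2) \<partial>lborel \<partial>lborel)"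
  by (rule lborel_nn_integral_pair) measurable
 also have "\<dots> \<le> (\<integral>\<^sup>+x. \<integral>\<^sup>+r. indicator {0<..<l} r * (ennreal l * (\<integral>\<^sup>+s. ennreal ((f (x, s))\<^sup>2) \<partial>lborel)) \<partial>lborel \<partial>lborel)"
  by (intro nn_integral_mono order_trans[OF pt]) (simp add: mult_ac)
 also have "\<dots> = (\<integral>\<^sup>+x. ennreal l * (ennreal l * (\<integral>\<^sup>+s. ennreal ((f (x, s))\<^sup>2) \<partial>lborel)) \<partial>lborel)"
  using l by (subst nn_integral_multc) (auto)
 also have "\<dots> = ennreal l * (ennreal l * (\<integral>\<^sup>+x. (\<integral>\<^sup>+s. ennreal ((f (x, s))\<^sup>2) \<partial>lborel) \<partial>lborel))"
  by (simp add: nn_integral_cmult)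
 also have "(\<integral>\<^sup>+x. (\<integral>\<^sup>+s. ennreal ((f (x, s))\<^sup>2) \<partial>lborel) \<partial>lborel) = (\<integral>\<^sup>+p. ennreal ((f p)\<^sup>2) \<partial>lborel)"
  by (rule lborel_nn_integral_pair[symmetric]) measurable
 also have "ennreal l * (ennreal l * (\<integral>\<^sup>+p. ennreal ((f p)\<^sup>2) \<partial>lborel)) = ennreal ((l * norm (cls f))\<^sup>2)"
  unfolding norm_cls_nn[OF f, symmetric] using l
  by (simp add: ennreal_mult[symmetric] power2_eq_square mult_ac)
 finally have le: "(\<integral>\<^sup>+p. ennreal ((ker_fun k f p)\<^sup>2) \<partial>lborel) \<le> ennreal ((l * norm (cls f))\<^sup>2)" .
 show s: "ker_fun k f \<in> sqi"
  by (rule sq_int_nnI) (use le in \<open>auto simp: less_top[symmetric] top_unique\<close>)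
 have "(norm (cls (ker_fun k f)))\<^sup>2 \<le> (l * norm (cls f))\<^sup>2"
  using le unfolding norm_cls_nn[OF s, symmetric] by (simp add: ennreal_le_iff)
 then show "norm (cls (ker_fun k f)) \<le> l * norm (cls f)"
  by (rule power2_le_imp_le) (use l in auto)
next
 fix f g :: "real \<times> real => real" and c assume f: "f \<in> sqi" and g: "g \<in> sqi"
 have [measurable]: "f \<in> borel_fun" "g \<in> borel_fun" using f g by (auto simp: sq_int_def)
 have [measurable]: "ker_fun k f \<in> borel_fun" "ker_fun k g \<in> borel_fun"
  "ker_fun k (\<lambda>p. f p + c * g p) \<in> borel_fun"
  by (intro ker_fun_measurable[OF k]; measurable)+
 show "AE p in lborel. ker_fun k (\<lambda>p. f p + c * g p) p = ker_fun k f p + c * ker_fun k g p"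
 proof (subst lborel_AE_pair_iff)
  show "{p. ker_fun k (\<lambda>p. f p + c * g p) p = ker_fun k f p + c * ker_fun k g p} \<in> sets borel"
   by measurable
  show "AE x in lborel. AE y in lborel. ker_fun k (\<lambda>p. f p + c * g p) (x, y) = ker_fun k f (x, y) + c * ker_fun k g (x, y)"
   using sq_int_slice[OF f] sq_int_slice[OF g]
  proof eventually_elim
   case (elim x)
   show ?case
    using bdd_kernel_integrable[OF k elim(1)] bdd_kernel_integrable[OF k elim(2)]
    by (simp add: ker_fun_def distrib_left mult.left_commute[of _ c])
  qed
 qed
qed

definition mul_op :: "(real \<times> real => real) => l2 => l2" where
 "mul_op g e = cls (mul_fun g (rep e))"

definition swap_op :: "l2 => l2" where
 "swap_op e = cls (swap_fun (rep e))"

definition ker_op :: "(real => real => real) => l2 => l2" where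
 "ker_op k e = cls (ker_fun k (rep e))"

definition kerx_op :: "(real => real => real) => l2 => l2" where
 "kerx_op k e = swap_op (ker_op k (swap_op e))"

lemma swap_op_cls: "f \<in> sqi ==> swap_op (cls f) = cls (swap_fun f)"
 and bounded_linear_swap_op: "bounded_linear swap_op"
 using l2_op.ap_cls[OF l2_op_swap, of f] l2_op.bounded_linear_ap[OF l2_op_swap]
 unfolding l2_op.ap_def[OF l2_op_swap, abs_def] swap_op_def[abs_def] by auto

lemma ap_mul: "l2_op.ap (mul_fun g) = mul_op g" if "g \<in> borel_fun" "\<And>p. \<bar>g p\<bar> \<le> C"
 using l2_op.ap_def[OF l2_op_mul[OF that]] by (simp add: mul_op_def fun_eq_iff)

lemma ap_ker: "l2_op.ap (ker_fun k) = ker_op k" if "bdd_kernel l k"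
 using l2_op.ap_def[OF l2_op_ker[OF that]] by (simp add: ker_op_def fun_eq_iff)

lemma mul_op_cls: "f \<in> sqi ==> mul_op g (cls f) = cls (\<lambda>p. g p * f p)"
 and bounded_linear_mul_op: "bounded_linear (mul_op g)"
 and norm_mul_op: "norm (mul_op g e) \<le> C * norm e"
 and mul_fun_sq_int: "f \<in> sqi ==> (\<lambda>p. g p * f p) \<in> sqi"
 if "g \<in> borel_fun" "\<And>p. \<bar>g p\<bar> \<le> C"
proof -
 interpret l2_op "mul_fun g" C by (rule l2_op_mul[OF that])
 show "f \<in> sqi ==> mul_op g (cls f) = cls (\<lambda>p. g p * f p)" "bounded_linear (mul_op g)"
  "norm (mul_op g e) \<le> C * norm e" "f \<in> sqi ==> (\<lambda>p. g p * f p) \<in> sqi"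
  using ap_cls[of f] bounded_linear_ap norm_ap[of e] sq[of f]
  unfolding ap_mul[OF that] unfolding mul_fun_def[abs_def] by auto
qed

lemma ker_op_cls: "f \<in> sqi ==> ker_op k (cls f) = cls (ker_fun k f)"
 and bounded_linear_ker_op: "bounded_linear (ker_op k)"
 and norm_ker_op: "norm (ker_op k e) \<le> l * norm e"
 and ker_fun_sq_int: "f \<in> sqi ==> ker_fun k f \<in> sqi"
 if "bdd_kernel l k"
proof -
 interpret l2_op "ker_fun k" l by (rule l2_op_ker[OF that])
 show "f \<in> sqi ==> ker_op k (cls f) = cls (ker_fun k f)" "bounded_linear (ker_op k)"
  "norm (ker_op k e) \<le> l * norm e" "f \<in> sqi ==> ker_fun k f \<in> sqi"
  using ap_cls[of f] bounded_linear_ap norm_ap[of e] sq[of f]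
  unfolding ap_ker[OF that] by auto
qed

lemma swap_swap_op [simp]: "swap_op (swap_op e) = e"
 using swap_op_cls[OF swap_fun_sq_int[OF rep_sq_int[of e]]]
 by (simp add: swap_op_def swap_fun_def[abs_def])

lemma inner_swap_op: "inner (swap_op a) (swap_op b) = inner a b"
proof -
 have "inner (swap_op a) (swap_op b) = (LINT p|lborel. swap_fun (\<lambda>p. rep a p * rep b p) p)"
  unfolding swap_op_def by (simp add: inner_cls swap_fun_sq_int) (simp add: swap_fun_def)
 also have "\<dots> = (LINT p|lborel. rep a p * rep b p)"
  by (rule integral_swap_fun) measurable
 also have "\<dots> = inner a b" using inner_cls[OF rep_sq_int[of a] rep_sq_int[of b]] by simp
 finally show ?thesis .
qed

lemma norm_swap_op [simp]: "norm (swap_op a) = norm a"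
 by (simp add: norm_eq_sqrt_inner inner_swap_op)

lemma bounded_linear_kerx_op: "bdd_kernel l k ==> bounded_linear (kerx_op k)"
 unfolding kerx_op_def[abs_def]
 by (intro bounded_linear_compose[OF bounded_linear_swap_op] bounded_linear_compose[OF bounded_linear_ker_op]
   bounded_linear_swap_op)

lemma kerx_op_cls:
 assumes k: "bdd_kernel l k" and f: "f \<in> sqi"
 shows "kerx_op k (cls f) = cls (\<lambda>p. LINT y|lborel. k (fst p) y * f (y, snd p))"
  and "(\<lambda>p. LINT y|lborel. k (fst p) y * f (y, snd p)) \<in> sqi"
proof -
 have eq: "swap_fun (ker_fun k (swap_fun f)) = (\<lambda>p. LINT y|lborel. k (fst p) y * f (y, snd p))"
  by (simp add: swap_fun_def ker_fun_def fun_eq_iff)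
 have s: "ker_fun k (swap_fun f) \<in> sqi"
  by (intro ker_fun_sq_int[OF k] swap_fun_sq_int f)
 show "kerx_op k (cls f) = cls (\<lambda>p. LINT y|lborel. k (fst p) y * f (y, snd p))"
  unfolding kerx_op_def eq[symmetric]
  by (simp add: swap_op_cls ker_op_cls[OF k] swap_fun_sq_int f s)
 show "(\<lambda>p. LINT y|lborel. k (fst p) y * f (y, snd p)) \<in> sqi"
  unfolding eq[symmetric] by (intro swap_fun_sq_int s)
qed

lemma integrable_fst_times_snd:
 fixes f g :: "real => real"
 assumes f: "integrable lborel f" and g: "integrable lborel g"
 shows "integrable (lborel \<Otimes>\<^sub>M lborel) (\<lambda>p. f (fst p) * g (snd p))"
proof (rule lborel_pair.Fubini_integrable)
 have [measurable]: "f \<in> borel_fun" "g \<in> borel_fun"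
  using borel_measurable_integrable[OF f] borel_measurable_integrable[OF g] by auto
 show "(\<lambda>p. f (fst p) * g (snd p)) \<in> borel_measurable (lborel \<Otimes>\<^sub>M lborel)" by measurable
 show "integrable lborel (\<lambda>x. LINT y|lborel. norm (f (fst (x, y)) * g (snd (x, y))))"
  using f g by (auto simp: abs_mult)
 show "AE x in lborel. integrable lborel (\<lambda>y. f (fst (x, y)) * g (snd (x, y)))"
  using g by auto
qed

text \<open>Fubini: the kernel confines both variables to an interval of length \<open>l\<close>,
  where square integrable functions are integrable, so the integrand is dominated by a tensor
  product of integrable functions.\<close>

lemma kernel_adjoint_1d:
 fixes f g :: "real => real"
 assumes k: "bdd_kernel l k" and f: "f \<in> sqi" and g: "g \<in> sqi"
 shows "(LINT r|lborel. (LINT s|lborel. k r s * f s) * g r) = (LINT s|lborel. f s * (LINT r|lborel. k r s * g r))"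
proof -
 have [measurable]: "f \<in> borel_fun" "g \<in> borel_fun" using f g by (auto simp: sq_int_def)
 have [measurable]: "(\<lambda>p. k (fst p) (snd p)) \<in> borel_measurable (lborel \<Otimes>\<^sub>M lborel)"
  using bdd_kernel_measurable[OF k] by (simp add: lborel_prod)
 have I: "integrable lborel (\<lambda>s. \<bar>h s\<bar> * ind l s)" if "h \<in> sqi" for h :: "real => real"
  using integrable_abs[OF sq_int_integrable_mult[OF that indicator_Ioo_sq_int[of 0 l]]] by (simp add: abs_mult)
 have "integrable (lborel \<Otimes>\<^sub>M lborel) (\<lambda>p. (\<bar>g (fst p)\<bar> * ind l (fst p)) * (\<bar>f (snd p)\<bar> * ind l (snd p)))"
  by (intro integrable_fst_times_snd I f g)
 then have int: "integrable (lborel \<Otimes>\<^sub>M lborel) (\<lambda>p. k (fst p) (snd p) * f (snd p) * g (fst p))"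
 proof (rule Bochner_Integration.integrable_bound)
  show "AE p in lborel \<Otimes>\<^sub>M lborel. norm (k (fst p) (snd p) * f (snd p) * g (fst p))
   \<le> norm ((\<bar>g (fst p)\<bar> * ind l (fst p)) * (\<bar>f (snd p)\<bar> * ind l (snd p)))"
  proof (rule AE_I2)
   fix p :: "real \<times> real"
   have "\<bar>k (fst p) (snd p)\<bar> * (\<bar>f (snd p)\<bar> * \<bar>g (fst p)\<bar>) \<le> ind l (fst p) * ind l (snd p) * (\<bar>f (snd p)\<bar> * \<bar>g (fst p)\<bar>)"
    using k by (intro mult_right_mono) (auto simp: bdd_kernel_def)
   then show "norm (k (fst p) (snd p) * f (snd p) * g (fst p))
   \<le> norm ((\<bar>g (fst p)\<bar> * ind l (fst p)) * (\<bar>f (snd p)\<bar> * ind l (snd p)))"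
    by (simp add: abs_mult mult_ac)
  qed
 qed measurable
 have "(LINT r|lborel. (LINT s|lborel. k r s * f s) * g r) = (LINT r|lborel. LINT s|lborel. k r s * f s * g r)"
  by simp
 also have "\<dots> = (LINT s|lborel. LINT r|lborel. k r s * f s * g r)"
  using lborel_pair.Fubini_integral[of "\<lambda>r s. k r s * f s * g r"] int by (simp add: case_prod_beta')
 also have "\<dots> = (LINT s|lborel. f s * (LINT r|lborel. k r s * g r))"
  by (intro lint_cong) (simp flip: integral_mult_right_zero add: mult_ac)
 finally show ?thesis .
qed

lemma inner_ker_op:
 assumes k: "bdd_kernel l k"
 shows "inner (ker_op k a) b = inner a (ker_op (\<lambda>r s. k s r) b)"
proof -
 note k' = bdd_kernel_transpose[OF k]
 have 1: "inner (ker_op k a) b = (LINT p|lborel. ker_fun k (rep a) p * rep b p)"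
  using inner_cls[OF ker_fun_sq_int[OF k rep_sq_int[of a]] rep_sq_int[of b]] by (simp add: ker_op_def)
 also have "\<dots> = (LINT x|lborel. LINT r|lborel. ker_fun k (rep a) (x, r) * rep b (x, r))"
  by (intro lborel_integral_pair sq_int_integrable_mult ker_fun_sq_int[OF k] rep_sq_int)
 also have "\<dots> = (LINT x|lborel. LINT r|lborel. rep a (x, r) * ker_fun (\<lambda>r s. k s r) (rep b) (x, r))"
 proof (rule integral_cong_AE)
  show "AE x in lborel. (LINT r|lborel. ker_fun k (rep a) (x, r) * rep b (x, r)) = (LINT r|lborel. rep a (x, r) * ker_fun (\<lambda>r s. k s r) (rep b) (x, r))"
   using sq_int_slice[OF rep_sq_int[of a]] sq_int_slice[OF rep_sq_int[of b]]
  proof eventually_elim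
   case (elim x)
   then show ?case using kernel_adjoint_1d[OF k elim] by (simp add: ker_fun_def)
  qed
  show "(\<lambda>x. LINT r|lborel. ker_fun k (rep a) (x, r) * rep b (x, r)) \<in> borel_measurable lborel"
   by (rule borel_measurable_integrable, rule lborel_integrable_pair)
    (intro sq_int_integrable_mult ker_fun_sq_int[OF k] rep_sq_int)
  show "(\<lambda>x. LINT r|lborel. rep a (x, r) * ker_fun (\<lambda>r s. k s r) (rep b) (x, r)) \<in> borel_measurable lborel"
   by (rule borel_measurable_integrable, rule lborel_integrable_pair)
    (intro sq_int_integrable_mult ker_fun_sq_int[OF k'] rep_sq_int)
 qed
 also have "\<dots> = (LINT p|lborel. rep a p * ker_fun (\<lambda>r s. k s r) (rep b) p)"
  by (intro lborel_integral_pair[symmetric] sq_int_integrable_mult ker_fun_sq_int[OF k'] rep_sq_int)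
 also have "\<dots> = inner a (ker_op (\<lambda>r s. k s r) b)"
  using inner_cls[OF rep_sq_int[of a] ker_fun_sq_int[OF k' rep_sq_int[of b]]] by (simp add: ker_op_def)
 finally show ?thesis .
qed

lemma inner_kerx_op:
 assumes k: "bdd_kernel l k"
 shows "inner (kerx_op k a) b = inner a (kerx_op (\<lambda>r s. k s r) b)"
 unfolding kerx_op_def
 by (metis inner_ker_op[OF k] inner_swap_op swap_swap_op)

section \<open>Evolution equations with a parametrised domain\<close>

text \<open>Mean value theorem. The derivative is required in the open interval only, because
  classical solutions are differentiable at positive times and merely continuous at 0.\<close>

lemma nonincreasing_from_deriv:
 fixes f :: "real => real"
 assumes "a \<le> b" and cont: "continuous_on {a..b} f"
  and der: "\<And>t. a < t ==> t < b ==> \<exists>d. (f has_real_derivative d) (at t) \<and> d \<le> 0"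
 shows "f b \<le> f a"
proof (cases "a = b")
 case False
 with assms have "a < b" by simp
 from der obtain f' where f': "\<And>t. a < t ==> t < b ==> (f has_real_derivative f' t) (at t) \<and> f' t \<le> 0" by metis
 obtain z where "a < z" "z < b" "f b - f a = (b - a) * f' z"
  by (rule mvt[OF \<open>a < b\<close> cont, of "\<lambda>t. (*) (f' t)"])
   (use f' in \<open>auto simp: has_field_derivative_def mult.commute\<close>)
 then have "f b - f a \<le> 0" using f'[of z] \<open>a < b\<close> by (simp add: mult_nonneg_nonpos)
 then show ?thesis by simp
qed simp

text \<open>Difference quotients in this form are what the notion \<open>has_curve_deriv\<close>
  uses.\<close>

lemma has_vector_derivative_iff_quotient:
 fixes u :: "real => 'a::real_normed_vector"
 shows "(u has_vector_derivative u') (at t within S) \<longleftrightarrow>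
  ((\<lambda>x. (1 / (x - t)) *\<^sub>R (u x - u t)) \<longlongrightarrow> u') (at t within S)"
proof -
 have "(u has_vector_derivative u') (at t within S) \<longleftrightarrow>
  ((\<lambda>x. norm (u x - u t - (x - t) *\<^sub>R u') / norm (x - t)) \<longlongrightarrow> 0) (at t within S)"
  by (simp add: has_vector_derivative_def has_derivative_iff_norm bounded_linear_scaleR_left)
 also have "\<dots> \<longleftrightarrow> ((\<lambda>x. norm ((1 / (x - t)) *\<^sub>R (u x - u t) - u')) \<longlongrightarrow> 0) (at t within S)"
 proof (rule filterlim_cong[OF refl refl])
  have "norm (u x - u t - (x - t) *\<^sub>R u') / norm (x - t) = norm ((1 / (x - t)) *\<^sub>R (u x - u t) - u')" if "x \<noteq> t" for x
  proof -
   have "(1 / (x - t)) *\<^sub>R (u x - u t) - u' = (1 / (x - t)) *\<^sub>R (u x - u t - (x - t) *\<^sub>R u')"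
    using that by (simp add: scaleR_diff_right)
   then show ?thesis by simp
  qed
  then show "\<forall>\<^sub>F x in at t within S. norm (u x - u t - (x - t) *\<^sub>R u') / norm (x - t) = norm ((1 / (x - t)) *\<^sub>R (u x - u t) - u')"
   by (auto simp: eventually_at_filter)
 qed
 also have "\<dots> \<longleftrightarrow> ((\<lambda>x. (1 / (x - t)) *\<^sub>R (u x - u t)) \<longlongrightarrow> u') (at t within S)"
  by (simp add: tendsto_norm_zero_iff LIM_zero_iff)
 finally show ?thesis .
qed

text \<open>The form bound is quasi-dissipativity, with \<open>\<kappa>\<close> depending on the
  time horizon. Variation of \<open>C\<close> in time is measured against \<open>norm y\<close>,
  which plays the role of the graph norm of the state. The last assumption bounds the generator from
  below; it converts bounds for time derivatives into bounds for \<open>y\<close>.\<close>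

locale evolution_system =
 fixes X :: "'e::{real_inner, banach} set" and B :: "'e => 'e" and C :: "real => 'e => 'e"
 assumes X_subspace: "subspace X" and X_closed: "closed X"
  and B_linear: "bounded_linear B" and B_X: "y \<in> X ==> B y \<in> X"
  and C_linear: "t \<ge> 0 ==> bounded_linear (C t)"
  and dissipative: "T \<ge> 0 ==> \<exists>\<kappa>\<ge>0. \<forall>t\<in>{0..T}. \<forall>y\<in>X. inner (B y) (C t y) \<le> \<kappa> * (norm (B y))\<^sup>2"
  and lipschitz: "T \<ge> 0 ==> \<exists>K\<ge>0. \<forall>s\<in>{0..T}. \<forall>t\<in>{0..T}. \<forall>y\<in>X. norm (C s y - C t y) \<le> K * \<bar>s - t\<bar> * norm y"
  and coercive: "T \<ge> 0 ==> \<exists>c>0. \<forall>t\<in>{0..T}. \<forall>y\<in>X. norm y \<le> c * norm (C t y)"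
begin

sublocale B: bounded_linear B by (rule B_linear)

lemma C_add: "t \<ge> 0 ==> C t (a + b) = C t a + C t b"
 and C_diff: "t \<ge> 0 ==> C t (a - b) = C t a - C t b"
 and C_scale: "t \<ge> 0 ==> C t (c *\<^sub>R a) = c *\<^sub>R C t a"
 using bounded_linear.linear[OF C_linear] linear_add linear_diff linear_scale by blast+

text \<open>The state is \<open>B y\<close>, and \<open>C t y\<close> is the value of the generator at that state.\<close>

definition classical :: "(real => 'e) => bool" where
 "classical y \<longleftrightarrow> (\<forall>t\<ge>0. y t \<in> X) \<and> continuous_on {0..} (\<lambda>t. B (y t)) \<and>
  (\<forall>t>0. ((\<lambda>t. B (y t)) has_vector_derivative C t (y t)) (at t))"

text \<open>Compared with \<open>classical\<close>, the coordinates themselves are continuous, which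
  amounts to continuity in the graph norm, and the one-sided derivative at 0 exists.\<close>

definition strong :: "(real => 'e) => bool" where
 "strong y \<longleftrightarrow> (\<forall>t\<ge>0. y t \<in> X) \<and> continuous_on {0..} y \<and>
  (\<forall>t\<ge>0. ((\<lambda>t. B (y t)) has_vector_derivative C t (y t)) (at0 t))"

lemma at_within_nonneg: "t > 0 ==> at0 t = at (t::real)"
 by (rule at_within_interior) (simp add: interior_real_atLeast)

lemma strong_classical: "strong y ==> classical y"
 unfolding strong_def classical_def
 by (auto intro!: continuous_on_compose2[OF B.continuous_on[OF continuous_on_id], where t = UNIV] simp flip: at_within_nonneg)

lemma classical_diff: "classical y ==> classical z ==> classical (\<lambda>t. y t - z t)"
 unfolding classical_def
 by (simp add: B.diff subspace_diff[OF X_subspace] C_diff continuous_on_diff has_vector_derivative_diff)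

lemma strong_add_scale: "strong y ==> strong z ==> strong (\<lambda>t. y t + c *\<^sub>R z t)"
 unfolding strong_def
 by (simp add: B.add B.scaleR subspace_add[OF X_subspace] subspace_scale[OF X_subspace]
   C_add C_scale continuous_intros has_vector_derivative_add
   bounded_linear.has_vector_derivative[OF bounded_linear_scaleR_right])

lemma strong_diff: "strong y ==> strong z ==> strong (\<lambda>t. y t - z t)"
 using strong_add_scale[of y z "-1"] by simp

lemma has_real_derivative_norm_sq:
 fixes u :: "real => 'e"
 assumes "(u has_vector_derivative u') (at t)"
 shows "((\<lambda>t. (norm (u t))\<^sup>2) has_real_derivative 2 * inner (u t) u') (at t)"
proof -
 have "((\<lambda>t. inner (u t) (u t)) has_vector_derivative (inner (u t) u' + inner u' (u t))) (at t)"
  by (rule bounded_bilinear.has_vector_derivative[OF bounded_bilinear_inner assms assms])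
 then show ?thesis
  by (simp add: power2_norm_eq_inner has_real_derivative_iff_has_vector_derivative inner_commute)
qed

text \<open>Gronwall: \<open>(norm (B (y t)))\<^sup>2 * exp (- (2 * \<kappa> * t))\<close> does not
  increase. The constant depends on the horizon alone, so the estimate applies uniformly to
  differences of solutions.\<close>

lemma energy_estimate:
 assumes "T \<ge> 0"
 shows "\<exists>M\<ge>0. \<forall>y. classical y --> (\<forall>t\<in>{0..T}. norm (B (y t)) \<le> M * norm (B (y 0)))"
proof -
 from dissipative[OF assms] obtain \<kappa> where \<kappa>: "\<kappa> \<ge> 0"
  and dis: "\<And>t y. t \<in> {0..T} ==> y \<in> X ==> inner (B y) (C t y) \<le> \<kappa> * (norm (B y))\<^sup>2" by blast
 have "norm (B (y t)) \<le> exp (\<kappa> * T) * norm (B (y 0))" if y: "classical y" and t: "t \<in> {0..T}" for y t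
 proof -
  define \<phi> where "\<phi> s = (norm (B (y s)))\<^sup>2" for s
  define f where "f t = \<phi> t * exp (- (2 * \<kappa> * t))" for t
  have cont: "continuous_on {0..t} (\<lambda>t. B (y t))"
   by (rule continuous_on_subset[of "{0..}"]) (use y in \<open>auto simp: classical_def\<close>)
  have "f t \<le> f 0"
  proof (rule nonincreasing_from_deriv[where f = f])
   show "0 \<le> t" using t by simp
   show "continuous_on {0..t} f" unfolding f_def \<phi>_def by (intro continuous_intros cont)
   fix s assume s: "0 < s" "s < t"
   then have d: "((\<lambda>t. B (y t)) has_vector_derivative C s (y s)) (at s)" and X: "y s \<in> X"
    using y by (auto simp: classical_def)
   have d\<phi>: "(\<phi> has_real_derivative 2 * inner (B (y s)) (C s (y s))) (at s)"
    unfolding \<phi>_def by (rule has_real_derivative_norm_sq[OF d])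
   have "(f has_real_derivative
    2 * inner (B (y s)) (C s (y s)) * exp (- (2 * \<kappa> * s)) + \<phi> s * (- (2 * \<kappa>) * exp (- (2 * \<kappa> * s)))) (at s)"
    unfolding f_def by (auto intro!: derivative_eq_intros d\<phi>)
   moreover have "2 * inner (B (y s)) (C s (y s)) * exp (- (2 * \<kappa> * s)) \<le> 2 * (\<kappa> * \<phi> s) * exp (- (2 * \<kappa> * s))"
    using dis[of s "y s"] s t X unfolding \<phi>_def by (intro mult_right_mono mult_left_mono) auto
   ultimately show "\<exists>d. (f has_real_derivative d) (at s) \<and> d \<le> 0"
    by (intro exI conjI) (assumption, simp add: algebra_simps)
  qed
  then have "(norm (B (y t)))\<^sup>2 * exp (- (2 * \<kappa> * t)) \<le> (norm (B (y 0)))\<^sup>2" by (simp add: f_def \<phi>_def)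
  then have "(norm (B (y t)))\<^sup>2 * exp (- (2 * \<kappa> * t)) * exp (2 * \<kappa> * t) \<le> (norm (B (y 0)))\<^sup>2 * exp (2 * \<kappa> * t)"
   by (rule mult_right_mono) simp
  then have "(norm (B (y t)))\<^sup>2 \<le> (norm (B (y 0)))\<^sup>2 * exp (2 * \<kappa> * t)"
   by (simp add: mult.assoc exp_add[symmetric])
  also have "\<dots> \<le> (norm (B (y 0)))\<^sup>2 * exp (2 * \<kappa> * T)"
   using t \<kappa> by (intro mult_left_mono) (auto intro: mult_left_mono)
  also have "\<dots> = (exp (\<kappa> * T) * norm (B (y 0)))\<^sup>2"
   by (simp add: power_mult_distrib exp_double[symmetric] mult_ac)
  finally show ?thesis by (rule power2_le_imp_le) simp
 qed
 then show ?thesis by (intro exI[of _ "exp (\<kappa> * T)"]) auto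
qed

text \<open>The difference of two classical solutions is classical, so the energy estimate carries
  closeness from time 0 to time \<open>t\<close>. With sequences this covers limits of classical
  solutions, with a constant sequence a classical solution itself.\<close>

lemma classical_unique:
 assumes "\<And>n. classical (y n)" "\<And>n. classical (z n)"
  and "(\<lambda>n. B (y n 0)) \<longlonglongrightarrow> u0" "(\<lambda>n. B (z n 0)) \<longlonglongrightarrow> u0"
  and "(\<lambda>n. B (y n t)) \<longlonglongrightarrow> u" "(\<lambda>n. B (z n t)) \<longlonglongrightarrow> v" and t: "t \<ge> 0"
 shows "u = v"
proof -
 obtain M where M: "\<And>y. classical y ==> norm (B (y t)) \<le> M * norm (B (y 0))"
 proof -
  from energy_estimate[OF t] obtain M
   where M: "\<forall>y. classical y --> (\<forall>t\<in>{0..t}. norm (B (y t)) \<le> M * norm (B (y 0)))" by blast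
  show thesis by (rule that[of M]) (use M t in simp)
 qed
 have "norm (B (y n t) - B (z n t)) \<le> M * norm (B (y n 0) - B (z n 0))" for n
  using M[OF classical_diff[OF assms(1,2)], of n n] by (simp add: B.diff)
 note le = this
 have "(\<lambda>n. M * norm (B (y n 0) - B (z n 0))) \<longlonglongrightarrow> M * norm (u0 - u0)"
  by (intro tendsto_intros assms)
 then have lim: "(\<lambda>n. M * norm (B (y n 0) - B (z n 0))) \<longlonglongrightarrow> 0" by simp
 have 0: "(\<lambda>n. B (y n t) - B (z n t)) \<longlonglongrightarrow> 0"
  by (rule Lim_null_comparison[OF always_eventually[OF allI[OF le]] lim])
 have "(\<lambda>n. B (y n t) - B (z n t)) \<longlonglongrightarrow> u - v" by (intro tendsto_intros assms)
 from LIMSEQ_unique[OF this 0] show ?thesis by simp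
qed

text \<open>Split \<open>C s (y s) - C t (y t)\<close> into \<open>C s (y s) - C t (y s)\<close>,
  small by the Lipschitz bound, and \<open>C t (y s - y t)\<close>, small by continuity of
  \<open>y\<close>. The horizon \<open>t + 1\<close> leaves room to the right of
  \<open>t\<close>.\<close>

lemma continuous_generator:
 assumes y: "\<forall>t\<ge>0. y t \<in> X" "continuous_on {0..} y"
 shows "continuous_on {0..} (\<lambda>t. C t (y t))"
 unfolding continuous_on_def
proof
 fix t :: real assume t: "t \<in> {0..}"
 then have T: "t + 1 \<ge> 0" by simp
 from lipschitz[OF T] obtain K where K: "K \<ge> 0"
  "\<And>s r y. s \<in> {0..t+1} ==> r \<in> {0..t+1} ==> y \<in> X ==> norm (C s y - C r y) \<le> K * \<bar>s - r\<bar> * norm y" by blast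
 from t interpret Ct: bounded_linear "C t" using C_linear by simp
 have yt: "(y \<longlongrightarrow> y t) (at0 t)" using y(2) t by (simp add: continuous_on_def)
 have 1: "((\<lambda>s. C t (y s)) \<longlongrightarrow> C t (y t)) (at0 t)" by (rule Ct.tendsto[OF yt])
 have "((\<lambda>s. K * \<bar>s - t\<bar> * norm (y s)) \<longlongrightarrow> K * \<bar>t - t\<bar> * norm (y t)) (at0 t)"
  by (intro tendsto_intros yt)
 then have lim0: "((\<lambda>s. K * \<bar>s - t\<bar> * norm (y s)) \<longlongrightarrow> 0) (at0 t)" by simp
 have "\<forall>\<^sub>F s in at0 t. norm (C s (y s) - C t (y s)) \<le> K * \<bar>s - t\<bar> * norm (y s)"
 proof -
  have "\<forall>\<^sub>F s in at0 t. s < t + 1"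
   by (rule order_tendstoD(2)[of _ t]) (auto intro: tendsto_ident_at)
  moreover have "\<forall>\<^sub>F s in at0 t. s \<in> {0..}" by (simp add: eventually_at_filter)
  ultimately show ?thesis
   by eventually_elim (use t y(1) in \<open>auto intro!: K(2)\<close>)
 qed
 then have "((\<lambda>s. C s (y s) - C t (y s)) \<longlongrightarrow> 0) (at0 t)"
  by (rule Lim_null_comparison) (rule lim0)
 from tendsto_add[OF this 1] show "((\<lambda>s. C s (y s)) \<longlongrightarrow> C t (y t)) (at0 t)" by simp
qed

text \<open>With \<open>w s = y (s + h) - y s\<close> one has
  \<open>(B w)' = C (s + h) w + (C (s + h) - C s) y\<close>. The form bound treats the first term;
  the second has norm at most \<open>K * h * norm (y s)\<close>, and splitting its product with
  \<open>B w\<close> into squares costs the extra 1 in \<open>2 * \<kappa> + 1\<close>. The horizon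
  is \<open>T + 1\<close> because \<open>h \<le> 1\<close>.\<close>

lemma difference_quotient_estimate:
 assumes y: "strong y" and T: "T \<ge> 0" and \<kappa>: "\<kappa> \<ge> 0" and K: "K \<ge> 0"
  and dis: "\<And>t y. t \<in> {0..T+1} ==> y \<in> X ==> inner (B y) (C t y) \<le> \<kappa> * (norm (B y))\<^sup>2"
  and lip: "\<And>s t y. s \<in> {0..T+1} ==> t \<in> {0..T+1} ==> y \<in> X ==> norm (C s y - C t y) \<le> K * \<bar>s - t\<bar> * norm y"
  and h: "0 < h" "h \<le> 1" and t: "t \<in> {0..T}"
 shows "(norm (B (y (t + h) - y t)))\<^sup>2 \<le> exp ((2 * \<kappa> + 1) * t) *
  ((norm (B (y h - y 0)))\<^sup>2 + (K * h)\<^sup>2 * integral {0..t} (\<lambda>s. (norm (y s))\<^sup>2))"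
proof -
 define \<phi> where "\<phi> s = (norm (B (y (s + h)) - B (y s)))\<^sup>2" for s
 define m where "m = 2 * \<kappa> + 1"
 \<comment> \<open>The subtracted integral grows at the rate
   \<open>(K * h)\<^sup>2 * (norm (y s))\<^sup>2\<close> that bounds the perturbation term, so
   \<open>f\<close> does not increase.\<close>
 define f where "f s = \<phi> s * exp (- (m * s)) - (K * h)\<^sup>2 * integral {0..s} (\<lambda>s. (norm (y s))\<^sup>2)" for s
 have yX: "\<And>s. s \<ge> 0 ==> y s \<in> X" and ycont: "continuous_on {0..} y"
  and yd: "\<And>s. s > 0 ==> ((\<lambda>t. B (y t)) has_vector_derivative C s (y s)) (at s)"
  using y strong_classical[OF y] by (auto simp: strong_def classical_def)
 have Bc: "continuous_on {0..} (\<lambda>s. B (y s))" by (rule B.continuous_on[OF ycont])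
 have nc: "continuous_on {0..t} (\<lambda>s. (norm (y s))\<^sup>2)"
  by (intro continuous_intros continuous_on_subset[OF ycont]) auto
 have "f t \<le> f 0"
 proof (rule nonincreasing_from_deriv[where f = f])
  show "0 \<le> t" using t by simp
  have "continuous_on {0..t} (\<lambda>s. B (y (s + h)))"
   by (rule continuous_on_compose2[OF Bc, of _ "\<lambda>s. s + h"]) (use h in \<open>auto intro!: continuous_intros\<close>)
  moreover have "continuous_on {0..t} (\<lambda>s. B (y s))" by (rule continuous_on_subset[OF Bc]) auto
  moreover have "continuous_on {0..t} (\<lambda>s. integral {0..s} (\<lambda>s. (norm (y s))\<^sup>2))"
   by (rule indefinite_integral_continuous_1) (rule integrable_continuous_interval[OF nc])
  ultimately show "continuous_on {0..t} f" unfolding f_def \<phi>_def by (intro continuous_intros)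
  fix s assume s: "0 < s" "s < t"
  have s': "s \<in> {0..T+1}" "s + h \<in> {0..T+1}" "s > 0" "s + h > 0" using s h t by auto
  let ?w = "y (s + h) - y s"
  have w: "?w \<in> X" using yX s' by (intro subspace_diff[OF X_subspace]) auto
  interpret Ch: bounded_linear "C (s + h)" using s' by (intro C_linear) auto
  have shifted: "((\<lambda>s. B (y (s + h))) has_vector_derivative C (s + h) (y (s + h))) (at s)"
  proof -
   have "((\<lambda>s. s + h) has_vector_derivative 1) (at s)"
    by (auto intro!: derivative_eq_intros simp flip: has_real_derivative_iff_has_vector_derivative)
   from vector_diff_chain_at[OF this yd[OF s'(4)]] show ?thesis by (simp add: o_def)
  qed
  have d\<phi>: "(\<phi> has_real_derivative 2 * inner (B ?w) (C (s + h) (y (s + h)) - C s (y s))) (at s)"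
   unfolding \<phi>_def B.diff
   by (rule has_real_derivative_norm_sq) (intro has_vector_derivative_diff shifted yd s')
  have "C (s + h) (y (s + h)) - C s (y s) = C (s + h) ?w + (C (s + h) (y s) - C s (y s))"
   by (simp add: Ch.diff)
  then have "2 * inner (B ?w) (C (s + h) (y (s + h)) - C s (y s))
   = 2 * inner (B ?w) (C (s + h) ?w) + 2 * inner (B ?w) (C (s + h) (y s) - C s (y s))"
   by (simp only: inner_add_right distrib_left)
  moreover have "inner (B ?w) (C (s + h) ?w) \<le> \<kappa> * \<phi> s"
   using dis[OF s'(2) w] by (simp add: \<phi>_def B.diff)
  moreover have "2 * inner (B ?w) (C (s + h) (y s) - C s (y s)) \<le> \<phi> s + (K * h)\<^sup>2 * (norm (y s))\<^sup>2"
  proof -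
   have "2 * inner (B ?w) (C (s + h) (y s) - C s (y s)) \<le> 2 * norm (B ?w) * norm (C (s + h) (y s) - C s (y s))"
    using norm_cauchy_schwarz[of "B ?w" "C (s + h) (y s) - C s (y s)"] by simp
   also have "\<dots> \<le> (norm (B ?w))\<^sup>2 + (norm (C (s + h) (y s) - C s (y s)))\<^sup>2"
    by (rule sum_squares_bound)
   also have "(norm (C (s + h) (y s) - C s (y s)))\<^sup>2 \<le> (K * \<bar>s + h - s\<bar> * norm (y s))\<^sup>2"
    by (intro power_mono lip yX s') (use s' in auto)
   finally show ?thesis using h by (simp add: \<phi>_def B.diff power_mult_distrib)
  qed
  ultimately have le: "2 * inner (B ?w) (C (s + h) (y (s + h)) - C s (y s)) \<le> m * \<phi> s + (K * h)\<^sup>2 * (norm (y s))\<^sup>2"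
   unfolding m_def by (simp add: algebra_simps)
  have "((\<lambda>u. integral {0..u} (\<lambda>s. (norm (y s))\<^sup>2)) has_vector_derivative (norm (y s))\<^sup>2) (at s within {0..t})"
   by (rule integral_has_vector_derivative[OF nc]) (use s in auto)
  then have dI: "((\<lambda>u. integral {0..u} (\<lambda>s. (norm (y s))\<^sup>2)) has_real_derivative (norm (y s))\<^sup>2) (at s)"
   using s by (simp add: has_real_derivative_iff_has_vector_derivative at_within_Icc_at)
  let ?d = "2 * inner (B ?w) (C (s + h) (y (s + h)) - C s (y s)) * exp (- (m * s)) + \<phi> s * (- m * exp (- (m * s)))
   - (K * h)\<^sup>2 * (norm (y s))\<^sup>2"
  have "(f has_real_derivative ?d) (at s)"
   unfolding f_def by (auto intro!: derivative_eq_intros d\<phi> dI)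
  moreover have "?d \<le> 0"
  proof -
   have "2 * inner (B ?w) (C (s + h) (y (s + h)) - C s (y s)) * exp (- (m * s))
     \<le> (m * \<phi> s + (K * h)\<^sup>2 * (norm (y s))\<^sup>2) * exp (- (m * s))"
    by (intro mult_right_mono le) simp
   moreover have "(K * h)\<^sup>2 * (norm (y s))\<^sup>2 * exp (- (m * s)) \<le> (K * h)\<^sup>2 * (norm (y s))\<^sup>2 * 1"
    using s \<kappa> by (intro mult_left_mono) (auto simp: m_def)
   ultimately show ?thesis by (simp add: algebra_simps)
  qed
  ultimately show "\<exists>d. (f has_real_derivative d) (at s) \<and> d \<le> 0" by blast
 qed
 then have "\<phi> t * exp (- (m * t)) \<le> \<phi> 0 + (K * h)\<^sup>2 * integral {0..t} (\<lambda>s. (norm (y s))\<^sup>2)"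
  by (simp add: f_def)
 then have "\<phi> t * exp (- (m * t)) * exp (m * t) \<le> (\<phi> 0 + (K * h)\<^sup>2 * integral {0..t} (\<lambda>s. (norm (y s))\<^sup>2)) * exp (m * t)"
  by (rule mult_right_mono) simp
 then show ?thesis
  by (simp add: mult.assoc exp_add[symmetric]) (simp add: \<phi>_def m_def B.diff mult.commute)
qed

text \<open>An integrating factor bounds the integral first, and the hypothesis then returns a bound
  for \<open>g\<close>. What matters is that the result is linear in \<open>a\<close>.\<close>

lemma gronwall_integral:
 fixes g :: "real => real"
 assumes g: "continuous_on {0..T} g" and le: "\<And>t. t \<in> {0..T} ==> g t \<le> a + b * integral {0..t} g"
  and "a \<ge> 0" "b \<ge> 0" and t: "t \<in> {0..T}"
 shows "g t \<le> a * (1 + b * (T * exp (b * T)))"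
proof -
 define f where "f s = integral {0..s} g * exp (- (b * s)) - a * s" for s
 have gt: "continuous_on {0..t} g" by (rule continuous_on_subset[OF g]) (use t in auto)
 have "f t \<le> f 0"
 proof (rule nonincreasing_from_deriv[where f = f])
  show "0 \<le> t" using t by simp
  have "continuous_on {0..t} (\<lambda>s. integral {0..s} g)"
   by (rule indefinite_integral_continuous_1) (rule integrable_continuous_interval[OF gt])
  then show "continuous_on {0..t} f" unfolding f_def by (intro continuous_intros)
  fix s assume s: "0 < s" "s < t"
  have "((\<lambda>u. integral {0..u} g) has_vector_derivative g s) (at s within {0..t})"
   by (rule integral_has_vector_derivative[OF gt]) (use s in auto)
  then have dI: "((\<lambda>u. integral {0..u} g) has_real_derivative g s) (at s)"
   using s by (simp add: has_real_derivative_iff_has_vector_derivative at_within_Icc_at)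
  have "(f has_real_derivative (g s * exp (- (b * s)) + integral {0..s} g * (- b * exp (- (b * s))) - a)) (at s)"
   unfolding f_def by (auto intro!: derivative_eq_intros dI)
  moreover have "(g s - b * integral {0..s} g) * exp (- (b * s)) \<le> a * 1"
  proof (rule mult_mono)
   show "g s - b * integral {0..s} g \<le> a" using le[of s] s t by simp
   show "exp (- (b * s)) \<le> 1" using s assms by simp
  qed (use assms in auto)
  ultimately show "\<exists>d. (f has_real_derivative d) (at s) \<and> d \<le> 0"
   by (intro exI conjI) (assumption, simp add: algebra_simps)
 qed
 then have "integral {0..t} g * exp (- (b * t)) \<le> a * t" by (simp add: f_def)
 then have "integral {0..t} g * exp (- (b * t)) * exp (b * t) \<le> a * t * exp (b * t)"
  by (rule mult_right_mono) simp
 then have "integral {0..t} g \<le> a * (t * exp (b * t))"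
  by (simp add: mult.assoc exp_add[symmetric])
 also have "\<dots> \<le> a * (T * exp (b * T))"
  using t assms by (intro mult_left_mono mult_mono) (auto intro: mult_left_mono)
 finally have "b * integral {0..t} g \<le> b * (a * (T * exp (b * T)))"
  using assms by (intro mult_left_mono)
 with le[OF t] show ?thesis by (simp add: algebra_simps)
qed

text \<open>Divided by \<open>h\<^sup>2\<close> and with \<open>h\<close> tending to 0 from the
  right, the estimate for differences bounds \<open>norm (C t (y t))\<close> through
  \<open>norm (C 0 (y 0))\<close> and the integral of \<open>(norm (y s))\<^sup>2\<close>.
  Coercivity puts \<open>norm (y t)\<close> on the left, and Gronwall removes the integral.\<close>

lemma strong_estimate:
 assumes T: "T \<ge> 0"
 shows "\<exists>M\<ge>0. \<forall>y. strong y --> (\<forall>t\<in>{0..T}. norm (y t) \<le> M * norm (y 0))"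
proof -
 have T1: "T + 1 \<ge> 0" using T by simp
 from dissipative[OF T1] obtain \<kappa> where \<kappa>: "\<kappa> \<ge> 0"
  and dis: "\<And>t y. t \<in> {0..T+1} ==> y \<in> X ==> inner (B y) (C t y) \<le> \<kappa> * (norm (B y))\<^sup>2" by blast
 from lipschitz[OF T1] obtain K where K: "K \<ge> 0"
  and lip: "\<And>s t y. s \<in> {0..T+1} ==> t \<in> {0..T+1} ==> y \<in> X ==> norm (C s y - C t y) \<le> K * \<bar>s - t\<bar> * norm y" by blast
 from coercive[OF T] obtain c where c: "c > 0"
  and coe: "\<And>t y. t \<in> {0..T} ==> y \<in> X ==> norm y \<le> c * norm (C t y)" by blast
 interpret C0: bounded_linear "C 0" by (rule C_linear) simp
 obtain c0 where c0: "\<And>y. norm (C 0 y) \<le> norm y * c0" using C0.bounded by blast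
 define E where "E = exp ((2 * \<kappa> + 1) * T)"
 define b where "b = c\<^sup>2 * E * K\<^sup>2"
 define N where "N = c\<^sup>2 * E * c0\<^sup>2 * (1 + b * (T * exp (b * T)))"
 have N: "N \<ge> 0" using T by (simp add: N_def b_def E_def)
 have "norm (y t) \<le> sqrt N * norm (y 0)" if y: "strong y" and t: "t \<in> {0..T}" for y t
 proof -
  have yX: "\<And>s. s \<ge> 0 ==> y s \<in> X" and ycont: "continuous_on {0..} y"
   and yd: "\<And>s. s \<ge> 0 ==> ((\<lambda>t. B (y t)) has_vector_derivative C s (y s)) (at0 s)"
   using y by (auto simp: strong_def)
  let ?g = "\<lambda>s. (norm (y s))\<^sup>2"
  have key: "(norm (C t (y t)))\<^sup>2 \<le> E * ((norm (C 0 (y 0)))\<^sup>2 + K\<^sup>2 * integral {0..t} ?g)"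
   if t: "t \<in> {0..T}" for t
  proof -
   define Q where "Q s h = (1 / h) *\<^sub>R (B (y (s + h)) - B (y s))" for s h
   define G where "G = integral {0..t} ?g"
   have q: "((\<lambda>h. Q s h) \<longlongrightarrow> C s (y s)) (at_right 0)" if "s \<ge> 0" for s
   proof -
    have "((\<lambda>x. (B (y x) - B (y s)) /\<^sub>R (x - s)) \<longlongrightarrow> C s (y s)) (at0 s)"
     using yd[OF that] by (simp add: has_vector_derivative_iff_quotient inverse_eq_divide)
    then have "((\<lambda>x. (B (y x) - B (y s)) /\<^sub>R (x - s)) \<longlongrightarrow> C s (y s)) (at_right s)"
     by (rule tendsto_within_subset) (use that in auto)
    then have "((\<lambda>h. (B (y (h + s)) - B (y s)) /\<^sub>R (h + s - s)) \<longlongrightarrow> C s (y s)) (at_right 0)"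
     unfolding at_right_to_0[of s] filterlim_filtermap .
    then show ?thesis by (simp add: add.commute inverse_eq_divide Q_def)
   qed
   have l1: "((\<lambda>h. (norm (Q t h))\<^sup>2) \<longlongrightarrow> (norm (C t (y t)))\<^sup>2) (at_right 0)"
    by (intro tendsto_intros q) (use t in auto)
   have l2: "((\<lambda>h. E * ((norm (Q 0 h))\<^sup>2 + K\<^sup>2 * G))
    \<longlongrightarrow> E * ((norm (C 0 (y 0)))\<^sup>2 + K\<^sup>2 * G)) (at_right 0)"
    by (intro tendsto_intros q) auto
   have ev: "\<forall>\<^sub>F h in at_right 0. (norm (Q t h))\<^sup>2
    \<le> E * ((norm (Q 0 h))\<^sup>2 + K\<^sup>2 * G)"
    using eventually_at_right_real[of 0 1, OF zero_less_one]
   proof eventually_elim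
    case (elim h)
    then have h: "0 < h" "h \<le> 1" by auto
    have I: "0 \<le> G"
     unfolding G_def by (rule integral_nonneg) (auto intro!: integrable_continuous_interval continuous_intros continuous_on_subset[OF ycont])
    have "(norm (B (y (t + h) - y t)))\<^sup>2 \<le> exp ((2 * \<kappa> + 1) * t) *
     ((norm (B (y h - y 0)))\<^sup>2 + (K * h)\<^sup>2 * G)"
     unfolding G_def by (rule difference_quotient_estimate[OF y T \<kappa> K dis lip h t])
    also have "\<dots> \<le> E * ((norm (B (y h - y 0)))\<^sup>2 + (K * h)\<^sup>2 * G)"
    proof (rule mult_right_mono)
     show "exp ((2 * \<kappa> + 1) * t) \<le> E"
      unfolding E_def exp_le_cancel_iff using t \<kappa> by (intro mult_left_mono) auto
     show "0 \<le> (norm (B (y h - y 0)))\<^sup>2 + (K * h)\<^sup>2 * G"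
      using I by simp
    qed
    finally have "(norm (B (y (t + h) - y t)))\<^sup>2 / h\<^sup>2 \<le> E * ((norm (B (y h - y 0)))\<^sup>2 + (K * h)\<^sup>2 * G) / h\<^sup>2"
     by (rule divide_right_mono) simp
    also have "\<dots> = E * ((norm (B (y h - y 0)))\<^sup>2 / h\<^sup>2 + K\<^sup>2 * G)"
     using h by (simp add: field_simps power_mult_distrib)
    finally show ?case using h by (simp add: B.diff power_divide Q_def)
   qed
   show ?thesis unfolding G_def[symmetric] by (rule tendsto_le[OF _ l2 l1 ev]) simp
  qed
  have "(norm (y t))\<^sup>2 \<le> c\<^sup>2 * E * (norm (C 0 (y 0)))\<^sup>2 * (1 + b * (T * exp (b * T)))"
  proof (rule gronwall_integral[of T "?g"])
   show "continuous_on {0..T} ?g" by (intro continuous_intros continuous_on_subset[OF ycont]) auto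
   fix t assume t: "t \<in> {0..T}"
   have "?g t \<le> (c * norm (C t (y t)))\<^sup>2"
    by (intro power_mono coe t yX) (use t in auto)
   also have "\<dots> \<le> c\<^sup>2 * (E * ((norm (C 0 (y 0)))\<^sup>2 + K\<^sup>2 * integral {0..t} ?g))"
    unfolding power_mult_distrib by (intro mult_left_mono key t) simp
   finally show "?g t \<le> c\<^sup>2 * E * (norm (C 0 (y 0)))\<^sup>2 + b * integral {0..t} ?g"
    by (simp add: b_def algebra_simps)
  qed (use t in \<open>auto simp: b_def E_def\<close>)
  also have "\<dots> \<le> c\<^sup>2 * E * (norm (y 0) * c0)\<^sup>2 * (1 + b * (T * exp (b * T)))"
   using T by (intro mult_right_mono mult_left_mono power_mono c0) (auto simp: b_def E_def)
  also have "\<dots> = (sqrt N * norm (y 0))\<^sup>2"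
   using N by (simp add: power_mult_distrib N_def)
  finally show ?thesis by (rule power2_le_imp_le) (use N in simp)
 qed
 then show ?thesis by (intro exI[of _ "sqrt N"]) (use N in auto)
qed

text \<open>Serves twice: with \<open>u n\<close> the coordinates, controlled by
  \<open>strong_estimate\<close>, and with \<open>u n\<close> the states, controlled by
  \<open>energy_estimate\<close>.\<close>

lemma uniform_limit_of_Cauchy_data:
 fixes u :: "nat => real => 'e" and a :: "nat => 'e"
 assumes est: "\<And>T. T \<ge> 0 ==> \<exists>M\<ge>0. \<forall>m n. \<forall>t\<in>{0..T}. norm (u m t - u n t) \<le> M * norm (a m - a n)"
  and a: "Cauchy a" and cont: "\<And>n. continuous_on {0..} (u n)"
 shows "\<exists>v. continuous_on {0..} v \<and> (\<forall>T\<ge>0. uniform_limit {0..T} u v sequentially)"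
proof -
 have uc: "\<exists>v. uniform_limit {0..T} u v sequentially" if "T \<ge> 0" for T
 proof -
  from est[OF that] obtain M where M: "M \<ge> 0" "\<And>m n t. t \<in> {0..T} ==> norm (u m t - u n t) \<le> M * norm (a m - a n)"
   by blast
  have "uniformly_Cauchy_on {0..T} u"
   unfolding uniformly_Cauchy_on_def
  proof (intro allI impI)
   fix e :: real assume "e > 0"
   then have "e / (M + 1) > 0" using M by simp
   with a obtain N where N: "\<And>m n. m \<ge> N ==> n \<ge> N ==> norm (a m - a n) < e / (M + 1)"
    unfolding Cauchy_def dist_norm by blast
   have "dist (u m t) (u n t) < e" if "t \<in> {0..T}" "m \<ge> N" "n \<ge> N" for t m n
   proof -
    have "dist (u m t) (u n t) \<le> M * norm (a m - a n)" using M(2)[OF that(1)] by (simp add: dist_norm)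
    also have "\<dots> \<le> (M + 1) * norm (a m - a n)" by (intro mult_right_mono) auto
    also have "\<dots> < (M + 1) * (e / (M + 1))" using N[OF that(2,3)] M(1) by (intro mult_strict_left_mono) auto
    also have "\<dots> = e" using M(1) by simp
    finally show ?thesis .
   qed
   then show "\<exists>N. \<forall>x\<in>{0..T}. \<forall>m\<ge>N. \<forall>n\<ge>N. dist (u m x) (u n x) < e" by blast
  qed
  then have "uniformly_convergent_on {0..T} u" by (rule Cauchy_uniformly_convergent)
  then show ?thesis by (simp add: uniformly_convergent_on_def)
 qed
 \<comment> \<open>The pointwise definition makes the uniform limits on different intervals
   restrictions of one function.\<close>
 define v where "v t = lim (\<lambda>n. u n t)" for t
 have ul: "uniform_limit {0..T} u v sequentially" if "T \<ge> 0" for T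
 proof -
  from uc[OF that] obtain w where w: "uniform_limit {0..T} u w sequentially" by blast
  have "w t = v t" if "t \<in> {0..T}" for t
   using tendsto_uniform_limitI[OF w that] by (simp add: v_def limI)
  with w show ?thesis by (subst uniform_limit_cong'[of _ _ u v w]) auto
 qed
 moreover have "continuous_on {0..} v"
 proof -
  have "continuous_on {0..<T} v" if "T \<ge> 0" for T
   by (rule continuous_on_subset[OF uniform_limit_theorem[OF _ ul[OF that]]])
    (auto intro!: always_eventually continuous_on_subset[OF cont])
  then have *: "continuous_on {0..<t+1} v" if "t \<ge> 0" for t using that by simp
  show ?thesis
   unfolding continuous_on_eq_continuous_within
  proof
   fix t :: real assume "t \<in> {0..}"
   then have "t \<ge> 0" by simp
   from *[OF this] \<open>t \<ge> 0\<close> have "continuous (at t within {0..<t+1}) v"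
    by (auto simp: continuous_on_eq_continuous_within)
   moreover have "at t within {0..<t+1} = at0 t"
    by (rule at_within_nhd[of _ "{..<t+1}"]) auto
   ultimately show "continuous (at0 t) v" by simp
  qed
 qed
 ultimately show ?thesis by blast
qed

text \<open>The coordinates of approximating solutions converge uniformly on bounded intervals,
  hence so do the derivatives \<open>C t (y n t)\<close>; the limit of the states may therefore be
  differentiated term by term, also at time 0.\<close>

theorem strong_exists:
 assumes dense: "\<And>y0. y0 \<in> X ==> y0 \<in> closure {y 0 |y. strong y}"
  and y0: "y0 \<in> X"
 shows "\<exists>y. strong y \<and> y 0 = y0"
proof -
 from dense[OF y0] obtain a where a: "\<And>n. a n \<in> {y 0 |y. strong y}" "a \<longlonglongrightarrow> y0"
  unfolding closure_sequential by blast
 have "\<exists>y. strong y \<and> y 0 = a n" for n using a(1)[of n] by auto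
 then obtain y where y: "\<And>n. strong (y n)" "\<And>n. y n 0 = a n" by metis
 have "\<exists>v. continuous_on {0..} v \<and> (\<forall>T\<ge>0. uniform_limit {0..T} y v sequentially)"
 proof (rule uniform_limit_of_Cauchy_data)
  show "Cauchy a" using a(2) by (rule LIMSEQ_imp_Cauchy)
  show "continuous_on {0..} (y n)" for n using y(1) by (simp add: strong_def)
  fix T :: real assume "T \<ge> 0"
  from strong_estimate[OF this] obtain M where M: "M \<ge> 0"
   "\<And>y t. strong y ==> t \<in> {0..T} ==> norm (y t) \<le> M * norm (y 0)" by blast
  show "\<exists>M\<ge>0. \<forall>m n. \<forall>t\<in>{0..T}. norm (y m t - y n t) \<le> M * norm (a m - a n)"
   using M(1) M(2)[OF strong_diff[OF y(1) y(1)]] y(2) by (intro exI[of _ M]) auto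
 qed
 then obtain v where vc: "continuous_on {0..} v" and vl: "\<And>T. T \<ge> 0 ==> uniform_limit {0..T} y v sequentially" by blast
 have lim: "(\<lambda>n. y n t) \<longlonglongrightarrow> v t" if "t \<ge> 0" for t
  using tendsto_uniform_limitI[OF vl[OF that], of t] that by simp
 have vX: "v t \<in> X" if "t \<ge> 0" for t
  using closed_sequentially[OF X_closed _ lim[OF that]] y(1) that by (auto simp: strong_def)
 have v0: "v 0 = y0" using lim[of 0] a(2) y(2) LIMSEQ_unique by auto
 have "((\<lambda>t. B (v t)) has_vector_derivative C t (v t)) (at0 t)" if t: "t \<ge> 0" for t
 proof -
  let ?S = "{0..t+1}"
  have T: "t + 1 \<ge> 0" using t by simp
  from lipschitz[OF T] obtain K where K: "K \<ge> 0"
   "\<And>s r y. s \<in> ?S ==> r \<in> ?S ==> y \<in> X ==> norm (C s y - C r y) \<le> K * \<bar>s - r\<bar> * norm y" by blast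
  interpret C0: bounded_linear "C 0" by (rule C_linear) simp
  obtain c0 where c0: "c0 > 0" "\<And>y. norm (C 0 y) \<le> norm y * c0" using C0.pos_bounded by blast
  \<comment> \<open>A bound for all \<open>C s\<close> on \<open>X\<close> with
    \<open>s \<le> t + 1\<close>: the norm of \<open>C 0\<close> plus the Lipschitz drift away from
    time 0.\<close>
  define c where "c = c0 + K * (t + 1)"
  have c: "c > 0" using c0(1) K t by (simp add: c_def add_pos_nonneg)
  have Cb: "norm (C s y) \<le> c * norm y" if "s \<in> ?S" "y \<in> X" for s y
  proof -
   have "norm (C s y) \<le> norm (C 0 y) + norm (C s y - C 0 y)" by (metis add.commute diff_add_cancel norm_triangle_ineq)
   also have "norm (C s y - C 0 y) \<le> K * \<bar>s - 0\<bar> * norm y" using K(2)[of s 0 y] that T by auto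
   also have "\<dots> \<le> K * (t + 1) * norm y" using that K(1) by (intro mult_right_mono mult_left_mono) auto
   also have "norm (C 0 y) \<le> norm y * c0" by (rule c0)
   finally show ?thesis by (simp add: c_def algebra_simps)
  qed
  have "\<exists>g. \<forall>x\<in>?S. (\<lambda>n. B (y n x)) \<longlonglongrightarrow> g x \<and> (g has_derivative (\<lambda>h. h *\<^sub>R C x (v x))) (at x within ?S)"
  proof (rule has_derivative_sequence[where f' = "\<lambda>n x h. h *\<^sub>R C x (y n x)"])
   fix n x assume "x \<in> ?S"
   then have "((\<lambda>t. B (y n t)) has_vector_derivative C x (y n x)) (at0 x)"
    using y(1)[of n] by (simp add: strong_def)
   then show "((\<lambda>t. B (y n t)) has_derivative (\<lambda>h. h *\<^sub>R C x (y n x))) (at x within ?S)"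
    unfolding has_vector_derivative_def by (rule has_derivative_subset) auto
  next
   fix e :: real assume "e > 0"
   with c have "e / c > 0" by simp
   have "\<forall>\<^sub>F n in sequentially. \<forall>x\<in>?S. dist (y n x) (v x) < e / c"
    using vl[OF T] \<open>e / c > 0\<close> by (simp add: uniform_limit_iff)
   then show "\<forall>\<^sub>F n in sequentially. \<forall>x\<in>?S. \<forall>h. norm (h *\<^sub>R C x (y n x) - h *\<^sub>R C x (v x)) \<le> e * norm h"
   proof eventually_elim
    case (elim n)
    show ?case
    proof (intro ballI allI)
     fix x h :: real assume x: "x \<in> ?S"
     then have "x \<ge> 0" by simp
     interpret Cx: bounded_linear "C x" by (rule C_linear) fact
     have "y n x - v x \<in> X" using y(1)[of n] vX \<open>x \<ge> 0\<close> by (auto simp: strong_def intro: subspace_diff[OF X_subspace])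
     from Cb[OF x this] have "norm (C x (y n x - v x)) \<le> c * (e / c)"
      using elim x c by (smt (verit) dist_norm mult_left_mono)
     then have "norm (C x (y n x - v x)) \<le> e" using c by simp
     then show "norm (h *\<^sub>R C x (y n x) - h *\<^sub>R C x (v x)) \<le> e * norm h"
      by (simp add: scaleR_diff_right[symmetric] Cx.diff[symmetric] mult.commute[of e] mult_left_mono)
    qed
   qed
  next
   show "(\<lambda>n. B (y n 0)) \<longlonglongrightarrow> B (v 0)" by (intro B.tendsto lim) simp
  qed (use t in auto)
  then obtain g where g: "\<And>x. x \<in> ?S ==> (\<lambda>n. B (y n x)) \<longlonglongrightarrow> g x"
   "\<And>x. x \<in> ?S ==> (g has_vector_derivative C x (v x)) (at x within ?S)"
   unfolding has_vector_derivative_def by blast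
  have "g x = B (v x)" if "x \<in> ?S" for x
   using LIMSEQ_unique[OF g(1)[OF that] B.tendsto[OF lim]] that by simp
  then have "((\<lambda>t. B (v t)) has_vector_derivative C t (v t)) (at t within ?S)"
   using t by (intro has_vector_derivative_transform[OF _ _ g(2)]) auto
  moreover have "at t within ?S = at0 t"
   by (rule at_within_nhd[of _ "{..<t+1}"]) auto
  ultimately show ?thesis by simp
 qed
 then have "strong v" using vX vc by (simp add: strong_def)
 with v0 show ?thesis by blast
qed

text \<open>Energy bounds control the states of the approximating solutions and not their
  coordinates, so the limit \<open>u\<close> is a curve in \<open>X\<close> that may leave the range
  of \<open>B\<close>.\<close>

theorem mild_exists:
 assumes dense: "\<And>y0. y0 \<in> X ==> y0 \<in> closure {y 0 |y. strong y}"
  and dom: "u0 \<in> closure (B ` X)"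
 shows "\<exists>u y. (\<forall>n. strong (y n)) \<and> (\<lambda>n. B (y n 0)) \<longlonglongrightarrow> u0 \<and> continuous_on {0..} u \<and>
  (\<forall>t\<ge>0. u t \<in> X) \<and> (\<forall>T\<ge>0. uniform_limit {0..T} (\<lambda>n t. B (y n t)) u sequentially) \<and> u 0 = u0"
proof -
 from dom obtain a where a: "\<And>n. a n \<in> B ` X" "a \<longlonglongrightarrow> u0"
  unfolding closure_sequential by blast
 have "\<exists>y. strong y \<and> B (y 0) = a n" for n
 proof -
  from a(1)[of n] obtain y0 where "y0 \<in> X" "B y0 = a n" by auto
  with strong_exists[OF dense, of y0] show ?thesis by blast
 qed
 then obtain y where y: "\<And>n. strong (y n)" "\<And>n. B (y n 0) = a n" by metis
 have "\<exists>v. continuous_on {0..} v \<and> (\<forall>T\<ge>0. uniform_limit {0..T} (\<lambda>n t. B (y n t)) v sequentially)"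
 proof (rule uniform_limit_of_Cauchy_data)
  show "Cauchy a" using a(2) by (rule LIMSEQ_imp_Cauchy)
  show "continuous_on {0..} (\<lambda>t. B (y n t))" for n using strong_classical[OF y(1)] by (simp add: classical_def)
  fix T :: real assume "T \<ge> 0"
  from energy_estimate[OF this] obtain M where M: "M \<ge> 0"
   "\<And>y t. classical y ==> t \<in> {0..T} ==> norm (B (y t)) \<le> M * norm (B (y 0))" by blast
  show "\<exists>M\<ge>0. \<forall>m n. \<forall>t\<in>{0..T}. norm (B (y m t) - B (y n t)) \<le> M * norm (a m - a n)"
   using M(1) M(2)[OF strong_classical[OF strong_diff[OF y(1) y(1)]]] y(2)
   by (intro exI[of _ M]) (auto simp: B.diff)
 qed
 then obtain v where vc: "continuous_on {0..} v"
  and vl: "\<And>T. T \<ge> 0 ==> uniform_limit {0..T} (\<lambda>n t. B (y n t)) v sequentially" by blast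
 have lim: "(\<lambda>n. B (y n t)) \<longlonglongrightarrow> v t" if "t \<ge> 0" for t
  using tendsto_uniform_limitI[OF vl[OF that], of t] that by simp
 have vX: "v t \<in> X" if "t \<ge> 0" for t
  using closed_sequentially[OF X_closed _ lim[OF that]] y(1) that by (auto simp: strong_def B_X)
 have "v 0 = u0" using lim[of 0] a(2) y(2) LIMSEQ_unique by auto
 then show ?thesis using y(1) a(2) vc vX vl unfolding y(2)[symmetric] by blast
qed

end

section \<open>Primitives of square integrable functions on the line\<close>

definition prim :: "(real => real) => real => real" where
 "prim f x = (LINT s|lborel. ind x s * f s)"

lemma ind_mult_integrable:
 fixes f :: "real => real"
 assumes "f \<in> sqi"
 shows "integrable lborel (\<lambda>s. indicator {a<..<b} s * f s)"
 by (rule sq_int_integrable_mult[OF indicator_Ioo_sq_int assms])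

lemma ind_mult_sq_int:
 fixes f :: "real => real"
 assumes "f \<in> sqi"
 shows "(\<lambda>s. indicator {a<..<b} s * f s) \<in> sqi"
proof (rule sq_int_bound[OF assms])
 show "(\<lambda>s. indicator {a<..<b} s * f s) \<in> borel_measurable lborel"
  using sq_int_measurable[OF assms] by measurable
qed (auto split: split_indicator)

lemma prim_le_0 [simp]: "x \<le> 0 ==> prim f x = 0"
 by (simp add: prim_def)

lemma prim_add: "f \<in> sqi ==> g \<in> sqi ==> prim (\<lambda>s. f s + g s) x = prim f x + prim g x"
 using ind_mult_integrable[of f] ind_mult_integrable[of g] by (simp add: prim_def distrib_left)

lemma prim_diff: "f \<in> sqi ==> g \<in> sqi ==> prim (\<lambda>s. f s - g s) x = prim f x - prim g x"
 using ind_mult_integrable[of f] ind_mult_integrable[of g] by (simp add: prim_def right_diff_distrib)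

lemma prim_scale: "prim (\<lambda>s. c * f s) x = c * prim f x"
 by (simp add: prim_def mult.left_commute[of _ c])

lemma prim_cong_AE:
 assumes [measurable]: "f \<in> borel_fun" "g \<in> borel_fun"
  and eq: "AE s in lborel. 0 < s \<and> s < l --> f s = g s" and "x \<le> l"
 shows "prim f x = prim g x"
 unfolding prim_def
proof (rule integral_cong_AE)
 show "AE s in lborel. ind x s * f s = ind x s * g s"
  using eq by eventually_elim (use \<open>x \<le> l\<close> in \<open>auto split: split_indicator\<close>)
qed measurable

lemma integral_ind_holder:
 assumes f: "f \<in> sqi" and "a \<le> b"
 shows "(LINT s|lborel. indicator {a<..<b} s * f s)\<^sup>2 \<le> (b - a) * (LINT s|lborel. (f s)\<^sup>2)"
proof -
 have [measurable]: "f \<in> borel_fun" using f by (simp add: sq_int_def)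
 have "ennreal ((LINT s|lborel. indicator {a<..<b} s * f s)\<^sup>2) \<le>
  (\<integral>\<^sup>+s. ennreal ((indicator {a<..<b} s)\<^sup>2) \<partial>lborel) * (\<integral>\<^sup>+s. ennreal ((f s)\<^sup>2) \<partial>lborel)"
  by (rule cauchy_schwarz_integral_sq) auto
 also have "(\<integral>\<^sup>+s. ennreal ((indicator {a<..<b} s)\<^sup>2) \<partial>lborel) = (\<integral>\<^sup>+s. indicator {a<..<b} s \<partial>lborel)"
  by (intro nn_integral_cong) (auto split: split_indicator)
 also have "\<dots> = ennreal (b - a)" using \<open>a \<le> b\<close> by simp
 also have "(\<integral>\<^sup>+s. ennreal ((f s)\<^sup>2) \<partial>lborel) = ennreal (LINT s|lborel. (f s)\<^sup>2)"
  using f by (intro nn_integral_eq_integral) (auto simp: sq_int_def)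
 finally show ?thesis
  using \<open>a \<le> b\<close> by (simp add: ennreal_mult[symmetric] ennreal_le_iff)
qed

lemma prim_increment:
 assumes f: "f \<in> sqi" and "0 \<le> x" "x \<le> y"
 shows "prim f y - prim f x = (LINT s|lborel. indicator {x<..<y} s * f s)"
proof -
 have [measurable]: "f \<in> borel_fun" using f by (simp add: sq_int_def)
 have "prim f y - prim f x = (LINT s|lborel. ind y s * f s - ind x s * f s)"
  unfolding prim_def by (intro Bochner_Integration.integral_diff[symmetric] ind_mult_integrable f)
 also have "\<dots> = (LINT s|lborel. indicator {x<..<y} s * f s)"
 proof (rule integral_cong_AE)
  show "AE s in lborel. ind y s * f s - ind x s * f s = indicator {x<..<y} s * f s"
   using AE_lborel_singleton[of x] by eventually_elim (use assms in \<open>auto split: split_indicator\<close>)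
 qed measurable
 finally show ?thesis .
qed

text \<open>Cauchy-Schwarz against the indicator of the interval between \<open>x\<close> and
  \<open>y\<close>: primitives are Hoelder continuous of exponent 1/2, whence continuity up to the
  end points.\<close>

lemma prim_holder:
 assumes f: "f \<in> sqi" and "0 \<le> x" "0 \<le> y"
 shows "(prim f y - prim f x)\<^sup>2 \<le> \<bar>y - x\<bar> * (LINT s|lborel. (f s)\<^sup>2)"
proof -
 have *: "(prim f y - prim f x)\<^sup>2 \<le> \<bar>y - x\<bar> * (LINT s|lborel. (f s)\<^sup>2)" if "0 \<le> x" "x \<le> y" for x y
  using integral_ind_holder[OF f that(2)] prim_increment[OF f that] that by simp
 show ?thesis
  using *[of x y] *[of y x] assms by (cases "x \<le> y") (auto simp: power2_commute abs_minus_commute)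
qed

lemma prim_continuous:
 assumes f: "f \<in> sqi"
 shows "continuous_on {0..} (prim f)"
 unfolding continuous_on_def
proof
 fix x :: real assume x: "x \<in> {0..}"
 let ?n = "LINT s|lborel. (f s)\<^sup>2"
 have "((\<lambda>y. sqrt (\<bar>y - x\<bar> * ?n)) \<longlongrightarrow> sqrt (\<bar>x - x\<bar> * ?n)) (at0 x)"
  by (intro tendsto_intros)
 then have lim: "((\<lambda>y. sqrt (\<bar>y - x\<bar> * ?n)) \<longlongrightarrow> 0) (at0 x)" by simp
 have "\<forall>\<^sub>F y in at0 x. norm (prim f y - prim f x) \<le> sqrt (\<bar>y - x\<bar> * ?n)"
  unfolding eventually_at_filter
  by (intro always_eventually allI impI, simp, rule real_le_rsqrt)
   (use prim_holder[OF f] x in auto)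
 then have "((\<lambda>y. prim f y - prim f x) \<longlongrightarrow> 0) (at0 x)"
  by (rule Lim_null_comparison) (rule lim)
 then show "(prim f \<longlongrightarrow> prim f x) (at0 x)" by (rule LIM_zero_cancel)
qed

lemma prim_bound:
 assumes f: "f \<in> sqi" and "x \<le> l" "0 \<le> l"
 shows "\<bar>prim f x\<bar> \<le> sqrt (l * (LINT s|lborel. (f s)\<^sup>2))"
proof (cases "x \<ge> 0")
 case True
 have "(prim f x)\<^sup>2 \<le> x * (LINT s|lborel. (f s)\<^sup>2)" using prim_holder[OF f, of 0 x] True by simp
 also have "\<dots> \<le> l * (LINT s|lborel. (f s)\<^sup>2)" using assms by (intro mult_right_mono) auto
 finally show ?thesis using real_le_rsqrt[of "\<bar>prim f x\<bar>"] by simp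
qed (use assms in simp)

text \<open>The kernels \<open>k_lt\<close>, \<open>k_gt\<close> and \<open>k_one\<close> integrate
  over \<open>0 < s < r\<close>, over \<open>r < s < l\<close>, and over the whole interval. That
  the second is the transpose of the first is integration by parts without boundary terms.\<close>

definition k_lt :: "real => real => real => real" where
 "k_lt l r s = ind l r * ind r s"

definition k_gt :: "real => real => real => real" where
 "k_gt l r s = k_lt l s r"

definition k_one :: "real => real => real => real" where
 "k_one l r s = ind l r * ind l s"

lemma bdd_kernel_k_lt: "0 < l ==> bdd_kernel l (k_lt l)"
proof -
 assume l: "0 < l"
 have "(\<lambda>p :: real \<times> real. k_lt l (fst p) (snd p)) = indicator {p. 0 < fst p \<and> fst p < l \<and> 0 < snd p \<and> snd p < fst p}"
  by (auto simp: k_lt_def split: split_indicator)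
 moreover have "{p :: real \<times> real. 0 < fst p \<and> fst p < l \<and> 0 < snd p \<and> snd p < fst p} \<in> sets borel"
  by (intro borel_open open_Collect_conj open_Collect_less continuous_intros)
 ultimately have "(\<lambda>p :: real \<times> real. k_lt l (fst p) (snd p)) \<in> borel_fun" by simp
 then show ?thesis using l by (auto simp: bdd_kernel_def k_lt_def split: split_indicator)
qed

lemma bdd_kernel_k_gt: "0 < l ==> bdd_kernel l (k_gt l)"
 unfolding k_gt_def[abs_def] by (rule bdd_kernel_transpose[OF bdd_kernel_k_lt])

lemma bdd_kernel_k_one: "0 < l ==> bdd_kernel l (k_one l)"
proof -
 assume l: "0 < l"
 have "(\<lambda>p :: real \<times> real. k_one l (fst p) (snd p)) = indicator {p. 0 < fst p \<and> fst p < l \<and> 0 < snd p \<and> snd p < l}"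
  by (auto simp: k_one_def split: split_indicator)
 moreover have "{p :: real \<times> real. 0 < fst p \<and> fst p < l \<and> 0 < snd p \<and> snd p < l} \<in> sets borel"
  by (intro borel_open open_Collect_conj open_Collect_less continuous_intros)
 ultimately have "(\<lambda>p :: real \<times> real. k_one l (fst p) (snd p)) \<in> borel_fun" by simp
 then show ?thesis using l by (auto simp: bdd_kernel_def k_one_def split: split_indicator)
qed

lemma integral_k_lt: "(LINT s|lborel. k_lt l r s * f s) = ind l r * prim f r"
 by (simp add: k_lt_def prim_def mult.assoc)

lemma integral_k_one: "(LINT s|lborel. k_one l r s * f s) = ind l r * prim f l"
 by (simp add: k_one_def prim_def mult.assoc)

lemma integral_k_gt:
 assumes f: "f \<in> sqi" and "0 < l"
 shows "(LINT s|lborel. k_gt l r s * f s) = ind l r * (prim f l - prim f r)"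
proof -
 have [measurable]: "f \<in> borel_fun" using f by (simp add: sq_int_def)
 have "(LINT s|lborel. k_gt l r s * f s) = (LINT s|lborel. ind l r * (indicator {r<..<l} s * f s))"
  by (intro lint_cong) (auto simp: k_gt_def k_lt_def split: split_indicator)
 also have "\<dots> = ind l r * (LINT s|lborel. indicator {r<..<l} s * f s)" by simp
 also have "\<dots> = ind l r * (prim f l - prim f r)"
  using prim_increment[OF f, of r l] by (auto split: split_indicator)
 finally show ?thesis .
qed

lemma bounded_mult_sq_int:
 fixes f h :: "real => real"
 assumes f: "f \<in> sqi" and [measurable]: "h \<in> borel_fun"
  and h: "\<And>s. s \<in> {0<..<l} ==> \<bar>h s\<bar> \<le> C"
 shows "(\<lambda>s. ind l s * (f s * h s)) \<in> sqi"
proof (rule sq_int_bound[OF sq_int_scale[OF f, of C]])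
 show "(\<lambda>s. ind l s * (f s * h s)) \<in> borel_measurable lborel"
  using sq_int_measurable[OF f] by measurable
 show "AE s in lborel. \<bar>ind l s * (f s * h s)\<bar> \<le> \<bar>C * f s\<bar>"
 proof (rule AE_I2)
  fix s
  show "\<bar>ind l s * (f s * h s)\<bar> \<le> \<bar>C * f s\<bar>"
  proof (cases "s \<in> {0<..<l}")
   case True
   with h[OF True] have "\<bar>f s\<bar> * \<bar>h s\<bar> \<le> \<bar>f s\<bar> * \<bar>C\<bar>" by (intro mult_left_mono) auto
   then show ?thesis using True by (simp add: abs_mult mult.commute)
  qed simp
 qed
qed

lemma prim_measurable [measurable]: "f \<in> sqi ==> prim f \<in> borel_fun"
proof -
 assume f: "f \<in> sqi"
 have "prim f = (\<lambda>x. prim f (max 0 x))" by (auto simp: max_def)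
 moreover have "continuous_on UNIV (\<lambda>x. prim f (max 0 x))"
  by (rule continuous_on_compose2[OF prim_continuous[OF f]]) (auto intro!: continuous_intros)
 ultimately show ?thesis by (metis borel_measurable_continuous_onI)
qed

text \<open>Integration by parts for \<open>c + prim f\<close> and \<open>e + prim g\<close>.
  Nothing is differentiated: the identity is Fubini on the triangle, in the form that
  \<open>k_lt\<close> and \<open>k_gt\<close> are adjoint.\<close>

lemma ac_product:
 assumes f: "f \<in> sqi" and g: "g \<in> sqi" and l: "0 < l"
 shows "(LINT r|lborel. ind l r * (f r * (e + prim g r) + (c + prim f r) * g r)) =
  (c + prim f l) * (e + prim g l) - c * e"
proof -
 have fg: "integrable lborel (\<lambda>r. ind l r * (f r * prim g r))" if "f \<in> sqi" "g \<in> sqi" for f g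
 proof -
  have "(\<lambda>r. ind l r * (f r * prim g r)) \<in> sqi"
   by (rule bounded_mult_sq_int[OF that(1) _ prim_bound[OF that(2), of _ l]]) (use that l in auto)
  from sq_int_integrable_mult[OF indicator_Ioo_sq_int[of 0 l] this] show ?thesis
   by (simp add: mult.assoc[symmetric] flip: indicator_inter_arith)
 qed
 have "(LINT r|lborel. ind l r * (f r * prim g r)) = (LINT r|lborel. (LINT s|lborel. k_lt l r s * g s) * f r)"
  unfolding integral_k_lt by (simp add: mult_ac)
 also have "\<dots> = (LINT s|lborel. g s * (LINT r|lborel. k_lt l r s * f r))"
  by (rule kernel_adjoint_1d[OF bdd_kernel_k_lt[OF l] g f])
 also have "\<dots> = (LINT s|lborel. g s * (ind l s * (prim f l - prim f s)))"
  using integral_k_gt[OF f l] by (simp add: k_gt_def)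
 also have "\<dots> = (LINT s|lborel. prim f l * (ind l s * g s) - ind l s * (g s * prim f s))"
  by (simp add: algebra_simps)
 also have "\<dots> = prim f l * prim g l - (LINT s|lborel. ind l s * (g s * prim f s))"
  using fg[OF g f] ind_mult_integrable[OF g, of 0 l]
  by (simp add: Bochner_Integration.integral_diff) (simp add: prim_def[of g])
 finally have 1: "(LINT r|lborel. ind l r * (f r * prim g r)) +
  (LINT s|lborel. ind l s * (g s * prim f s)) = prim f l * prim g l" by simp
 have "(LINT r|lborel. ind l r * (f r * (e + prim g r) + (c + prim f r) * g r)) =
  (LINT r|lborel. e * (ind l r * f r) + c * (ind l r * g r) +
   (ind l r * (f r * prim g r) + ind l r * (g r * prim f r)))"
  by (simp add: algebra_simps)
 also have "\<dots> = e * prim f l + c * prim g l + prim f l * prim g l"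
  using 1 fg[OF f g] fg[OF g f] ind_mult_integrable[OF f, of 0 l] ind_mult_integrable[OF g, of 0 l]
  by (simp add: prim_def)
 finally show ?thesis by (simp add: algebra_simps)
qed

lemma prim_one: "0 \<le> x ==> x \<le> l ==> prim (ind l) x = x"
proof -
 assume x: "0 \<le> x" "x \<le> l"
 have "prim (ind l) x = (LINT s|lborel. ind x s)"
  unfolding prim_def using x by (intro lint_cong) (auto split: split_indicator)
 then show ?thesis using x by simp
qed

text \<open>The square of \<open>Z\<close> is a primitive of \<open>2 * g * Z\<close>, so the left
  side is half the integral of \<open>A * r - B\<close> times the derivative of that square;
  integration by parts leaves the end values and the integral of the square.\<close>

lemma weighted_square_identity:
 fixes c0 A B :: real
 assumes g: "g \<in> sqi"
 defines "Z \<equiv> \<lambda>r. c0 + prim g r"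
 shows "(LINT r|lborel. ind 1 r * ((A * r - B) * g r * Z r)) =
  ((A - B) * (Z 1)\<^sup>2 + B * c0\<^sup>2 - A * (LINT r|lborel. ind 1 r * (Z r)\<^sup>2)) / 2"
proof -
 have [measurable]: "g \<in> borel_fun" using g by (simp add: sq_int_def)
 have [measurable]: "Z \<in> borel_fun" unfolding Z_def using g by measurable
 define b where "b = \<bar>c0\<bar> + sqrt (1 * (LINT s|lborel. (g s)\<^sup>2))"
 have Zb: "\<bar>Z r\<bar> \<le> b" if "r \<in> {0<..<1}" for r
  using prim_bound[OF g, of r 1] that unfolding Z_def b_def by auto
 define h where "h r = 2 * (ind 1 r * (g r * Z r))" for r
 have h: "h \<in> sqi"
  unfolding h_def by (intro sq_int_scale bounded_mult_sq_int[OF g _ Zb]) auto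
 have prim_h: "c0\<^sup>2 + prim h r = (Z r)\<^sup>2" if "0 < r" "r \<le> 1" for r
 proof -
  have "prim h r = (LINT s|lborel. ind r s * (g s * (c0 + prim g s) + (c0 + prim g s) * g s))"
   unfolding prim_def h_def using that
   by (intro lint_cong) (auto simp: Z_def prim_def split: split_indicator)
  also have "\<dots> = (Z r)\<^sup>2 - c0\<^sup>2"
   unfolding ac_product[OF g g \<open>0 < r\<close>] by (simp add: Z_def power2_eq_square)
  finally show ?thesis by simp
 qed
 have one: "ind 1 \<in> (sqi :: (real => real) set)" by (rule indicator_Ioo_sq_int)
 have ih: "integrable lborel (\<lambda>r. r * h r)"
 proof -
  have "(\<lambda>r. ind 1 r * (h r * r)) \<in> sqi"
   by (rule bounded_mult_sq_int[OF h, where C = 1]) auto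
  from sq_int_integrable_mult[OF one this] show ?thesis
   by (rule Bochner_Integration.integrable_cong[THEN iffD1, rotated 2]) (auto simp: h_def split: split_indicator)
 qed
 have ih1: "integrable lborel h"
  using sq_int_integrable_mult[OF one h]
  by (rule Bochner_Integration.integrable_cong[THEN iffD1, rotated 2]) (auto simp: h_def split: split_indicator)
 have iZ: "integrable lborel (\<lambda>r. ind 1 r * (Z r)\<^sup>2)"
 proof -
  have "(\<lambda>r. ind 1 r * (ind 1 r * Z r)) \<in> sqi"
   by (rule bounded_mult_sq_int[OF one _ Zb]) auto
  from sq_int_integrable_sq[OF this] show ?thesis
   by (rule Bochner_Integration.integrable_cong[THEN iffD1, rotated 2]) (auto split: split_indicator)
 qed
 have I1: "(LINT r|lborel. h r) = (Z 1)\<^sup>2 - c0\<^sup>2"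
 proof -
  have "(LINT r|lborel. h r) = prim h 1"
   unfolding prim_def by (intro lint_cong) (auto simp: h_def split: split_indicator)
  then show ?thesis using prim_h[of 1] by simp
 qed
 \<comment> \<open>The weight \<open>r\<close> is written as the primitive of the indicator of the
   unit interval, so that \<open>ac_product\<close> becomes the product rule for
   \<open>r * (Z r)\<^sup>2\<close>.\<close>
 have "(Z 1)\<^sup>2 = (0 + prim (ind 1) 1) * (c0\<^sup>2 + prim h 1) - 0 * c0\<^sup>2"
  using prim_h[of 1] prim_one[of 1 1] by simp
 also have "\<dots> = (LINT r|lborel. ind 1 r * (ind 1 r * (c0\<^sup>2 + prim h r) + (0 + prim (ind 1) r) * h r))"
  by (rule ac_product[OF one h, symmetric]) simp
 also have "\<dots> = (LINT r|lborel. ind 1 r * (Z r)\<^sup>2 + r * h r)"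
  by (intro lint_cong)
   (auto simp: prim_h prim_one h_def split: split_indicator)
 also have "\<dots> = (LINT r|lborel. ind 1 r * (Z r)\<^sup>2) + (LINT r|lborel. r * h r)"
  by (rule Bochner_Integration.integral_add[OF iZ ih])
 finally have I2: "(LINT r|lborel. r * h r) = (Z 1)\<^sup>2 - (LINT r|lborel. ind 1 r * (Z r)\<^sup>2)" by simp
 have "(LINT r|lborel. ind 1 r * ((A * r - B) * g r * Z r)) = (LINT r|lborel. A / 2 * (r * h r) - B / 2 * h r)"
  by (intro lint_cong) (auto simp: h_def algebra_simps split: split_indicator)
 also have "\<dots> = A / 2 * (LINT r|lborel. r * h r) - B / 2 * (LINT r|lborel. h r)"
  using ih ih1 by simp
 finally show ?thesis unfolding I1 I2 by (simp add: field_simps)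
qed

section \<open>Functions on the rectangle and integration in each variable\<close>

definition ind2 :: "real => real \<times> real => real" where
 "ind2 L p = ind L (fst p) * ind 1 (snd p)"

text \<open>A function of \<open>x\<close> alone is identified with the function on the rectangle that is
 constant in \<open>r\<close>.\<close>

definition cls1 :: "real => (real => real) => l2" where
 "cls1 L g = cls (\<lambda>p. ind2 L p * g (fst p))"

definition sq1 :: "real => (real => real) set" where
 "sq1 L = {g. (\<lambda>x. ind L x * g x) \<in> sqi}"

definition X1 :: "real => l2 set" where "X1 L = cls1 L ` sq1 L"

definition X2 :: "real => l2 set" where "X2 L = {e. mul_op (ind2 L) e = e}"

text \<open>\<open>J0\<close> and \<open>JL\<close> are the primitives in \<open>x\<close> that
  vanish at 0 and at \<open>L\<close>; \<open>Kr\<close> is the primitive in \<open>r\<close> that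
  vanishes at 0, and \<open>Rr\<close> its end value at \<open>r = 1\<close>, kept as a function
  constant in \<open>r\<close>. The sign in \<open>JL\<close> turns the integral from
  \<open>x\<close> to \<open>L\<close> into a primitive.\<close>

definition J0 :: "real => l2 => l2" where "J0 L = kerx_op (k_lt L)"
definition JL :: "real => l2 => l2" where "JL L e = - kerx_op (k_gt L) e"
definition Kr :: "l2 => l2" where "Kr = ker_op (k_lt 1)"
definition Rr :: "l2 => l2" where "Rr = ker_op (k_one 1)"

lemma fst_borel [measurable]: "(fst :: real \<times> real => real) \<in> borel_fun"
 and snd_borel [measurable]: "(snd :: real \<times> real => real) \<in> borel_fun"
 by (intro borel_measurable_continuous_onI continuous_intros)+

lemma ind2_measurable [measurable]: "ind2 L \<in> borel_fun"
proof -
 have "(\<lambda>p :: real \<times> real. ind L (fst p) * ind 1 (snd p) :: real) \<in> borel_fun"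
  by (intro borel_measurable_times measurable_compose[OF fst_borel borel_measurable_indicator]
    measurable_compose[OF snd_borel borel_measurable_indicator]) auto
 then show ?thesis by (simp add: ind2_def[abs_def])
qed

lemma ind2_bound: "\<bar>ind2 L p\<bar> \<le> 1"
 by (auto simp: ind2_def split: split_indicator)

lemma ind2_idem: "ind2 L p * (ind2 L p * y) = ind2 L p * y"
 by (auto simp: ind2_def split: split_indicator)

lemma sq_int_sq1: "g \<in> sqi ==> g \<in> sq1 L"
 by (simp add: sq1_def ind_mult_sq_int)

lemma tensor_sq_int:
 assumes g: "g \<in> sqi" and h: "h \<in> sqi"
 shows "(\<lambda>p :: real \<times> real. g (fst p) * h (snd p)) \<in> sqi"
  and "(LINT p|lborel. (g (fst p) * h (snd p))\<^sup>2) = (LINT x|lborel. (g x)\<^sup>2) * (LINT x|lborel. (h x)\<^sup>2)"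
proof -
 have [measurable]: "g \<in> borel_fun" "h \<in> borel_fun" using g h by (auto simp: sq_int_def)
 have i: "integrable lborel (\<lambda>p :: real \<times> real. (g (fst p))\<^sup>2 * (h (snd p))\<^sup>2)"
  using integrable_fst_times_snd[OF sq_int_integrable_sq[OF g] sq_int_integrable_sq[OF h]] by (simp add: lborel_prod)
 have "(\<lambda>p. g (fst p) * h (snd p)) \<in> borel_measurable (borel :: (real \<times> real) measure)"
  by (intro borel_measurable_times measurable_compose[OF fst_borel] measurable_compose[OF snd_borel]) auto
 with i show "(\<lambda>p :: real \<times> real. g (fst p) * h (snd p)) \<in> sqi"
  by (simp add: sq_int_def power_mult_distrib)
 show "(LINT p|lborel. (g (fst p) * h (snd p))\<^sup>2) = (LINT x|lborel. (g x)\<^sup>2) * (LINT x|lborel. (h x)\<^sup>2)"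
  using lborel_integral_pair[OF i] by (simp add: power_mult_distrib)
qed

lemma cls1_sq_int:
 assumes "g \<in> sq1 L" shows "(\<lambda>p. ind2 L p * g (fst p)) \<in> sqi"
proof -
 have "(\<lambda>p :: real \<times> real. (\<lambda>x. ind L x * g x) (fst p) * ind 1 (snd p)) \<in> sqi"
  by (rule tensor_sq_int) (use assms in \<open>auto simp: sq1_def indicator_Ioo_sq_int\<close>)
 then show ?thesis by (simp add: ind2_def mult_ac)
qed

lemma sq1_add: "g \<in> sq1 L ==> h \<in> sq1 L ==> (\<lambda>x. g x + h x) \<in> sq1 L"
 using sq_int_add[of "\<lambda>x. ind L x * g x" lborel "\<lambda>x. ind L x * h x"]
 by (simp add: sq1_def distrib_left)

lemma sq1_scale: "g \<in> sq1 L ==> (\<lambda>x. c * g x) \<in> sq1 L"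
 using sq_int_scale[of "\<lambda>x. ind L x * g x" lborel c]
 by (simp add: sq1_def mult.left_commute)

lemma sq1_diff: "g \<in> sq1 L ==> h \<in> sq1 L ==> (\<lambda>x. g x - h x) \<in> sq1 L"
 using sq1_add[OF _ sq1_scale[of h L "-1"]] by simp

lemma cls1_add: "g \<in> sq1 L ==> h \<in> sq1 L ==> cls1 L (\<lambda>x. g x + h x) = cls1 L g + cls1 L h"
 by (simp add: cls1_def cls_add cls1_sq_int distrib_left)

lemma cls1_diff: "g \<in> sq1 L ==> h \<in> sq1 L ==> cls1 L (\<lambda>x. g x - h x) = cls1 L g - cls1 L h"
 by (simp add: cls1_def cls_diff cls1_sq_int right_diff_distrib)

lemma cls1_scale: "g \<in> sq1 L ==> cls1 L (\<lambda>x. c * g x) = c *\<^sub>R cls1 L g"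
 by (simp add: cls1_def cls_scale cls1_sq_int mult.left_commute)

lemma cls1_ind: "cls1 L (\<lambda>x. ind L x * g x) = cls1 L g"
proof -
 have "(\<lambda>p. ind2 L p * (ind L (fst p) * g (fst p))) = (\<lambda>p. ind2 L p * g (fst p))"
  by (auto simp: ind2_def fun_eq_iff split: split_indicator)
 then show ?thesis by (simp add: cls1_def)
qed

text \<open>The factor in \<open>r\<close> is an interval of length 1, so the embedding of functions
  of \<open>x\<close> preserves inner products.\<close>

lemma inner_cls1:
 assumes "g \<in> sq1 L" "h \<in> sq1 L"
 shows "inner (cls1 L g) (cls1 L h) = (LINT x|lborel. ind L x * (g x * h x))"
proof -
 have i: "integrable lborel (\<lambda>p. (ind2 L p * g (fst p)) * (ind2 L p * h (fst p)))"
  by (intro sq_int_integrable_mult cls1_sq_int assms)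
 have "inner (cls1 L g) (cls1 L h) = (LINT p|lborel. (ind2 L p * g (fst p)) * (ind2 L p * h (fst p)))"
  unfolding cls1_def by (rule inner_cls) (intro cls1_sq_int assms)+
 also have "\<dots> = (LINT x|lborel. LINT r|lborel. (ind2 L (x, r) * g x) * (ind2 L (x, r) * h x))"
  unfolding lborel_integral_pair[OF i] by simp
 also have "\<dots> = (LINT x|lborel. ind L x * (g x * h x))"
 proof (intro lint_cong)
  fix x :: real
  have "(LINT r|lborel. (ind2 L (x, r) * g x) * (ind2 L (x, r) * h x)) = (LINT r|lborel. (ind L x * (g x * h x)) * indicator {0<..<1::real} r)"
   by (intro lint_cong) (auto simp: ind2_def split: split_indicator)
  then show "(LINT r|lborel. (ind2 L (x, r) * g x) * (ind2 L (x, r) * h x)) = ind L x * (g x * h x)" by simp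
 qed
 finally show ?thesis .
qed

lemma norm_cls1: "g \<in> sq1 L ==> (norm (cls1 L g))\<^sup>2 = (LINT x|lborel. ind L x * (g x)\<^sup>2)"
 unfolding power2_norm_eq_inner by (simp add: inner_cls1 power2_eq_square)

lemma cls1_eq_iff:
 assumes g: "g \<in> sq1 L" and h: "h \<in> sq1 L"
 shows "cls1 L g = cls1 L h \<longleftrightarrow> (AE x\<in>{0<..<L} in lborel. g x = h x)"
proof -
 let ?d = "\<lambda>x. g x - h x"
 have d: "(\<lambda>x. ind L x * ?d x) \<in> sqi"
  using sq1_diff[OF g h] by (simp add: sq1_def)
 have "cls1 L g = cls1 L h \<longleftrightarrow> (norm (cls1 L ?d))\<^sup>2 = 0"
  by (simp add: cls1_diff g h)
 also have "\<dots> \<longleftrightarrow> (LINT x|lborel. (ind L x * ?d x) * (ind L x * ?d x)) = 0"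
  unfolding norm_cls1[OF sq1_diff[OF g h]]
  by (intro arg_cong2[of _ _ _ _ "(=)"] lint_cong)
   (auto simp: power2_eq_square split: split_indicator)
 also have "\<dots> \<longleftrightarrow> (AE x in lborel. ind L x * ?d x = 0)"
  by (rule integral_sq_eq_0_iff[OF d])
 also have "\<dots> \<longleftrightarrow> (AE x\<in>{0<..<L} in lborel. g x = h x)"
  by (intro AE_cong) (auto split: split_indicator)
 finally show ?thesis .
qed

lemma cls1_cong: "(\<And>x. x \<in> {0<..<L} ==> g x = h x) ==> cls1 L g = cls1 L h"
 unfolding cls1_def by (intro arg_cong[of _ _ cls]) (auto simp: ind2_def fun_eq_iff split: split_indicator)

lemma bounded_linear_ops:
 assumes "0 < L"
 shows "bounded_linear (J0 L)" "bounded_linear (JL L)" "bounded_linear Kr" "bounded_linear Rr"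
  "bounded_linear (mul_op (ind2 L))"
 unfolding J0_def JL_def[abs_def] Kr_def Rr_def
 by (intro bounded_linear_kerx_op[OF bdd_kernel_k_lt[OF assms]] bounded_linear_minus
   bounded_linear_kerx_op[OF bdd_kernel_k_gt[OF assms]]
   bounded_linear_ker_op[OF bdd_kernel_k_lt] bounded_linear_ker_op[OF bdd_kernel_k_one]
   bounded_linear_mul_op[of _ 1] ind2_bound; simp)+

lemma prim_ind: "x \<le> L ==> prim (\<lambda>x. ind L x * g x) x = prim g x"
 unfolding prim_def by (intro lint_cong) (auto split: split_indicator)

lemma bounded_sq1:
 assumes "h \<in> borel_fun" "\<And>s. s \<in> {0<..<l} ==> \<bar>h s\<bar> \<le> C"
 shows "h \<in> sq1 l"
proof -
 have "(\<lambda>s. ind l s * (ind l s * h s)) \<in> sqi"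
  by (rule bounded_mult_sq_int[OF indicator_Ioo_sq_int assms])
 then show ?thesis by (simp add: sq1_def mult.assoc[symmetric] flip: indicator_inter_arith)
qed

lemma sq1_cong: "(\<And>x. x \<in> {0<..<L} ==> g x = h x) ==> g \<in> sq1 L \<longleftrightarrow> h \<in> sq1 L"
proof -
 assume "\<And>x. x \<in> {0<..<L} ==> g x = h x"
 then have "(\<lambda>x. ind L x * g x) = (\<lambda>x. ind L x * h x)"
  by (auto simp: fun_eq_iff split: split_indicator)
 then show ?thesis by (simp add: sq1_def)
qed

lemma prim_sq1:
 assumes "0 < L" "g \<in> sq1 L"
 shows "(\<lambda>x. c + prim g x) \<in> sq1 L"
proof -
 let ?g = "\<lambda>x. ind L x * g x"
 have g: "?g \<in> sqi" using assms by (simp add: sq1_def)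
 have "(\<lambda>x. c + prim ?g x) \<in> sq1 L"
 proof (rule bounded_sq1[where C = "\<bar>c\<bar> + sqrt (L * (LINT s|lborel. (?g s)\<^sup>2))"])
  show "\<bar>c + prim ?g s\<bar> \<le> \<bar>c\<bar> + sqrt (L * (LINT s|lborel. (?g s)\<^sup>2))" if "s \<in> {0<..<L}" for s
   using prim_bound[OF g, of s L] that assms by auto
 qed (use g in measurable)
 also have "(\<lambda>x. c + prim ?g x) \<in> sq1 L \<longleftrightarrow> ?thesis"
  by (rule sq1_cong) (simp add: prim_ind)
 finally show ?thesis .
qed

lemma J0_cls1:
 assumes "0 < L" "g \<in> sq1 L"
 shows "J0 L (cls1 L g) = cls1 L (prim g)"
proof -
 have "J0 L (cls1 L g) = cls (\<lambda>p. LINT y|lborel. k_lt L (fst p) y * (ind2 L (y, snd p) * g y))"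
  unfolding J0_def cls1_def by (subst kerx_op_cls(1)[OF bdd_kernel_k_lt cls1_sq_int]) (use assms in auto)
 also have "(\<lambda>p. LINT y|lborel. k_lt L (fst p) y * (ind2 L (y, snd p) * g y)) = (\<lambda>p. ind2 L p * prim g (fst p))"
 proof
  fix p :: "real \<times> real"
  have "(LINT y|lborel. k_lt L (fst p) y * (ind2 L (y, snd p) * g y)) = (LINT y|lborel. ind 1 (snd p) * (k_lt L (fst p) y * g y))"
   by (intro lint_cong) (auto simp: ind2_def k_lt_def split: split_indicator)
  also have "\<dots> = ind2 L p * prim g (fst p)" by (simp add: integral_k_lt ind2_def)
  finally show "(LINT y|lborel. k_lt L (fst p) y * (ind2 L (y, snd p) * g y)) = ind2 L p * prim g (fst p)" .
 qed
 finally show ?thesis by (simp add: cls1_def)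
qed

lemma JL_cls1:
 assumes "0 < L" "g \<in> sq1 L"
 shows "JL L (cls1 L g) = cls1 L (\<lambda>x. prim g x - prim g L)"
proof -
 let ?g = "\<lambda>x. ind L x * g x"
 have g: "?g \<in> sqi" using assms by (simp add: sq1_def)
 have s: "(\<lambda>x. - prim g L + prim g x) \<in> sq1 L" using prim_sq1[OF assms, of "- prim g L"] by simp
 have "kerx_op (k_gt L) (cls1 L g) = cls (\<lambda>p. LINT y|lborel. k_gt L (fst p) y * (ind2 L (y, snd p) * g y))"
  unfolding cls1_def by (subst kerx_op_cls(1)[OF bdd_kernel_k_gt cls1_sq_int]) (use assms in auto)
 also have "(\<lambda>p. LINT y|lborel. k_gt L (fst p) y * (ind2 L (y, snd p) * g y)) = (\<lambda>p. ind2 L p * ((-1) * (prim g (fst p) - prim g L)))"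
 proof
  fix p :: "real \<times> real"
  have "(LINT y|lborel. k_gt L (fst p) y * (ind2 L (y, snd p) * g y)) = (LINT y|lborel. ind 1 (snd p) * (k_gt L (fst p) y * ?g y))"
   by (intro lint_cong) (auto simp: ind2_def k_gt_def k_lt_def split: split_indicator)
  also have "\<dots> = ind 1 (snd p) * (ind L (fst p) * (prim ?g L - prim ?g (fst p)))"
   by (simp add: integral_k_gt[OF g \<open>0 < L\<close>])
  also have "\<dots> = ind2 L p * ((-1) * (prim g (fst p) - prim g L))"
   by (auto simp: ind2_def prim_ind split: split_indicator)
  finally show "(LINT y|lborel. k_gt L (fst p) y * (ind2 L (y, snd p) * g y)) = ind2 L p * ((-1) * (prim g (fst p) - prim g L))" .
 qed
 also have "cls \<dots> = cls1 L (\<lambda>x. (-1) * (prim g x - prim g L))" by (simp add: cls1_def)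
 also have "\<dots> = - cls1 L (\<lambda>x. prim g x - prim g L)"
  using s by (subst cls1_scale) (auto simp: add.commute[of "- _"])
 finally show ?thesis by (simp add: JL_def)
qed

lemma Rr_cls1:
 assumes "g \<in> sq1 L"
 shows "Rr (cls1 L g) = cls1 L g"
proof -
 have "Rr (cls1 L g) = cls (ker_fun (k_one 1) (\<lambda>p. ind2 L p * g (fst p)))"
  unfolding Rr_def cls1_def by (rule ker_op_cls[OF bdd_kernel_k_one cls1_sq_int[OF assms]]) simp
 also have "ker_fun (k_one 1) (\<lambda>p. ind2 L p * g (fst p)) = (\<lambda>p. ind2 L p * g (fst p))"
 proof
  fix p :: "real \<times> real"
  have "ker_fun (k_one 1) (\<lambda>p. ind2 L p * g (fst p)) p = (LINT s|lborel. (ind2 L p * g (fst p)) * indicator {0<..<1::real} s)"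
   unfolding ker_fun_def by (intro lint_cong) (auto simp: k_one_def ind2_def split: split_indicator)
  then show "ker_fun (k_one 1) (\<lambda>p. ind2 L p * g (fst p)) p = ind2 L p * g (fst p)" by simp
 qed
 finally show ?thesis by (simp add: cls1_def)
qed

lemma X2_rep: "e \<in> X2 L ==> AE p in lborel. rep e p = ind2 L p * rep e p"
proof -
 assume "e \<in> X2 L"
 then have "cls (\<lambda>p. ind2 L p * rep e p) = cls (rep e)"
  using mul_op_cls[OF ind2_measurable[of L] ind2_bound rep_sq_int[of e]] by (simp add: X2_def)
 moreover have "(\<lambda>p. ind2 L p * rep e p) \<in> sqi"
  by (rule mul_fun_sq_int[OF ind2_measurable[of L] ind2_bound rep_sq_int[of e]])
 ultimately have "AE p in lborel. ind2 L p * rep e p = rep e p"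
  using cls_eq_iff[OF _ rep_sq_int[of e]] by blast
 then show ?thesis by eventually_elim simp
qed

lemma cls_ind2_X2:
 assumes "f \<in> sqi"
 shows "cls (\<lambda>p. ind2 L p * f p) \<in> X2 L"
 using mul_op_cls[OF ind2_measurable[of L] ind2_bound mul_fun_sq_int[OF ind2_measurable[of L] ind2_bound assms]]
 by (simp add: X2_def ind2_idem)

lemma X2_cls: "e \<in> X2 L ==> e = cls (\<lambda>p. ind2 L p * rep e p)"
 using mul_op_cls[OF ind2_measurable[of L] ind2_bound rep_sq_int[of e]] by (simp add: X2_def)

lemma cls1_X2: "g \<in> sq1 L ==> cls1 L g \<in> X2 L"
 using cls_ind2_X2[OF cls1_sq_int, of g L L] by (simp add: cls1_def ind2_idem)

lemma Rr_X2:
 assumes e: "e \<in> X2 L"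
 shows "Rr e = cls1 L (\<lambda>x. LINT s|lborel. ind2 L (x, s) * rep e (x, s))"
  and "(\<lambda>x. LINT s|lborel. ind2 L (x, s) * rep e (x, s)) \<in> sq1 L"
proof -
 let ?f = "\<lambda>p. ind2 L p * rep e p"
 have f: "?f \<in> sqi" by (rule mul_fun_sq_int[OF ind2_measurable[of L] ind2_bound rep_sq_int[of e]])
 have "Rr (cls ?f) = cls (ker_fun (k_one 1) ?f)"
  unfolding Rr_def by (rule ker_op_cls[OF bdd_kernel_k_one f]) simp
 also have eq: "ker_fun (k_one 1) ?f = (\<lambda>p. ind2 L p * (LINT s|lborel. ?f (fst p, s)))"
 proof
  fix p :: "real \<times> real"
  have "ker_fun (k_one 1) ?f p = (LINT s|lborel. ind2 L p * ?f (fst p, s))"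
   unfolding ker_fun_def by (intro lint_cong) (auto simp: k_one_def ind2_def split: split_indicator)
  then show "ker_fun (k_one 1) ?f p = ind2 L p * (LINT s|lborel. ?f (fst p, s))" by simp
 qed
 finally show "Rr e = cls1 L (\<lambda>x. LINT s|lborel. ind2 L (x, s) * rep e (x, s))"
  using X2_cls[OF e] by (simp add: cls1_def)
 have k: "ker_fun (k_one 1) ?f \<in> sqi" by (rule ker_fun_sq_int[OF bdd_kernel_k_one f]) simp
 have "(\<lambda>x. LINT r|lborel. (ker_fun (k_one 1) ?f (x, r))\<^sup>2) = (\<lambda>x. (ind L x * (LINT s|lborel. ?f (x, s)))\<^sup>2)"
 proof
  fix x
  have "(LINT r|lborel. (ker_fun (k_one 1) ?f (x, r))\<^sup>2) = (LINT r|lborel. (ind L x * (LINT s|lborel. ?f (x, s)))\<^sup>2 * indicator {0<..<1::real} r)"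
   unfolding eq by (intro lint_cong) (auto simp: ind2_def power_mult_distrib split: split_indicator)
  then show "(LINT r|lborel. (ker_fun (k_one 1) ?f (x, r))\<^sup>2) = (ind L x * (LINT s|lborel. ?f (x, s)))\<^sup>2" by simp
 qed
 with lborel_integrable_pair[OF sq_int_integrable_sq[OF k]]
 have i: "integrable lborel (\<lambda>x. (ind L x * (LINT s|lborel. ?f (x, s)))\<^sup>2)" by simp
 have "(\<lambda>x. LINT s|lborel. (\<lambda>p. ?f p) (x, s)) \<in> borel_measurable lborel"
 proof (rule lborel.borel_measurable_lebesgue_integral)
  have "?f \<in> borel_measurable (lborel \<Otimes>\<^sub>M lborel)"
   using sq_int_measurable[OF f] by (simp add: lborel_prod)
  then show "(\<lambda>(x, s). ?f (x, s)) \<in> borel_measurable (lborel \<Otimes>\<^sub>M lborel)" by simp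
 qed
 then have "(\<lambda>x. ind L x * (LINT s|lborel. ?f (x, s))) \<in> borel_measurable lborel" by simp
 with i show "(\<lambda>x. LINT s|lborel. ?f (x, s)) \<in> sq1 L" unfolding sq1_def by (auto intro: sq_intI)
qed

text \<open>Averaging over the unit interval fixes exactly the functions of \<open>x\<close> alone.
  As the fixed points of a bounded operator in \<open>X2 L\<close>, they form a closed
  subspace.\<close>

lemma X1_iff: "e \<in> X1 L \<longleftrightarrow> e \<in> X2 L \<and> Rr e = e"
proof
 assume "e \<in> X1 L"
 then show "e \<in> X2 L \<and> Rr e = e" by (auto simp: X1_def cls1_X2 Rr_cls1)
next
 assume "e \<in> X2 L \<and> Rr e = e"
 then have "e = cls1 L (\<lambda>x. LINT s|lborel. ind2 L (x, s) * rep e (x, s))" using Rr_X2(1)[of e L] by simp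
 then show "e \<in> X1 L" using Rr_X2(2)[of e L] \<open>e \<in> X2 L \<and> Rr e = e\<close> unfolding X1_def by blast
qed

lemma subspace_X2: "subspace (X2 L)"
 and closed_X2: "closed (X2 L)"
proof -
 interpret bounded_linear "mul_op (ind2 L)" by (rule bounded_linear_mul_op[OF ind2_measurable ind2_bound])
 show "subspace (X2 L)" by (auto simp: subspace_def X2_def add scaleR zero)
 show "closed (X2 L)" unfolding X2_def
  by (intro closed_Collect_eq continuous_on_id continuous_on[OF continuous_on_id])
qed

lemma subspace_X1: "subspace (X1 L)"
 and closed_X1: "closed (X1 L)"
proof -
 interpret R: bounded_linear Rr using bounded_linear_ops[of 1] by simp
 have eq: "X1 L = X2 L \<inter> {e. Rr e = e}" using X1_iff by auto
 show "subspace (X1 L)" unfolding eq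
  using subspace_X2[of L] by (auto simp: subspace_def R.add R.scaleR R.zero)
 show "closed (X1 L)" unfolding eq
  by (intro closed_Int closed_X2 closed_Collect_eq continuous_on_id R.continuous_on[OF continuous_on_id])
qed

lemma J0_X1: "0 < L ==> e \<in> X1 L ==> J0 L e \<in> X1 L"
 using prim_sq1[of L _ 0] by (auto simp: X1_def J0_cls1)

lemma JL_X1: "0 < L ==> e \<in> X1 L ==> JL L e \<in> X1 L"
proof -
 assume L: "0 < L" and "e \<in> X1 L"
 then obtain g where g: "g \<in> sq1 L" "e = cls1 L g" by (auto simp: X1_def)
 have "(\<lambda>x. - prim g L + prim g x) \<in> sq1 L" by (rule prim_sq1[OF L g(1)])
 then show ?thesis unfolding X1_def g(2) JL_cls1[OF L g(1)] by (simp add: add.commute[of "- _"])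
qed

lemma X1_X2: "e \<in> X1 L ==> e \<in> X2 L" by (simp add: X1_iff)

lemma Kr_cls:
 assumes "f \<in> sqi"
 shows "Kr (cls f) = cls (\<lambda>p. ind 1 (snd p) * prim (\<lambda>s. f (fst p, s)) (snd p))"
  and "(\<lambda>p. ind 1 (snd p) * prim (\<lambda>s. f (fst p, s)) (snd p)) \<in> sqi"
proof -
 have eq: "ker_fun (k_lt 1) f = (\<lambda>p. ind 1 (snd p) * prim (\<lambda>s. f (fst p, s)) (snd p))"
  by (simp add: ker_fun_def integral_k_lt fun_eq_iff)
 show "Kr (cls f) = cls (\<lambda>p. ind 1 (snd p) * prim (\<lambda>s. f (fst p, s)) (snd p))"
  unfolding eq[symmetric] Kr_def by (rule ker_op_cls[OF bdd_kernel_k_lt assms]) simp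
 show "(\<lambda>p. ind 1 (snd p) * prim (\<lambda>s. f (fst p, s)) (snd p)) \<in> sqi"
  unfolding eq[symmetric] by (rule ker_fun_sq_int[OF bdd_kernel_k_lt assms]) simp
qed

lemma Rr_cls:
 assumes "f \<in> sqi"
 shows "Rr (cls f) = cls (\<lambda>p :: real \<times> real. ind 1 (snd p) * prim (\<lambda>s. f (fst p, s)) 1)"
  and "(\<lambda>p :: real \<times> real. ind 1 (snd p) * prim (\<lambda>s. f (fst p, s)) 1) \<in> sqi"
proof -
 have eq: "ker_fun (k_one 1) f = (\<lambda>p :: real \<times> real. ind 1 (snd p) * prim (\<lambda>s. f (fst p, s)) 1)"
  by (simp add: ker_fun_def integral_k_one fun_eq_iff)
 show "Rr (cls f) = cls (\<lambda>p :: real \<times> real. ind 1 (snd p) * prim (\<lambda>s. f (fst p, s)) 1)"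
  unfolding eq[symmetric] Rr_def by (rule ker_op_cls[OF bdd_kernel_k_one assms]) simp
 show "(\<lambda>p :: real \<times> real. ind 1 (snd p) * prim (\<lambda>s. f (fst p, s)) 1) \<in> sqi"
  unfolding eq[symmetric] by (rule ker_fun_sq_int[OF bdd_kernel_k_one assms]) simp
qed

lemma Kr_X2: "e \<in> X2 L ==> Kr e \<in> X2 L"
proof -
 assume e: "e \<in> X2 L"
 let ?f = "\<lambda>p. ind2 L p * rep e p"
 have f: "?f \<in> sqi" by (rule mul_fun_sq_int[OF ind2_measurable[of L] ind2_bound rep_sq_int[of e]])
 have "ind 1 (snd p) * prim (\<lambda>s. ?f (fst p, s)) (snd p) = ind2 L p * (ind 1 (snd p) * prim (\<lambda>s. ?f (fst p, s)) (snd p))" for p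
  by (auto simp: ind2_def prim_def split: split_indicator)
 then have "(\<lambda>p. ind2 L p * (ind 1 (snd p) * prim (\<lambda>s. ?f (fst p, s)) (snd p))) = (\<lambda>p. ind 1 (snd p) * prim (\<lambda>s. ?f (fst p, s)) (snd p))"
  by metis
 then have "Kr (cls ?f) \<in> X2 L"
  using cls_ind2_X2[OF Kr_cls(2)[OF f], of L] unfolding Kr_cls(1)[OF f] by (simp only:)
 then show ?thesis using X2_cls[OF e] by simp
qed

text \<open>One primitive vanishes at 0 and the other at \<open>L\<close>, so integration by parts
  leaves no boundary term. This cancels the coupling of velocities and stresses in the
  energy.\<close>

lemma inner_J0_JL: "0 < L ==> inner (J0 L u) v = - inner u (JL L v)"
 unfolding J0_def JL_def using inner_kerx_op[OF bdd_kernel_k_lt, of L u v] by (simp add: k_gt_def[abs_def])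

text \<open>\<open>weighted_square_identity\<close> on almost every section, integrated over
  \<open>x\<close>. In the application \<open>A = \<tau>' / \<tau>\<close> and
  \<open>B = 1 / \<tau>\<close>, so the outgoing trace \<open>z1\<close> gets the weight
  \<open>- (1 - \<tau>') / (2 * \<tau>)\<close>.\<close>

lemma delay_identity:
 assumes g: "g \<in> sq1 L" and w: "w \<in> X2 L"
 defines "z \<equiv> cls1 L g + Kr w" and "z1 \<equiv> cls1 L g + Rr w"
 shows "inner z (mul_op (\<lambda>p. ind 1 (snd p) * (A * snd p - B)) w) =
  ((A - B) * (norm z1)\<^sup>2 + B * (norm (cls1 L g))\<^sup>2 - A * (norm z)\<^sup>2) / 2"
proof -
 define G where "G x = ind L x * g x" for x
 define W where "W x s = rep w (x, s)" for x s
 define m where "m p = ind 1 (snd p) * (A * snd p - B)" for p :: "real \<times> real"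
 have m_meas: "m \<in> borel_fun"
  unfolding m_def[abs_def]
  by (intro borel_measurable_times borel_measurable_diff borel_measurable_const measurable_compose[OF snd_borel]) auto
 have m_bd: "\<bar>m p\<bar> \<le> \<bar>A\<bar> + \<bar>B\<bar>" for p
 proof -
  have "\<bar>A * r - B\<bar> \<le> \<bar>A\<bar> + \<bar>B\<bar>" if "0 < r" "r < 1" for r
  proof -
   have "\<bar>A * r\<bar> \<le> \<bar>A\<bar> * 1" unfolding abs_mult using that by (intro mult_left_mono) auto
   then show ?thesis by linarith
  qed
  then show ?thesis by (auto simp: m_def split: split_indicator)
 qed
 have c1: "cls1 L g = cls (\<lambda>p :: real \<times> real. ind 1 (snd p) * G (fst p))"
  unfolding cls1_def G_def ind2_def by (simp add: mult_ac)
 have c1s: "(\<lambda>p :: real \<times> real. ind 1 (snd p) * G (fst p)) \<in> sqi"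
  using cls1_sq_int[OF g] unfolding G_def ind2_def by (simp add: mult_ac)
 let ?z = "\<lambda>p :: real \<times> real. ind 1 (snd p) * (G (fst p) + prim (W (fst p)) (snd p))"
 let ?z1 = "\<lambda>p :: real \<times> real. ind 1 (snd p) * (G (fst p) + prim (W (fst p)) 1)"
 have zs: "?z \<in> sqi" and z: "z = cls ?z"
  using sq_int_add[OF c1s Kr_cls(2)[OF rep_sq_int[of w]]] cls_add[OF c1s Kr_cls(2)[OF rep_sq_int[of w]]]
   Kr_cls(1)[OF rep_sq_int[of w]] unfolding z_def c1 W_def[abs_def] by (simp_all add: distrib_left)
 have z1s: "?z1 \<in> sqi" and z1: "z1 = cls ?z1"
  using sq_int_add[OF c1s Rr_cls(2)[OF rep_sq_int[of w]]] cls_add[OF c1s Rr_cls(2)[OF rep_sq_int[of w]]]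
   Rr_cls(1)[OF rep_sq_int[of w]] unfolding z1_def c1 W_def[abs_def] by (simp_all add: distrib_left)
 have ms: "(\<lambda>p. m p * rep w p) \<in> sqi" by (rule mul_fun_sq_int[OF m_meas m_bd rep_sq_int])
 have mw: "mul_op m w = cls (\<lambda>p. m p * rep w p)" using mul_op_cls[OF m_meas m_bd rep_sq_int[of w]] by simp
 have i0: "integrable lborel (\<lambda>p. ?z p * (m p * rep w p))" by (rule sq_int_integrable_mult[OF zs ms])
 note i1 = sq_int_integrable_sq[OF z1s] and i2 = sq_int_integrable_sq[OF c1s] and i3 = sq_int_integrable_sq[OF zs]
 have "inner z (mul_op m w) = (LINT p|lborel. ?z p * (m p * rep w p))"
  unfolding z mw by (rule inner_cls[OF zs ms])
 also have "\<dots> = (LINT x|lborel. LINT r|lborel. ?z (x, r) * (m (x, r) * rep w (x, r)))"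
  by (rule lborel_integral_pair[OF i0])
 also have "\<dots> = (LINT x|lborel. ((A - B) / 2 * (LINT r|lborel. (?z1 (x, r))\<^sup>2) + B / 2 * (LINT r|lborel. (indicator {0<..<1::real} (snd (x, r)) * G (fst (x, r)))\<^sup>2)
   - A / 2 * (LINT r|lborel. (?z (x, r))\<^sup>2)))"
 proof (rule integral_cong_AE)
  show "AE x in lborel. (LINT r|lborel. ?z (x, r) * (m (x, r) * rep w (x, r))) =
   (A - B) / 2 * (LINT r|lborel. (?z1 (x, r))\<^sup>2) + B / 2 * (LINT r|lborel. (indicator {0<..<1::real} (snd (x, r)) * G (fst (x, r)))\<^sup>2)
   - A / 2 * (LINT r|lborel. (?z (x, r))\<^sup>2)"
   using sq_int_slice[OF rep_sq_int[of w]]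
  proof eventually_elim
   case (elim x)
   then have W: "W x \<in> sqi" by (simp add: W_def[abs_def])
   have e0: "(LINT r|lborel. ?z (x, r) * (m (x, r) * rep w (x, r))) =
    (LINT r|lborel. ind 1 r * ((A * r - B) * W x r * (G x + prim (W x) r)))"
    by (intro lint_cong) (auto simp: m_def W_def split: split_indicator)
   have e1: "(LINT r|lborel. (?z1 (x, r))\<^sup>2) = (LINT r|lborel. (G x + prim (W x) 1)\<^sup>2 * indicator {0<..<1::real} r)"
    by (intro lint_cong) (auto split: split_indicator)
   have e2: "(LINT r|lborel. (indicator {0<..<1::real} (snd (x, r)) * G (fst (x, r)))\<^sup>2) = (LINT r|lborel. (G x)\<^sup>2 * indicator {0<..<1::real} r)"
    by (intro lint_cong) (auto split: split_indicator)
   have e3: "(LINT r|lborel. (?z (x, r))\<^sup>2) = (LINT r|lborel. ind 1 r * (G x + prim (W x) r)\<^sup>2)"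
    by (intro lint_cong) (auto split: split_indicator)
   show ?case
    unfolding e0 e1 e2 e3 weighted_square_identity[OF W] by (simp add: field_simps)
  qed
 qed (use lborel_integrable_pair[OF i0] lborel_integrable_pair[OF i1] lborel_integrable_pair[OF i2] lborel_integrable_pair[OF i3] in
   \<open>auto intro!: borel_measurable_integrable Bochner_Integration.integrable_add Bochner_Integration.integrable_diff integrable_mult_right\<close>)
 also have "\<dots> = (A - B) / 2 * (LINT x|lborel. LINT r|lborel. (?z1 (x, r))\<^sup>2) + B / 2 * (LINT x|lborel. LINT r|lborel. (indicator {0<..<1::real} (snd (x, r)) * G (fst (x, r)))\<^sup>2)
   - A / 2 * (LINT x|lborel. LINT r|lborel. (?z (x, r))\<^sup>2)"
  using lborel_integrable_pair[OF i1] lborel_integrable_pair[OF i2] lborel_integrable_pair[OF i3] by simp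
 also have "\<dots> = (A - B) / 2 * (norm z1)\<^sup>2 + B / 2 * (norm (cls1 L g))\<^sup>2 - A / 2 * (norm z)\<^sup>2"
  unfolding z1 z c1 norm_cls[OF z1s] norm_cls[OF zs] norm_cls[OF c1s]
  by (simp only: lborel_integral_pair[OF i1] lborel_integral_pair[OF i2] lborel_integral_pair[OF i3])
 finally show ?thesis unfolding m_def[abs_def] by (simp add: field_simps)
qed

section \<open>The beam in scaled variables\<close>

type_synonym est = "l2 \<times> l2 \<times> l2 \<times> l2 \<times> l2"

lemma norm5: "(norm ((f, h, q, s, w) :: est))\<^sup>2 = (norm f)\<^sup>2 + (norm h)\<^sup>2 + (norm q)\<^sup>2 + (norm s)\<^sup>2 + (norm w)\<^sup>2"
 by (simp add: norm_Pair)

lemma norm5_ge: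
 "norm f \<le> norm ((f, h, q, s, w) :: est)" "norm h \<le> norm ((f, h, q, s, w) :: est)"
 "norm q \<le> norm ((f, h, q, s, w) :: est)" "norm s \<le> norm ((f, h, q, s, w) :: est)"
 "norm w \<le> norm ((f, h, q, s, w) :: est)"
 by (rule power2_le_imp_le; simp only: norm5 norm_ge_zero; simp)+

lemma norm5_le: "norm ((f, h, q, s, w) :: est) \<le> norm f + norm h + norm q + norm s + norm w"
proof -
 have *: "norm (x, y) \<le> norm x + norm y" for x :: "'x::real_normed_vector" and y :: "'y::real_normed_vector"
  by (simp add: norm_Pair sqrt_sum_squares_le_sum)
 show ?thesis
  using *[of f "(h, q, s, w)"] *[of h "(q, s, w)"] *[of q "(s, w)"] *[of s w] by linarith
qed

lemma mul_op_diff_bound: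
 assumes g: "g \<in> borel_fun" "\<And>p. \<bar>g p\<bar> \<le> C" and h: "h \<in> borel_fun" "\<And>p. \<bar>h p\<bar> \<le> C'"
  and gh: "\<And>p. \<bar>g p - h p\<bar> \<le> N"
 shows "norm (mul_op g e - mul_op h e) \<le> N * norm e"
proof -
 have "mul_op g (cls (rep e)) - mul_op h (cls (rep e)) = cls (\<lambda>p. g p * rep e p - h p * rep e p)"
  unfolding mul_op_cls[OF g rep_sq_int] mul_op_cls[OF h rep_sq_int]
  by (intro cls_diff mul_fun_sq_int[OF g rep_sq_int] mul_fun_sq_int[OF h rep_sq_int])
 also have "\<dots> = cls (\<lambda>p. (g p - h p) * rep e p)" by (simp add: left_diff_distrib)
 also have "\<dots> = mul_op (\<lambda>p. g p - h p) (cls (rep e))"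
  by (rule mul_op_cls[OF _ gh rep_sq_int, symmetric]) (use g(1) h(1) in auto)
 finally have "mul_op g e - mul_op h e = mul_op (\<lambda>p. g p - h p) e" by simp
 then show ?thesis using norm_mul_op[OF _ gh, where e = e] g(1) h(1) by simp
qed

text \<open>A point of \<open>est\<close> is read in two ways: as a state in the scaled variables, and as the
 tuple of its derivatives, from which \<open>Bop\<close> recovers the state.\<close>

locale beam =
 fixes L \<rho> a b c \<tau>0 \<tau>1 d D :: real and \<tau> \<tau>' \<delta>1 \<delta>2 :: "real => real"
 assumes L: "0 < L" and \<rho>: "0 < \<rho>" and a: "0 < a" and c: "0 < c" and \<tau>0: "0 < \<tau>0" and d: "d < 1"
  and delay_bounds: "t \<ge> 0 ==> \<tau>0 \<le> \<tau> t \<and> \<tau> t \<le> \<tau>1"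
  and delay_deriv: "t \<ge> 0 ==> (\<tau> has_real_derivative \<tau>' t) (at0 t)"
  and delay_deriv_le: "t \<ge> 0 ==> \<tau>' t \<le> d"
  and weight_bounds: "t \<ge> 0 ==> \<bar>\<delta>1 t\<bar> \<le> D \<and> \<bar>\<delta>2 t\<bar> \<le> D"
  and data_lipschitz: "T \<ge> 0 ==> \<exists>K\<ge>0. \<forall>s\<in>{0..T}. \<forall>t\<in>{0..T}. \<bar>\<tau> s - \<tau> t\<bar> \<le> K * \<bar>s - t\<bar> \<and>
   \<bar>\<tau>' s - \<tau>' t\<bar> \<le> K * \<bar>s - t\<bar> \<and> \<bar>\<delta>1 s - \<delta>1 t\<bar> \<le> K * \<bar>s - t\<bar> \<and> \<bar>\<delta>2 s - \<delta>2 t\<bar> \<le> K * \<bar>s - t\<bar>"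
begin

definition Mt :: "real => real \<times> real => real" where
 "Mt t p = ind 1 (snd p) * (\<tau>' t / \<tau> t * snd p - 1 / \<tau> t)"

definition X :: "est set" where "X = X1 L \<times> X1 L \<times> X1 L \<times> X1 L \<times> X2 L"

text \<open>Velocities vanish at 0 and are recovered by \<open>J0\<close>; the scaled
  \<open>v_x\<close> and \<open>\<gamma> v_x - p_x\<close> vanish at \<open>L\<close> and are
  recovered by \<open>JL\<close>. The history starts at \<open>r = 0\<close> from the velocity
  \<open>J0 L f\<close>, so the matching of history and velocity is built in.\<close>

fun Bop :: "est => est" where
 "Bop (f, h, q, s, w) = (J0 L f, J0 L h, JL L q, JL L s, J0 L f + Kr w)"

text \<open>\<open>J0 L f + Rr w\<close> is the trace of the history at \<open>r = 1\<close>. Each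
  of \<open>a\<close>, \<open>b\<close>, \<open>c\<close> occurs in two mirrored places; as
  \<open>J0\<close> and \<open>- JL\<close> are adjoint, this makes the coupling skew.\<close>

fun Cop :: "real => est => est" where
 "Cop t (f, h, q, s, w) =
  (a *\<^sub>R q + b *\<^sub>R s - (\<delta>1 t / \<rho>) *\<^sub>R J0 L f - (\<delta>2 t / \<rho>) *\<^sub>R (J0 L f + Rr w),
  - c *\<^sub>R s, a *\<^sub>R f, b *\<^sub>R f - c *\<^sub>R h, mul_op (Mt t) w)"

lemma \<tau>1: "0 < \<tau>1" using delay_bounds[of 0] \<tau>0 by simp

lemma D: "0 \<le> D" using weight_bounds[of 0] abs_ge_zero[of "\<delta>1 0"] by linarith

lemma Mt_measurable: "Mt t \<in> borel_fun"
 unfolding Mt_def[abs_def]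
 by (intro borel_measurable_times borel_measurable_diff borel_measurable_const measurable_compose[OF snd_borel]) auto

lemma Mt_bound: "\<bar>Mt t p\<bar> \<le> \<bar>\<tau>' t / \<tau> t\<bar> + \<bar>1 / \<tau> t\<bar>"
proof -
 have "\<bar>A * r - B\<bar> \<le> \<bar>A\<bar> + \<bar>B\<bar>" if "0 < r" "r < 1" for A B r :: real
 proof -
  have "\<bar>A * r\<bar> \<le> \<bar>A\<bar> * 1" unfolding abs_mult using that by (intro mult_left_mono) auto
  then show ?thesis by linarith
 qed
 from this[of "snd p" "\<tau>' t / \<tau> t" "1 / \<tau> t"] show ?thesis
  by (auto simp: Mt_def split: split_indicator)
qed

lemma subspace_X: "subspace X"
 unfolding X_def by (intro subspace_Times subspace_X1 subspace_X2)

lemma closed_X: "closed X"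
 unfolding X_def by (intro closed_Times closed_X1 closed_X2)

lemma bounded_linear_Bop: "bounded_linear Bop"
proof -
 have eq: "Bop = (\<lambda>y. (J0 L (fst y), J0 L (fst (snd y)), JL L (fst (snd (snd y))), JL L (fst (snd (snd (snd y)))),
   J0 L (fst y) + Kr (snd (snd (snd (snd y))))))"
  by (simp add: fun_eq_iff)
 show ?thesis unfolding eq
  by (intro bounded_linear_Pair bounded_linear_add
    bounded_linear_compose[OF bounded_linear_ops(1)[OF L]]
    bounded_linear_compose[OF bounded_linear_ops(2)[OF L]]
    bounded_linear_compose[OF bounded_linear_ops(3)[OF L]]
    bounded_linear_compose[OF bounded_linear_fst] bounded_linear_compose[OF bounded_linear_snd]
    bounded_linear_fst bounded_linear_snd bounded_linear_ident)
qed

lemma bounded_linear_Cop: "bounded_linear (Cop t)"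
proof -
 have eq: "Cop t = (\<lambda>y. (a *\<^sub>R fst (snd (snd y)) + b *\<^sub>R fst (snd (snd (snd y))) - (\<delta>1 t / \<rho>) *\<^sub>R J0 L (fst y)
   - (\<delta>2 t / \<rho>) *\<^sub>R (J0 L (fst y) + Rr (snd (snd (snd (snd y))))),
  - c *\<^sub>R fst (snd (snd (snd y))), a *\<^sub>R fst y, b *\<^sub>R fst y - c *\<^sub>R fst (snd y), mul_op (Mt t) (snd (snd (snd (snd y))))))"
  by (simp add: fun_eq_iff)
 show ?thesis unfolding eq
  by (intro bounded_linear_Pair bounded_linear_add bounded_linear_sub bounded_linear_minus
    bounded_linear_compose[OF bounded_linear_scaleR_right]
    bounded_linear_compose[OF bounded_linear_ops(1)[OF L]]
    bounded_linear_compose[OF bounded_linear_ops(4)[OF L]]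
    bounded_linear_compose[OF bounded_linear_mul_op[OF Mt_measurable Mt_bound]]
    bounded_linear_compose[OF bounded_linear_fst] bounded_linear_compose[OF bounded_linear_snd]
    bounded_linear_fst bounded_linear_snd bounded_linear_ident)
qed

lemma Bop_X: "y \<in> X ==> Bop y \<in> X"
 unfolding X_def
 by (auto simp: J0_X1[OF L] JL_X1[OF L] Kr_X2 X1_X2 subspace_add[OF subspace_X2])

lemma delay_deriv_bounded: "T \<ge> 0 ==> \<exists>E\<ge>0. \<forall>t\<in>{0..T}. \<bar>\<tau>' t\<bar> \<le> E"
proof -
 assume T: "T \<ge> 0"
 from data_lipschitz[OF T] obtain K where K: "K \<ge> 0"
  "\<And>s t. s \<in> {0..T} ==> t \<in> {0..T} ==> \<bar>\<tau>' s - \<tau>' t\<bar> \<le> K * \<bar>s - t\<bar>" by blast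
 have "\<bar>\<tau>' t\<bar> \<le> \<bar>\<tau>' 0\<bar> + K * T" if "t \<in> {0..T}" for t
 proof -
  have "\<bar>\<tau>' t - \<tau>' 0\<bar> \<le> K * \<bar>t - 0\<bar>" using K(2)[of t 0] that T by auto
  also have "\<dots> \<le> K * T" using that K(1) by (intro mult_left_mono) auto
  finally show ?thesis by linarith
 qed
 then show ?thesis using T K(1) by (intro exI[of _ "\<bar>\<tau>' 0\<bar> + K * T"]) auto
qed

text \<open>After the skew part cancels, three terms remain: friction, delay, and the transport term
  given by \<open>delay_identity\<close>. The delay term is a product with the outgoing trace
  \<open>z1\<close> and is absorbed by the negative multiple of \<open>(norm z1)\<^sup>2\<close> in
  the transport term.\<close>

lemma dissipative:
 assumes T: "T \<ge> 0"
 shows "\<exists>\<kappa>\<ge>0. \<forall>t\<in>{0..T}. \<forall>y\<in>X. inner (Bop y) (Cop t y) \<le> \<kappa> * (norm (Bop y))\<^sup>2"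
proof -
 from delay_deriv_bounded[OF T] obtain E where E: "E \<ge> 0" "\<And>t. t \<in> {0..T} ==> \<bar>\<tau>' t\<bar> \<le> E" by blast
 \<comment> \<open>\<open>m\<close> is the guaranteed damping of the outgoing trace, as \<open>(1 -
   \<tau>' t) / (2 * \<tau> t) \<ge> (1 - d) / (2 * \<tau>1)\<close>. The summands of
   \<open>k1\<close> come from \<open>\<delta>1\<close>, from Young's inequality with weight
   \<open>m\<close>, and from the trace at \<open>r = 0\<close>; \<open>k2\<close> comes from the
   term with \<open>\<tau>'\<close> in \<open>delay_identity\<close>.\<close>
 define m where "m = (1 - d) / (2 * \<tau>1)"
 have m: "m > 0" using d \<tau>1 by (simp add: m_def)
 define k1 where "k1 = D / \<rho> + (D / \<rho>)\<^sup>2 / (4 * m) + 1 / (2 * \<tau>0)"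
 define k2 where "k2 = E / (2 * \<tau>0)"
 have k: "k1 \<ge> 0" "k2 \<ge> 0" using D E \<rho> \<tau>0 m by (auto simp: k1_def k2_def)
 have "inner (Bop y) (Cop t y) \<le> (k1 + k2) * (norm (Bop y))\<^sup>2" if t: "t \<in> {0..T}" and y: "y \<in> X" for t y
 proof -
  obtain f h q s w where y_eq: "y = (f, h, q, s, w)" by (metis prod.exhaust)
  from y have mem: "f \<in> X1 L" "h \<in> X1 L" "q \<in> X1 L" "s \<in> X1 L" "w \<in> X2 L" by (auto simp: y_eq X_def)
  obtain g where g: "g \<in> sq1 L" "J0 L f = cls1 L g" using J0_X1[OF L mem(1)] by (auto simp: X1_def)
  define F where "F = J0 L f"
  define z where "z = F + Kr w"
  define z1 where "z1 = F + Rr w"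
  have tb: "\<tau>0 \<le> \<tau> t" "\<tau> t \<le> \<tau>1" "\<tau>' t \<le> d" "\<bar>\<delta>1 t\<bar> \<le> D" "\<bar>\<delta>2 t\<bar> \<le> D" "\<bar>\<tau>' t\<bar> \<le> E"
   using delay_bounds[of t] delay_deriv_le[of t] weight_bounds[of t] E(2)[OF t] t by auto
  have tp: "\<tau> t > 0" using tb \<tau>0 by linarith
  have dl: "inner z (mul_op (Mt t) w) = ((\<tau>' t / \<tau> t - 1 / \<tau> t) * (norm z1)\<^sup>2 + 1 / \<tau> t * (norm F)\<^sup>2 - \<tau>' t / \<tau> t * (norm z)\<^sup>2) / 2"
   using delay_identity[OF g(1) mem(5), of "\<tau>' t / \<tau> t" "1 / \<tau> t"]
   unfolding z_def z1_def F_def g(2) Mt_def[abs_def] by simp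
  have adj: "inner (JL L u) v = - inner (J0 L v) u" for u v
   using inner_J0_JL[OF L, of v u] by (simp add: inner_commute)
  have "inner (Bop y) (Cop t y) = - (\<delta>1 t / \<rho>) * (norm F)\<^sup>2 - (\<delta>2 t / \<rho>) * inner F z1 + inner z (mul_op (Mt t) w)"
   unfolding y_eq Bop.simps Cop.simps inner_Pair inner_add_right inner_diff_right inner_scaleR_right adj
    F_def[symmetric] z1_def[symmetric] z_def[symmetric]
   by (simp add: adj power2_norm_eq_inner inner_commute F_def)
  also have "\<dots> \<le> k1 * (norm F)\<^sup>2 + k2 * (norm z)\<^sup>2"
  proof -
   have 1: "- (\<delta>1 t / \<rho>) * (norm F)\<^sup>2 \<le> D / \<rho> * (norm F)\<^sup>2"
   proof (rule mult_right_mono)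
    have "- \<delta>1 t / \<rho> \<le> D / \<rho>" using tb \<rho> by (intro divide_right_mono) auto
    then show "- (\<delta>1 t / \<rho>) \<le> D / \<rho>" by simp
   qed simp
   have 2: "- (\<delta>2 t / \<rho>) * inner F z1 \<le> m * (norm z1)\<^sup>2 + (D / \<rho>)\<^sup>2 / (4 * m) * (norm F)\<^sup>2"
   proof -
    have "- (\<delta>2 t / \<rho>) * inner F z1 \<le> \<bar>\<delta>2 t / \<rho>\<bar> * \<bar>inner F z1\<bar>"
     by (metis abs_ge_minus_self abs_mult mult_minus_left)
    also have "\<dots> \<le> (D / \<rho>) * (norm F * norm z1)"
     using tb \<rho> D Cauchy_Schwarz_ineq2[of F z1] by (intro mult_mono) (auto simp: divide_right_mono)
    also have "\<dots> = 2 * (sqrt m * norm z1) * ((D / \<rho>) / (2 * sqrt m) * norm F)"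
     using m by (simp add: field_simps)
    also have "\<dots> \<le> (sqrt m * norm z1)\<^sup>2 + ((D / \<rho>) / (2 * sqrt m) * norm F)\<^sup>2"
     by (rule sum_squares_bound)
    also have "\<dots> = m * (norm z1)\<^sup>2 + (D / \<rho>)\<^sup>2 / (4 * m) * (norm F)\<^sup>2"
     using m by (simp add: power_mult_distrib power_divide)
    finally show ?thesis .
   qed
   have 3: "(\<tau>' t / \<tau> t - 1 / \<tau> t) / 2 \<le> - m"
   proof -
    have "(1 - d) / \<tau>1 \<le> (1 - \<tau>' t) / \<tau> t" using tb tp d by (intro frac_le) auto
    then have le: "(1 - d) / \<tau>1 / 2 \<le> (1 - \<tau>' t) / \<tau> t / 2" by (rule divide_right_mono) simp
    have eq: "(\<tau>' t / \<tau> t - 1 / \<tau> t) / 2 = - ((1 - \<tau>' t) / \<tau> t / 2)"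
     by (simp add: diff_divide_distrib)
    have m_eq: "m = (1 - d) / \<tau>1 / 2" by (simp add: m_def)
    show ?thesis unfolding eq m_eq neg_le_iff_le by (rule le)
   qed
   have 4: "1 / \<tau> t / 2 \<le> 1 / (2 * \<tau>0)" using tb \<tau>0 by (simp add: frac_le)
   have 5: "- (\<tau>' t / \<tau> t) / 2 \<le> k2"
   proof -
    have "- \<tau>' t / \<tau> t \<le> E / \<tau>0" using tb tp \<tau>0 E(1) by (intro frac_le) auto
    then show ?thesis by (simp add: k2_def)
   qed
   have "(\<tau>' t / \<tau> t - 1 / \<tau> t) / 2 * (norm z1)\<^sup>2 \<le> - m * (norm z1)\<^sup>2"
    "1 / \<tau> t / 2 * (norm F)\<^sup>2 \<le> 1 / (2 * \<tau>0) * (norm F)\<^sup>2"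
    "- (\<tau>' t / \<tau> t) / 2 * (norm z)\<^sup>2 \<le> k2 * (norm z)\<^sup>2"
    by (intro mult_right_mono 3 4 5 zero_le_power2)+
   moreover have "inner z (mul_op (Mt t) w) = (\<tau>' t / \<tau> t - 1 / \<tau> t) / 2 * (norm z1)\<^sup>2 + 1 / \<tau> t / 2 * (norm F)\<^sup>2 + - (\<tau>' t / \<tau> t) / 2 * (norm z)\<^sup>2"
    unfolding dl by (simp add: add_divide_distrib diff_divide_distrib)
   ultimately show ?thesis using 1 2 unfolding k1_def distrib_right by linarith
  qed
  also have "\<dots> \<le> k1 * (norm (Bop y))\<^sup>2 + k2 * (norm (Bop y))\<^sup>2"
   unfolding y_eq Bop.simps F_def z_def
   by (intro add_mono mult_left_mono power_mono norm5_ge k norm_ge_zero)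
  finally show ?thesis by (simp add: distrib_right)
 qed
 then show ?thesis using k by (intro exI[of _ "k1 + k2"]) auto
qed

lemma Mt_lipschitz:
 assumes T: "T \<ge> 0"
 shows "\<exists>K\<ge>0. \<forall>s\<in>{0..T}. \<forall>t\<in>{0..T}. \<forall>p. \<bar>Mt s p - Mt t p\<bar> \<le> K * \<bar>s - t\<bar>"
proof -
 from delay_deriv_bounded[OF T] obtain E where E: "E \<ge> 0" "\<And>t. t \<in> {0..T} ==> \<bar>\<tau>' t\<bar> \<le> E" by blast
 from data_lipschitz[OF T] obtain K where K: "K \<ge> 0"
  "\<And>s t. s \<in> {0..T} ==> t \<in> {0..T} ==> \<bar>\<tau> s - \<tau> t\<bar> \<le> K * \<bar>s - t\<bar>"
  "\<And>s t. s \<in> {0..T} ==> t \<in> {0..T} ==> \<bar>\<tau>' s - \<tau>' t\<bar> \<le> K * \<bar>s - t\<bar>" by blast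
 define N where "N = (K * \<tau>1 + E * K + K) / \<tau>0\<^sup>2"
 have "\<bar>Mt s p - Mt t p\<bar> \<le> N * \<bar>s - t\<bar>" if s: "s \<in> {0..T}" and t: "t \<in> {0..T}" for s t p
 proof (cases "snd p \<in> {0<..<1}")
  case False
  then have "Mt s p = 0" "Mt t p = 0" by (auto simp: Mt_def)
  then show ?thesis using K(1) E(1) \<tau>1 by (simp add: N_def)
 next
  case True
  define r where "r = snd p"
  have r: "0 < r" "r < 1" using True by (auto simp: r_def)
  have b: "\<tau>0 \<le> \<tau> s" "\<tau> s \<le> \<tau>1" "\<tau>0 \<le> \<tau> t" "\<tau> t \<le> \<tau>1" using delay_bounds[of s] delay_bounds[of t] s t by auto
  then have pos: "\<tau> s > 0" "\<tau> t > 0" using \<tau>0 by linarith+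
  \<comment> \<open>Over the common denominator the numerator is linear in the increments of
    \<open>\<tau>'\<close> and \<open>\<tau>\<close>; the factors left over are bounded on the
    horizon.\<close>
  have "Mt s p - Mt t p = ((\<tau>' s - \<tau>' t) * \<tau> t * r + \<tau>' t * (\<tau> t - \<tau> s) * r + (\<tau> s - \<tau> t)) / (\<tau> s * \<tau> t)"
   using pos True by (simp add: Mt_def r_def[symmetric] field_simps)
  then have "\<bar>Mt s p - Mt t p\<bar> = \<bar>(\<tau>' s - \<tau>' t) * \<tau> t * r + \<tau>' t * (\<tau> t - \<tau> s) * r + (\<tau> s - \<tau> t)\<bar> / (\<tau> s * \<tau> t)"
   using pos by (simp add: abs_mult)
  also have "\<dots> \<le> ((K * \<tau>1 + E * K + K) * \<bar>s - t\<bar>) / \<tau>0\<^sup>2"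
  proof (rule frac_le)
   have "\<bar>(\<tau>' s - \<tau>' t) * \<tau> t * r\<bar> \<le> (K * \<bar>s - t\<bar>) * \<tau>1 * 1"
    unfolding abs_mult using K s t b pos r by (intro mult_mono) auto
   moreover have "\<bar>\<tau>' t * (\<tau> t - \<tau> s) * r\<bar> \<le> E * (K * \<bar>s - t\<bar>) * 1"
    unfolding abs_mult using K(1) K(2)[OF t s] s t E r by (intro mult_mono) (auto simp: abs_minus_commute)
   moreover have "(K * \<tau>1 + E * K + K) * \<bar>s - t\<bar> = (K * \<bar>s - t\<bar>) * \<tau>1 * 1 + E * (K * \<bar>s - t\<bar>) * 1 + K * \<bar>s - t\<bar>"
    by (simp add: algebra_simps)
   ultimately show "\<bar>(\<tau>' s - \<tau>' t) * \<tau> t * r + \<tau>' t * (\<tau> t - \<tau> s) * r + (\<tau> s - \<tau> t)\<bar> \<le> (K * \<tau>1 + E * K + K) * \<bar>s - t\<bar>"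
    using K(2)[OF s t] by linarith
   show "\<tau>0\<^sup>2 \<le> \<tau> s * \<tau> t" unfolding power2_eq_square using b \<tau>0 by (intro mult_mono) auto
  qed (use K(1) E(1) \<tau>1 \<tau>0 in auto)
  finally show ?thesis by (simp add: N_def)
 qed
 moreover have "N \<ge> 0" using K(1) E(1) \<tau>1 by (simp add: N_def)
 ultimately show ?thesis by blast
qed

lemma lipschitz:
 assumes T: "T \<ge> 0"
 shows "\<exists>K\<ge>0. \<forall>s\<in>{0..T}. \<forall>t\<in>{0..T}. \<forall>y\<in>X. norm (Cop s y - Cop t y) \<le> K * \<bar>s - t\<bar> * norm y"
proof -
 from Mt_lipschitz[OF T] obtain N where N: "N \<ge> 0"
  "\<And>s t p. s \<in> {0..T} ==> t \<in> {0..T} ==> \<bar>Mt s p - Mt t p\<bar> \<le> N * \<bar>s - t\<bar>" by blast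
 from data_lipschitz[OF T] obtain K where K: "K \<ge> 0"
  "\<And>s t. s \<in> {0..T} ==> t \<in> {0..T} ==> \<bar>\<delta>1 s - \<delta>1 t\<bar> \<le> K * \<bar>s - t\<bar>"
  "\<And>s t. s \<in> {0..T} ==> t \<in> {0..T} ==> \<bar>\<delta>2 s - \<delta>2 t\<bar> \<le> K * \<bar>s - t\<bar>" by blast
 obtain n0 where n0: "n0 > 0" "\<And>x. norm (J0 L x) \<le> norm x * n0"
  using bounded_linear.pos_bounded[OF bounded_linear_ops(1)[OF L]] by blast
 obtain n1 where n1: "n1 > 0" "\<And>x. norm (Rr x) \<le> norm x * n1"
  using bounded_linear.pos_bounded[OF bounded_linear_ops(4)[OF L]] by blast
 define M where "M = K / \<rho> * n0 + K / \<rho> * (n0 + n1) + N"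
 have "norm (Cop s y - Cop t y) \<le> M * \<bar>s - t\<bar> * norm y" if st: "s \<in> {0..T}" "t \<in> {0..T}" and "y \<in> X" for s t y
 proof -
  obtain f h q u w where y_eq: "y = (f, h, q, u, w)" by (metis prod.exhaust)
  have ny: "norm f \<le> norm y" "norm w \<le> norm y" unfolding y_eq by (rule norm5_ge)+
  let ?e = "K * \<bar>s - t\<bar> / \<rho>"
  have e: "?e \<ge> 0" using K \<rho> by simp
  have d12: "\<bar>(\<delta>1 t - \<delta>1 s) / \<rho>\<bar> \<le> ?e" "\<bar>(\<delta>2 t - \<delta>2 s) / \<rho>\<bar> \<le> ?e"
   using K(2,3)[OF st] \<rho> by (auto simp: abs_minus_commute divide_right_mono)
  have F: "norm (J0 L f) \<le> n0 * norm y"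
   using n0(2)[of f] ny(1) n0(1) by (smt (verit) mult.commute mult_left_mono)
  have R: "norm (J0 L f + Rr w) \<le> (n0 + n1) * norm y"
  proof -
   have "norm (Rr w) \<le> n1 * norm y" using n1(2)[of w] ny(2) n1(1) by (smt (verit) mult.commute mult_left_mono)
   with F norm_triangle_ineq[of "J0 L f" "Rr w"] show ?thesis by (simp add: distrib_right)
  qed
  have "Cop s y - Cop t y = (((\<delta>1 t - \<delta>1 s) / \<rho>) *\<^sub>R J0 L f + ((\<delta>2 t - \<delta>2 s) / \<rho>) *\<^sub>R (J0 L f + Rr w), 0, 0, 0,
    mul_op (Mt s) w - mul_op (Mt t) w)"
   by (simp add: y_eq diff_divide_distrib scaleR_diff_left)
  then have "norm (Cop s y - Cop t y) \<le> norm (((\<delta>1 t - \<delta>1 s) / \<rho>) *\<^sub>R J0 L f + ((\<delta>2 t - \<delta>2 s) / \<rho>) *\<^sub>R (J0 L f + Rr w))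
   + norm (mul_op (Mt s) w - mul_op (Mt t) w)"
   using norm5_le[of _ 0 0 0 "mul_op (Mt s) w - mul_op (Mt t) w"] by simp
  also have "\<dots> \<le> (\<bar>(\<delta>1 t - \<delta>1 s) / \<rho>\<bar> * norm (J0 L f) + \<bar>(\<delta>2 t - \<delta>2 s) / \<rho>\<bar> * norm (J0 L f + Rr w)) + N * \<bar>s - t\<bar> * norm w"
  proof (rule add_mono)
   show "norm (((\<delta>1 t - \<delta>1 s) / \<rho>) *\<^sub>R J0 L f + ((\<delta>2 t - \<delta>2 s) / \<rho>) *\<^sub>R (J0 L f + Rr w))
    \<le> \<bar>(\<delta>1 t - \<delta>1 s) / \<rho>\<bar> * norm (J0 L f) + \<bar>(\<delta>2 t - \<delta>2 s) / \<rho>\<bar> * norm (J0 L f + Rr w)"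
    by (rule norm_triangle_le) simp
   show "norm (mul_op (Mt s) w - mul_op (Mt t) w) \<le> N * \<bar>s - t\<bar> * norm w"
    by (rule mul_op_diff_bound[OF Mt_measurable Mt_bound Mt_measurable Mt_bound N(2)[OF st]])
  qed
  also have "\<dots> \<le> (?e * (n0 * norm y) + ?e * ((n0 + n1) * norm y)) + N * \<bar>s - t\<bar> * norm y"
   by (intro add_mono mult_mono d12 F R e mult_left_mono ny) (use N(1) in auto)
  also have "\<dots> = M * \<bar>s - t\<bar> * norm y" using \<rho> by (simp add: M_def field_simps)
  finally show ?thesis .
 qed
 moreover have "M \<ge> 0" using K(1) \<rho> n0(1) n1(1) N(1) by (simp add: M_def)
 ultimately show ?thesis by blast
qed

text \<open>For \<open>0 < r < 1\<close> the factor \<open>1 - \<tau>' t * r\<close> is at least 1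
  when \<open>\<tau>' t \<le> 0\<close> and at least \<open>1 - d\<close> otherwise. So
  multiplication by \<open>Mt t\<close> has a bounded left inverse on functions supported in the
  rectangle, namely multiplication by \<open>G\<close>.\<close>

lemma norm_le_mul_Mt:
 assumes t: "t \<ge> 0" and w: "w \<in> X2 L"
 shows "norm w \<le> \<tau>1 / min 1 (1 - d) * norm (mul_op (Mt t) w)"
proof -
 define e0 where "e0 = min 1 (1 - d)"
 have e0: "e0 > 0" using d by (simp add: e0_def)
 define G where "G p = ind 1 (snd p) * inverse (\<tau>' t / \<tau> t * snd p - 1 / \<tau> t)" for p :: "real \<times> real"
 have b: "\<tau>0 \<le> \<tau> t" "\<tau> t \<le> \<tau>1" "\<tau>' t \<le> d" using delay_bounds[OF t] delay_deriv_le[OF t] by auto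
 then have pos: "\<tau> t > 0" using \<tau>0 by linarith
 have den: "1 - \<tau>' t * r \<ge> e0" if "0 < r" "r < 1" for r
 proof (cases "\<tau>' t \<le> 0")
  case True
  then have "\<tau>' t * r \<le> 0" using that by (simp add: mult_nonpos_nonneg)
  then show ?thesis by (simp add: e0_def)
 next
  case False
  then have "\<tau>' t * r \<le> d * 1" using that b by (intro mult_mono) auto
  then show ?thesis by (simp add: e0_def)
 qed
 have inv: "inverse (\<tau>' t / \<tau> t * r - 1 / \<tau> t) = - (\<tau> t / (1 - \<tau>' t * r))" for r
 proof -
  have "\<tau>' t / \<tau> t * r - 1 / \<tau> t = - ((1 - \<tau>' t * r) / \<tau> t)" using pos by (simp add: field_simps)
  then show ?thesis by simp
 qed
 have Gm: "G \<in> borel_fun"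
  unfolding G_def[abs_def]
  by (intro borel_measurable_times borel_measurable_inverse borel_measurable_diff borel_measurable_const measurable_compose[OF snd_borel]) auto
 have Gb: "\<bar>G p\<bar> \<le> \<tau>1 / e0" for p
 proof (cases "snd p \<in> {0<..<1}")
  case True
  then have "\<bar>G p\<bar> = \<tau> t / (1 - \<tau>' t * snd p)" using den[of "snd p"] e0 pos unfolding G_def inv by simp
  also have "\<dots> \<le> \<tau>1 / e0" using den[of "snd p"] True b e0 pos by (intro frac_le) auto
  finally show ?thesis .
 qed (use \<tau>1 e0 in \<open>auto simp: G_def\<close>)
 have "mul_op G (mul_op (Mt t) (cls (rep w))) = cls (\<lambda>p. G p * (Mt t p * rep w p))"
  unfolding mul_op_cls[OF Mt_measurable Mt_bound rep_sq_int]
  by (rule mul_op_cls[OF Gm Gb mul_fun_sq_int[OF Mt_measurable Mt_bound rep_sq_int]])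
 also have "\<dots> = cls (rep w)"
 proof (rule iffD2[OF cls_eq_iff])
  show "AE p in lborel. G p * (Mt t p * rep w p) = rep w p"
   using X2_rep[OF w]
  proof eventually_elim
   case (elim p)
   show ?case
   proof (cases "snd p \<in> {0<..<1}")
    case True
    then have "\<tau>' t / \<tau> t * snd p - 1 / \<tau> t \<noteq> 0"
     using inv[of "snd p"] den[of "snd p"] e0 pos by auto
    then show ?thesis using True by (simp add: G_def Mt_def)
   next
    case False
    then have "ind2 L p = 0" by (auto simp: ind2_def)
    then show ?thesis using elim by simp
   qed
  qed
 qed (intro mul_fun_sq_int[OF Gm Gb mul_fun_sq_int[OF Mt_measurable Mt_bound rep_sq_int]] rep_sq_int)+
 finally have "mul_op G (mul_op (Mt t) w) = w" by simp
 then show ?thesis using norm_mul_op[OF Gm Gb, of "mul_op (Mt t) w"] by (simp add: e0_def)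
qed

text \<open>The system is triangular: \<open>f\<close>, \<open>s\<close> and \<open>w\<close> are
  controlled by the third, second and fifth components of \<open>Cop t y\<close>, then
  \<open>h\<close> by the fourth and \<open>q\<close> by the first. The bound is uniform over all
  \<open>t \<ge> 0\<close>, as the data bounds are.\<close>

lemma coercive:
 shows "\<exists>k>0. \<forall>t\<ge>0. \<forall>y\<in>X. norm y \<le> k * norm (Cop t y)"
proof -
 obtain n0 where n0: "n0 > 0" "\<And>x. norm (J0 L x) \<le> norm x * n0"
  using bounded_linear.pos_bounded[OF bounded_linear_ops(1)[OF L]] by blast
 obtain n1 where n1: "n1 > 0" "\<And>x. norm (Rr x) \<le> norm x * n1"
  using bounded_linear.pos_bounded[OF bounded_linear_ops(4)[OF L]] by blast
 define kw where "kw = \<tau>1 / min 1 (1 - d)"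
 define kh where "kh = (\<bar>b\<bar> / a + 1) / c"
 define kq where "kq = (1 + \<bar>b\<bar> / c + D / \<rho> * (n0 / a) + D / \<rho> * (n0 / a + n1 * kw)) / a"
 define k where "k = 1 / a + kh + kq + 1 / c + kw"
 have kwp: "kw \<ge> 0" using \<tau>1 d by (simp add: kw_def)
 have kp: "kh \<ge> 0" "kq \<ge> 0" using kwp a c D \<rho> n0(1) n1(1) by (auto simp: kh_def kq_def)
 have "norm y \<le> k * norm (Cop t y)" if t: "t \<ge> 0" and "y \<in> X" for t y
 proof -
  obtain f h q s w where y_eq: "y = (f, h, q, s, w)" by (metis prod.exhaust)
  have w: "w \<in> X2 L" using \<open>y \<in> X\<close> by (simp add: y_eq X_def)
  define N where "N = norm (Cop t y)"
  have N0: "N \<ge> 0" by (simp add: N_def)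
  define v where "v = a *\<^sub>R q + b *\<^sub>R s - (\<delta>1 t / \<rho>) *\<^sub>R J0 L f - (\<delta>2 t / \<rho>) *\<^sub>R (J0 L f + Rr w)"
  have comp: "norm v \<le> N" "norm (- c *\<^sub>R s) \<le> N" "norm (a *\<^sub>R f) \<le> N" "norm (b *\<^sub>R f - c *\<^sub>R h) \<le> N"
   "norm (mul_op (Mt t) w) \<le> N"
   unfolding N_def y_eq Cop.simps v_def by (rule norm5_ge)+
  have f: "norm f \<le> 1 / a * N" using comp(3) a by (simp add: field_simps)
  have s: "norm s \<le> 1 / c * N" using comp(2) c by (simp add: field_simps)
  have w': "norm w \<le> kw * N"
   using norm_le_mul_Mt[OF t w] mult_left_mono[OF comp(5) kwp] by (simp add: kw_def)
  have h: "norm h \<le> kh * N"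
  proof -
   have "c * norm h = norm (b *\<^sub>R f - (b *\<^sub>R f - c *\<^sub>R h))" using c by simp
   also have "\<dots> \<le> norm (b *\<^sub>R f) + norm (b *\<^sub>R f - c *\<^sub>R h)" by (rule norm_triangle_ineq4)
   also have "\<dots> \<le> \<bar>b\<bar> * (1 / a * N) + N" using comp(4) mult_left_mono[OF f, of "\<bar>b\<bar>"] by (intro add_mono) simp_all
   finally show ?thesis using c by (simp add: kh_def field_simps)
  qed
  have F: "norm (J0 L f) \<le> n0 / a * N"
   using n0(2)[of f] mult_right_mono[OF f, of n0] n0(1) by (simp add: mult_ac)
  have R: "norm (J0 L f + Rr w) \<le> (n0 / a + n1 * kw) * N"
  proof -
   have "norm (Rr w) \<le> kw * N * n1" using n1(2)[of w] mult_right_mono[OF w', of n1] n1(1) by linarith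
   moreover have "(n0 / a + n1 * kw) * N = n0 / a * N + kw * N * n1" by (simp add: algebra_simps)
   ultimately show ?thesis using norm_triangle_ineq[of "J0 L f" "Rr w"] F by linarith
  qed
  have d12: "\<bar>\<delta>1 t / \<rho>\<bar> \<le> D / \<rho>" "\<bar>\<delta>2 t / \<rho>\<bar> \<le> D / \<rho>"
   using weight_bounds[OF t] \<rho> by (auto simp: divide_right_mono)
  have q: "norm q \<le> kq * N"
  proof -
   have "a * norm q = norm ((v - b *\<^sub>R s) + ((\<delta>1 t / \<rho>) *\<^sub>R J0 L f + (\<delta>2 t / \<rho>) *\<^sub>R (J0 L f + Rr w)))"
    using a by (simp add: v_def)
   also have "\<dots> \<le> (norm v + norm (b *\<^sub>R s)) + (norm ((\<delta>1 t / \<rho>) *\<^sub>R J0 L f) + norm ((\<delta>2 t / \<rho>) *\<^sub>R (J0 L f + Rr w)))"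
    by (intro order_trans[OF norm_triangle_ineq] add_mono norm_triangle_ineq norm_triangle_ineq4)
   also have "\<dots> = (norm v + \<bar>b\<bar> * norm s) + (\<bar>\<delta>1 t / \<rho>\<bar> * norm (J0 L f) + \<bar>\<delta>2 t / \<rho>\<bar> * norm (J0 L f + Rr w))"
    by simp
   also have "\<dots> \<le> (N + \<bar>b\<bar> * (1 / c * N)) + (D / \<rho> * (n0 / a * N) + D / \<rho> * ((n0 / a + n1 * kw) * N))"
    by (intro add_mono comp mult_left_mono s mult_mono d12 F R) (use D \<rho> in auto)
   finally have le: "a * norm q \<le> \<dots>" .
   have "norm q = a * norm q / a" using a by simp
   also have "\<dots> \<le> ((N + \<bar>b\<bar> * (1 / c * N)) + (D / \<rho> * (n0 / a * N) + D / \<rho> * ((n0 / a + n1 * kw) * N))) / a"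
    using le a by (intro divide_right_mono) auto
   also have "\<dots> = kq * N" unfolding kq_def times_divide_eq_left by (rule arg_cong2[of _ _ _ _ "(/)"]) (simp_all add: algebra_simps)
   finally show ?thesis .
  qed
  have "norm y \<le> norm f + norm h + norm q + norm s + norm w" unfolding y_eq by (rule norm5_le)
  also have "\<dots> \<le> k * N" unfolding k_def distrib_right using f h q s w' by linarith
  finally show ?thesis by (simp add: N_def)
 qed
 moreover have "k > 0" using a c kp kwp by (simp add: k_def add_pos_nonneg)
 ultimately show ?thesis by blast
qed

sublocale evolution_system X Bop Cop
proof (rule evolution_system.intro, goal_cases)
 case 1 show ?case by (rule subspace_X)
next
 case 2 show ?case by (rule closed_X)
next
 case 3 show ?case by (rule bounded_linear_Bop)
next
 case (4 y) then show ?case by (rule Bop_X)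
next
 case (5 t) show ?case by (rule bounded_linear_Cop)
next
 case (6 T) then show ?case by (rule dissipative)
next
 case (7 T) then show ?case by (rule lipschitz)
next
 case (8 T)
 from coercive obtain k where "k > 0" "\<forall>t\<ge>0. \<forall>y\<in>X. norm y \<le> k * norm (Cop t y)" by blast
 then show ?case by (intro exI[of _ k]) simp
qed

end

section \<open>Closed spans and approximation by continuous functions\<close>

lemma subspace_closure:
 fixes S :: "'a::real_normed_vector set"
 assumes S: "subspace S" shows "subspace (closure S)"
 unfolding subspace_def
proof (intro conjI ballI allI)
 show "0 \<in> closure S" using subspace_0[OF S] closure_subset by blast
 fix x y assume "x \<in> closure S" "y \<in> closure S"
 then obtain a b where "\<And>n. a n \<in> S" "a \<longlonglongrightarrow> x" "\<And>n. b n \<in> S" "b \<longlonglongrightarrow> y"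
  unfolding closure_sequential by blast
 then show "x + y \<in> closure S" unfolding closure_sequential
  by (intro exI[of _ "\<lambda>n. a n + b n"]) (auto intro: subspace_add[OF S] tendsto_intros)
next
 fix c x assume "x \<in> closure S"
 then obtain a where "\<And>n. a n \<in> S" "a \<longlonglongrightarrow> x" unfolding closure_sequential by blast
 then show "c *\<^sub>R x \<in> closure S" unfolding closure_sequential
  by (intro exI[of _ "\<lambda>n. c *\<^sub>R a n"]) (auto intro: subspace_scale[OF S] tendsto_intros)
qed

text \<open>Invariance and density claims are reduced to generators through this: linearity reaches
  the span, continuity and closedness of \<open>W\<close> its closure.\<close>

lemma bounded_linear_maps_closure_span:
 assumes T: "bounded_linear T" and "closed W" "subspace W" and gen: "\<And>e. e \<in> G ==> T e \<in> W"
  and e: "e \<in> closure (span G)"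
 shows "T e \<in> W"
proof -
 interpret T: bounded_linear T by fact
 have "T ` span G \<subseteq> W"
 proof -
  have "T ` span G = span (T ` G)" by (rule linear_span_image[OF T.linear, symmetric])
  also have "\<dots> \<subseteq> W" using gen \<open>subspace W\<close> by (intro span_minimal) auto
  finally show ?thesis .
 qed
 then have "T ` closure (span G) \<subseteq> W"
  by (intro image_closure_subset T.continuous_on continuous_on_id \<open>closed W\<close>)
 with e show ?thesis by auto
qed

text \<open>Comes from the description of Lebesgue measurability by continuous approximants. The
  approximants carry no bound; one is imposed afterwards by truncation.\<close>

lemma borel_limit_of_continuous:
 fixes u :: "real \<times> real => real"
 assumes u: "u \<in> borel_fun"
 shows "\<exists>g. (\<forall>n. continuous_on UNIV (g n)) \<and> (AE p in lborel. (\<lambda>n. g n p) \<longlonglongrightarrow> u p)"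
proof -
 have "u \<in> borel_measurable lebesgue" using u by (intro measurable_completion) simp
 then have "u measurable_on UNIV" by (rule lebesgue_measurable_imp_measurable_on_real) simp
 then obtain N g where N: "negligible N" and g: "\<And>n. continuous_on UNIV (g n)"
  "\<And>x. x \<notin> N ==> (\<lambda>n. g n x) \<longlonglongrightarrow> u x"
  unfolding measurable_on_def by auto
 have "AE p in lebesgue. p \<notin> N" using N by (simp add: negligible_iff_null_sets AE_not_in)
 then have "AE p in lborel. p \<notin> N" by (simp add: AE_completion_iff)
 then have "AE p in lborel. (\<lambda>n. g n p) \<longlonglongrightarrow> u p" by eventually_elim (rule g(2))
 with g(1) show ?thesis by blast
qed

section \<open>Modes and their density\<close>

text \<open>Sine and cosine are treated together: both families are wanted, since integration in
  \<open>x\<close> exchanges them. \<open>\<epsilon>\<close> records the parity,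
  \<open>\<sigma> (- x) = \<epsilon> * \<sigma> x\<close>.\<close>

locale trig_system =
 fixes L :: real and \<sigma> :: "real => real" and \<epsilon> :: real
 assumes L: "0 < L" and \<sigma>: "\<sigma> = sin \<and> \<epsilon> = -1 \<or> \<sigma> = cos \<and> \<epsilon> = 1"
begin

text \<open>The half-integers make \<open>cos (om k * L) = 0\<close>, so sines have zero slope at
  \<open>L\<close> and cosines vanish there.\<close>

definition om :: "nat => real" where "om k = (real k + 1/2) * pi / L"

definition gen :: "nat => nat => l2" where
 "gen k j = cls (\<lambda>p. ind2 L p * (\<sigma> (om k * fst p) * snd p ^ j))"

definition W :: "l2 set" where "W = closure (span {gen k j |k j. True})"

lemma \<sigma>_cont: "continuous_on S \<sigma>"
 using \<sigma> by (auto intro: continuous_intros)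

lemma \<sigma>_bound: "\<bar>\<sigma> x\<bar> \<le> 1"
 using \<sigma> by auto

text \<open>The lowest mode has no zero inside the interval, so functions can be divided by it
  there.\<close>

lemma \<sigma>_pos: "0 < x ==> x < L ==> 0 < \<sigma> (om 0 * x)"
proof -
 assume x: "0 < x" "x < L"
 then have "pi * x < pi * L" by simp
 then have "0 < pi * x / (2 * L)" "pi * x / (2 * L) < pi / 2" using x by (auto simp: field_simps)
 moreover have "om 0 * x = pi * x / (2 * L)" using x by (simp add: om_def)
 ultimately show ?thesis using \<sigma> by (auto intro!: sin_gt_zero cos_gt_zero)
qed

text \<open>The recursion that makes the span of the modes invariant under multiplication by
 \<open>cos (\<pi> x / L)\<close>; for \<open>k = 0\<close> parity closes it.\<close>

lemma \<sigma>_cos: "cos (pi * x / L) * \<sigma> (om k * x) =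
 (\<sigma> (om (Suc k) * x) + (if k = 0 then \<epsilon> * \<sigma> (om 0 * x) else \<sigma> (om (k - 1) * x))) / 2"
proof -
 define \<theta> where "\<theta> = pi * x / L"
 have s: "om (Suc k) * x = om k * x + \<theta>" for k
  unfolding om_def \<theta>_def using L by (simp add: field_simps)
 have 1: "cos \<theta> * \<sigma> y = (\<sigma> (y + \<theta>) + \<sigma> (y - \<theta>)) / 2" for y
  using \<sigma> by (auto simp: sin_add sin_diff cos_add cos_diff)
 have 2: "\<sigma> (om k * x - \<theta>) = (if k = 0 then \<epsilon> * \<sigma> (om 0 * x) else \<sigma> (om (k - 1) * x))"
 proof (cases k)
  case 0
  have eq: "om 0 * x - \<theta> = - (om 0 * x)" unfolding om_def \<theta>_def using L by (simp add: field_simps)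
  show ?thesis unfolding 0 eq using \<sigma> by auto
 next
  case (Suc j)
  then show ?thesis using s[of j] by simp
 qed
 show ?thesis unfolding \<theta>_def[symmetric] 1 2 s[symmetric] by simp
qed

lemma cont_ind2_bounded:
 assumes "continuous_on UNIV (g :: real \<times> real => real)"
 shows "\<exists>C. \<forall>p. \<bar>ind2 L p * g p\<bar> \<le> C" and "(\<lambda>p. ind2 L p * g p) \<in> borel_fun"
proof -
 have "compact (cbox (0, 0) (L, 1 :: real))" by simp
 then have "bounded (g ` cbox (0, 0) (L, 1))"
  by (intro compact_imp_bounded compact_continuous_image continuous_on_subset[OF assms]) auto
 then obtain C where C: "\<And>p. p \<in> cbox (0, 0) (L, 1) ==> \<bar>g p\<bar> \<le> C"
  by (auto simp: bounded_iff)
 have "\<bar>ind2 L p * g p\<bar> \<le> \<bar>C\<bar>" for p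
 proof (cases "p \<in> cbox (0, 0) (L, 1)")
  case True
  then show ?thesis using C[OF True] by (auto simp: ind2_def split: split_indicator)
 next
  case False
  then have "ind2 L p = 0" by (cases p) (auto simp: ind2_def cbox_Pair_eq split: split_indicator)
  then show ?thesis by simp
 qed
 then show "\<exists>C. \<forall>p. \<bar>ind2 L p * g p\<bar> \<le> C" by blast
 show "(\<lambda>p. ind2 L p * g p) \<in> borel_fun"
  using borel_measurable_continuous_onI[OF assms] by (intro borel_measurable_times) auto
qed

lemma ind2_sq_int: "ind2 L \<in> sqi"
 using tensor_sq_int(1)[OF indicator_Ioo_sq_int[of 0 L] indicator_Ioo_sq_int[of 0 1]]
 by (simp add: ind2_def[abs_def])

lemma cont_sq_int:
 assumes "continuous_on UNIV (g :: real \<times> real => real)"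
 shows "(\<lambda>p. ind2 L p * g p) \<in> sqi"
proof -
 obtain C where C: "\<And>p. \<bar>ind2 L p * g p\<bar> \<le> C" using cont_ind2_bounded(1)[OF assms] by blast
 show ?thesis
 proof -
  have "(\<lambda>p. (ind2 L p * g p) * ind2 L p) = (\<lambda>p. ind2 L p * g p)"
   by (auto simp: fun_eq_iff ind2_def split: split_indicator)
  then show ?thesis using mul_fun_sq_int[OF cont_ind2_bounded(2)[OF assms] C ind2_sq_int] by simp
 qed
qed

definition mu :: "(real \<times> real => real) => l2 => l2" where "mu g = mul_op (\<lambda>p. ind2 L p * g p)"

lemma mu_cls:
 assumes "continuous_on UNIV g" "f \<in> sqi"
 shows "mu g (cls f) = cls (\<lambda>p. ind2 L p * (g p * f p))"
proof -
 obtain C where C: "\<And>p. \<bar>ind2 L p * g p\<bar> \<le> C" using cont_ind2_bounded(1)[OF assms(1)] by blast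
 show ?thesis unfolding mu_def using mul_op_cls[OF cont_ind2_bounded(2)[OF assms(1)] C assms(2)] by (simp add: mult.assoc)
qed

lemma mu_linear:
 assumes "continuous_on UNIV g"
 shows "bounded_linear (mu g)"
proof -
 obtain C where C: "\<And>p. \<bar>ind2 L p * g p\<bar> \<le> C" using cont_ind2_bounded(1)[OF assms(1)] by blast
 show ?thesis unfolding mu_def using bounded_linear_mul_op[OF cont_ind2_bounded(2)[OF assms(1)] C] .
qed

lemma gen_cont: "continuous_on UNIV (\<lambda>p :: real \<times> real. \<sigma> (om k * fst p) * snd p ^ j)"
 by (intro continuous_intros continuous_on_compose2[OF \<sigma>_cont[of UNIV]]) auto

lemma W_subspace: "subspace W" and W_closed: "closed W"
 unfolding W_def by (auto intro: subspace_closure subspace_span)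

lemma gen_W: "gen k j \<in> W"
proof -
 have "gen k j \<in> span {gen k j |k j. True}" by (rule span_base) auto
 then show ?thesis unfolding W_def using closure_subset by blast
qed

lemma gen_X2: "gen k j \<in> X2 L"
 using cls_ind2_X2[OF cont_sq_int[OF gen_cont], of L k j] by (simp add: gen_def ind2_idem)

lemma W_X2: "W \<subseteq> X2 L"
proof
 fix e assume "e \<in> W"
 then show "e \<in> X2 L" unfolding W_def
  using bounded_linear_maps_closure_span[OF bounded_linear_ident closed_X2 subspace_X2, of "{gen k j |k j. True}" L e] gen_X2
  by auto
qed

lemma mu_cos_W: "e \<in> W ==> mu (\<lambda>p. cos (pi * fst p / L)) e \<in> W"
proof -
 let ?g = "\<lambda>p :: real \<times> real. cos (pi * fst p / L)"
 assume e: "e \<in> W"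
 have gc: "continuous_on UNIV ?g" using L by (intro continuous_intros) auto
 show ?thesis
 proof (rule bounded_linear_maps_closure_span[OF mu_linear[OF gc] W_closed W_subspace _ e[unfolded W_def]])
  fix x assume "x \<in> {gen k j |k j. True}"
  then obtain k j where x: "x = gen k j" by auto
  let ?h = "\<lambda>k p. ind2 L p * (\<sigma> (om k * fst p) * snd p ^ j)"
  have hs: "?h k \<in> sqi" for k by (rule cont_sq_int[OF gen_cont])
  let ?k2 = "if k = 0 then 0 else k - 1" and ?c = "if k = 0 then \<epsilon> else 1"
  have pt: "ind2 L p * (?g p * ?h k p) = (1/2) * ?h (Suc k) p + (?c / 2) * ?h ?k2 p" for p
  proof -
   have "ind2 L p * (?g p * ?h k p) = ind2 L p * ((?g p * \<sigma> (om k * fst p)) * snd p ^ j)"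
    using ind2_idem[of L p "?g p * \<sigma> (om k * fst p) * snd p ^ j"] by (simp only: mult_ac)
   also have "\<dots> = (1/2) * ?h (Suc k) p + (?c / 2) * ?h ?k2 p"
    unfolding \<sigma>_cos by (simp add: algebra_simps)
   finally show ?thesis .
  qed
  have "mu ?g x = cls (\<lambda>p. (1/2) * ?h (Suc k) p + (?c / 2) * ?h ?k2 p)"
   unfolding x gen_def mu_cls[OF gc hs] pt ..
  also have "\<dots> = (1/2) *\<^sub>R gen (Suc k) j + (?c / 2) *\<^sub>R gen ?k2 j"
   unfolding gen_def cls_scale[OF hs] by (intro cls_add[symmetric] sq_int_scale hs)
  also have "\<dots> \<in> W" by (intro subspace_add[OF W_subspace] subspace_scale[OF W_subspace] gen_W)
  finally show "mu ?g x \<in> W" .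
 qed
qed

lemma mu_snd_W: "e \<in> W ==> mu snd e \<in> W"
proof -
 assume e: "e \<in> W"
 have gc: "continuous_on UNIV (snd :: real \<times> real => real)" by (intro continuous_intros)
 show ?thesis
 proof (rule bounded_linear_maps_closure_span[OF mu_linear[OF gc] W_closed W_subspace _ e[unfolded W_def]])
  fix x assume "x \<in> {gen k j |k j. True}"
  then obtain k j where x: "x = gen k j" by auto
  have "mu snd x = cls (\<lambda>p. ind2 L p * (snd p * (ind2 L p * (\<sigma> (om k * fst p) * snd p ^ j))))"
   unfolding x gen_def by (rule mu_cls[OF gc cont_sq_int[OF gen_cont]])
  also have "\<dots> = gen k (Suc j)"
   unfolding gen_def by (intro arg_cong[of _ _ cls]) (auto simp: fun_eq_iff ind2_def split: split_indicator)
  finally show "mu snd x \<in> W" using gen_W by simp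
 qed
qed

text \<open>The continuous multipliers that leave the closed span of the modes invariant. They form
  an algebra, to which Stone-Weierstrass applies.\<close>

definition R :: "(real \<times> real => real) set" where
 "R = {g. continuous_on UNIV g \<and> (\<forall>e\<in>W. mu g e \<in> W)}"

lemma mu_rep: "continuous_on UNIV g ==> mu g e = cls (\<lambda>p. ind2 L p * (g p * rep e p))"
 using mu_cls[of g "rep e"] by simp

lemma mu_add:
 assumes g: "continuous_on UNIV g" and h: "continuous_on UNIV h"
 shows "mu (\<lambda>p. g p + h p) e = mu g e + mu h e"
proof -
 have s: "(\<lambda>p. ind2 L p * (g p * rep e p)) \<in> sqi" if g: "continuous_on UNIV g" for g
 proof -
  obtain C where C: "\<And>p. \<bar>ind2 L p * g p\<bar> \<le> C" using cont_ind2_bounded(1)[OF g] by blast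
  show ?thesis using mul_fun_sq_int[OF cont_ind2_bounded(2)[OF g] C rep_sq_int[of e]] by (simp add: mult.assoc)
 qed
 show ?thesis
  unfolding mu_rep[OF g] mu_rep[OF h] mu_rep[OF continuous_on_add[OF g h]] cls_add[OF s[OF g] s[OF h]]
  by (simp add: algebra_simps)
qed

lemma mu_mult:
 assumes g: "continuous_on UNIV g" and h: "continuous_on UNIV h"
 shows "mu (\<lambda>p. g p * h p) e = mu g (mu h e)"
proof -
 obtain C where C: "\<And>p. \<bar>ind2 L p * h p\<bar> \<le> C" using cont_ind2_bounded(1)[OF h] by blast
 have s: "(\<lambda>p. ind2 L p * (h p * rep e p)) \<in> sqi"
  using mul_fun_sq_int[OF cont_ind2_bounded(2)[OF h] C rep_sq_int[of e]] by (simp add: mult.assoc)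
 have "mu g (mu h e) = cls (\<lambda>p. ind2 L p * (g p * (ind2 L p * (h p * rep e p))))"
  unfolding mu_rep[OF h] by (rule mu_cls[OF g s])
 also have "\<dots> = cls (\<lambda>p. ind2 L p * (g p * h p * rep e p))"
  by (intro arg_cong[of _ _ cls]) (auto simp: fun_eq_iff ind2_def split: split_indicator)
 finally show ?thesis using mu_rep[OF continuous_on_mult[OF g h]] by simp
qed

lemma mu_const: "e \<in> X2 L ==> mu (\<lambda>_. c) e = c *\<^sub>R e"
proof -
 assume e: "e \<in> X2 L"
 have s: "(\<lambda>p. ind2 L p * rep e p) \<in> sqi" by (rule mul_fun_sq_int[OF ind2_measurable ind2_bound rep_sq_int])
 have "mu (\<lambda>_. c) e = c *\<^sub>R cls (\<lambda>p. ind2 L p * rep e p)"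
  unfolding cls_scale[OF s] by (simp add: mu_rep mult.left_commute)
 then show ?thesis using X2_cls[OF e] by simp
qed

text \<open>The multipliers \<open>snd\<close> and \<open>cos (pi * fst p / L)\<close> separate the
  points of the closed rectangle, since the cosine is injective on
  \<open>0 \<le> x \<le> L\<close>.\<close>

lemma ring: "function_ring_on R (cbox (0, 0) (L, 1))"
proof
 show "compact (cbox (0, 0) (L, 1 :: real))" by simp
 show "\<And>f. f \<in> R ==> continuous_on (cbox (0, 0) (L, 1)) f"
  by (auto simp: R_def intro: continuous_on_subset)
 fix f g assume "f \<in> R" "g \<in> R"
 then have c: "continuous_on UNIV f" "continuous_on UNIV g" and W: "\<And>e. e \<in> W ==> mu f e \<in> W" "\<And>e. e \<in> W ==> mu g e \<in> W"
  by (auto simp: R_def)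
 show "(\<lambda>x. f x + g x) \<in> R"
  using c W by (auto simp: R_def mu_add intro: continuous_intros subspace_add[OF W_subspace])
 show "(\<lambda>x. f x * g x) \<in> R"
  using c W by (auto simp: R_def mu_mult intro: continuous_intros)
next
 fix c :: real
 show "(\<lambda>_. c) \<in> R"
  using W_X2 by (auto simp: R_def mu_const subset_iff intro: subspace_scale[OF W_subspace])
next
 fix x y assume xy: "x \<in> cbox (0, 0) (L, 1 :: real)" "y \<in> cbox (0, 0) (L, 1)" "x \<noteq> y"
 have R1: "(\<lambda>p. cos (pi * fst p / L)) \<in> R"
  using mu_cos_W L by (auto simp: R_def intro!: continuous_intros)
 have R2: "snd \<in> R"
  using mu_snd_W by (auto simp: R_def intro!: continuous_intros)
 show "\<exists>f\<in>R. f x \<noteq> f y"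
 proof (cases "snd x = snd y")
  case False
  with R2 show ?thesis by blast
 next
  case True
  with xy(3) have ne: "fst x \<noteq> fst y" by (simp add: prod_eq_iff)
  have r: "0 \<le> fst z \<and> fst z \<le> L" if "z \<in> cbox (0, 0) (L, 1 :: real)" for z
   using that by (cases z) (auto simp: cbox_Pair_eq)
  have r': "0 \<le> pi * fst z / L \<and> pi * fst z / L \<le> pi" if "z \<in> cbox (0, 0) (L, 1 :: real)" for z
   using r[OF that] L by (auto simp: field_simps)
  have "cos (pi * fst x / L) \<noteq> cos (pi * fst y / L)"
  proof
   assume "cos (pi * fst x / L) = cos (pi * fst y / L)"
   then have "pi * fst x / L = pi * fst y / L" using r'[OF xy(1)] r'[OF xy(2)] by (auto dest: cos_inj_pi)
   then show False using ne L by simp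
  qed
  then show ?thesis by (intro bexI[OF _ R1])
 qed
qed

text \<open>By Stone-Weierstrass \<open>g\<close> is a uniform limit on the rectangle of multipliers
  in \<open>R\<close>, and \<open>W\<close> is closed.\<close>

lemma mu_continuous_W:
 assumes g: "continuous_on UNIV g" and e: "e \<in> W"
 shows "mu g e \<in> W"
proof -
 have "\<exists>h\<in>R. norm (mu g e - mu h e) \<le> (1 / real (Suc n)) * norm e" for n
 proof -
  have "\<exists>h\<in>R. \<forall>x\<in>cbox (0, 0) (L, 1). \<bar>g x - h x\<bar> < 1 / real (Suc n)"
   using function_ring_on.Stone_Weierstrass_basic[OF ring, of g "1 / real (Suc n)"] continuous_on_subset[OF g] by simp
  then obtain h where h: "h \<in> R" "\<And>x. x \<in> cbox (0, 0) (L, 1) ==> \<bar>g x - h x\<bar> < 1 / real (Suc n)" by blast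
  have hc: "continuous_on UNIV h" using h(1) by (simp add: R_def)
  obtain C where C: "\<And>p. \<bar>ind2 L p * g p\<bar> \<le> C" using cont_ind2_bounded(1)[OF g] by blast
  obtain C' where C': "\<And>p. \<bar>ind2 L p * h p\<bar> \<le> C'" using cont_ind2_bounded(1)[OF hc] by blast
  have d: "\<bar>ind2 L p * g p - ind2 L p * h p\<bar> \<le> 1 / real (Suc n)" for p
  proof (cases "p \<in> cbox (0, 0) (L, 1)")
   case True
   then show ?thesis using h(2)[OF True] by (auto simp: ind2_def split: split_indicator)
  next
   case False
   then have "ind2 L p = 0" by (cases p) (auto simp: ind2_def cbox_Pair_eq split: split_indicator)
   then show ?thesis by simp
  qed
  have "norm (mu g e - mu h e) \<le> (1 / real (Suc n)) * norm e"
   unfolding mu_def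
   by (rule mul_op_diff_bound[OF cont_ind2_bounded(2)[OF g] C cont_ind2_bounded(2)[OF hc] C' d])
  with h(1) show ?thesis by blast
 qed
 then obtain h where h: "\<And>n. h n \<in> R" "\<And>n. norm (mu g e - mu (h n) e) \<le> (1 / real (Suc n)) * norm e" by metis
 have "(\<lambda>n. (1 / real (Suc n)) * norm e) \<longlonglongrightarrow> 0 * norm e"
  by (intro tendsto_intros LIMSEQ_inverse_real_of_nat[unfolded inverse_eq_divide])
 then have lim: "(\<lambda>n. (1 / real (Suc n)) * norm e) \<longlonglongrightarrow> 0" by simp
 have "(\<lambda>n. mu g e - mu (h n) e) \<longlonglongrightarrow> 0"
  by (rule Lim_null_comparison[OF always_eventually[OF allI[OF h(2)]] lim])
 from tendsto_diff[OF tendsto_const[of "mu g e"] this] have "(\<lambda>n. mu (h n) e) \<longlonglongrightarrow> mu g e" by simp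
 moreover have "mu (h n) e \<in> W" for n using h(1)[of n] e by (simp add: R_def)
 ultimately show ?thesis using closed_sequentially[OF W_closed, of "\<lambda>n. mu (h n) e" "mu g e"] by blast
qed

text \<open>Products of the lowest mode \<open>gen 0 0\<close> with continuous functions stay in
  \<open>W\<close>; truncating the approximants of \<open>b\<close> at the bound \<open>n\<close>
  makes the convergence dominated.\<close>

lemma weighted_bounded_W:
 assumes b: "b \<in> borel_fun" and n: "\<And>p. \<bar>b p\<bar> \<le> n"
 shows "cls (\<lambda>p. ind2 L p * (\<sigma> (om 0 * fst p) * b p)) \<in> W"
proof -
 have n0: "n \<ge> 0" using n[of undefined] by linarith
 obtain g where g: "\<And>m. continuous_on UNIV (g m)" and lim: "AE p in lborel. (\<lambda>m. g m p) \<longlonglongrightarrow> b p"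
  using borel_limit_of_continuous[OF b] by blast
 define h where "h m p = max (- n) (min n (g m p))" for m :: nat and p
 have hc: "continuous_on UNIV (h m)" for m unfolding h_def by (intro continuous_intros g)
 have hb: "\<bar>h m p\<bar> \<le> n" for m p using n0 by (auto simp: h_def)
 have hlim: "AE p in lborel. (\<lambda>m. h m p) \<longlonglongrightarrow> b p"
  using lim
 proof eventually_elim
  case (elim p)
  have "(\<lambda>m. h m p) \<longlonglongrightarrow> max (- n) (min n (b p))" unfolding h_def by (intro tendsto_intros elim)
  moreover have "max (- n) (min n (b p)) = b p" using n[of p] by auto
  ultimately show ?case by simp
 qed
 let ?s = "\<lambda>p :: real \<times> real. \<sigma> (om 0 * fst p)"
 have sc: "continuous_on UNIV ?s" using gen_cont[of 0 0] by simp
 have s_m: "?s \<in> borel_fun" by (rule borel_measurable_continuous_onI[OF sc])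
 have "(\<lambda>m. cls (\<lambda>p. ind2 L p * (?s p * h m p))) \<longlonglongrightarrow> cls (\<lambda>p. ind2 L p * (?s p * b p))"
 proof (rule cls_tendsto[THEN conjunct2])
  show "(\<lambda>p. ind2 L p * (?s p * h m p)) \<in> borel_fun" for m
   using borel_measurable_continuous_onI[OF hc[of m]] s_m by measurable
  show "(\<lambda>p. ind2 L p * (?s p * b p)) \<in> borel_fun"
   using b s_m by measurable
  show "AE p in lborel. (\<lambda>m. ind2 L p * (?s p * h m p)) \<longlonglongrightarrow> ind2 L p * (?s p * b p)"
   using hlim by eventually_elim (intro tendsto_intros)
  show "AE p in lborel. \<bar>ind2 L p * (?s p * h m p)\<bar> \<le> n * ind2 L p" for m
  proof (rule AE_I2)
   fix p
   have "\<bar>?s p * h m p\<bar> \<le> 1 * n" unfolding abs_mult using \<sigma>_bound hb n0 by (intro mult_mono) auto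
   then show "\<bar>ind2 L p * (?s p * h m p)\<bar> \<le> n * ind2 L p"
    by (auto simp: ind2_def split: split_indicator)
  qed
  show "(\<lambda>p. n * ind2 L p) \<in> sqi" by (intro sq_int_scale ind2_sq_int)
 qed
 moreover have "cls (\<lambda>p. ind2 L p * (?s p * h m p)) \<in> W" for m
 proof -
  have "mu (h m) (gen 0 0) = cls (\<lambda>p. ind2 L p * (h m p * (ind2 L p * (?s p * snd p ^ 0))))"
   unfolding gen_def by (rule mu_cls[OF hc cont_sq_int[OF gen_cont]])
  also have "\<dots> = cls (\<lambda>p. ind2 L p * (?s p * h m p))"
   by (intro arg_cong[of _ _ cls]) (auto simp: fun_eq_iff ind2_def split: split_indicator)
  finally show ?thesis using mu_continuous_W[OF hc gen_W, of m 0 0] by simp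
 qed
 ultimately show ?thesis
  using closed_sequentially[OF W_closed, of "\<lambda>m. cls (\<lambda>p. ind2 L p * (?s p * h m p))"] by blast
qed

text \<open>A given \<open>e\<close> is the lowest mode times a quotient. On \<open>A n\<close> the
  quotient is bounded by \<open>n\<close>, and these sets exhaust the rectangle because the mode is
  positive inside.\<close>

lemma W_eq: "W = X2 L"
proof (rule antisym[OF W_X2], rule subsetI)
 fix e assume e: "e \<in> X2 L"
 let ?s = "\<lambda>p :: real \<times> real. \<sigma> (om 0 * fst p)"
 have sc: "continuous_on UNIV ?s" using gen_cont[of 0 0] by simp
 have s_m [measurable]: "?s \<in> borel_fun" by (rule borel_measurable_continuous_onI[OF sc])
 define A where "A n = {p. ind2 L p = 1 \<and> \<bar>rep e p\<bar> \<le> real n * ?s p}" for n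
 define b where "b n p = indicator (A n) p * (rep e p / ?s p)" for n p
 have A_m [measurable]: "A n \<in> sets borel" for n unfolding A_def by measurable
 have b_m: "b n \<in> borel_fun" for n unfolding b_def[abs_def] by measurable
 have pos: "0 < ?s p" if "ind2 L p = 1" for p
  using that \<sigma>_pos[of "fst p"] by (auto simp: ind2_def split: split_indicator_asm)
 have b_b: "\<bar>b n p\<bar> \<le> real n" for n p
 proof (cases "p \<in> A n")
  case True
  then have "?s p > 0" "\<bar>rep e p\<bar> \<le> real n * ?s p" using pos by (auto simp: A_def)
  then show ?thesis by (auto simp: b_def abs_mult divide_le_eq split: split_indicator)
 qed (simp add: b_def)
 have eq: "ind2 L p * (?s p * b n p) = indicator (A n) p * rep e p" for n p
 proof (cases "p \<in> A n")
  case True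
  then have "?s p > 0" "ind2 L p = 1" using pos by (auto simp: A_def)
  then show ?thesis using True by (simp add: b_def)
 qed (simp add: b_def)
 have "(\<lambda>n. cls (\<lambda>p. indicator (A n) p * rep e p)) \<longlonglongrightarrow> cls (rep e)"
 proof (rule cls_tendsto[THEN conjunct2])
  show "AE p in lborel. (\<lambda>n. indicator (A n) p * rep e p) \<longlonglongrightarrow> rep e p"
   using X2_rep[OF e]
  proof eventually_elim
   case (elim p)
   show ?case
   proof (cases "ind2 L p = 1")
    case True
    obtain n0 where n0: "\<bar>rep e p\<bar> / ?s p \<le> real n0" using real_arch_simple by blast
    have "indicator (A n) p * rep e p = rep e p" if "n \<ge> n0" for n
    proof -
     have "\<bar>rep e p\<bar> \<le> real n0 * ?s p" using n0 pos[OF True] by (simp add: divide_le_eq)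
     also have "\<dots> \<le> real n * ?s p" using that pos[OF True] by (intro mult_right_mono) auto
     finally show ?thesis using True by (simp add: A_def)
    qed
    then show ?thesis by (intro tendsto_eventually eventually_sequentiallyI[of n0])
   next
    case False
    then have "ind2 L p = 0" by (auto simp: ind2_def split: split_indicator_asm split_indicator)
    then have "rep e p = 0" using elim by simp
    then show ?thesis by simp
   qed
  qed
  show "AE p in lborel. \<bar>indicator (A n) p * rep e p\<bar> \<le> \<bar>rep e p\<bar>" for n
   by (auto split: split_indicator)
  show "(\<lambda>p. \<bar>rep e p\<bar>) \<in> sqi"
   by (rule sq_int_bound[OF rep_sq_int]) auto
 qed measurable
 moreover have "cls (\<lambda>p. indicator (A n) p * rep e p) \<in> W" for n
  using weighted_bounded_W[OF b_m b_b, of n] by (simp add: eq)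
 ultimately show "e \<in> W" using closed_sequentially[OF W_closed, of "\<lambda>n. cls (\<lambda>p. indicator (A n) p * rep e p)" e] by simp
qed

lemma X2_dense: "X2 L = closure (span {gen k j |k j. True})"
 using W_eq by (simp add: W_def)

lemma \<sigma>_sq1: "(\<lambda>x. \<sigma> (om k * x)) \<in> sq1 L"
 by (rule bounded_sq1[OF _ \<sigma>_bound])
  (intro borel_measurable_continuous_onI continuous_on_compose2[OF \<sigma>_cont[of UNIV]] continuous_intros, auto)

text \<open>The average \<open>Rr\<close> fixes \<open>e\<close> and sends \<open>gen k j\<close> to
  a multiple of the mode \<open>k\<close>, so density in two variables implies density in
  one.\<close>

lemma X1_dense: "X1 L \<subseteq> closure (span {cls1 L (\<lambda>x. \<sigma> (om k * x)) |k. True})"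
proof
 let ?G = "{cls1 L (\<lambda>x. \<sigma> (om k * x)) |k. True}"
 fix e assume "e \<in> X1 L"
 then have e: "e \<in> X2 L" "Rr e = e" by (auto simp: X1_iff)
 have "Rr e \<in> closure (span ?G)"
 proof (rule bounded_linear_maps_closure_span[OF bounded_linear_ops(4)[OF L]])
  show "closed (closure (span ?G))" "subspace (closure (span ?G))" by (auto intro: subspace_closure subspace_span)
  show "e \<in> closure (span {gen k j |k j. True})" using e X2_dense by simp
  fix x assume "x \<in> {gen k j |k j. True}"
  then obtain k j where x: "x = gen k j" by auto
  define c where "c = (LINT s|lborel. ind 1 s * s ^ j :: real)"
  have "Rr x = cls (\<lambda>p. ind 1 (snd p) * prim (\<lambda>s. ind2 L (fst p, s) * (\<sigma> (om k * fst p) * s ^ j)) 1)"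
   unfolding x gen_def by (subst Rr_cls(1)[OF cont_sq_int[OF gen_cont]]) simp
  also have "\<dots> = cls (\<lambda>p. ind2 L p * (c * \<sigma> (om k * fst p)))"
  proof (intro arg_cong[of _ _ cls] ext)
   fix p :: "real \<times> real"
   have "prim (\<lambda>s. ind2 L (fst p, s) * (\<sigma> (om k * fst p) * s ^ j)) 1 = (LINT s|lborel. (ind L (fst p) * \<sigma> (om k * fst p)) * (ind 1 s * s ^ j))"
    unfolding prim_def by (intro lint_cong) (auto simp: ind2_def split: split_indicator)
   also have "\<dots> = (ind L (fst p) * \<sigma> (om k * fst p)) * c"
    unfolding c_def by (rule integral_mult_right_zero)
   finally show "ind 1 (snd p) * prim (\<lambda>s. ind2 L (fst p, s) * (\<sigma> (om k * fst p) * s ^ j)) 1 = ind2 L p * (c * \<sigma> (om k * fst p))"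
    by (simp add: ind2_def)
  qed
  also have "\<dots> = c *\<^sub>R cls1 L (\<lambda>x. \<sigma> (om k * x))"
   using cls1_scale[OF \<sigma>_sq1, of c k] by (simp add: cls1_def)
  also have "\<dots> \<in> span ?G" by (intro span_scale span_base) auto
  finally show "Rr x \<in> closure (span ?G)" using closure_subset by blast
 qed
 with e show "e \<in> closure (span ?G)" by simp
qed

end

section \<open>Delay differential equations\<close>

lemma integral_exp_le:
 fixes m t :: real
 assumes "m > 0" "t \<ge> 0"
 shows "integral {0..t} (\<lambda>s. exp (m * s)) \<le> exp (m * t) / m" "(\<lambda>s. exp (m * s)) integrable_on {0..t}"
proof -
 have "((\<lambda>s. exp (m * s)) has_integral (exp (m * t) / m - exp (m * 0) / m)) {0..t}"
  using assms by (intro fundamental_theorem_of_calculus[where f = "\<lambda>s. exp (m * s) / m"])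
   (auto intro!: derivative_eq_intros simp flip: has_real_derivative_iff_has_vector_derivative)
 then show "integral {0..t} (\<lambda>s. exp (m * s)) \<le> exp (m * t) / m" "(\<lambda>s. exp (m * s)) integrable_on {0..t}"
  using assms by (auto simp: integral_unique has_integral_integrable)
qed

text \<open>Picard iteration in the space of functions \<open>exp (m t) b(t)\<close> with \<open>b\<close> bounded and
 continuous: the exponential weight makes the Volterra operator a contraction on the whole half
 line.\<close>

theorem delay_ode_exists:
 fixes \<Phi> :: "real => 'e::banach => 'e => 'e" and \<tau> :: "real => real" and h :: "real => 'e"
 assumes K: "K > 0"
  and lip: "\<And>s y \<eta> y' \<eta>'. s \<ge> 0 ==> norm (\<Phi> s y \<eta> - \<Phi> s y' \<eta>') \<le> K * (norm (y - y') + norm (\<eta> - \<eta>'))"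
  and zero: "\<And>s. s \<ge> 0 ==> \<Phi> s 0 0 = 0"
  and cont: "\<And>u v. continuous_on {0..} u ==> continuous_on {0..} v ==> continuous_on {0..} (\<lambda>s. \<Phi> s (u s) (v s))"
  and \<tau>: "continuous_on {0..} \<tau>" "\<And>s. s \<ge> 0 ==> 0 \<le> \<tau> s"
  and h: "continuous_on UNIV h" "\<And>\<sigma>. norm (h \<sigma>) \<le> H"
 shows "\<exists>y. continuous_on UNIV y \<and> (\<forall>\<sigma>\<le>0. y \<sigma> = h \<sigma>) \<and>
  (\<forall>t\<ge>0. (y has_vector_derivative \<Phi> t (y t) (y (t - \<tau> t))) (at0 t))"
proof -
 \<comment> \<open>The integrand varies by at most
   \<open>2 * K * norm (b - b') * exp (m * s)\<close>, and integrating the exponential gains a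
   factor \<open>1 / m\<close>; so this \<open>m\<close> yields the contraction factor 1/2.\<close>
 define m where "m = 4 * K"
 have m: "m > 0" using K by (simp add: m_def)
 have H: "H \<ge> 0" using h(2)[of 0] norm_ge_zero order_trans by blast
 \<comment> \<open>At negative times this is the history up to the constant
   \<open>b 0 - h 0\<close>, a form that is continuous for every \<open>b\<close>. For the fixed
   point the constant vanishes, as the integral equation gives \<open>b 0 = h 0\<close>.\<close>
 define ext where "ext b \<sigma> = exp (m * max 0 \<sigma>) *\<^sub>R apply_bcontfun b (max 0 \<sigma>) + (h (min \<sigma> 0) - h 0)" for b :: "real \<Rightarrow>\<^sub>C 'e" and \<sigma>
 define I where "I b s = \<Phi> s (exp (m * s) *\<^sub>R apply_bcontfun b s) (ext b (s - \<tau> s))" for b s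
 define V where "V b t = exp (- (m * max 0 t)) *\<^sub>R (h 0 + integral {0..max 0 t} (I b))" for b t
 have ext_cont: "continuous_on UNIV (ext b)" for b
  unfolding ext_def
  by (intro continuous_intros continuous_on_compose2[OF continuous_on_apply_bcontfun[of UNIV]]
    continuous_on_compose2[OF h(1)]) auto
 have I_cont: "continuous_on {0..} (I b)" for b
  unfolding I_def
  by (intro cont continuous_intros continuous_on_compose2[OF ext_cont] \<tau>) auto
 have I_int: "I b integrable_on {0..t}" for b t
  by (intro integrable_continuous_interval continuous_on_subset[OF I_cont]) auto
 have e1: "exp (m * s) \<ge> 1" if "s \<ge> 0" for s using that m by simp
 have I_diff: "norm (I b s - I b' s) \<le> 2 * K * norm (b - b') * exp (m * s)" if "s \<ge> 0" for b b' s
 proof -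
  have 1: "norm (exp (m * s) *\<^sub>R b s - exp (m * s) *\<^sub>R b' s) \<le> exp (m * s) * norm (b - b')"
   using norm_bounded[of "b - b'" s] by (simp add: scaleR_diff_right[symmetric] minus_bcontfun.rep_eq)
  have "norm (ext b (s - \<tau> s) - ext b' (s - \<tau> s)) = exp (m * max 0 (s - \<tau> s)) * norm ((b - b') (max 0 (s - \<tau> s)))"
   by (simp add: ext_def scaleR_diff_right[symmetric] minus_bcontfun.rep_eq)
  \<comment> \<open>A delayed time is never later than \<open>s\<close>, so its weight is at most
    \<open>exp (m * s)\<close>.\<close>
  also have "\<dots> \<le> exp (m * s) * norm (b - b')"
   using that m \<tau>(2)[OF that] by (intro mult_mono norm_bounded) auto
  finally have 2: "norm (ext b (s - \<tau> s) - ext b' (s - \<tau> s)) \<le> exp (m * s) * norm (b - b')" .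
  have "norm (I b s - I b' s) \<le> K * (exp (m * s) * norm (b - b') + exp (m * s) * norm (b - b'))"
   unfolding I_def by (rule order_trans[OF lip[OF that]]) (intro mult_left_mono add_mono 1 2, use K in auto)
  then show ?thesis by (simp add: mult_ac)
 qed
 have I_bound: "norm (I b s) \<le> K * (2 * norm b + 2 * H) * exp (m * s)" if "s \<ge> 0" for b s
 proof -
  have 1: "norm (exp (m * s) *\<^sub>R b s - 0) \<le> exp (m * s) * norm b"
   using norm_bounded[of b s] by simp
  have "norm (ext b (s - \<tau> s) - 0) \<le> exp (m * max 0 (s - \<tau> s)) * norm (b (max 0 (s - \<tau> s))) + (H + H)"
   unfolding ext_def diff_zero
   by (rule norm_triangle_le, intro add_mono norm_triangle_le_diff h(2)) simp
  also have "\<dots> \<le> exp (m * s) * norm b + 2 * H"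
   using that m \<tau>(2)[OF that] by (intro add_mono mult_mono norm_bounded) auto
  also have "\<dots> \<le> exp (m * s) * norm b + exp (m * s) * (2 * H)"
   using mult_right_mono[OF e1[OF that], of "2 * H"] H by simp
  finally have 2: "norm (ext b (s - \<tau> s) - 0) \<le> exp (m * s) * norm b + exp (m * s) * (2 * H)" .
  have "norm (\<Phi> s (exp (m * s) *\<^sub>R b s) (ext b (s - \<tau> s)) - \<Phi> s 0 0)
   \<le> K * (exp (m * s) * norm b + (exp (m * s) * norm b + exp (m * s) * (2 * H)))"
   by (rule order_trans[OF lip[OF that]]) (intro mult_left_mono add_mono 1 2, use K in auto)
  then show ?thesis by (simp add: I_def zero[OF that] algebra_simps)
 qed
 have V_bound: "norm (V b t) \<le> H + K * (2 * norm b + 2 * H) / m" for b t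
 proof -
  let ?t = "max 0 t"
  have "norm (integral {0..?t} (I b)) \<le> integral {0..?t} (\<lambda>s. K * (2 * norm b + 2 * H) * exp (m * s))"
   by (rule integral_norm_bound_integral[OF I_int])
    (use integral_exp_le(2)[OF m, of ?t] in \<open>auto intro!: I_bound integrable_on_mult_right\<close>)
  also have "\<dots> \<le> K * (2 * norm b + 2 * H) * (exp (m * ?t) / m)"
   unfolding integral_mult_right using K H by (intro mult_left_mono integral_exp_le(1)[OF m]) auto
  finally have "norm (h 0 + integral {0..?t} (I b)) \<le> H + K * (2 * norm b + 2 * H) * (exp (m * ?t) / m)"
   using h(2)[of 0] by (intro norm_triangle_le) linarith
  then have "norm (V b t) \<le> exp (- (m * ?t)) * (H + K * (2 * norm b + 2 * H) * (exp (m * ?t) / m))"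
   unfolding V_def norm_scaleR by (simp add: mult_left_mono)
  also have "\<dots> = exp (- (m * ?t)) * H + K * (2 * norm b + 2 * H) / m * (exp (- (m * ?t)) * exp (m * ?t))"
   using m by (simp add: field_simps)
  also have "\<dots> = exp (- (m * ?t)) * H + K * (2 * norm b + 2 * H) / m"
   by (simp add: exp_add[symmetric])
  also have "exp (- (m * ?t)) * H \<le> 1 * H" using m H by (intro mult_right_mono) auto
  finally show ?thesis by simp
 qed
 have V_cont: "continuous_on UNIV (V b)" for b
 proof -
  have "continuous_on {0..} (\<lambda>t. integral {0..t} (I b))"
   unfolding continuous_on_eq_continuous_within
  proof
   fix t :: real assume "t \<in> {0..}"
   have "continuous_on {0..t+1} (\<lambda>t. integral {0..t} (I b))"
    by (rule indefinite_integral_continuous_1[OF I_int])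
   then have "continuous (at t within {0..t+1}) (\<lambda>t. integral {0..t} (I b))"
    using \<open>t \<in> {0..}\<close> by (auto simp: continuous_on_eq_continuous_within)
   moreover have "at t within {0..t+1} = at0 t"
    by (rule at_within_nhd[of _ "{..<t+1}"]) auto
   ultimately show "continuous (at0 t) (\<lambda>t. integral {0..t} (I b))" by simp
  qed
  then show ?thesis unfolding V_def
   by (intro continuous_intros continuous_on_compose2[of "{0..}" "\<lambda>t. integral {0..t} (I b)" UNIV "\<lambda>t. max 0 t"]) auto
 qed
 have V_bc: "V b \<in> bcontfun" for b
  unfolding bcontfun_def bounded_iff using V_cont V_bound by blast
 define TT where "TT b = Bcontfun (V b)" for b
 have TT_app: "apply_bcontfun (TT b) = V b" for b
  unfolding TT_def by (rule Bcontfun_inverse[OF V_bc])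
 have contr: "dist (TT b) (TT b') \<le> (1/2) * dist b b'" for b b'
 proof (rule dist_bound)
  fix t :: real
  let ?t = "max 0 t"
  have "norm (integral {0..?t} (\<lambda>s. I b s - I b' s)) \<le> integral {0..?t} (\<lambda>s. 2 * K * norm (b - b') * exp (m * s))"
   by (rule integral_norm_bound_integral[OF integrable_diff[OF I_int I_int]])
    (use integral_exp_le(2)[OF m, of ?t] in \<open>auto intro!: I_diff integrable_on_mult_right\<close>)
  also have "\<dots> \<le> 2 * K * norm (b - b') * (exp (m * ?t) / m)"
   unfolding integral_mult_right using K by (intro mult_left_mono integral_exp_le(1)[OF m]) auto
  finally have le: "norm (integral {0..?t} (I b) - integral {0..?t} (I b')) \<le> 2 * K * norm (b - b') * (exp (m * ?t) / m)"
   by (simp add: integral_diff[OF I_int I_int])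
  have "dist (TT b t) (TT b' t) = exp (- (m * ?t)) * norm (integral {0..?t} (I b) - integral {0..?t} (I b'))"
   by (simp add: TT_app V_def dist_norm scaleR_diff_right[symmetric])
  also have "\<dots> \<le> exp (- (m * ?t)) * (2 * K * norm (b - b') * (exp (m * ?t) / m))"
   by (intro mult_left_mono le) simp
  also have "\<dots> = 2 * K / m * norm (b - b') * (exp (- (m * ?t)) * exp (m * ?t))" by simp
  also have "\<dots> = (1/2) * dist b b'" using K by (simp add: exp_add[symmetric] m_def dist_norm)
  finally show "dist (TT b t) (TT b' t) \<le> (1/2) * dist b b'" .
 qed
 have "\<exists>!b. TT b = b"
  by (rule banach_fix_type[of "1/2"]) (use contr in auto)
 then obtain b where b: "TT b = b" by blast
 have bt: "exp (m * t) *\<^sub>R b t = h 0 + integral {0..t} (I b)" if "t \<ge> 0" for t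
 proof -
  have "b t = V b t" using TT_app[of b] b by simp
  then show ?thesis using that by (simp add: V_def exp_add[symmetric])
 qed
 have y_pos: "ext b t = exp (m * t) *\<^sub>R b t" if "t \<ge> 0" for t using that by (simp add: ext_def)
 have "(ext b has_vector_derivative \<Phi> t (ext b t) (ext b (t - \<tau> t))) (at0 t)" if t: "t \<ge> 0" for t
 proof -
  have "((\<lambda>t. integral {0..t} (I b)) has_vector_derivative I b t) (at t within {0..t+1})"
   by (rule integral_has_vector_derivative[OF continuous_on_subset[OF I_cont]]) (use t in auto)
  then have "((\<lambda>t. h 0 + integral {0..t} (I b)) has_vector_derivative I b t) (at t within {0..t+1})"
   by (auto intro: derivative_eq_intros)
  moreover have "at t within {0..t+1} = at0 t"
   by (rule at_within_nhd[of _ "{..<t+1}"]) (use t in auto)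
  ultimately have "((\<lambda>t. h 0 + integral {0..t} (I b)) has_vector_derivative I b t) (at0 t)" by simp
  then have "(ext b has_vector_derivative I b t) (at0 t)"
   by (rule has_vector_derivative_transform[rotated 2]) (use t bt y_pos in auto)
  then show ?thesis using t by (simp add: I_def y_pos)
 qed
 moreover have "ext b \<sigma> = h \<sigma>" if "\<sigma> \<le> 0" for \<sigma>
  using that bt[of 0] by (simp add: ext_def max_def min_def)
 ultimately show ?thesis using ext_cont by blast
qed

section \<open>Limits and primitives of time-dependent profiles\<close>

lemma ind2_bounded_sq_int:
 assumes g: "g \<in> borel_fun" and C: "\<And>p. ind2 L p = 1 ==> \<bar>g p\<bar> \<le> C"
 shows "(\<lambda>p. ind2 L p * g p) \<in> sqi"
proof (rule sq_int_bound[OF sq_int_scale])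
 show "ind2 L \<in> sqi"
  using tensor_sq_int(1)[OF indicator_Ioo_sq_int[of 0 L] indicator_Ioo_sq_int[of 0 1]]
  by (simp add: ind2_def[abs_def])
 show "(\<lambda>p. ind2 L p * g p) \<in> borel_measurable lborel" using g by measurable
 have "\<bar>ind2 L p * g p\<bar> \<le> \<bar>C * ind2 L p\<bar>" for p
 proof (cases "ind2 L p = 1")
  case True
  with C[OF True] show ?thesis by simp
 next
  case False
  then have "ind2 L p = 0" by (auto simp: ind2_def split: split_indicator_asm split_indicator)
  then show ?thesis by simp
 qed
 then show "AE p in lborel. \<bar>ind2 L p * g p\<bar> \<le> \<bar>C * ind2 L p\<bar>" by simp
qed

text \<open>Dominated convergence along a real parameter, through sequences. The bound is asked for
  away from \<open>s = t\<close>, so that difference quotients qualify.\<close>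

lemma cls_tendsto_within:
 fixes g :: "real => real \<times> real => real"
 assumes meas: "\<And>s. s \<ge> 0 ==> g s \<in> borel_fun" "f \<in> borel_fun"
  and dom: "\<And>T. \<exists>C. \<forall>s\<in>{0..T} - {t}. \<forall>p. ind2 L p = 1 --> \<bar>g s p\<bar> \<le> C"
  and lim: "AE p in lborel. ind2 L p = 1 --> ((\<lambda>s. g s p) \<longlongrightarrow> f p) (at0 t)"
 shows "((\<lambda>s. cls (\<lambda>p. ind2 L p * g s p)) \<longlongrightarrow> cls (\<lambda>p. ind2 L p * f p)) (at0 t)"
 unfolding tendsto_at_iff_sequentially
proof (intro allI impI)
 fix X :: "nat => real" assume X: "\<forall>i. X i \<in> {0..} - {t}" "X \<longlonglongrightarrow> t"
 have "Bseq X" using X(2) by (rule convergent_imp_Bseq[OF convergentI])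
 then obtain T where T: "\<And>n. norm (X n) \<le> T" by (auto simp: Bseq_def)
 from dom[of T] obtain C where C: "\<And>s p. s \<in> {0..T} - {t} ==> ind2 L p = 1 ==> \<bar>g s p\<bar> \<le> C" by blast
 have XT: "X n \<in> {0..T} - {t}" for n using X(1) T[of n] by auto
 have bd: "\<bar>ind2 L p * g (X n) p\<bar> \<le> C * ind2 L p" for n p
 proof (cases "ind2 L p = 1")
  case True
  with C[OF XT True] show ?thesis by simp
 next
  case False
  then have "ind2 L p = 0" by (auto simp: ind2_def split: split_indicator_asm split_indicator)
  then show ?thesis by simp
 qed
 have "(\<lambda>n. cls (\<lambda>p. ind2 L p * g (X n) p)) \<longlonglongrightarrow> cls (\<lambda>p. ind2 L p * f p)"
 proof (rule cls_tendsto[THEN conjunct2])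
  show "(\<lambda>p. ind2 L p * g (X n) p) \<in> borel_fun" for n
   using meas(1)[of "X n"] XT[of n] by (intro borel_measurable_times) auto
  show "(\<lambda>p. ind2 L p * f p) \<in> borel_fun" using meas(2) by measurable
  show "AE p in lborel. (\<lambda>n. ind2 L p * g (X n) p) \<longlonglongrightarrow> ind2 L p * f p"
   using lim
  proof eventually_elim
   case (elim p)
   show ?case
   proof (cases "ind2 L p = 1")
    case True
    with elim have "((\<lambda>s. g s p) \<longlongrightarrow> f p) (at0 t)" by simp
    then have "(\<lambda>n. g (X n) p) \<longlonglongrightarrow> f p" using X unfolding tendsto_at_iff_sequentially by (auto simp: o_def)
    then show ?thesis by (intro tendsto_intros)
   next
    case False
    then have "ind2 L p = 0" by (auto simp: ind2_def split: split_indicator_asm split_indicator)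
    then show ?thesis by simp
   qed
  qed
  show "AE p in lborel. \<bar>ind2 L p * g (X n) p\<bar> \<le> C * ind2 L p" for n using bd by simp
  show "(\<lambda>p. C * ind2 L p) \<in> sqi"
   using ind2_bounded_sq_int[of "\<lambda>_. 1" L 1] by (intro sq_int_scale) auto
 qed
 then show "((\<lambda>s. cls (\<lambda>p. ind2 L p * g s p)) \<circ> X) \<longlonglongrightarrow> cls (\<lambda>p. ind2 L p * f p)" by (simp add: o_def)
qed

text \<open>The exceptional set admits kinks of the profile. Boundedness of \<open>W\<close> makes
  it Lebesgue integrable on the interval, so the gauge integral of the fundamental theorem is the
  Lebesgue integral.\<close>

lemma lborel_integral_ftc:
 fixes \<phi> W :: "real => real"
 assumes r: "0 \<le> r" and S: "finite S" and c: "continuous_on {0..r} \<phi>"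
  and d: "\<And>s. s \<in> {0<..<r} - S ==> (\<phi> has_real_derivative W s) (at s)"
  and W: "W \<in> borel_fun" "\<And>s. s \<in> {0<..<r} ==> \<bar>W s\<bar> \<le> C"
 shows "(LINT s|lborel. ind r s * W s) = \<phi> r - \<phi> 0"
proof -
 have "(W has_integral (\<phi> r - \<phi> 0)) {0..r}"
  by (rule fundamental_theorem_of_calculus_interior_strong[OF S r _ c])
   (use d in \<open>auto simp flip: has_real_derivative_iff_has_vector_derivative\<close>)
 then have "(W has_integral (\<phi> r - \<phi> 0)) {0<..<r}" by (simp add: has_integral_Icc_iff_Ioo)
 then have "((\<lambda>s. if s \<in> {0<..<r} then W s else 0) has_integral (\<phi> r - \<phi> 0)) UNIV"
  unfolding has_integral_restrict_UNIV .
 also have "(\<lambda>s. if s \<in> {0<..<r} then W s else 0) = (\<lambda>s. ind r s * W s)"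
  by (auto simp: fun_eq_iff)
 finally have 1: "((\<lambda>s. ind r s * W s) has_integral (\<phi> r - \<phi> 0)) UNIV" .
 have "integrable lborel (\<lambda>s. ind r s * W s)"
 proof -
  have "(\<lambda>s. ind r s * (ind r s * W s)) \<in> sqi"
   by (rule bounded_mult_sq_int[OF indicator_Ioo_sq_int W])
  from sq_int_integrable_mult[OF indicator_Ioo_sq_int[of 0 r] this] show ?thesis
   by (rule Bochner_Integration.integrable_cong[THEN iffD1, rotated 2]) (auto split: split_indicator)
 qed
 then have "((\<lambda>s. ind r s * W s) has_integral (LINT s|lborel. ind r s * W s)) UNIV"
  by (rule has_integral_integral_lborel)
 with 1 show ?thesis by (simp add: has_integral_unique)
qed

lemma has_derivative_ge_nonneg:
 assumes "(f has_real_derivative f') (at0 t)" "0 < t"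
 shows "(f has_real_derivative f') (at t)"
proof -
 have "at0 t = at t" by (rule at_within_interior) (simp add: \<open>0 < t\<close> interior_real_atLeast)
 with assms show ?thesis by simp
qed

context beam
begin

lemma data_continuous: "continuous_on {0..} \<delta>1" "continuous_on {0..} \<delta>2" "continuous_on {0..} \<tau>" "continuous_on {0..} \<tau>'"
proof -
 have *: "continuous_on {0..} f" if "\<And>T. T \<ge> 0 ==> \<exists>K\<ge>0. \<forall>s\<in>{0..T}. \<forall>t\<in>{0..T}. \<bar>f s - f t\<bar> \<le> K * \<bar>s - t\<bar>" for f :: "real => real"
  unfolding continuous_on_def
 proof
  fix t :: real assume t: "t \<in> {0..}"
  from that[of "t + 1"] t obtain K where K: "\<And>s. s \<in> {0..t+1} ==> \<bar>f s - f t\<bar> \<le> K * \<bar>s - t\<bar>" by force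
  have "((\<lambda>s. K * \<bar>s - t\<bar>) \<longlongrightarrow> K * \<bar>t - t\<bar>) (at0 t)" by (intro tendsto_intros)
  then have l: "((\<lambda>s. K * \<bar>s - t\<bar>) \<longlongrightarrow> 0) (at0 t)" by simp
  have "\<forall>\<^sub>F s in at0 t. s < t + 1"
   by (rule order_tendstoD(2)[of _ t]) (auto intro: tendsto_ident_at)
  moreover have "\<forall>\<^sub>F s in at0 t. s \<in> {0..}" by (simp add: eventually_at_filter)
  ultimately have "\<forall>\<^sub>F s in at0 t. norm (f s - f t) \<le> K * \<bar>s - t\<bar>"
   by eventually_elim (auto intro!: K)
  then have "((\<lambda>s. f s - f t) \<longlongrightarrow> 0) (at0 t)" by (rule Lim_null_comparison) (rule l)
  then show "(f \<longlongrightarrow> f t) (at0 t)" by (rule LIM_zero_cancel)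
 qed
 have dl: "\<exists>K\<ge>0. \<forall>s\<in>{0..T}. \<forall>t\<in>{0..T}. \<bar>g s - g t\<bar> \<le> K * \<bar>s - t\<bar>"
  if "T \<ge> 0" "g \<in> {\<tau>, \<tau>', \<delta>1, \<delta>2}" for T g
 proof -
  from data_lipschitz[OF that(1)] obtain K where K: "K \<ge> 0" "\<forall>s\<in>{0..T}. \<forall>t\<in>{0..T}. \<bar>\<tau> s - \<tau> t\<bar> \<le> K * \<bar>s - t\<bar> \<and>
   \<bar>\<tau>' s - \<tau>' t\<bar> \<le> K * \<bar>s - t\<bar> \<and> \<bar>\<delta>1 s - \<delta>1 t\<bar> \<le> K * \<bar>s - t\<bar> \<and> \<bar>\<delta>2 s - \<delta>2 t\<bar> \<le> K * \<bar>s - t\<bar>" by blast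
  show ?thesis by (rule exI[of _ K]) (use K that(2) in auto)
 qed
 show "continuous_on {0..} \<delta>1" by (rule *) (rule dl, simp_all)
 show "continuous_on {0..} \<delta>2" by (rule *) (rule dl, simp_all)
 show "continuous_on {0..} \<tau>" by (rule *) (rule dl, simp_all)
 show "continuous_on {0..} \<tau>'" by (rule *) (rule dl, simp_all)
qed

text \<open>Since \<open>\<tau>' \<le> d\<close>, the function \<open>\<tau> t - d * t\<close> does
  not increase, and \<open>d < 1\<close> gives \<open>\<tau> t - t \<le> \<tau> 0\<close>. So a
  delayed time never reaches behind the prescribed history.\<close>

lemma delay_arg_gt:
 assumes t: "t \<ge> 0" and r: "0 \<le> r" "r < 1"
 shows "- \<tau> 0 < t - \<tau> t * r"
proof -
 have "\<tau> t - d * t \<le> \<tau> 0 - d * 0"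
 proof (rule nonincreasing_from_deriv[where f = "\<lambda>t. \<tau> t - d * t"])
  show "continuous_on {0..t} (\<lambda>t. \<tau> t - d * t)"
   by (intro continuous_intros continuous_on_subset[OF data_continuous(3)]) auto
  fix s assume s: "0 < s" "s < t"
  have "((\<lambda>t. \<tau> t - d * t) has_real_derivative \<tau>' s - d) (at s)"
   using has_derivative_ge_nonneg[OF delay_deriv, of s] s by (auto intro!: derivative_eq_intros)
  with delay_deriv_le[of s] s show "\<exists>e. ((\<lambda>t. \<tau> t - d * t) has_real_derivative e) (at s) \<and> e \<le> 0"
   by (intro exI[of _ "\<tau>' s - d"]) auto
 qed (use t in auto)
 moreover have "d * t \<le> 1 * t" using d t by (intro mult_right_mono) auto
 ultimately have le: "\<tau> t - t \<le> \<tau> 0" by simp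
 have pos: "\<tau> 0 > 0" using delay_bounds[of 0] \<tau>0 by simp
 have "\<tau> t * r - t \<le> (\<tau> t - t) * r" using mult_left_mono[of r 1 t] t r by (simp add: algebra_simps)
 also have "\<dots> \<le> \<tau> 0 * r" using le r by (intro mult_right_mono) auto
 also have "\<dots> < \<tau> 0" using r pos by simp
 finally show ?thesis by simp
qed

lemma delay_pos: "t \<ge> 0 ==> 0 < \<tau> t" using delay_bounds[of t] \<tau>0 by linarith

end

text \<open>\<open>Fh\<close> is the time profile of one mode of the velocity, with the history glued in for
 negative times; it may have a kink at 0.\<close>

locale mode_profile = beam +
 fixes \<omega> :: real and Fh Fh' :: "real => real"
 assumes Fh_cont: "continuous_on UNIV Fh"
  and Fh_deriv: "\<And>\<sigma>. - \<tau> 0 < \<sigma> ==> \<sigma> \<noteq> 0 ==> (Fh has_real_derivative Fh' \<sigma>) (at \<sigma>)"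
  and Fh'_cont: "\<And>\<sigma>. - \<tau> 0 < \<sigma> ==> \<sigma> \<noteq> 0 ==> isCont Fh' \<sigma>"
  and Fh'_bounded: "\<And>T. \<exists>C. \<forall>\<sigma>\<in>{- \<tau> 0<..<T}. \<bar>Fh' \<sigma>\<bar> \<le> C"
  and Fh'_measurable [measurable]: "Fh' \<in> borel_fun"
begin

definition sn :: "real => real" where "sn x = sin (\<omega> * x)"

definition zf :: "real => real \<times> real => real" where "zf t p = sn (fst p) * Fh (t - \<tau> t * snd p)"
text \<open>The derivative of \<open>zf t\<close> in the delay variable, away from the kink of
  \<open>Fh\<close>.\<close>

definition wf :: "real => real \<times> real => real" where "wf t p = sn (fst p) * (- \<tau> t * Fh' (t - \<tau> t * snd p))"

definition zc :: "real => l2" where "zc t = cls (\<lambda>p. ind2 L p * zf t p)"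
definition wc :: "real => l2" where "wc t = cls (\<lambda>p. ind2 L p * wf t p)"

lemma ind2_one: "ind2 L p = 1 \<longleftrightarrow> 0 < fst p \<and> fst p < L \<and> 0 < snd p \<and> snd p < 1"
 by (auto simp: ind2_def split: split_indicator split_indicator_asm)

lemma sn_measurable [measurable]: "sn \<in> borel_fun"
 unfolding sn_def by (intro borel_measurable_continuous_onI continuous_intros)

lemma sn_bound: "\<bar>sn x\<bar> \<le> 1" by (simp add: sn_def)

lemma sn_sq1: "sn \<in> sq1 L" by (rule bounded_sq1[OF sn_measurable sn_bound])

lemma Fh_measurable [measurable]: "Fh \<in> borel_fun"
 by (rule borel_measurable_continuous_onI[OF Fh_cont])

lemma zf_measurable: "zf t \<in> borel_fun" and wf_measurable: "wf t \<in> borel_fun"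
proof -
 have 1: "(\<lambda>p :: real \<times> real. t - \<tau> t * snd p) \<in> borel_fun"
  by (intro borel_measurable_diff borel_measurable_times borel_measurable_const snd_borel)
 show "zf t \<in> borel_fun" unfolding zf_def[abs_def]
  by (intro borel_measurable_times measurable_compose[OF fst_borel sn_measurable] measurable_compose[OF 1 Fh_measurable])
 show "wf t \<in> borel_fun" unfolding wf_def[abs_def]
  by (intro borel_measurable_times borel_measurable_const measurable_compose[OF fst_borel sn_measurable] measurable_compose[OF 1 Fh'_measurable])
qed

lemma delay_arg_range: "t \<in> {0..T} ==> 0 < r ==> r < 1 ==> t - \<tau> t * r \<in> {- \<tau> 0<..<T}"
 using delay_arg_gt[of t r] delay_pos[of t] by auto (smt (verit) mult_pos_pos)

lemma wf_bounded: "\<exists>C. \<forall>s\<in>{0..T} - S. \<forall>p. ind2 L p = 1 --> \<bar>wf s p\<bar> \<le> C"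
proof -
 from Fh'_bounded[of T] obtain C where C: "\<And>\<sigma>. \<sigma> \<in> {- \<tau> 0<..<T} ==> \<bar>Fh' \<sigma>\<bar> \<le> C" by blast
 have "\<bar>wf s p\<bar> \<le> 1 * (\<tau>1 * \<bar>C\<bar>)" if s: "s \<in> {0..T}" and p: "ind2 L p = 1" for s p
 proof -
  have "\<bar>Fh' (s - \<tau> s * snd p)\<bar> \<le> \<bar>C\<bar>"
   using C[OF delay_arg_range[OF s, of "snd p"]] p by (auto simp: ind2_one)
  then show ?thesis unfolding wf_def abs_mult abs_minus_cancel
   using sn_bound delay_bounds[of s] delay_pos[of s] s by (intro mult_mono) auto
 qed
 then show ?thesis by blast
qed

lemma zf_bounded: "t \<ge> 0 ==> \<exists>C. \<forall>p. ind2 L p = 1 --> \<bar>zf t p\<bar> \<le> C"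
proof -
 assume t: "t \<ge> 0"
 obtain C where C: "\<And>\<sigma>. \<sigma> \<in> {- \<tau> 0..t} ==> \<bar>Fh \<sigma>\<bar> \<le> C"
  using continuous_abs_bounded[OF continuous_on_subset[OF Fh_cont subset_UNIV], of "- \<tau> 0" t] by blast
 have "\<bar>zf t p\<bar> \<le> 1 * \<bar>C\<bar>" if p: "ind2 L p = 1" for p
 proof -
  have "\<bar>Fh (t - \<tau> t * snd p)\<bar> \<le> \<bar>C\<bar>"
   using C[of "t - \<tau> t * snd p"] delay_arg_range[of t t "snd p"] p t by (force simp: ind2_one)
  then show ?thesis unfolding zf_def abs_mult using sn_bound by (intro mult_mono) auto
 qed
 then show ?thesis by blast
qed

lemma zf_sq_int: "t \<ge> 0 ==> (\<lambda>p. ind2 L p * zf t p) \<in> sqi"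
 using zf_bounded[of t] ind2_bounded_sq_int[OF zf_measurable] by blast

lemma wf_sq_int: "t \<ge> 0 ==> (\<lambda>p. ind2 L p * wf t p) \<in> sqi"
 using wf_bounded[of t "{}"] ind2_bounded_sq_int[OF wf_measurable, of L t] by force

lemma history_ftc:
 assumes t: "t \<ge> 0" and r: "0 \<le> r" "r \<le> 1"
 shows "(LINT s|lborel. ind r s * (- \<tau> t * Fh' (t - \<tau> t * s))) = Fh (t - \<tau> t * r) - Fh t"
proof -
 from Fh'_bounded[of t] obtain C where C: "\<And>\<sigma>. \<sigma> \<in> {- \<tau> 0<..<t} ==> \<bar>Fh' \<sigma>\<bar> \<le> C" by blast
 \<comment> \<open>At \<open>s = t / \<tau> t\<close> the delayed time is 0, where the profile may
   have its kink.\<close>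
 have "(LINT s|lborel. ind r s * (- \<tau> t * Fh' (t - \<tau> t * s))) = Fh (t - \<tau> t * r) - Fh (t - \<tau> t * 0)"
 proof (rule lborel_integral_ftc[where S = "{t / \<tau> t}" and \<phi> = "\<lambda>s. Fh (t - \<tau> t * s)"])
  show "continuous_on {0..r} (\<lambda>s. Fh (t - \<tau> t * s))"
   by (intro continuous_on_compose2[OF Fh_cont] continuous_intros) auto
  show "(\<lambda>s. - \<tau> t * Fh' (t - \<tau> t * s)) \<in> borel_fun" by measurable
  fix s assume s: "s \<in> {0<..<r} - {t / \<tau> t}"
  then have ne: "t - \<tau> t * s \<noteq> 0" using delay_pos[OF t] by (auto simp: field_simps)
  have "- \<tau> 0 < t - \<tau> t * s" using s r by (intro delay_arg_gt t) auto
  note ch = DERIV_chain2[of Fh _ "\<lambda>s. t - \<tau> t * s" s "- \<tau> t" UNIV, OF Fh_deriv[OF this ne]]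
  have "((\<lambda>s. t - \<tau> t * s) has_real_derivative - \<tau> t) (at s)"
   by (auto intro!: derivative_eq_intros)
  from ch[OF this] show "((\<lambda>s. Fh (t - \<tau> t * s)) has_real_derivative - \<tau> t * Fh' (t - \<tau> t * s)) (at s)"
   by (simp add: mult.commute)
 next
  fix s assume s: "s \<in> {0<..<r}"
  then have "\<bar>Fh' (t - \<tau> t * s)\<bar> \<le> C" using r t by (intro C delay_arg_range) auto
  then show "\<bar>- \<tau> t * Fh' (t - \<tau> t * s)\<bar> \<le> \<tau> t * C" using delay_pos[OF t] by (simp add: abs_mult)
 qed (use r in auto)
 then show ?thesis by simp
qed

lemma prim_wf:
 assumes t: "t \<ge> 0" and r: "0 \<le> r" "r \<le> 1"
 shows "prim (\<lambda>s. ind2 L (x, s) * wf t (x, s)) r = ind L x * sn x * (Fh (t - \<tau> t * r) - Fh t)"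
proof -
 have "prim (\<lambda>s. ind2 L (x, s) * wf t (x, s)) r =
  (LINT s|lborel. (ind L x * sn x) * (ind r s * (- \<tau> t * Fh' (t - \<tau> t * s))))"
  unfolding prim_def using r
  by (intro lint_cong) (auto simp: ind2_def wf_def split: split_indicator)
 also have "\<dots> = ind L x * sn x * (LINT s|lborel. ind r s * (- \<tau> t * Fh' (t - \<tau> t * s)))"
  by (rule integral_mult_right_zero)
 finally show ?thesis unfolding history_ftc[OF assms] .
qed

lemma cls1_sn_scale: "k *\<^sub>R cls1 L sn = cls (\<lambda>p. ind2 L p * (k * sn (fst p)))"
 using cls1_scale[OF sn_sq1, of k] by (simp add: cls1_def)

lemma k_sn_sq_int: "(\<lambda>p. ind2 L p * (k * sn (fst p))) \<in> sqi"
 by (rule cls1_sq_int[OF sq1_scale[OF sn_sq1]])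

text \<open>With velocity \<open>Fh t\<close> times the mode, the history \<open>zc t\<close> has
  the form of the fifth component of \<open>Bop\<close>, and its trace at \<open>r = 1\<close> is
  the profile at the delayed time.\<close>

lemma zc_eq: "t \<ge> 0 ==> Fh t *\<^sub>R cls1 L sn + Kr (wc t) = zc t"
 and Rr_wc: "t \<ge> 0 ==> Fh t *\<^sub>R cls1 L sn + Rr (wc t) = Fh (t - \<tau> t) *\<^sub>R cls1 L sn"
proof -
 assume t: "t \<ge> 0"
 have 1: "ind2 L p * (Fh t * sn (fst p)) + ind 1 (snd p) * prim (\<lambda>s. ind2 L (fst p, s) * wf t (fst p, s)) (snd p) = ind2 L p * zf t p" for p
 proof (cases "snd p \<in> {0<..<1}")
  case True
  then have "prim (\<lambda>s. ind2 L (fst p, s) * wf t (fst p, s)) (snd p) = ind L (fst p) * sn (fst p) * (Fh (t - \<tau> t * snd p) - Fh t)"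
   by (intro prim_wf t) auto
  then show ?thesis using True by (simp add: ind2_def[of L p] zf_def algebra_simps)
 qed (auto simp: ind2_def)
 show "Fh t *\<^sub>R cls1 L sn + Kr (wc t) = zc t"
  unfolding cls1_sn_scale wc_def Kr_cls(1)[OF wf_sq_int[OF t]] cls_add[OF k_sn_sq_int Kr_cls(2)[OF wf_sq_int[OF t]]] zc_def 1 ..
 have 2: "ind2 L p * (Fh t * sn (fst p)) + ind 1 (snd p) * prim (\<lambda>s. ind2 L (fst p, s) * wf t (fst p, s)) 1 = ind2 L p * (Fh (t - \<tau> t) * sn (fst p))" for p
 proof (cases "snd p \<in> {0<..<1}")
  case True
  have "prim (\<lambda>s. ind2 L (fst p, s) * wf t (fst p, s)) 1 = ind L (fst p) * sn (fst p) * (Fh (t - \<tau> t * 1) - Fh t)"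
   by (intro prim_wf t) auto
  then show ?thesis using True by (simp add: ind2_def[of L p] algebra_simps)
 qed (auto simp: ind2_def)
 show "Fh t *\<^sub>R cls1 L sn + Rr (wc t) = Fh (t - \<tau> t) *\<^sub>R cls1 L sn"
  unfolding cls1_sn_scale wc_def Rr_cls(1)[OF wf_sq_int[OF t]] cls_add[OF k_sn_sq_int Rr_cls(2)[OF wf_sq_int[OF t]]] 2 ..
qed

text \<open>A fixed value of the delay variable is a null set of the plane; this discards the line
  on which the kink sits.\<close>

lemma AE_snd_ne: "AE p in lborel. snd (p :: real \<times> real) \<noteq> k"
proof (subst lborel_AE_pair_iff)
 show "{p :: real \<times> real. snd p \<noteq> k} \<in> sets borel"
  by (intro borel_open open_Collect_neq continuous_intros)
 show "AE x in lborel. AE y in lborel. snd (x :: real, y) \<noteq> k"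
  using AE_lborel_singleton[of k] by simp
qed

text \<open>\<open>Fh'\<close> may jump at 0, so continuity in the supremum norm cannot be expected.
  For each \<open>t\<close> the jump concerns a single value of \<open>r\<close>; elsewhere
  \<open>wf\<close> converges, and it is bounded uniformly.\<close>

lemma wc_continuous: "continuous_on {0..} wc"
 unfolding continuous_on_def wc_def
proof
 fix t :: real assume "t \<in> {0..}"
 then have t: "t \<ge> 0" by simp
 show "((\<lambda>s. cls (\<lambda>p. ind2 L p * wf s p)) \<longlongrightarrow> cls (\<lambda>p. ind2 L p * wf t p)) (at0 t)"
 proof (rule cls_tendsto_within)
  show "AE p in lborel. ind2 L p = 1 --> ((\<lambda>s. wf s p) \<longlongrightarrow> wf t p) (at0 t)"
   using AE_snd_ne[of "t / \<tau> t"]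
  proof (rule AE_mp[OF _ AE_I2[OF impI]], intro impI)
   fix p assume ne: "snd p \<noteq> t / \<tau> t" and "ind2 L p = 1"
   then have p: "0 < snd p" "snd p < 1" by (auto simp: ind2_one)
   have 0: "t - \<tau> t * snd p \<noteq> 0" using ne delay_pos[OF t] by (auto simp: field_simps)
   have "- \<tau> 0 < t - \<tau> t * snd p" using p by (intro delay_arg_gt t) auto
   from Fh'_cont[OF this 0] have c: "isCont Fh' (t - \<tau> t * snd p)" .
   have \<tau>c: "(\<tau> \<longlongrightarrow> \<tau> t) (at0 t)" using data_continuous(3) t by (simp add: continuous_on_def)
   have "((\<lambda>s. Fh' (s - \<tau> s * snd p)) \<longlongrightarrow> Fh' (t - \<tau> t * snd p)) (at0 t)"
    by (rule isCont_tendsto_compose[OF c]) (intro tendsto_intros \<tau>c)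
   then show "((\<lambda>s. wf s p) \<longlongrightarrow> wf t p) (at0 t)"
    unfolding wf_def by (intro tendsto_intros \<tau>c)
  qed
 qed (use wf_measurable wf_bounded in auto)
qed

text \<open>The kink is bridged by the fundamental theorem with 0 as exceptional point. The
  Lipschitz bound is the majorant for difference quotients in time.\<close>

lemma Fh_lipschitz: "\<exists>C\<ge>0. \<forall>s\<in>{- \<tau> 0<..<T}. \<forall>t\<in>{- \<tau> 0<..<T}. \<bar>Fh s - Fh t\<bar> \<le> C * \<bar>s - t\<bar>"
proof -
 from Fh'_bounded[of T] obtain C where C: "\<And>\<sigma>. \<sigma> \<in> {- \<tau> 0<..<T} ==> \<bar>Fh' \<sigma>\<bar> \<le> C" by blast
 have le: "\<bar>Fh t - Fh s\<bar> \<le> \<bar>C\<bar> * \<bar>s - t\<bar>" if st: "s \<in> {- \<tau> 0<..<T}" "t \<in> {- \<tau> 0<..<T}" "s \<le> t" for s t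
 proof -
  have "(Fh' has_integral Fh t - Fh s) {s..t}"
   by (rule fundamental_theorem_of_calculus_interior_strong[of "{0}"])
    (use st Fh_deriv in \<open>auto simp flip: has_real_derivative_iff_has_vector_derivative intro: continuous_on_subset[OF Fh_cont]\<close>)
  then have i: "(Fh' has_integral Fh t - Fh s) (cbox s t)" by (simp add: cbox_interval)
  have "norm (Fh t - Fh s) \<le> \<bar>C\<bar> * measure lborel (cbox s t)"
  proof (rule has_integral_bound[OF _ i])
   fix x assume "x \<in> cbox s t"
   then have "x \<in> {- \<tau> 0<..<T}" using st by (auto simp: cbox_interval)
   from C[OF this] show "norm (Fh' x) \<le> \<bar>C\<bar>" by simp
  qed simp
  then show ?thesis using st by simp
 qed
 have "\<bar>Fh s - Fh t\<bar> \<le> \<bar>C\<bar> * \<bar>s - t\<bar>" if "s \<in> {- \<tau> 0<..<T}" "t \<in> {- \<tau> 0<..<T}" for s t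
  using le[of s t] le[of t s] that by (cases "s \<le> t") (auto simp: abs_minus_commute)
 then show ?thesis by (intro exI[of _ "\<bar>C\<bar>"]) auto
qed

lemma mul_Mt_wc:
 assumes t: "t \<ge> 0"
 shows "mul_op (Mt t) (wc t) = cls (\<lambda>p. ind2 L p * (sn (fst p) * (Fh' (t - \<tau> t * snd p) * (1 - \<tau>' t * snd p))))"
proof -
 have "mul_op (Mt t) (wc t) = cls (\<lambda>p. Mt t p * (ind2 L p * wf t p))"
  unfolding wc_def by (rule mul_op_cls[OF Mt_measurable Mt_bound wf_sq_int[OF t]])
 also have "(\<lambda>p. Mt t p * (ind2 L p * wf t p)) = (\<lambda>p. ind2 L p * (sn (fst p) * (Fh' (t - \<tau> t * snd p) * (1 - \<tau>' t * snd p))))"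
 proof
  fix p :: "real \<times> real"
  show "Mt t p * (ind2 L p * wf t p) = ind2 L p * (sn (fst p) * (Fh' (t - \<tau> t * snd p) * (1 - \<tau>' t * snd p)))"
   using delay_pos[OF t] by (cases "snd p \<in> {0<..<1}") (auto simp: Mt_def ind2_def wf_def field_simps)
 qed
 finally show ?thesis .
qed

text \<open>Pointwise the chain rule gives \<open>Fh'\<close> at the delayed time times
  \<open>1 - \<tau>' t * snd p\<close>, and this is \<open>Mt t\<close> times \<open>wf t\<close>:
  the transport equation for the history.\<close>

lemma zc_derivative:
 assumes t: "t \<ge> 0"
 shows "(zc has_vector_derivative mul_op (Mt t) (wc t)) (at0 t)"
 unfolding has_vector_derivative_iff_quotient mul_Mt_wc[OF t]
proof -
 let ?q = "\<lambda>s p. (1 / (s - t)) * (zf s p - zf t p)"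
 have eq: "(1 / (s - t)) *\<^sub>R (zc s - zc t) = cls (\<lambda>p. ind2 L p * ?q s p)" if s: "s \<ge> 0" for s
 proof -
  have "zc s - zc t = cls (\<lambda>p. ind2 L p * zf s p - ind2 L p * zf t p)"
   unfolding zc_def by (rule cls_diff[OF zf_sq_int[OF s] zf_sq_int[OF t]])
  then have "(1 / (s - t)) *\<^sub>R (zc s - zc t) = cls (\<lambda>p. (1 / (s - t)) * (ind2 L p * zf s p - ind2 L p * zf t p))"
   using cls_scale[OF sq_int_diff[OF zf_sq_int[OF s] zf_sq_int[OF t]], of "1 / (s - t)"] by simp
  then show ?thesis by (simp add: right_diff_distrib mult.left_commute)
 qed
 have ev: "\<forall>\<^sub>F s in at0 t. (1 / (s - t)) *\<^sub>R (zc s - zc t) = cls (\<lambda>p. ind2 L p * ?q s p)"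
  unfolding eventually_at_filter by (intro always_eventually allI impI eq) auto
 have "((\<lambda>s. cls (\<lambda>p. ind2 L p * ?q s p)) \<longlongrightarrow> cls (\<lambda>p. ind2 L p * (sn (fst p) * (Fh' (t - \<tau> t * snd p) * (1 - \<tau>' t * snd p))))) (at0 t)"
 proof (rule cls_tendsto_within)
  show "(\<lambda>p. ?q s p) \<in> borel_fun" for s
   using zf_measurable[of s] zf_measurable[of t] by measurable
  have 1: "(\<lambda>p :: real \<times> real. t - \<tau> t * snd p) \<in> borel_fun"
   by (intro borel_measurable_diff borel_measurable_times borel_measurable_const snd_borel)
  show "(\<lambda>p. sn (fst p) * (Fh' (t - \<tau> t * snd p) * (1 - \<tau>' t * snd p))) \<in> borel_fun"
   by (intro borel_measurable_times borel_measurable_diff borel_measurable_const measurable_compose[OF fst_borel sn_measurable]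
     measurable_compose[OF 1 Fh'_measurable] snd_borel)
  show "AE p in lborel. ind2 L p = 1 --> ((\<lambda>s. ?q s p) \<longlongrightarrow> sn (fst p) * (Fh' (t - \<tau> t * snd p) * (1 - \<tau>' t * snd p))) (at0 t)"
   using AE_snd_ne[of "t / \<tau> t"]
  proof (rule AE_mp[OF _ AE_I2[OF impI]], intro impI)
   fix p assume ne: "snd p \<noteq> t / \<tau> t" and "ind2 L p = 1"
   then have p: "0 < snd p" "snd p < 1" by (auto simp: ind2_one)
   have 0: "t - \<tau> t * snd p \<noteq> 0" using ne delay_pos[OF t] by (auto simp: field_simps)
   have "- \<tau> 0 < t - \<tau> t * snd p" using p by (intro delay_arg_gt t) auto
   note ch = DERIV_chain2[of Fh _ "\<lambda>s. s - \<tau> s * snd p" t "1 - \<tau>' t * snd p" "{0..}", OF Fh_deriv[OF this 0]]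
   have "((\<lambda>s. s - \<tau> s * snd p) has_real_derivative 1 - \<tau>' t * snd p) (at0 t)"
    by (intro DERIV_diff DERIV_ident DERIV_cmult_right delay_deriv[OF t])
   from ch[OF this] have "((\<lambda>s. zf s p) has_real_derivative sn (fst p) * (Fh' (t - \<tau> t * snd p) * (1 - \<tau>' t * snd p))) (at0 t)"
    unfolding zf_def by (rule DERIV_cmult)
   then show "((\<lambda>s. ?q s p) \<longlongrightarrow> sn (fst p) * (Fh' (t - \<tau> t * snd p) * (1 - \<tau>' t * snd p))) (at0 t)"
    unfolding has_real_derivative_iff_has_vector_derivative has_vector_derivative_iff_quotient by simp
  qed
  fix T :: real
  \<comment> \<open>Both \<open>s\<close> and \<open>t\<close> have to lie in the interval on which
    the Lipschitz constants are taken, whatever \<open>T\<close> is.\<close>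
  define T' where "T' = max T t"
  have T': "T' \<ge> 0" "t \<in> {0..T'}" using t by (auto simp: T'_def)
  from Fh_lipschitz[of T'] obtain C where C: "C \<ge> 0"
   "\<And>a b. a \<in> {- \<tau> 0<..<T'} ==> b \<in> {- \<tau> 0<..<T'} ==> \<bar>Fh a - Fh b\<bar> \<le> C * \<bar>a - b\<bar>" by blast
  from data_lipschitz[OF T'(1)] obtain K where K: "K \<ge> 0"
   "\<And>s t. s \<in> {0..T'} ==> t \<in> {0..T'} ==> \<bar>\<tau> s - \<tau> t\<bar> \<le> K * \<bar>s - t\<bar>" by blast
  have "\<bar>?q s p\<bar> \<le> C * (1 + K)" if s: "s \<in> {0..T} - {t}" and p: "ind2 L p = 1" for s p
  proof -
   have s': "s \<in> {0..T'}" "s \<noteq> t" using s by (auto simp: T'_def)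
   have r: "0 < snd p" "snd p < 1" using p by (auto simp: ind2_one)
   have "\<bar>Fh (s - \<tau> s * snd p) - Fh (t - \<tau> t * snd p)\<bar> \<le> C * \<bar>(s - \<tau> s * snd p) - (t - \<tau> t * snd p)\<bar>"
    by (intro C(2) delay_arg_range s' T' r)
   also have "\<dots> \<le> C * ((1 + K) * \<bar>s - t\<bar>)"
   proof (rule mult_left_mono[OF _ C(1)])
    have le: "\<bar>(\<tau> s - \<tau> t) * snd p\<bar> \<le> (K * \<bar>s - t\<bar>) * 1"
     unfolding abs_mult using r K(2)[OF s'(1) T'(2)] K(1) by (intro mult_mono) auto
    have eq: "(s - \<tau> s * snd p) - (t - \<tau> t * snd p) = (s - t) - (\<tau> s - \<tau> t) * snd p" by (simp add: algebra_simps)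
    have "\<bar>(s - \<tau> s * snd p) - (t - \<tau> t * snd p)\<bar> \<le> \<bar>s - t\<bar> + \<bar>(\<tau> s - \<tau> t) * snd p\<bar>"
     unfolding eq by (rule abs_triangle_ineq4)
    also have "\<dots> \<le> \<bar>s - t\<bar> + (K * \<bar>s - t\<bar>) * 1" by (rule add_left_mono[OF le])
    finally show "\<bar>(s - \<tau> s * snd p) - (t - \<tau> t * snd p)\<bar> \<le> (1 + K) * \<bar>s - t\<bar>"
     by (simp add: distrib_right)
   qed
   finally have le: "\<bar>Fh (s - \<tau> s * snd p) - Fh (t - \<tau> t * snd p)\<bar> \<le> C * (1 + K) * \<bar>s - t\<bar>" by simp
   have "\<bar>zf s p - zf t p\<bar> \<le> 1 * (C * (1 + K) * \<bar>s - t\<bar>)"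
    unfolding zf_def right_diff_distrib[symmetric] abs_mult
    by (intro mult_mono sn_bound) (use le in auto)
   then have "\<bar>zf s p - zf t p\<bar> / \<bar>s - t\<bar> \<le> C * (1 + K)"
    using s'(2) by (simp add: divide_le_eq)
   then show ?thesis by (simp add: abs_mult)
  qed
  then show "\<exists>C. \<forall>s\<in>{0..T} - {t}. \<forall>p. ind2 L p = 1 --> \<bar>?q s p\<bar> \<le> C" by blast
 qed
 then show "((\<lambda>s. (1 / (s - t)) *\<^sub>R (zc s - zc t)) \<longlongrightarrow> cls (\<lambda>p. ind2 L p * (sn (fst p) * (Fh' (t - \<tau> t * snd p) * (1 - \<tau>' t * snd p))))) (at0 t)"
  by (subst filterlim_cong[OF refl refl ev])
qed

end

section \<open>Solutions in a single mode\<close>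

lemma norm4_le: "norm ((x, y, z, w) :: real \<times> real \<times> real \<times> real) \<le> \<bar>x\<bar> + \<bar>y\<bar> + \<bar>z\<bar> + \<bar>w\<bar>"
proof -
 have *: "norm (x, y) \<le> norm x + norm y" for x :: "'x::real_normed_vector" and y :: "'y::real_normed_vector"
  by (simp add: norm_Pair sqrt_sum_squares_le_sum)
 show ?thesis
  using *[of x "(y, z, w)"] *[of y "(z, w)"] *[of z w] by simp
qed

lemma norm4_ge:
 fixes v :: "real \<times> real \<times> real \<times> real"
 shows "\<bar>fst v\<bar> \<le> norm v" "\<bar>fst (snd v)\<bar> \<le> norm v" "\<bar>fst (snd (snd v))\<bar> \<le> norm v" "\<bar>snd (snd (snd v))\<bar> \<le> norm v"
proof -
 have *: "norm (fst p) \<le> norm p" "norm (snd p) \<le> norm p" for p :: "'x::real_normed_vector \<times> 'y::real_normed_vector"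
  using norm_fst_le[of "fst p" "snd p"] norm_snd_le[of "snd p" "fst p"] by simp_all
 show "\<bar>fst v\<bar> \<le> norm v" "\<bar>fst (snd v)\<bar> \<le> norm v" "\<bar>fst (snd (snd v))\<bar> \<le> norm v" "\<bar>snd (snd (snd v))\<bar> \<le> norm v"
  using *(1)[of v] *(2)[of v] *(1)[of "snd v"] *(2)[of "snd v"] *(1)[of "snd (snd v)"] *(2)[of "snd (snd v)"]
  by auto
qed

lemma sum_abs_bound:
 fixes p q r s u v w z :: real
 assumes "\<bar>p\<bar> \<le> A" "\<bar>q\<bar> \<le> B" "\<bar>r\<bar> \<le> R1" "\<bar>s\<bar> \<le> R2" "\<bar>u\<bar> \<le> C" "\<bar>v\<bar> \<le> A" "\<bar>w\<bar> \<le> B" "\<bar>z\<bar> \<le> C"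
 shows "\<bar>- p - q - r - s\<bar> + \<bar>u\<bar> + \<bar>v\<bar> + \<bar>w - z\<bar> \<le> 2 * A + 2 * B + 2 * C + R1 + R2"
proof -
 have "\<bar>- p - q - r - s\<bar> \<le> A + B + R1 + R2" using assms(1-4) by linarith
 moreover have "\<bar>w - z\<bar> \<le> B + C" using assms(7,8) by linarith
 ultimately show ?thesis using assms(5,6) by linarith
qed

lemma sum_coeff_bound:
 fixes \<alpha> \<beta> \<gamma> \<delta> N E :: real
 assumes "0 \<le> \<alpha>" "0 \<le> \<beta>" "0 \<le> \<gamma>" "0 \<le> \<delta>" "0 \<le> N" "0 \<le> E"
 shows "2 * (\<alpha> * N) + 2 * (\<beta> * N) + 2 * (\<gamma> * N) + \<delta> * N + \<delta> * E \<le> (2 * \<alpha> + 2 * \<beta> + 2 * \<gamma> + 2 * \<delta> + 1) * (N + E)"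
proof -
 have "(2 * \<alpha> + 2 * \<beta> + 2 * \<gamma> + 2 * \<delta> + 1) * (N + E) - (2 * (\<alpha> * N) + 2 * (\<beta> * N) + 2 * (\<gamma> * N) + \<delta> * N + \<delta> * E) =
  2 * (\<alpha> * E) + 2 * (\<beta> * E) + 2 * (\<gamma> * E) + \<delta> * N + \<delta> * E + N + E" by (simp add: algebra_simps)
 also have "\<dots> \<ge> 0" using assms by (intro add_nonneg_nonneg) auto
 finally show ?thesis by simp
qed

locale interval =
 fixes L :: real
 assumes L_pos: "0 < L"
begin

sublocale S: trig_system L sin "-1" by unfold_locales (use L_pos in auto)
sublocale C: trig_system L cos 1 by unfold_locales (use L_pos in auto)

lemma S_om_pos: "0 < S.om k" using L_pos by (simp add: S.om_def)

lemma cos_S_om: "cos (S.om k * L) = 0"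
proof -
 have "S.om k * L = real (2 * k + 1) * pi / 2" using L_pos by (simp add: S.om_def field_simps)
 then show ?thesis by (simp only: cos_zero_iff) (metis odd_two_times_div_two_nat times_divide_eq_right even_mult_iff odd_even_add odd_one evenE dvd_triv_left even_plus_one_iff)
qed

abbreviation "sinc k \<equiv> cls1 L (\<lambda>x. sin (S.om k * x))"
abbreviation "cosc k \<equiv> cls1 L (\<lambda>x. cos (S.om k * x))"

lemma sin_sq1: "(\<lambda>x. sin (k * x)) \<in> sq1 L" and cos_sq1: "(\<lambda>x. cos (k * x)) \<in> sq1 L"
 by (rule bounded_sq1[where C = 1]; (intro borel_measurable_continuous_onI continuous_intros)?; simp)+

lemma J0_cosc: "J0 L (cosc k) = (1 / S.om k) *\<^sub>R sinc k"
proof -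
 have "J0 L (cosc k) = cls1 L (\<lambda>x. (1 / S.om k) * sin (S.om k * x))"
  unfolding J0_cls1[OF L_pos cos_sq1]
 proof (rule cls1_cong)
  fix x assume "x \<in> {0<..<L}"
  have "prim (\<lambda>x. cos (S.om k * x)) x = 1 / S.om k * sin (S.om k * x) - 1 / S.om k * sin (S.om k * 0)"
   unfolding prim_def
   by (rule lborel_integral_ftc[of _ "{}" _ _ 1])
    (use \<open>x \<in> {0<..<L}\<close> S_om_pos[of k] in \<open>auto intro!: continuous_intros derivative_eq_intros borel_measurable_continuous_onI\<close>)
  then show "prim (\<lambda>x. cos (S.om k * x)) x = 1 / S.om k * sin (S.om k * x)" by simp
 qed
 then show ?thesis by (simp only: cls1_scale[OF sin_sq1])
qed

text \<open>The constant of integration is a multiple of \<open>cos (S.om k * L)\<close>, which is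
  0. Together with \<open>J0_cosc\<close> this closes a mode under both integrations.\<close>

lemma JL_sinc: "JL L (sinc k) = - (1 / S.om k) *\<^sub>R cosc k"
proof -
 have p: "prim (\<lambda>x. sin (S.om k * x)) x = - 1 / S.om k * cos (S.om k * x) + 1 / S.om k" if "x \<in> {0<..L}" for x
 proof -
  have "prim (\<lambda>x. sin (S.om k * x)) x = - 1 / S.om k * cos (S.om k * x) - - 1 / S.om k * cos (S.om k * 0)"
   unfolding prim_def
   by (rule lborel_integral_ftc[of _ "{}" _ _ 1])
    (use that S_om_pos[of k] in \<open>auto intro!: continuous_intros derivative_eq_intros borel_measurable_continuous_onI\<close>)
  then show ?thesis by simp
 qed
 have "JL L (sinc k) = cls1 L (\<lambda>x. (- (1 / S.om k)) * cos (S.om k * x))"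
  unfolding JL_cls1[OF L_pos sin_sq1]
  by (rule cls1_cong) (use L_pos in \<open>auto simp: p cos_S_om\<close>)
 then show ?thesis by (simp only: cls1_scale[OF cos_sq1])
qed

end

context beam
begin

sublocale interval L by unfold_locales (rule L)

text \<open>The equation for the amplitudes of one mode: sine coefficients of the two velocities,
  then cosine coefficients of the two stress variables. \<open>\<eta>\<close> is the delayed vector,
  of which only the first velocity amplitude enters.\<close>

definition rhs :: "real => real => real \<times> real \<times> real \<times> real => real \<times> real \<times> real \<times> real => real \<times> real \<times> real \<times> real" where
 "rhs \<omega> s y \<eta> = (- (a * \<omega> * fst (snd (snd y))) - b * \<omega> * snd (snd (snd y)) - \<delta>1 s / \<rho> * fst y - \<delta>2 s / \<rho> * fst \<eta>,
  c * \<omega> * snd (snd (snd y)), a * \<omega> * fst y, b * \<omega> * fst y - c * \<omega> * fst (snd y))"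

lemma rhs_bound:
 assumes "\<omega> > 0" "s \<ge> 0"
 shows "norm (rhs \<omega> s y \<eta>) \<le> (2 * (a * \<omega>) + 2 * (\<bar>b\<bar> * \<omega>) + 2 * (c * \<omega>) + 2 * (D / \<rho>) + 1) * (norm y + norm \<eta>)"
proof -
 have d: "\<bar>\<delta>1 s / \<rho>\<bar> \<le> D / \<rho>" "\<bar>\<delta>2 s / \<rho>\<bar> \<le> D / \<rho>"
  using weight_bounds[OF assms(2)] \<rho> by (auto simp: divide_right_mono)
 have Dr: "0 \<le> D / \<rho>" using D \<rho> by simp
 let ?n = "norm y"
 have q: "\<bar>a * \<omega> * fst (snd (snd y))\<bar> \<le> a * \<omega> * ?n" "\<bar>b * \<omega> * snd (snd (snd y))\<bar> \<le> \<bar>b\<bar> * \<omega> * ?n"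
  "\<bar>c * \<omega> * snd (snd (snd y))\<bar> \<le> c * \<omega> * ?n" "\<bar>a * \<omega> * fst y\<bar> \<le> a * \<omega> * ?n" "\<bar>b * \<omega> * fst y\<bar> \<le> \<bar>b\<bar> * \<omega> * ?n"
  "\<bar>c * \<omega> * fst (snd y)\<bar> \<le> c * \<omega> * ?n"
  using norm4_ge[of y] a c assms by (auto simp: abs_mult intro!: mult_left_mono)
 have e: "\<bar>\<delta>1 s / \<rho> * fst y\<bar> \<le> D / \<rho> * ?n" "\<bar>\<delta>2 s / \<rho> * fst \<eta>\<bar> \<le> D / \<rho> * norm \<eta>"
  unfolding abs_mult by (rule mult_mono[OF d(1) norm4_ge(1)] mult_mono[OF d(2) norm4_ge(1)]; use Dr in simp)+
 have "norm (rhs \<omega> s y \<eta>) \<le> \<bar>- (a * \<omega> * fst (snd (snd y))) - b * \<omega> * snd (snd (snd y)) - \<delta>1 s / \<rho> * fst y - \<delta>2 s / \<rho> * fst \<eta>\<bar>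
  + \<bar>c * \<omega> * snd (snd (snd y))\<bar> + \<bar>a * \<omega> * fst y\<bar> + \<bar>b * \<omega> * fst y - c * \<omega> * fst (snd y)\<bar>"
  unfolding rhs_def by (rule norm4_le)
 also have "\<dots> \<le> 2 * (a * \<omega> * ?n) + 2 * (\<bar>b\<bar> * \<omega> * ?n) + 2 * (c * \<omega> * ?n) + D / \<rho> * ?n + D / \<rho> * norm \<eta>"
  by (rule sum_abs_bound[OF q(1,2) e q(3-6)])
 also have "\<dots> \<le> (2 * (a * \<omega>) + 2 * (\<bar>b\<bar> * \<omega>) + 2 * (c * \<omega>) + 2 * (D / \<rho>) + 1) * (norm y + norm \<eta>)"
  by (rule sum_coeff_bound) (use a c assms Dr in auto)
 finally show ?thesis .
qed

lemma rhs_diff: "rhs \<omega> s y \<eta> - rhs \<omega> s y' \<eta>' = rhs \<omega> s (y - y') (\<eta> - \<eta>')"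
 by (simp add: rhs_def algebra_simps)

lemma rhs_continuous:
 assumes "continuous_on {0..} u" "continuous_on {0..} v"
 shows "continuous_on {0..} (\<lambda>s. rhs \<omega> s (u s) (v s))"
 unfolding rhs_def using \<rho> by (intro continuous_intros assms data_continuous) auto

text \<open>\<open>\<zeta>\<close> is the history profile in \<open>r\<close>, and
  \<open>\<zeta> 0 = F0\<close> matches it to the velocity at time 0. No matching of slopes is
  demanded, so any continuous \<open>\<zeta>'\<close> occurs in the last coordinate of the initial
  datum.\<close>

theorem mode_solution:
 fixes F0 H0 Q0 S0 :: real and \<zeta> \<zeta>' :: "real => real"
 assumes \<zeta>: "\<And>r. (\<zeta> has_real_derivative \<zeta>' r) (at r)" and \<zeta>': "continuous_on UNIV \<zeta>'" and \<zeta>0: "\<zeta> 0 = F0"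
 shows "\<exists>y. strong y \<and> y 0 = ((S.om k * F0) *\<^sub>R cosc k, (S.om k * H0) *\<^sub>R cosc k, - (S.om k * Q0) *\<^sub>R sinc k,
  - (S.om k * S0) *\<^sub>R sinc k, cls (\<lambda>p. ind2 L p * (sin (S.om k * fst p) * \<zeta>' (snd p))))"
proof -
 define \<omega> where "\<omega> = S.om k"
 have \<omega>: "\<omega> > 0" using S_om_pos by (simp add: \<omega>_def)
 have \<tau>00: "\<tau> 0 > 0" by (rule delay_pos) simp
 \<comment> \<open>Arguments are clamped so that the initial function is bounded and continuous on
   the whole line; for \<open>- \<tau> 0 \<le> \<sigma> \<le> 0\<close> it is the profile
   \<open>\<zeta>\<close> at \<open>r = - \<sigma> / \<tau> 0\<close>.\<close>
 define cl where "cl \<sigma> = max 0 (min 1 (- \<sigma> / \<tau> 0))" for \<sigma> :: real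
 define h where "h \<sigma> = (\<zeta> (cl \<sigma>), H0, Q0, S0)" for \<sigma>
 have \<zeta>c: "continuous_on UNIV \<zeta>" using \<zeta> by (intro DERIV_continuous_on) (auto intro: has_field_derivative_at_within)
 have cl_cont: "continuous_on UNIV cl" unfolding cl_def using \<tau>00 by (intro continuous_intros) auto
 have h_cont: "continuous_on UNIV h"
  unfolding h_def by (intro continuous_intros continuous_on_compose2[OF \<zeta>c cl_cont]) auto
 obtain Z where Z: "\<And>r. r \<in> {0..1} ==> \<bar>\<zeta> r\<bar> \<le> Z"
  using continuous_abs_bounded[OF continuous_on_subset[OF \<zeta>c subset_UNIV], of 0 1] by blast
 have h_bound: "norm (h \<sigma>) \<le> Z + \<bar>H0\<bar> + \<bar>Q0\<bar> + \<bar>S0\<bar>" for \<sigma>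
  unfolding h_def by (rule order_trans[OF norm4_le]) (use Z[of "cl \<sigma>"] in \<open>auto simp: cl_def\<close>)
 have "\<exists>y. continuous_on UNIV y \<and> (\<forall>\<sigma>\<le>0. y \<sigma> = h \<sigma>) \<and>
  (\<forall>t\<ge>0. (y has_vector_derivative rhs \<omega> t (y t) (y (t - \<tau> t))) (at0 t))"
 proof (rule delay_ode_exists[OF _ _ _ rhs_continuous data_continuous(3) _ h_cont h_bound])
  show "0 < 2 * (a * \<omega>) + 2 * (\<bar>b\<bar> * \<omega>) + 2 * (c * \<omega>) + 2 * (D / \<rho>) + 1"
  proof -
   have "0 \<le> a * \<omega>" "0 \<le> \<bar>b\<bar> * \<omega>" "0 \<le> c * \<omega>" "0 \<le> D / \<rho>" using a c \<omega> D \<rho> by auto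
   then show ?thesis by linarith
  qed
  show "norm (rhs \<omega> s y \<eta> - rhs \<omega> s y' \<eta>') \<le> (2 * (a * \<omega>) + 2 * (\<bar>b\<bar> * \<omega>) + 2 * (c * \<omega>) + 2 * (D / \<rho>) + 1) * (norm (y - y') + norm (\<eta> - \<eta>'))"
   if "s \<ge> 0" for s y \<eta> y' \<eta>' unfolding rhs_diff by (rule rhs_bound[OF \<omega> that])
  show "rhs \<omega> s 0 0 = 0" for s by (simp add: rhs_def zero_prod_def)
  show "0 \<le> \<tau> s" if "s \<ge> 0" for s using delay_pos[OF that] by simp
 qed
 then obtain y where y_cont: "continuous_on UNIV y" and y_h: "\<And>\<sigma>. \<sigma> \<le> 0 ==> y \<sigma> = h \<sigma>"
  and y_d: "\<And>t. t \<ge> 0 ==> (y has_vector_derivative rhs \<omega> t (y t) (y (t - \<tau> t))) (at0 t)" by blast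
 define Fh where "Fh \<sigma> = fst (y \<sigma>)" for \<sigma>
 define G where "G t = fst (rhs \<omega> t (y t) (y (t - \<tau> t)))" for t
 \<comment> \<open>Right of 0 the derivative comes from the equation, left of 0 from the given
   history. The two one-sided values at 0 need not agree.\<close>
 define Fh' where "Fh' \<sigma> = (if 0 \<le> \<sigma> then G (max 0 \<sigma>) else - (\<zeta>' (- \<sigma> / \<tau> 0) / \<tau> 0))" for \<sigma>
 have G_cont: "continuous_on {0..} G"
  unfolding G_def
  by (intro continuous_intros rhs_continuous continuous_on_compose2[OF y_cont] data_continuous) auto
 have Fh_d: "(Fh has_vector_derivative G t) (at0 t)" if "t \<ge> 0" for t
  unfolding Fh_def G_def by (rule bounded_linear.has_vector_derivative[OF bounded_linear_fst y_d[OF that]])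
 have G_max: "continuous_on UNIV (\<lambda>\<sigma>. G (max 0 \<sigma>))"
  by (intro continuous_on_compose2[OF G_cont] continuous_intros) auto
 have \<zeta>'_s: "continuous_on UNIV (\<lambda>\<sigma>. - (\<zeta>' (- \<sigma> / \<tau> 0) / \<tau> 0))"
  using \<tau>00 by (intro continuous_intros continuous_on_compose2[OF \<zeta>']) auto
 have Fh_neg: "Fh \<sigma> = \<zeta> (- \<sigma> / \<tau> 0)" if "- \<tau> 0 < \<sigma>" "\<sigma> \<le> 0" for \<sigma>
  using that \<tau>00 by (simp add: Fh_def y_h h_def cl_def min_def max_def field_simps)
 interpret m: mode_profile L \<rho> a b c \<tau>0 \<tau>1 d D \<tau> \<tau>' \<delta>1 \<delta>2 \<omega> Fh Fh'
 proof
  show "continuous_on UNIV Fh" unfolding Fh_def by (intro continuous_intros y_cont)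
  fix \<sigma> assume \<sigma>: "- \<tau> 0 < \<sigma>" "\<sigma> \<noteq> 0"
  show "(Fh has_real_derivative Fh' \<sigma>) (at \<sigma>)"
  proof (cases "0 < \<sigma>")
   case True
   then show ?thesis using Fh_d[of \<sigma>]
    by (intro has_derivative_ge_nonneg) (auto simp: Fh'_def has_real_derivative_iff_has_vector_derivative max_def)
  next
   case False
   then have neg: "\<sigma> < 0" using \<sigma> by simp
   note ch = DERIV_chain2[of \<zeta> "\<zeta>' (- \<sigma> / \<tau> 0)" "\<lambda>\<sigma>. - \<sigma> / \<tau> 0" \<sigma> "- 1 / \<tau> 0" UNIV, OF \<zeta>]
   have "((\<lambda>\<sigma>. - \<sigma> / \<tau> 0) has_real_derivative - 1 / \<tau> 0) (at \<sigma>)"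
    using \<tau>00 by (auto intro!: derivative_eq_intros)
   from ch[OF this] have "((\<lambda>\<sigma>. \<zeta> (- \<sigma> / \<tau> 0)) has_real_derivative Fh' \<sigma>) (at \<sigma>)"
    using neg by (simp add: Fh'_def)
   then show ?thesis
    by (rule has_field_derivative_transform_within_open[where S = "{- \<tau> 0<..<0}"]) (use \<sigma> neg Fh_neg in auto)
  qed
  show "isCont Fh' \<sigma>"
  proof (cases "0 < \<sigma>")
   case True
   have "continuous_on {0<..} Fh'"
    by (rule continuous_on_cong[THEN iffD1, OF refl _ continuous_on_subset[OF G_max]]) (auto simp: Fh'_def)
   then show ?thesis using True by (simp add: continuous_on_eq_continuous_at)
  next
   case False
   then have "\<sigma> < 0" using \<sigma> by simp
   have "continuous_on {..<0} Fh'"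
    by (rule continuous_on_cong[THEN iffD1, OF refl _ continuous_on_subset[OF \<zeta>'_s]]) (auto simp: Fh'_def)
   then show ?thesis using \<open>\<sigma> < 0\<close> by (simp add: continuous_on_eq_continuous_at)
  qed
 next
  fix T :: real
  have "bounded ((\<lambda>\<sigma>. G (max 0 \<sigma>)) ` {- \<tau> 0..T})" "bounded ((\<lambda>\<sigma>. - (\<zeta>' (- \<sigma> / \<tau> 0) / \<tau> 0)) ` {- \<tau> 0..T})"
   by (intro compact_imp_bounded compact_continuous_image continuous_on_subset[OF G_max] continuous_on_subset[OF \<zeta>'_s]; simp)+
  then obtain C1 C2 where "\<forall>x\<in>(\<lambda>\<sigma>. G (max 0 \<sigma>)) ` {- \<tau> 0..T}. norm x \<le> C1"
   "\<forall>x\<in>(\<lambda>\<sigma>. - (\<zeta>' (- \<sigma> / \<tau> 0) / \<tau> 0)) ` {- \<tau> 0..T}. norm x \<le> C2" unfolding bounded_iff by blast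
  then have "\<bar>G (max 0 \<sigma>)\<bar> \<le> max C1 C2 \<and> \<bar>- (\<zeta>' (- \<sigma> / \<tau> 0) / \<tau> 0)\<bar> \<le> max C1 C2" if "\<sigma> \<in> {- \<tau> 0<..<T}" for \<sigma>
   using that by (simp add: le_max_iff_disj)
  then have "\<forall>\<sigma>\<in>{- \<tau> 0<..<T}. \<bar>Fh' \<sigma>\<bar> \<le> max C1 C2" unfolding Fh'_def by (metis (full_types))
  then show "\<exists>C. \<forall>\<sigma>\<in>{- \<tau> 0<..<T}. \<bar>Fh' \<sigma>\<bar> \<le> C" by blast
 next
  show "Fh' \<in> borel_fun"
   unfolding Fh'_def[abs_def]
   by (intro measurable_If borel_measurable_continuous_onI[OF G_max] borel_measurable_continuous_onI[OF \<zeta>'_s]) auto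
 qed
 have sn: "cls1 L m.sn = sinc k" unfolding m.sn_def[abs_def] by (simp add: \<omega>_def)
 let ?H = "\<lambda>t. fst (snd (y t))" and ?Q = "\<lambda>t. fst (snd (snd (y t)))" and ?S = "\<lambda>t. snd (snd (snd (y t)))"
 \<comment> \<open>Coordinates are derivatives in \<open>x\<close>: a sine of amplitude
   \<open>F\<close> yields \<open>\<omega> * F\<close> times the cosine, a cosine of amplitude
   \<open>Q\<close> yields \<open>- (\<omega> * Q)\<close> times the sine.\<close>
 define Y where "Y t = ((\<omega> * Fh t) *\<^sub>R cosc k, (\<omega> * ?H t) *\<^sub>R cosc k, - (\<omega> * ?Q t) *\<^sub>R sinc k, - (\<omega> * ?S t) *\<^sub>R sinc k, m.wc t)" for t
 have mem: "cosc k \<in> X1 L" "sinc k \<in> X1 L" using sin_sq1 cos_sq1 by (auto simp: X1_def)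
 have wX2: "m.wc t \<in> X2 L" if "t \<ge> 0" for t
  using cls_ind2_X2[OF m.wf_sq_int[OF that], of L] by (simp add: m.wc_def ind2_idem)
 have comp_d: "(?H has_vector_derivative c * \<omega> * ?S t) (at0 t)"
  "(?Q has_vector_derivative a * \<omega> * Fh t) (at0 t)"
  "(?S has_vector_derivative b * \<omega> * Fh t - c * \<omega> * ?H t) (at0 t)" if "t \<ge> 0" for t
  using bounded_linear.has_vector_derivative[OF bounded_linear_compose[OF bounded_linear_fst bounded_linear_snd] y_d[OF that]]
   bounded_linear.has_vector_derivative[OF bounded_linear_compose[OF bounded_linear_fst bounded_linear_compose[OF bounded_linear_snd bounded_linear_snd]] y_d[OF that]]
   bounded_linear.has_vector_derivative[OF bounded_linear_compose[OF bounded_linear_snd bounded_linear_compose[OF bounded_linear_snd bounded_linear_snd]] y_d[OF that]]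
  by (simp_all add: rhs_def Fh_def)
 interpret J0: bounded_linear "J0 L" by (rule bounded_linear_ops(1)[OF L])
 interpret JL: bounded_linear "JL L" by (rule bounded_linear_ops(2)[OF L])
 have J0c: "J0 L (cosc k) = (1 / \<omega>) *\<^sub>R sinc k" and JLc: "JL L (sinc k) = - (1 / \<omega>) *\<^sub>R cosc k"
  unfolding \<omega>_def by (rule J0_cosc, rule JL_sinc)
 have BY: "Bop (Y t) = (Fh t *\<^sub>R sinc k, ?H t *\<^sub>R sinc k, ?Q t *\<^sub>R cosc k, ?S t *\<^sub>R cosc k, m.zc t)" if "t \<ge> 0" for t
  using \<omega> m.zc_eq[OF that]
  by (simp add: Y_def J0.scaleR JL.scaleR linear_neg[OF JL.linear] J0c JLc sn)
 have sc: "((\<lambda>t. f t *\<^sub>R e) has_vector_derivative f' *\<^sub>R e) (at0 t)"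
  if "(f has_vector_derivative f') (at0 t)" for f :: "real => real" and f' t and e :: l2
  by (rule bounded_linear.has_vector_derivative[OF bounded_linear_scaleR_left that])
 have "strong Y"
  unfolding strong_def
 proof (intro conjI allI impI)
  show "Y t \<in> X" if "t \<ge> 0" for t
   unfolding Y_def X_def using mem wX2[OF that] by (auto intro!: subspace_scale[OF subspace_X1] subspace_neg[OF subspace_X1])
  have "continuous_on {0..} (\<lambda>t. y t)" by (rule continuous_on_subset[OF y_cont]) simp
  then show "continuous_on {0..} Y"
   unfolding Y_def Fh_def by (intro continuous_intros m.wc_continuous)
  fix t :: real assume t: "t \<ge> 0"
  have "((\<lambda>t. (Fh t *\<^sub>R sinc k, ?H t *\<^sub>R sinc k, ?Q t *\<^sub>R cosc k, ?S t *\<^sub>R cosc k, m.zc t)) has_vector_derivative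
   (G t *\<^sub>R sinc k, (c * \<omega> * ?S t) *\<^sub>R sinc k, (a * \<omega> * Fh t) *\<^sub>R cosc k, (b * \<omega> * Fh t - c * \<omega> * ?H t) *\<^sub>R cosc k, mul_op (Mt t) (m.wc t)))
   (at0 t)"
   by (intro has_vector_derivative_Pair sc Fh_d comp_d t m.zc_derivative)
  also have "(G t *\<^sub>R sinc k, (c * \<omega> * ?S t) *\<^sub>R sinc k, (a * \<omega> * Fh t) *\<^sub>R cosc k, (b * \<omega> * Fh t - c * \<omega> * ?H t) *\<^sub>R cosc k, mul_op (Mt t) (m.wc t))
   = Cop t (Y t)"
  proof -
   have J: "J0 L ((\<omega> * Fh t) *\<^sub>R cosc k) = Fh t *\<^sub>R sinc k" using \<omega> by (simp add: J0.scaleR J0c)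
   have R: "Fh t *\<^sub>R sinc k + Rr (m.wc t) = Fh (t - \<tau> t) *\<^sub>R sinc k" using m.Rr_wc[OF t] by (simp add: sn)
   show ?thesis
    unfolding Y_def Cop.simps J R G_def rhs_def
    by (simp add: Fh_def algebra_simps scaleR_left.diff scaleR_left.add scaleR_left.minus)
  qed
  finally show "((\<lambda>t. Bop (Y t)) has_vector_derivative Cop t (Y t)) (at0 t)"
   by (rule has_vector_derivative_transform[rotated 2]) (use t BY in auto)
 qed
 moreover have "Y 0 = ((S.om k * F0) *\<^sub>R cosc k, (S.om k * H0) *\<^sub>R cosc k, - (S.om k * Q0) *\<^sub>R sinc k,
  - (S.om k * S0) *\<^sub>R sinc k, cls (\<lambda>p. ind2 L p * (sin (S.om k * fst p) * \<zeta>' (snd p))))"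
 proof -
  have "m.wc 0 = cls (\<lambda>p. ind2 L p * (sin (S.om k * fst p) * \<zeta>' (snd p)))"
   unfolding m.wc_def
  proof (intro arg_cong[of _ _ cls] ext)
   fix p :: "real \<times> real"
   show "ind2 L p * m.wf 0 p = ind2 L p * (sin (S.om k * fst p) * \<zeta>' (snd p))"
   proof (cases "snd p \<in> {0<..<1}")
    case True
    then have "0 < \<tau> 0 * snd p" using \<tau>00 by simp
    then have "m.wf 0 p = sin (S.om k * fst p) * \<zeta>' (snd p)"
     unfolding m.wf_def m.sn_def Fh'_def using \<tau>00 by (simp add: \<omega>_def)
    then show ?thesis by simp
   qed (simp add: ind2_def)
  qed
  moreover have "y 0 = (F0, H0, Q0, S0)" using \<zeta>0 by (simp add: y_h h_def cl_def)
  ultimately show ?thesis by (simp add: Y_def Fh_def \<omega>_def)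
 qed
 ultimately show ?thesis by blast
qed

end

section \<open>Density of the initial data and of the domain\<close>

context beam
begin

lemma subspace_strong_data: "subspace {y 0 |y. strong y}"
proof -
 have 0: "strong (\<lambda>_. 0)"
  unfolding strong_def
  using subspace_0[OF subspace_X] linear_0[OF bounded_linear.linear[OF bounded_linear_Bop]]
   linear_0[OF bounded_linear.linear[OF bounded_linear_Cop]] by auto
 show ?thesis
  unfolding subspace_def
 proof (intro conjI ballI allI)
  show "0 \<in> {y 0 |y. strong y}" using 0 by (intro CollectI exI[of _ "\<lambda>_. 0"]) simp
  fix u v assume "u \<in> {y 0 |y. strong y}" "v \<in> {y 0 |y. strong y}"
  then obtain x y where "u = x 0" "strong x" "v = y 0" "strong y" by blast
  then show "u + v \<in> {y 0 |y. strong y}"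
   using strong_add_scale[of x y 1] by (intro CollectI exI[of _ "\<lambda>t. x t + 1 *\<^sub>R y t"]) simp
 next
  fix c u assume "u \<in> {y 0 |y. strong y}"
  then obtain x where "u = x 0" "strong x" by blast
  then show "c *\<^sub>R u \<in> {y 0 |y. strong y}"
   using strong_add_scale[OF 0, of x c] by (intro CollectI exI[of _ "\<lambda>t. 0 + c *\<^sub>R x t"]) simp
 qed
qed

lemma inclusions:
 "bounded_linear (\<lambda>e. (e, 0, 0, 0, 0) :: est)" "bounded_linear (\<lambda>e. (0, e, 0, 0, 0) :: est)"
 "bounded_linear (\<lambda>e. (0, 0, e, 0, 0) :: est)" "bounded_linear (\<lambda>e. (0, 0, 0, e, 0) :: est)"
 "bounded_linear (\<lambda>e. (0, 0, 0, 0, e) :: est)"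
 by (intro bounded_linear_Pair bounded_linear_ident bounded_linear_zero)+

lemma S_gen_eq: "S.gen k j = cls (\<lambda>p. ind2 L p * (sin (S.om k * fst p) * snd p ^ j))"
 by (rule S.gen_def)

lemma subspace_of_components:
 assumes V: "subspace V" "closed V"
  and G1: "\<And>e. e \<in> X1 L ==> (e, 0, 0, 0, 0) \<in> V" and G2: "\<And>e. e \<in> X1 L ==> (0, e, 0, 0, 0) \<in> V"
  and G3: "\<And>e. e \<in> X1 L ==> (0, 0, e, 0, 0) \<in> V" and G4: "\<And>e. e \<in> X1 L ==> (0, 0, 0, e, 0) \<in> V"
  and G5: "\<And>e. e \<in> X2 L ==> (0, 0, 0, 0, e) \<in> V"
 shows "X \<subseteq> V"
proof
 fix y assume y: "y \<in> X"
 obtain f h q s w where y_eq: "y = (f, h, q, s, w)" by (metis prod.exhaust)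
 from y have mem: "f \<in> X1 L" "h \<in> X1 L" "q \<in> X1 L" "s \<in> X1 L" "w \<in> X2 L" by (auto simp: y_eq X_def)
 have "(f, 0, 0, 0, 0) + ((0, h, 0, 0, 0) + ((0, 0, q, 0, 0) + ((0, 0, 0, s, 0) + (0, 0, 0, 0, w)))) \<in> V"
  by (intro subspace_add[OF V(1)] G1 G2 G3 G4 G5 mem)
 then show "y \<in> V" by (simp add: y_eq)
qed

lemma X1_in_closure_cos: "e \<in> X1 L ==> e \<in> closure (span {cosc k |k. True})"
 and X1_in_closure_sin: "e \<in> X1 L ==> e \<in> closure (span {sinc k |k. True})"
 and X2_in_closure: "e \<in> X2 L ==> e \<in> closure (span {S.gen k j |k j. True})"
 using C.X1_dense S.X1_dense S.X2_dense by auto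

text \<open>A constant history has \<open>\<zeta>' = 0\<close>, so switching on one amplitude at a
  time gives the generators of the first four components. The histories
  \<open>r ^ Suc j / real (Suc j)\<close> vanish at 0 and give those of the last one.\<close>

theorem strong_data_dense:
 assumes "y0 \<in> X"
 shows "y0 \<in> closure {y 0 |y. strong y}"
proof -
 let ?S = "{y 0 |y. strong y}"
 define V where "V = closure ?S"
 have V: "subspace V" "closed V" unfolding V_def by (auto intro: subspace_closure subspace_strong_data)
 have om: "S.om k > 0" for k by (rule S_om_pos)
 have z0: "cls (\<lambda>p. ind2 L p * (g p * 0)) = 0" for g by (simp add: cls_zero)
 have sol: "((S.om k * F0) *\<^sub>R cosc k, (S.om k * H0) *\<^sub>R cosc k, - (S.om k * Q0) *\<^sub>R sinc k,
  - (S.om k * S0) *\<^sub>R sinc k, cls (\<lambda>p. ind2 L p * (sin (S.om k * fst p) * \<zeta>' (snd p)))) \<in> V"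
  if "\<And>r. (\<zeta> has_real_derivative \<zeta>' r) (at r)" "continuous_on UNIV \<zeta>'" "\<zeta> 0 = F0" for k F0 H0 Q0 S0 \<zeta> \<zeta>'
 proof -
  from mode_solution[OF that, of k H0 Q0 S0] obtain y where y: "strong y" "y 0 = ((S.om k * F0) *\<^sub>R cosc k, (S.om k * H0) *\<^sub>R cosc k, - (S.om k * Q0) *\<^sub>R sinc k,
   - (S.om k * S0) *\<^sub>R sinc k, cls (\<lambda>p. ind2 L p * (sin (S.om k * fst p) * \<zeta>' (snd p))))"
   by blast
  have "y 0 \<in> ?S" using y(1) by blast
  then have "y 0 \<in> V" unfolding V_def by (rule subsetD[OF closure_subset])
  then show ?thesis by (simp only: y(2))
 qed
 have c: "((\<lambda>_. k) has_real_derivative 0) (at r)" for k r :: real by simp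
 have g1: "(cosc k, 0, 0, 0, 0) \<in> V" for k
  using sol[OF c continuous_on_const refl, of k "1 / S.om k" 0 0 0] om[of k] by (simp add: cls_zero)
 have g2: "(0, cosc k, 0, 0, 0) \<in> V" for k
  using sol[OF c continuous_on_const refl, of k 0 "1 / S.om k" 0 0] om[of k] by (simp add: cls_zero)
 have g3: "(0, 0, sinc k, 0, 0) \<in> V" for k
  using sol[OF c continuous_on_const refl, of k 0 0 "- 1 / S.om k" 0] om[of k] by (simp add: cls_zero)
 have g4: "(0, 0, 0, sinc k, 0) \<in> V" for k
  using sol[OF c continuous_on_const refl, of k 0 0 0 "- 1 / S.om k"] om[of k] by (simp add: cls_zero)
 have g5: "(0, 0, 0, 0, S.gen k j) \<in> V" for k j
 proof -
  have d: "((\<lambda>r. r ^ Suc j / real (Suc j)) has_real_derivative r ^ j) (at r)" for r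
   using DERIV_cdivide[OF DERIV_pow[of "Suc j" r UNIV], of "real (Suc j)"] by (simp del: of_nat_Suc power_Suc)
  have "continuous_on UNIV (\<lambda>r :: real. r ^ j)" by (intro continuous_intros)
  from sol[OF d this, of 0 k 0 0 0] show ?thesis by (simp add: S_gen_eq)
 qed
 have "X \<subseteq> V"
 proof (rule subspace_of_components[OF V])
  show "(e, 0, 0, 0, 0) \<in> V" if "e \<in> X1 L" for e
   by (rule bounded_linear_maps_closure_span[OF inclusions(1) V(2,1) _ X1_in_closure_cos[OF that]]) (use g1 in auto)
  show "(0, e, 0, 0, 0) \<in> V" if "e \<in> X1 L" for e
   by (rule bounded_linear_maps_closure_span[OF inclusions(2) V(2,1) _ X1_in_closure_cos[OF that]]) (use g2 in auto)
  show "(0, 0, e, 0, 0) \<in> V" if "e \<in> X1 L" for e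
   by (rule bounded_linear_maps_closure_span[OF inclusions(3) V(2,1) _ X1_in_closure_sin[OF that]]) (use g3 in auto)
  show "(0, 0, 0, e, 0) \<in> V" if "e \<in> X1 L" for e
   by (rule bounded_linear_maps_closure_span[OF inclusions(4) V(2,1) _ X1_in_closure_sin[OF that]]) (use g4 in auto)
  show "(0, 0, 0, 0, e) \<in> V" if "e \<in> X2 L" for e
   by (rule bounded_linear_maps_closure_span[OF inclusions(5) V(2,1) _ X2_in_closure[OF that]]) (use g5 in auto)
 qed
 with assms show ?thesis by (auto simp: V_def)
qed

lemma sin_profile_sq_int:
 assumes "continuous_on UNIV \<psi>"
 shows "(\<lambda>p. ind2 L p * (sin (S.om k * fst p) * \<psi> (snd p))) \<in> sqi"
 by (rule S.cont_sq_int) (intro continuous_intros continuous_on_compose2[OF assms], auto)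

lemma Kr_sin_profile:
 assumes \<Psi>: "\<And>r. (\<Psi> has_real_derivative \<psi> r) (at r)" and \<psi>: "continuous_on UNIV \<psi>" and 0: "\<Psi> 0 = 0"
 shows "Kr (cls (\<lambda>p. ind2 L p * (sin (S.om k * fst p) * \<psi> (snd p)))) = cls (\<lambda>p. ind2 L p * (sin (S.om k * fst p) * \<Psi> (snd p)))"
proof -
 have \<Psi>c: "continuous_on UNIV \<Psi>" using \<Psi> by (intro DERIV_continuous_on) (auto intro: has_field_derivative_at_within)
 obtain Z where Z: "\<And>r. r \<in> {0..1} ==> \<bar>\<psi> r\<bar> \<le> Z"
  using continuous_abs_bounded[OF continuous_on_subset[OF \<psi> subset_UNIV], of 0 1] by blast
 have "Kr (cls (\<lambda>p. ind2 L p * (sin (S.om k * fst p) * \<psi> (snd p)))) =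
  cls (\<lambda>p. ind 1 (snd p) * prim (\<lambda>s. ind2 L (fst p, s) * (sin (S.om k * fst p) * \<psi> s)) (snd p))"
  by (subst Kr_cls(1)[OF sin_profile_sq_int[OF \<psi>]]) simp
 also have "\<dots> = cls (\<lambda>p. ind2 L p * (sin (S.om k * fst p) * \<Psi> (snd p)))"
 proof (intro arg_cong[of _ _ cls] ext)
  fix p :: "real \<times> real"
  show "ind 1 (snd p) * prim (\<lambda>s. ind2 L (fst p, s) * (sin (S.om k * fst p) * \<psi> s)) (snd p) =
   ind2 L p * (sin (S.om k * fst p) * \<Psi> (snd p))"
  proof (cases "snd p \<in> {0<..<1}")
   case True
   have "prim (\<lambda>s. ind2 L (fst p, s) * (sin (S.om k * fst p) * \<psi> s)) (snd p) =
    (LINT s|lborel. (ind L (fst p) * sin (S.om k * fst p)) * (indicator {0<..<snd p} s * \<psi> s))"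
    unfolding prim_def using True
    by (intro lint_cong) (auto simp: ind2_def split: split_indicator)
   also have "\<dots> = (ind L (fst p) * sin (S.om k * fst p)) * (LINT s|lborel. indicator {0<..<snd p} s * \<psi> s)"
    by (rule integral_mult_right_zero)
   also have "(LINT s|lborel. indicator {0<..<snd p} s * \<psi> s) = \<Psi> (snd p) - \<Psi> 0"
    by (rule lborel_integral_ftc[of _ "{}" _ _ Z])
     (use True \<Psi> Z in \<open>auto intro: continuous_on_subset[OF \<Psi>c] borel_measurable_continuous_onI[OF \<psi>]\<close>)
   finally show ?thesis using True 0 by (simp add: ind2_def[of L p])
  qed (simp add: ind2_def)
 qed
 finally show ?thesis .
qed

text \<open>This becomes density of the domain. Histories in the range of \<open>Kr\<close> vanish
  at \<open>r = 0\<close>, so one that is constant in \<open>r\<close> is reached only as a limit; a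
  velocity mode carries such a constant history with it, which is then subtracted.\<close>

theorem range_dense:
 assumes "u \<in> X"
 shows "u \<in> closure (Bop ` X)"
proof -
 define V where "V = closure (Bop ` X)"
 have V: "subspace V" "closed V" unfolding V_def
  by (auto intro!: subspace_closure linear_subspace_image subspace_X bounded_linear.linear[OF bounded_linear_Bop])
 have BV: "Bop y \<in> V" if "y \<in> X" for y using subsetD[OF closure_subset imageI[OF that]] unfolding V_def .
 have om: "S.om k > 0" for k by (rule S_om_pos)
 have zero: "J0 L 0 = 0" "JL L 0 = 0" "Kr 0 = 0"
  using bounded_linear_ops[OF L] linear_0 bounded_linear.linear by blast+
 have mem: "0 \<in> X1 L" "0 \<in> X2 L" "cosc k \<in> X1 L" "sinc k \<in> X1 L" for k
  using subspace_0[OF subspace_X1] subspace_0[OF subspace_X2] sin_sq1 cos_sq1 by (auto simp: X1_def)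
 have prof: "(0, 0, 0, 0, cls (\<lambda>p. ind2 L p * (sin (S.om k * fst p) * \<Psi> (snd p)))) \<in> V"
  if "\<And>r. (\<Psi> has_real_derivative \<psi> r) (at r)" "continuous_on UNIV \<psi>" "\<Psi> 0 = 0" for \<Psi> \<psi> k
 proof -
  let ?w = "cls (\<lambda>p. ind2 L p * (sin (S.om k * fst p) * \<psi> (snd p)))"
  have "?w \<in> X2 L" using cls_ind2_X2[OF sin_profile_sq_int[OF that(2)], of L k] by (simp add: ind2_idem)
  then have "Bop (0, 0, 0, 0, ?w) \<in> V" by (intro BV) (auto simp: X_def mem)
  then show ?thesis by (simp add: zero Kr_sin_profile[OF that])
 qed
 have gS: "(0, 0, 0, 0, S.gen k (Suc j)) \<in> V" for k j
 proof -
  have "((\<lambda>r. r ^ Suc j) has_real_derivative real (Suc j) * r ^ j) (at r)" for r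
   using DERIV_pow[of "Suc j" r UNIV] by (simp del: of_nat_Suc power_Suc)
  moreover have "continuous_on UNIV (\<lambda>r :: real. real (Suc j) * r ^ j)" by (intro continuous_intros)
  ultimately show ?thesis using prof[of "\<lambda>r. r ^ Suc j" "\<lambda>r. real (Suc j) * r ^ j" k] by (simp add: S_gen_eq)
 qed
 have g0: "(0, 0, 0, 0, S.gen k 0) \<in> V" for k
 proof -
  \<comment> \<open>\<open>1 - (1 - r) ^ Suc n\<close> vanishes at \<open>r = 0\<close> and
    increases to 1 for every \<open>0 < r < 1\<close>, so these admissible histories approximate the
    constant one.\<close>
  let ?g = "\<lambda>n p. ind2 L p * (sin (S.om k * fst p) * (1 - (1 - snd p) ^ Suc n))"
  have c: "continuous_on UNIV (\<lambda>r :: real. 1 - (1 - r) ^ Suc n)" for n by (intro continuous_intros)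
  have "(\<lambda>n. cls (?g n)) \<longlonglongrightarrow> cls (\<lambda>p. ind2 L p * (sin (S.om k * fst p) * snd p ^ 0))"
  proof (rule cls_tendsto[THEN conjunct2])
   show "?g n \<in> borel_fun" for n using sin_profile_sq_int[OF c, of k n] by (simp add: sq_int_def)
   show "(\<lambda>p. ind2 L p * (sin (S.om k * fst p) * snd p ^ 0)) \<in> borel_fun"
    using sin_profile_sq_int[OF continuous_on_const, of k 1] by (simp add: sq_int_def)
   have "(\<lambda>n. ?g n p) \<longlonglongrightarrow> ind2 L p * (sin (S.om k * fst p) * snd p ^ 0)" for p
   proof (cases "snd p \<in> {0<..<1}")
    case True
    then have "(\<lambda>n. (1 - snd p) ^ n) \<longlonglongrightarrow> 0" by (intro LIMSEQ_realpow_zero) auto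
    then have "(\<lambda>n. (1 - snd p) ^ Suc n) \<longlonglongrightarrow> 0" by (rule LIMSEQ_Suc)
    then have "(\<lambda>n. ?g n p) \<longlonglongrightarrow> ind2 L p * (sin (S.om k * fst p) * (1 - 0))" by (intro tendsto_intros)
    then show ?thesis by simp
   qed (simp add: ind2_def)
   then show "AE p in lborel. (\<lambda>n. ?g n p) \<longlonglongrightarrow> ind2 L p * (sin (S.om k * fst p) * snd p ^ 0)" by simp
   have "\<bar>?g n p\<bar> \<le> ind2 L p" for n p
   proof (cases "snd p \<in> {0<..<1}")
    case True
    then have "0 \<le> (1 - snd p) ^ Suc n" "(1 - snd p) ^ Suc n \<le> 1" by (auto intro!: power_le_one simp del: power_Suc)
    then have "\<bar>sin (S.om k * fst p) * (1 - (1 - snd p) ^ Suc n)\<bar> \<le> 1 * 1"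
     unfolding abs_mult by (intro mult_mono) auto
    then have "\<bar>ind2 L p\<bar> * \<bar>sin (S.om k * fst p) * (1 - (1 - snd p) ^ Suc n)\<bar> \<le> \<bar>ind2 L p\<bar> * 1"
     by (intro mult_left_mono) auto
    then show ?thesis unfolding abs_mult[of "ind2 L p"] by (simp add: ind2_def)
   qed (simp add: ind2_def)
   then show "AE p in lborel. \<bar>?g n p\<bar> \<le> ind2 L p" for n by simp
   show "ind2 L \<in> sqi" by (rule S.ind2_sq_int)
  qed
  then have lim: "(\<lambda>n. (0, 0, 0, 0, cls (?g n)) :: est) \<longlonglongrightarrow> (0, 0, 0, 0, S.gen k 0)"
   unfolding S_gen_eq by (intro tendsto_intros)
  have "(0, 0, 0, 0, cls (?g n)) \<in> V" for n
  proof (rule prof[of "\<lambda>r. 1 - (1 - r) ^ Suc n" "\<lambda>r. real (Suc n) * (1 - r) ^ n"])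
   show "((\<lambda>r. 1 - (1 - r) ^ Suc n) has_real_derivative real (Suc n) * (1 - r) ^ n) (at r)" for r
    using DERIV_diff[OF DERIV_const[of 1] DERIV_power_Suc[OF DERIV_diff[OF DERIV_const[of 1] DERIV_ident[of "at r"]], of n]]
    by (simp del: power_Suc)
  qed (auto intro!: continuous_intros)
  then show ?thesis using closed_sequentially[OF V(2) _ lim] by blast
 qed
 have g: "(0, 0, 0, 0, S.gen k j) \<in> V" for k j using g0 gS by (cases j) auto
 have G5: "(0, 0, 0, 0, e) \<in> V" if "e \<in> X2 L" for e
  by (rule bounded_linear_maps_closure_span[OF inclusions(5) V(2,1) _ X2_in_closure[OF that]]) (use g in auto)
 have sc: "J0 L (S.om k *\<^sub>R cosc k) = sinc k" "JL L ((- S.om k) *\<^sub>R sinc k) = cosc k" for k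
  using om[of k] by (simp_all only: bounded_linear.linear[OF bounded_linear_ops(1)[OF L], THEN linear_scale]
    bounded_linear.linear[OF bounded_linear_ops(2)[OF L], THEN linear_scale] J0_cosc JL_sinc) simp_all
 have g1: "(sinc k, 0, 0, 0, 0) \<in> V" for k
 proof -
  have "Bop (S.om k *\<^sub>R cosc k, 0, 0, 0, 0) - (0, 0, 0, 0, sinc k) \<in> V"
   by (intro subspace_diff[OF V(1)] BV G5 X1_X2 mem) (auto simp: X_def mem intro!: subspace_scale[OF subspace_X1])
  then show ?thesis unfolding Bop.simps sc zero diff_Pair by simp
 qed
 have g2: "(0, sinc k, 0, 0, 0) \<in> V" for k
  using BV[of "(0, S.om k *\<^sub>R cosc k, 0, 0, 0)"] by (simp add: zero sc X_def mem subspace_scale[OF subspace_X1])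
 have g3: "(0, 0, cosc k, 0, 0) \<in> V" for k
  using BV[of "(0, 0, (- S.om k) *\<^sub>R sinc k, 0, 0)"] unfolding Bop.simps sc zero
  by (simp add: X_def mem subspace_neg[OF subspace_X1] subspace_scale[OF subspace_X1])
 have g4: "(0, 0, 0, cosc k, 0) \<in> V" for k
  using BV[of "(0, 0, 0, (- S.om k) *\<^sub>R sinc k, 0)"] unfolding Bop.simps sc zero
  by (simp add: X_def mem subspace_neg[OF subspace_X1] subspace_scale[OF subspace_X1])
 have "X \<subseteq> V"
 proof (rule subspace_of_components[OF V])
  show "(e, 0, 0, 0, 0) \<in> V" if "e \<in> X1 L" for e
   by (rule bounded_linear_maps_closure_span[OF inclusions(1) V(2,1) _ X1_in_closure_sin[OF that]]) (use g1 in auto)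
  show "(0, e, 0, 0, 0) \<in> V" if "e \<in> X1 L" for e
   by (rule bounded_linear_maps_closure_span[OF inclusions(2) V(2,1) _ X1_in_closure_sin[OF that]]) (use g2 in auto)
  show "(0, 0, e, 0, 0) \<in> V" if "e \<in> X1 L" for e
   by (rule bounded_linear_maps_closure_span[OF inclusions(3) V(2,1) _ X1_in_closure_cos[OF that]]) (use g3 in auto)
  show "(0, 0, 0, e, 0) \<in> V" if "e \<in> X1 L" for e
   by (rule bounded_linear_maps_closure_span[OF inclusions(4) V(2,1) _ X1_in_closure_cos[OF that]]) (use g4 in auto)
  show "(0, 0, 0, 0, e) \<in> V" if "e \<in> X2 L" for e by (rule G5[OF that])
 qed
 with assms show ?thesis by (auto simp: V_def)
qed

end

section \<open>Weak derivatives on an interval\<close>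

lemma borel_measurable_lebesgue_AE:
 fixes f g :: "'a::euclidean_space => real"
 assumes g: "g \<in> borel_fun" and eq: "AE x in lborel. f x = g x"
 shows "f \<in> borel_measurable lebesgue"
proof -
 have g': "g \<in> borel_measurable lebesgue" using g by (intro measurable_completion) simp
 show ?thesis
 proof (rule measurableI)
  fix A :: "real set" assume A: "A \<in> sets borel"
  show "f -` A \<inter> space lebesgue \<in> sets lebesgue"
  proof (rule completion.in_sets_AE[OF _ measurable_sets[OF g' A]])
   show "AE x in lebesgue. (x \<in> g -` A \<inter> space lebesgue) = (x \<in> f -` A \<inter> space lebesgue)"
    unfolding AE_completion_iff using eq by eventually_elim simp
  qed simp
 qed simp
qed

lemma AE_lebesgue_on:
 assumes "S \<in> sets borel"
 shows "(AE x in lebesgue_on S. P x) \<longleftrightarrow> (AE x\<in>S in lborel. P x)"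
 using assms by (subst AE_restrict_space_iff) (auto simp: AE_completion_iff)

lemma borel_measurable_lebesgue_on_AE:
 fixes f g :: "'a::euclidean_space => real"
 assumes S: "S \<in> sets borel" and g: "g \<in> borel_fun" and eq: "AE x\<in>S in lborel. f x = g x"
 shows "f \<in> borel_measurable (lebesgue_on S)"
proof (subst borel_measurable_restrict_space_iff)
 show "S \<inter> space lebesgue \<in> sets lebesgue" using S by simp
 show "(\<lambda>x. indicator S x *\<^sub>R f x) \<in> borel_measurable lebesgue"
 proof (rule borel_measurable_lebesgue_AE)
  show "(\<lambda>x. indicator S x * g x) \<in> borel_fun" using S g by measurable
  show "AE x in lborel. indicator S x *\<^sub>R f x = indicator S x * g x"
   using eq by eventually_elim (simp split: split_indicator)
 qed
qed

lemma integral_lebesgue_on_AE: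
 fixes f g :: "'a::euclidean_space => real"
 assumes S: "S \<in> sets borel" and g: "g \<in> borel_fun" and eq: "AE x\<in>S in lborel. f x = g x"
 shows "(LINT x|lebesgue_on S. f x) = (LINT x|lborel. indicator S x * g x)"
proof -
 have m: "(\<lambda>x. indicator S x * g x) \<in> borel_fun" using S g by measurable
 have ae: "AE x in lborel. indicator S x *\<^sub>R f x = indicator S x * g x"
  using eq by eventually_elim (simp split: split_indicator)
 have "(LINT x|lebesgue_on S. f x) = (LINT x|lebesgue. indicator S x *\<^sub>R f x)"
  using S by (intro integral_restrict_space) simp
 also have "\<dots> = (LINT x|lebesgue. indicator S x * g x)"
  using ae by (intro integral_cong_AE borel_measurable_lebesgue_AE[OF m] measurable_completion)
   (auto simp: AE_completion_iff m)
 also have "\<dots> = (LINT x|lborel. indicator S x * g x)" by (rule integral_completion) (simp add: m)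
 finally show ?thesis .
qed

text \<open>A Lebesgue measurable function agrees almost everywhere with a Borel function. This
  leads from the spaces of the statement to Borel functions on the whole space.\<close>

lemma L2_iff:
 fixes S :: "'a::euclidean_space set"
 assumes S: "S \<in> sets borel"
 shows "u \<in> L2 S \<longleftrightarrow> (\<exists>h\<in>sqi. AE x\<in>S in lborel. u x = h x)"
proof
 have S': "S \<inter> space lebesgue \<in> sets lebesgue" using S by simp
 assume u: "u \<in> L2 S"
 then have um: "(\<lambda>x. indicator S x *\<^sub>R u x) \<in> borel_measurable lebesgue"
  using borel_measurable_restrict_space_iff[OF S', of u] by (simp add: L2_def)
 then obtain g where g: "g \<in> borel_measurable lborel" "AE x in lborel. indicator S x *\<^sub>R u x = g x"
  using completion_ex_borel_measurable_real[of "\<lambda>x. indicator S x *\<^sub>R u x" lborel] by blast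
 have g': "(\<lambda>x. (g x)\<^sup>2) \<in> borel_measurable lborel" using g(1) by measurable
 have "integrable lebesgue (\<lambda>x. indicator S x *\<^sub>R (u x)\<^sup>2)"
  using u integrable_restrict_space[OF S', of "\<lambda>x. (u x)\<^sup>2"] by (simp add: L2_def)
 moreover have "AE x in lebesgue. indicator S x *\<^sub>R (u x)\<^sup>2 = (g x)\<^sup>2"
  unfolding AE_completion_iff using g(2) by eventually_elim (auto split: split_indicator)
 ultimately have "integrable lebesgue (\<lambda>x. (g x)\<^sup>2)"
  by (rule integrable_cong_AE_imp[OF _ measurable_completion[OF g']])
 then have "g \<in> sqi" using g(1) g' by (simp add: sq_int_def integrable_completion)
 moreover have "AE x\<in>S in lborel. u x = g x" using g(2) by eventually_elim auto
 ultimately show "\<exists>h\<in>sqi. AE x\<in>S in lborel. u x = h x" by blast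
next
 have S': "S \<inter> space lebesgue \<in> sets lebesgue" using S by simp
 assume "\<exists>h\<in>sqi. AE x\<in>S in lborel. u x = h x"
 then obtain h where h: "h \<in> sqi" "AE x\<in>S in lborel. u x = h x" by blast
 have hm: "h \<in> borel_fun" using h(1) by (simp add: sq_int_def)
 have um: "u \<in> borel_measurable (lebesgue_on S)" by (rule borel_measurable_lebesgue_on_AE[OF S hm h(2)])
 have "integrable lborel (\<lambda>x. indicator S x * (h x)\<^sup>2)"
  by (rule Bochner_Integration.integrable_bound[OF sq_int_integrable_sq[OF h(1)]])
   (use S hm in \<open>auto split: split_indicator\<close>)
 then have "integrable lebesgue (\<lambda>x. indicator S x * (h x)\<^sup>2)"
  using S hm by (subst integrable_completion) auto
 moreover have "AE x in lebesgue. indicator S x * (h x)\<^sup>2 = indicator S x *\<^sub>R (u x)\<^sup>2"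
  unfolding AE_completion_iff using h(2) by eventually_elim (auto split: split_indicator)
 moreover have "(\<lambda>x. indicator S x *\<^sub>R (u x)\<^sup>2) \<in> borel_measurable lebesgue"
  using borel_measurable_restrict_space_iff[OF S', of "\<lambda>x. (u x)\<^sup>2"] um by simp
 ultimately have "integrable lebesgue (\<lambda>x. indicator S x *\<^sub>R (u x)\<^sup>2)"
  using integrable_cong_AE_imp by blast
 then show "u \<in> L2 S" using integrable_restrict_space[OF S', of "\<lambda>x. (u x)\<^sup>2"] um by (simp add: L2_def)
qed

lemma Ioo_borel: "{a<..<b :: real} \<in> sets borel" by simp

subsection \<open>Test functions\<close>

text \<open>The flat function \<open>exp (- 1 / x)\<close>, with powers of \<open>1 / x\<close> as
  factors because differentiation produces them.\<close>

definition germ :: "nat => real => real" where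
 "germ k x = (if x > 0 then (1 / x) ^ k * exp (- 1 / x) else 0)"

text \<open>The series of \<open>exp (1 / x)\<close> exceeds its single term of order
  \<open>k + 2\<close>. The quadratic decay gives derivative 0 at the origin.\<close>

lemma germ_bound: "\<bar>germ k x\<bar> \<le> fact (k + 2) * x\<^sup>2"
proof (cases "x > 0")
 case True
 have s: "(\<lambda>n. (1 / x) ^ n /\<^sub>R fact n) sums exp (1 / x)" by (rule exp_converges)
 have "(\<Sum>n\<in>{k + 2}. (1 / x) ^ n /\<^sub>R fact n) \<le> (\<Sum>n. (1 / x) ^ n /\<^sub>R fact n)"
  by (rule sum_le_suminf[OF sums_summable[OF s]]) (use True in auto)
 then have "inverse (fact (k + 2)) * (1 / x) ^ (k + 2) \<le> exp (1 / x)" using sums_unique[OF s] by simp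
 from mult_left_mono[OF this, of "fact (k + 2)"] have "(1 / x) ^ (k + 2) \<le> fact (k + 2) * exp (1 / x)"
  by (simp only: mult.assoc[symmetric] fact_nonzero right_inverse not_False_eq_True mult_1 fact_ge_zero)
 then have "(1 / x) ^ (k + 2) * exp (- 1 / x) \<le> fact (k + 2) * exp (1 / x) * exp (- 1 / x)" by (rule mult_right_mono) simp
 also have "\<dots> = fact (k + 2)" by (simp add: exp_minus mult.assoc)
 finally have "x\<^sup>2 * ((1 / x) ^ (k + 2) * exp (- 1 / x)) \<le> x\<^sup>2 * fact (k + 2)" by (rule mult_left_mono) simp
 moreover have "x\<^sup>2 * ((1 / x) ^ (k + 2) * exp (- 1 / x)) = germ k x"
  using True by (simp add: germ_def power_add power2_eq_square)
 moreover have "0 \<le> germ k x" by (simp add: germ_def)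
 ultimately show ?thesis by (simp add: mult.commute)
qed (simp add: germ_def)

lemma germ_derivative: "(germ k has_real_derivative germ (k + 2) x - real k * germ (k + 1) x) (at x)"
proof -
 consider "x > 0" | "x < 0" | "x = 0" by linarith
 then show ?thesis
 proof cases
  case 1
  have "((\<lambda>x. (1 / x) ^ k * exp (- 1 / x)) has_real_derivative germ (k + 2) x - real k * germ (k + 1) x) (at x)"
  proof -
   have i: "((\<lambda>x. 1 / x) has_real_derivative - ((1 / x)\<^sup>2)) (at x)"
    using 1 by (auto intro!: derivative_eq_intros simp: power2_eq_square)
   have e: "((\<lambda>x. exp (- 1 / x)) has_real_derivative exp (- 1 / x) * (1 / x)\<^sup>2) (at x)"
    using 1 by (auto intro!: derivative_eq_intros simp: power2_eq_square)
   show ?thesis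
   proof (cases k)
    case 0
    then show ?thesis using e 1 by (simp add: germ_def power2_eq_square)
   next
    case (Suc n)
    show ?thesis
     using DERIV_mult[OF DERIV_power_Suc[OF i, of n] e] 1
     by (simp add: Suc germ_def algebra_simps power2_eq_square)
   qed
  qed
  then show ?thesis
   by (rule has_field_derivative_transform_within_open[of _ _ _ "{0<..}"]) (use 1 in \<open>auto simp: germ_def\<close>)
 next
  case 2
  have "((\<lambda>x. 0) has_real_derivative germ (k + 2) x - real k * germ (k + 1) x) (at x)" using 2 by (simp add: germ_def)
  then show ?thesis
   by (rule has_field_derivative_transform_within_open[of _ _ _ "{..<0}"]) (use 2 in \<open>auto simp: germ_def\<close>)
 next
  case 3
  have "((\<lambda>h. germ k h / h) \<longlongrightarrow> 0) (at 0)"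
  proof (rule Lim_null_comparison[of _ "\<lambda>h. fact (k + 2) * \<bar>h\<bar>"])
   have "norm (germ k h / h) \<le> fact (k + 2) * \<bar>h\<bar>" for h
    using germ_bound[of k h] by (cases "h = 0") (auto simp: divide_le_eq power2_eq_square mult.assoc)
   then show "\<forall>\<^sub>F h in at 0. norm (germ k h / h) \<le> fact (k + 2) * \<bar>h\<bar>" by simp
   have "((\<lambda>h :: real. fact (k + 2) * \<bar>h\<bar>) \<longlongrightarrow> fact (k + 2) * \<bar>0\<bar>) (at 0)" by (intro tendsto_intros)
   then show "((\<lambda>h :: real. fact (k + 2) * \<bar>h\<bar>) \<longlongrightarrow> 0) (at 0)" by simp
  qed
  then show ?thesis using 3 by (simp add: has_field_derivative_iff germ_def)
 qed
qed

text \<open>An algebra closed under differentiation, so its members are smooth without any formula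
  for higher derivatives.\<close>

inductive_set germs :: "(real => real) set" where
 const: "(\<lambda>_. c) \<in> germs"
| germ: "(\<lambda>x. germ k (m * x + s)) \<in> germs"
| add: "f \<in> germs ==> g \<in> germs ==> (\<lambda>x. f x + g x) \<in> germs"
| mult: "f \<in> germs ==> g \<in> germs ==> (\<lambda>x. f x * g x) \<in> germs"

lemma germs_derivative: "f \<in> germs ==> \<exists>g\<in>germs. \<forall>x. (f has_real_derivative g x) (at x)"
proof (induction rule: germs.induct)
 case (const c)
 show ?case by (rule bexI[of _ "\<lambda>_. 0"]) (auto intro: germs.const)
next
 case (germ k m s)
 let ?g = "\<lambda>x. m * germ (k + 2) (m * x + s) + (- (m * real k)) * germ (k + 1) (m * x + s)"
 have "((\<lambda>x. germ k (m * x + s)) has_real_derivative ?g x) (at x)" for x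
  by (rule DERIV_cong[OF DERIV_chain2[OF germ_derivative]]) (auto intro!: derivative_eq_intros simp: algebra_simps)
 moreover have "?g \<in> germs" by (intro germs.intros)
 ultimately show ?case by (intro bexI[of _ ?g] allI)
next
 case (add f g)
 then obtain f' g' where f': "f' \<in> germs" "\<And>x. (f has_real_derivative f' x) (at x)"
  and g': "g' \<in> germs" "\<And>x. (g has_real_derivative g' x) (at x)" by blast
 show ?case by (rule bexI[of _ "\<lambda>x. f' x + g' x"]) (auto intro: DERIV_add f' g' germs.add)
next
 case (mult f g)
 then obtain f' g' where f': "f' \<in> germs" "\<And>x. (f has_real_derivative f' x) (at x)"
  and g': "g' \<in> germs" "\<And>x. (g has_real_derivative g' x) (at x)" by blast
 show ?case
  by (rule bexI[of _ "\<lambda>x. f' x * g x + g' x * f x"])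
   (intro allI DERIV_mult f' g', intro germs.add germs.mult f' g' mult.hyps)
qed

lemma smooth_closed_class:
 assumes step: "\<And>f. f \<in> A ==> \<exists>g\<in>A. \<forall>x. (f has_real_derivative g x) (at x)" and f: "f \<in> A"
 shows "(deriv ^^ n) f differentiable (at x)"
proof -
 have "(deriv ^^ n) f \<in> A"
 proof (induction n)
  case (Suc n)
  obtain g where g: "g \<in> A" "\<And>x. ((deriv ^^ n) f has_real_derivative g x) (at x)" using step[OF Suc] by blast
  then have "deriv ((deriv ^^ n) f) = g" by (intro ext DERIV_imp_deriv)
  then show ?case using g(1) by simp
 qed (simp add: f)
 then show ?thesis using step real_differentiable_def by blast
qed

text \<open>Two flat functions, rising at \<open>s\<close> and falling at \<open>t\<close>; the
  factor \<open>Suc n\<close> makes the product tend to the indicator of the interval. The sums with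
  a negated term match the shape \<open>m * x + s\<close> in \<open>germs\<close>.\<close>

definition bump :: "nat => real => real => real => real" where
 "bump n s t x = germ 0 (real (Suc n) * x + - (real (Suc n) * s)) * germ 0 (- real (Suc n) * x + real (Suc n) * t)"

lemma bump_germs: "bump n s t \<in> germs"
 unfolding bump_def[abs_def] by (intro germs.intros)

lemma bump_bounds: "0 \<le> bump n s t x" "bump n s t x \<le> indicator {s<..<t} x"
proof -
 have g: "0 \<le> germ 0 y" "germ 0 y \<le> 1" for y by (auto simp: germ_def)
 show "0 \<le> bump n s t x" unfolding bump_def by (intro mult_nonneg_nonneg g)
 have "bump n s t x = 0" if "x \<le> s \<or> t \<le> x"
 proof -
  have "real (Suc n) * (x - s) \<le> 0 \<or> real (Suc n) * (t - x) \<le> 0"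
   using that by (auto simp: mult_le_0_iff simp del: of_nat_Suc)
  then show ?thesis unfolding bump_def germ_def by (auto simp: algebra_simps)
 qed
 moreover have "bump n s t x \<le> 1 * 1" unfolding bump_def by (intro mult_mono g) simp
 ultimately show "bump n s t x \<le> indicator {s<..<t} x" by (auto split: split_indicator)
qed

lemma bump_tendsto: "(\<lambda>n. bump n s t x) \<longlonglongrightarrow> indicator {s<..<t} x"
proof (cases "s < x \<and> x < t")
 case True
 have *: "(\<lambda>n. germ 0 (real (Suc n) * y)) \<longlonglongrightarrow> 1" if "y > 0" for y
 proof -
  have "(\<lambda>n. exp (- (1 / y) * inverse (real (Suc n)))) \<longlonglongrightarrow> exp (- (1 / y) * 0)"
   by (intro tendsto_intros LIMSEQ_inverse_real_of_nat)
  moreover have "germ 0 (real (Suc n) * y) = exp (- (1 / y) * inverse (real (Suc n)))" for n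
   using that by (simp add: germ_def field_simps del: of_nat_Suc)
  ultimately show ?thesis by simp
 qed
 have "(\<lambda>n. germ 0 (real (Suc n) * (x - s)) * germ 0 (real (Suc n) * (t - x))) \<longlonglongrightarrow> 1 * 1"
  using True by (intro tendsto_mult *) auto
 moreover have "bump n s t x = germ 0 (real (Suc n) * (x - s)) * germ 0 (real (Suc n) * (t - x))" for n
  by (simp add: bump_def algebra_simps del: of_nat_Suc)
 ultimately show ?thesis using True by simp
next
 case False
 then have "bump n s t x = 0" for n using bump_bounds[of n s t x] by (auto split: split_indicator)
 then show ?thesis using False by auto
qed

lemma germs_continuous: "f \<in> germs ==> continuous_on S f"
proof -
 assume "f \<in> germs"
 then obtain g where "\<And>x. (f has_real_derivative g x) (at x)" using germs_derivative by blast
 then show ?thesis by (meson DERIV_isCont continuous_at_imp_continuous_on)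
qed

lemma bump_measurable [measurable]: "bump n s t \<in> borel_fun"
 by (rule borel_measurable_continuous_onI[OF germs_continuous[OF bump_germs]])

lemma bump_sq_int: "bump n s t \<in> sqi"
proof (rule sq_int_bound[OF indicator_Ioo_sq_int[of s t]])
 show "AE x in lborel. \<bar>bump n s t x\<bar> \<le> \<bar>indicator {s<..<t} x\<bar>"
  by (rule AE_I2) (metis abs_of_nonneg bump_bounds order_trans)
qed simp

lemma integral_bump_tendsto:
 assumes g: "g \<in> sqi"
 shows "(\<lambda>n. LINT x|lborel. g x * bump n s t x) \<longlonglongrightarrow> (LINT x|lborel. indicator {s<..<t} x * g x)"
proof -
 have [measurable]: "g \<in> borel_fun" using g by (simp add: sq_int_def)
 have "(\<lambda>n. LINT x|lborel. g x * bump n s t x) \<longlonglongrightarrow> (LINT x|lborel. g x * indicator {s<..<t} x)"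
 proof (rule integral_dominated_convergence[where w = "\<lambda>x. \<bar>indicator {s<..<t} x * g x\<bar>"])
  show "integrable lborel (\<lambda>x. \<bar>indicator {s<..<t} x * g x\<bar>)"
   by (intro integrable_abs ind_mult_integrable[OF g])
  show "AE x in lborel. (\<lambda>n. g x * bump n s t x) \<longlonglongrightarrow> g x * indicator {s<..<t} x"
   by (intro AE_I2 tendsto_intros bump_tendsto)
  show "AE x in lborel. norm (g x * bump n s t x) \<le> \<bar>indicator {s<..<t} x * g x\<bar>" for n
  proof (rule AE_I2)
   fix x
   have "\<bar>bump n s t x\<bar> \<le> indicator {s<..<t} x" using bump_bounds[of n s t x] by simp
   then have "\<bar>g x\<bar> * \<bar>bump n s t x\<bar> \<le> \<bar>g x\<bar> * indicator {s<..<t} x" by (rule mult_left_mono) simp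
   then show "norm (g x * bump n s t x) \<le> \<bar>indicator {s<..<t} x * g x\<bar>" by (simp add: abs_mult mult.commute)
  qed
 qed simp_all
 then show ?thesis by (simp add: mult.commute)
qed

text \<open>A primitive of \<open>h\<close> is constant on each side of the support; it is 0 on the
  left by normalisation and 0 on the right because the total integral vanishes.\<close>

lemma germ_primitive_test:
 assumes h: "h \<in> germs" and st: "0 < s" "s < t" "t < l" and supp: "\<And>x. x \<notin> {s<..<t} ==> h x = 0"
  and zero: "(LINT x|lborel. ind l x * h x) = 0"
 shows "\<exists>\<phi>\<in>test_functions 0 l. deriv \<phi> = h"
proof -
 have hc: "continuous_on S h" for S by (rule germs_continuous[OF h])
 have "\<exists>F. \<forall>x :: real. -\<infinity> < ereal x --> ereal x < \<infinity> --> (F has_vector_derivative h x) (at x)"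
  using hc[of UNIV] by (intro einterval_antiderivative) (auto simp: continuous_on_eq_continuous_at)
 then obtain F where F: "\<And>x. (F has_real_derivative h x) (at x)" by (auto simp: has_real_derivative_iff_has_vector_derivative)
 define \<phi> where "\<phi> x = F x - F 0" for x
 have \<phi>: "(\<phi> has_real_derivative h x) (at x)" for x
  unfolding \<phi>_def by (auto intro!: derivative_eq_intros F)
 have const: "\<phi> x = \<phi> y" if "convex S" "S \<inter> {s<..<t} = {}" "x \<in> S" "y \<in> S" for S x y
 proof -
  have "(\<phi> has_field_derivative 0) (at z within S)" if "z \<in> S" for z
  proof -
   have "z \<notin> {s<..<t}" using that \<open>S \<inter> {s<..<t} = {}\<close> by blast
   then show ?thesis using has_field_derivative_at_within[OF \<phi>[of z]] supp[of z] by simp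
  qed
  from has_field_derivative_zero_constant[OF that(1) this] show ?thesis using that(3,4) by auto
 qed
 obtain C where C: "\<And>x. x \<in> {0..l} ==> \<bar>h x\<bar> \<le> C"
  using continuous_abs_bounded[OF hc, of 0 l] by blast
 have \<phi>c: "continuous_on {0..l} \<phi>" by (rule DERIV_continuous_on[OF has_field_derivative_at_within[OF \<phi>]])
 have "\<phi> l - \<phi> 0 = (LINT x|lborel. ind l x * h x)"
  by (rule lborel_integral_ftc[where S = "{}" and C = C, symmetric])
   (use st \<phi> C \<phi>c in \<open>auto intro: borel_measurable_continuous_onI[OF hc]\<close>)
 then have "\<phi> l = 0" "\<phi> 0 = 0" using zero by (auto simp: \<phi>_def)
 then have out: "\<phi> x = 0" if "x \<notin> {s<..<t}" for x
 proof -
  have "{..s} \<inter> {s<..<t} = {}" "{t..} \<inter> {s<..<t} = {}" by auto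
  then show ?thesis using const[of "{..s}" x 0] const[of "{t..}" x l] st that \<open>\<phi> l = 0\<close> \<open>\<phi> 0 = 0\<close>
   by (cases "x \<le> s") auto
 qed
 have "closure {x. \<phi> x \<noteq> 0} \<subseteq> {s..t}"
 proof (rule closure_minimal)
  have "\<phi> x = 0" if "x \<notin> {s..t}" for x by (rule out) (use that in auto)
  then show "{x. \<phi> x \<noteq> 0} \<subseteq> {s..t}" by blast
 qed simp
 moreover from this have "compact (closure {x. \<phi> x \<noteq> 0})"
  by (meson bounded_closed_interval bounded_subset closed_closure compact_eq_bounded_closed)
 \<comment> \<open>The primitive need not belong to \<open>germs\<close>, but its derivative does,
   so adding it to the class keeps closure under differentiation.\<close>
 moreover have "(deriv ^^ n) \<phi> differentiable (at x)" for n x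
 proof (rule smooth_closed_class[where A = "insert \<phi> germs"])
  show "\<exists>g\<in>insert \<phi> germs. \<forall>x. (f has_real_derivative g x) (at x)" if "f \<in> insert \<phi> germs" for f
   using that germs_derivative[of f] \<phi> h by blast
 qed simp
 ultimately have "\<phi> \<in> test_functions 0 l" using st by (fastforce simp: test_functions_def)
 moreover have "deriv \<phi> = h" by (intro ext DERIV_imp_deriv \<phi>)
 ultimately show ?thesis by blast
qed

subsection \<open>Primitives and the du Bois-Reymond lemma\<close>

text \<open>A function with vanishing primitive is orthogonal to the images of all sines under
  \<open>JL\<close>, that is to all cosine modes, and these span a dense subspace.\<close>

lemma prim_zero_imp_zero:
 assumes l: "0 < l" and k: "k \<in> sqi" and 0: "\<And>x. x \<in> {0<..<l} ==> prim k x = 0"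
 shows "AE x\<in>{0<..<l} in lborel. k x = 0"
proof -
 interpret interval l by unfold_locales (rule l)
 let ?u = "cls1 l k"
 have ks: "k \<in> sq1 l" and zs: "(\<lambda>_. 0) \<in> sq1 l" by (auto intro: sq_int_sq1 k sq_int_zero)
 have z: "cls1 l (\<lambda>_. 0) = 0" by (simp add: cls1_def cls_zero)
 have J: "J0 l ?u = 0" unfolding J0_cls1[OF l ks] z[symmetric] by (rule cls1_cong) (rule 0)
 have "inner ?u (cosc j) = 0" for j
  using inner_J0_JL[OF l, of ?u "sinc j"] S_om_pos[of j] by (simp add: J JL_sinc)
 moreover have "?u \<in> closure (span {cosc j |j. True})" using C.X1_dense ks by (auto simp: X1_def)
 moreover have "subspace {0 :: real}" "closed {0 :: real}" by (simp_all add: subspace_0)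
 ultimately have "inner ?u ?u \<in> {0}"
  using bounded_linear_maps_closure_span[OF bounded_linear_inner_right, of "{0}" "{cosc j |j. True}" ?u ?u] by fastforce
 then have "?u = cls1 l (\<lambda>_. 0)" by (simp add: z)
 then show ?thesis using cls1_eq_iff[OF ks zs] by simp
qed

text \<open>The set of interior points where two continuous functions differ is open, and a nonempty
  open set is not null; continuity carries equality to the end points.\<close>

lemma continuous_AE_eq:
 fixes f g :: "real => real"
 assumes l: "0 < l" and c: "continuous_on {0..l} f" "continuous_on {0..l} g"
  and eq: "AE x\<in>{0<..<l} in lborel. f x = g x" and x: "x \<in> {0..l}"
 shows "f x = g x"
proof -
 let ?h = "\<lambda>x. f x - g x"
 define D where "D = {0<..<l} \<inter> ?h -` (- {0})"
 have hc: "continuous_on {0..l} ?h" by (intro continuous_intros c)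
 have "open D" unfolding D_def
  by (rule continuous_open_preimage[OF continuous_on_subset[OF hc]]) auto
 moreover have "negligible D"
 proof -
  have "AE x in lborel. x \<notin> D" using eq by eventually_elim (auto simp: D_def)
  then have "D \<in> null_sets lborel" using \<open>open D\<close> by (subst AE_iff_null_sets) auto
  then show ?thesis by (simp add: negligible_iff_null_sets null_sets_completionI)
 qed
 ultimately have "D = {}" using open_not_negligible by blast
 then have "?h y = 0" if "y \<in> {0<..<l}" for y using that by (auto simp: D_def)
 then have "?h x = 0" using hc x l by (intro continuous_constant_on_closure[of "{0<..<l}" ?h 0 x]) auto
 then show ?thesis by simp
qed

text \<open>A bump minus a multiple of a fixed bump \<open>\<psi>\<close> can be given integral 0
  and is then the derivative of a test function. So \<open>e\<close> minus its
  \<open>\<psi>\<close>-weighted mean \<open>c\<close> integrates to 0 against all bumps, hence over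
  all subintervals.\<close>

lemma du_bois_reymond:
 assumes l: "0 < l" and e: "e \<in> sqi"
  and test: "\<And>\<phi>. \<phi> \<in> test_functions 0 l ==> (LINT x|lborel. ind l x * (e x * deriv \<phi> x)) = 0"
 shows "\<exists>c. AE x\<in>{0<..<l} in lborel. e x = c"
proof -
 let ?I = "ind l :: real => real"
 have I: "?I \<in> sqi" by (rule indicator_Ioo_sq_int)
 have Ibump: "?I x * bump n s t x = bump n s t x" if "0 < s" "t < l" for n s t x
  using bump_bounds[of n s t x] that by (auto split: split_indicator)
 have ib: "(LINT x|lborel. ?I x * bump n s t x) = (LINT x|lborel. bump n s t x)" if "0 < s" "t < l" for n s t
  by (intro lint_cong Ibump that)
 have "(\<lambda>n. LINT x|lborel. ?I x * bump n (l/3) (2*l/3) x) \<longlonglongrightarrow> (LINT x|lborel. indicator {l/3<..<2*l/3} x * ?I x)"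
  by (rule integral_bump_tendsto[OF I])
 moreover have "(LINT x|lborel. indicator {l/3<..<2*l/3} x * ?I x) = l / 3"
 proof -
  have "(LINT x|lborel. indicator {l/3<..<2*l/3} x * ?I x) = (LINT x|lborel. indicator {l/3<..<2*l/3} x)"
   using l by (intro lint_cong) (auto split: split_indicator)
  then show ?thesis using l by simp
 qed
 ultimately have "(\<lambda>n. LINT x|lborel. ?I x * bump n (l/3) (2*l/3) x) \<longlonglongrightarrow> l / 3" by simp
 \<comment> \<open>The integrals of the bumps on the middle third tend to \<open>l / 3\<close>, so
   one of them is positive and can serve as normaliser.\<close>
 then have "\<forall>\<^sub>F n in sequentially. 0 < (LINT x|lborel. ?I x * bump n (l/3) (2*l/3) x)"
  by (rule order_tendstoD(1)) (use l in simp)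
 then obtain n0 where n0: "0 < (LINT x|lborel. ?I x * bump n0 (l/3) (2*l/3) x)"
  by (meson eventually_happens trivial_limit_sequentially)
 define \<psi> where "\<psi> = bump n0 (l/3) (2*l/3)"
 define I0 where "I0 = (LINT x|lborel. \<psi> x)"
 have I0: "0 < I0" using n0 ib[of "l/3" "2*l/3" n0] l by (simp add: I0_def \<psi>_def)
 have \<psi>: "\<psi> \<in> sqi" "\<psi> \<in> germs" by (simp_all add: \<psi>_def bump_sq_int bump_germs)
 have I\<psi>: "?I x * \<psi> x = \<psi> x" for x unfolding \<psi>_def using l by (intro Ibump) auto
 have int: "integrable lborel \<psi>" "integrable lborel (\<lambda>x. e x * \<psi> x)"
  using sq_int_integrable_mult[OF I \<psi>(1)] sq_int_integrable_mult[OF e \<psi>(1)] by (simp_all add: I\<psi>)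
 define c where "c = (LINT x|lborel. e x * \<psi> x) / I0"
 define k where "k x = e x - c * ?I x" for x
 have k: "k \<in> sqi" unfolding k_def[abs_def] by (intro sq_int_diff sq_int_scale e I)
 have kb: "(LINT x|lborel. k x * bump n s t x) = 0" if st: "0 < s" "s < t" "t < l" for n s t
 proof -
  let ?b = "bump n s t"
  have b: "?b \<in> sqi" by (rule bump_sq_int)
  have Ib: "?I x * ?b x = ?b x" for x by (rule Ibump) (use st in auto)
  have bi: "integrable lborel ?b" "integrable lborel (\<lambda>x. e x * ?b x)"
   using sq_int_integrable_mult[OF I b] sq_int_integrable_mult[OF e b] by (simp_all add: Ib)
  \<comment> \<open>The multiple of \<open>\<psi>\<close> that makes the integral of
    \<open>h\<close> vanish.\<close>
  define \<kappa> where "\<kappa> = (LINT x|lborel. ?b x) / I0"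
  define h where "h x = ?b x + (- \<kappa>) * \<psi> x" for x
  have h: "h \<in> germs" unfolding h_def[abs_def] by (intro germs.intros bump_germs \<psi>(2))
  have Ih: "?I x * h x = h x" for x unfolding h_def distrib_left using Ib[of x] I\<psi>[of x] by (simp only: mult.left_commute[of "?I x"])
  have "(LINT x|lborel. ?I x * h x) = 0" unfolding Ih using bi int I0 by (simp add: h_def \<kappa>_def I0_def[symmetric])
  moreover have "h x = 0" if "x \<notin> {min s (l/3)<..<max t (2*l/3)}" for x
   using that bump_bounds[of n s t x] bump_bounds[of n0 "l/3" "2*l/3" x]
   by (auto simp: h_def \<psi>_def split: split_indicator_asm)
  ultimately obtain \<phi> where \<phi>: "\<phi> \<in> test_functions 0 l" "deriv \<phi> = h"
  proof -
   assume supp: "(LINT x|lborel. ?I x * h x) = 0" "\<And>x. x \<notin> {min s (l/3)<..<max t (2*l/3)} ==> h x = 0"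
    and thesis: "\<And>\<phi>. \<phi> \<in> test_functions 0 l ==> deriv \<phi> = h ==> thesis"
   have "\<exists>\<phi>\<in>test_functions 0 l. deriv \<phi> = h"
    by (rule germ_primitive_test[OF h _ _ _ supp(2,1)]) (use st l in auto)
   then show thesis using thesis by blast
  qed
  have "0 = (LINT x|lborel. ?I x * (e x * h x))" using test[OF \<phi>(1)] \<phi>(2) by simp
  also have "\<dots> = (LINT x|lborel. e x * ?b x + (- \<kappa>) * (e x * \<psi> x))"
   using Ih by (intro lint_cong) (metis (no_types, opaque_lifting) h_def distrib_left mult.left_commute)
  also have "\<dots> = (LINT x|lborel. e x * ?b x) - c * (LINT x|lborel. ?b x)"
   using bi int I0 by (simp add: \<kappa>_def c_def)
  also have "\<dots> = (LINT x|lborel. e x * ?b x - c * ?b x)" using bi by simp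
  also have "\<dots> = (LINT x|lborel. k x * ?b x)"
   using Ib by (intro lint_cong) (simp add: k_def left_diff_distrib mult.assoc)
  finally show ?thesis by simp
 qed
 have const: "prim k t = prim k s" if st: "0 < s" "s < t" "t < l" for s t
 proof -
  have "(\<lambda>n. LINT x|lborel. k x * bump n s t x) \<longlonglongrightarrow> (LINT x|lborel. indicator {s<..<t} x * k x)"
   by (rule integral_bump_tendsto[OF k])
  then have "(LINT x|lborel. indicator {s<..<t} x * k x) = 0"
   unfolding kb[OF st] using LIMSEQ_unique tendsto_const by blast
  then show ?thesis using prim_increment[OF k, of s t] st by simp
 qed
 have "prim k x = 0" if x: "x \<in> {0<..<l}" for x
 proof -
  have cl: "continuous_on {0..l} (prim k)" by (rule continuous_on_subset[OF prim_continuous[OF k]]) auto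
  have "prim k y = prim k x" if "y \<in> {0<..<l}" for y
   using const[of x y] const[of y x] x that by (cases x y rule: linorder_cases) auto
  then have "prim k 0 = prim k x"
   using cl l by (intro continuous_constant_on_closure[of "{0<..<l}" "prim k" _ 0]) auto
  then show ?thesis by simp
 qed
 from prim_zero_imp_zero[OF l k this] have "AE x\<in>{0<..<l} in lborel. k x = 0" by blast
 then have "AE x\<in>{0<..<l} in lborel. e x = c" by eventually_elim (simp add: k_def)
 then show ?thesis by blast
qed

subsection \<open>Functions of class \<open>H\<^sup>1\<close> as primitives\<close>

text \<open>The working form of a function of class \<open>H1 0 l\<close>: value \<open>c\<close> at
  the left end, derivative \<open>k\<close>. Equality almost everywhere is the right notion, because
  \<open>u\<close> stands for a class.\<close>

definition ac_on :: "real => (real => real) => real => (real => real) => bool" where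
 "ac_on l u c k \<longleftrightarrow> k \<in> sqi \<and> (AE x\<in>{0<..<l} in lborel. u x = c + prim k x)"

lemma test_function_prim:
 assumes l: "0 < l" and \<phi>: "\<phi> \<in> test_functions 0 l"
 defines "g \<equiv> \<lambda>x. ind l x * deriv \<phi> x"
 shows "g \<in> sqi" "\<And>x. x \<in> {0..l} ==> prim g x = \<phi> x" "\<phi> l = 0"
  "deriv \<phi> \<in> borel_fun" "\<phi> \<in> borel_fun"
proof -
 have d: "(\<phi> has_real_derivative deriv \<phi> x) (at x)" for x
 proof -
  have "((deriv ^^ 0) \<phi>) differentiable (at x)" using \<phi> unfolding test_functions_def by blast
  then show ?thesis by (simp add: DERIV_deriv_iff_real_differentiable)
 qed
 have "isCont (deriv \<phi>) x" for x
 proof -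
  have "((deriv ^^ 1) \<phi>) differentiable (at x)" using \<phi> unfolding test_functions_def by blast
  then show ?thesis by (simp add: differentiable_imp_continuous_within)
 qed
 then have dc: "continuous_on S (deriv \<phi>)" for S by (simp add: continuous_at_imp_continuous_on)
 have c: "continuous_on S \<phi>" for S by (rule DERIV_continuous_on[OF has_field_derivative_at_within[OF d]])
 obtain C where C: "\<And>x. x \<in> {0..l} ==> \<bar>deriv \<phi> x\<bar> \<le> C"
  using continuous_abs_bounded[OF dc, of 0 l] by blast
 show m: "deriv \<phi> \<in> borel_fun" "\<phi> \<in> borel_fun"
  by (rule borel_measurable_continuous_onI[OF dc]) (rule borel_measurable_continuous_onI[OF c])
 have "deriv \<phi> \<in> sq1 l" by (rule bounded_sq1[OF m(1), of l C]) (use C in auto)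
 then show "g \<in> sqi" by (simp add: sq1_def g_def)
 have "closure {x. \<phi> x \<noteq> 0} \<subseteq> {0<..<l}" using \<phi> by (simp add: test_functions_def)
 then have "{x. \<phi> x \<noteq> 0} \<subseteq> {0<..<l}" by (rule order_trans[OF closure_subset])
 then have 0: "\<phi> 0 = 0" and "\<phi> l = 0" by auto
 then show "\<phi> l = 0" by simp
 show "prim g x = \<phi> x" if x: "x \<in> {0..l}" for x
 proof -
  have "prim g x = (LINT s|lborel. ind x s * deriv \<phi> s)"
   using prim_ind[of x l "deriv \<phi>"] x by (simp add: g_def prim_def)
  also have "\<dots> = \<phi> x - \<phi> 0"
  proof (rule lborel_integral_ftc[where S = "{}"])
   show "\<bar>deriv \<phi> s\<bar> \<le> C" if "s \<in> {0<..<x}" for s using C[of s] x that by simp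
  qed (use x in \<open>simp_all add: d c m\<close>)
  finally show ?thesis using 0 by simp
 qed
qed

text \<open>\<open>ac_product\<close> for \<open>c + prim k\<close> and the test function, which is
  the primitive of its own derivative and vanishes at both ends.\<close>

lemma weak_derivative_prim:
 assumes l: "0 < l" and k: "k \<in> sqi" and \<phi>: "\<phi> \<in> test_functions 0 l"
 shows "(LINT x|lborel. ind l x * ((c + prim k x) * deriv \<phi> x)) =
  - (LINT x|lborel. ind l x * (k x * \<phi> x))"
proof -
 let ?I = "ind l :: real => real"
 define g where "g x = ?I x * deriv \<phi> x" for x
 note t = test_function_prim[OF l \<phi>, folded g_def]
 have "(\<lambda>x. ?I x * (0 + prim g x)) \<in> sqi" "(\<lambda>x. ?I x * (c + prim k x)) \<in> sqi"
  using prim_sq1[OF l sq_int_sq1[OF t(1)], of 0] prim_sq1[OF l sq_int_sq1[OF k], of c] by (simp_all add: sq1_def)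
 from sq_int_integrable_mult[OF k this(1)] sq_int_integrable_mult[OF this(2) t(1)]
 have i: "integrable lborel (\<lambda>x. ?I x * (k x * (0 + prim g x)))" "integrable lborel (\<lambda>x. ?I x * ((c + prim k x) * g x))"
  by (simp_all add: mult.assoc mult.left_commute)
 have "(LINT x|lborel. ?I x * (k x * (0 + prim g x))) + (LINT x|lborel. ?I x * ((c + prim k x) * g x)) =
   (LINT x|lborel. ?I x * (k x * (0 + prim g x) + (c + prim k x) * g x))"
  using i by (simp add: distrib_left)
 also have "\<dots> = 0" using ac_product[OF k t(1) l, of 0 c] t(2)[of l] t(3) l by simp
 finally have "(LINT x|lborel. ?I x * ((c + prim k x) * g x)) = - (LINT x|lborel. ?I x * (k x * (0 + prim g x)))" by linarith
 moreover have "(LINT x|lborel. ?I x * (k x * (0 + prim g x))) = (LINT x|lborel. ?I x * (k x * \<phi> x))"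
  using t(2) by (intro lint_cong) (auto split: split_indicator)
 moreover have "(LINT x|lborel. ?I x * ((c + prim k x) * g x)) = (LINT x|lborel. ?I x * ((c + prim k x) * deriv \<phi> x))"
  by (intro lint_cong) (auto simp: g_def split: split_indicator)
 ultimately show ?thesis by simp
qed

lemma ac_on_sq_int: "0 < l ==> ac_on l u c k ==> (\<lambda>x. ind l x * (c + prim k x)) \<in> sqi"
 using prim_sq1[OF _ sq_int_sq1, of l k c] by (simp add: sq1_def ac_on_def)

text \<open>If \<open>g\<close> is a weak derivative of \<open>u\<close>, then \<open>u\<close>
  minus a primitive of \<open>g\<close> has weak derivative 0 and is constant by the du Bois-Reymond
  lemma; the converse is integration by parts.\<close>

lemma has_L2_deriv_iff:
 assumes l: "0 < l"
 shows "has_L2_deriv 0 l u g \<longleftrightarrow> (\<exists>c k. ac_on l u c k \<and> (AE x\<in>{0<..<l} in lborel. g x = k x))"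
proof
 let ?I = "ind l :: real => real"
 assume "\<exists>c k. ac_on l u c k \<and> (AE x\<in>{0<..<l} in lborel. g x = k x)"
 then obtain c k where ac: "ac_on l u c k" and g: "AE x\<in>{0<..<l} in lborel. g x = k x" by blast
 then have k: "k \<in> sqi" and u: "AE x\<in>{0<..<l} in lborel. u x = c + prim k x" by (auto simp: ac_on_def)
 have pm: "k \<in> borel_fun" "prim k \<in> borel_fun"
  using k by (auto simp: sq_int_def prim_measurable)
 have u': "AE x\<in>{0<..<l} in lborel. u x = ?I x * (c + prim k x)" using u by eventually_elim simp
 have "has_weak_deriv 0 l u g" unfolding has_weak_deriv_def
 proof
  fix \<phi> assume \<phi>: "\<phi> \<in> test_functions 0 l"
  note bm = borel_measurable_times borel_measurable_add borel_measurable_const test_function_prim(4,5)[OF l \<phi>] pm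
  have "(LINT x|lebesgue_on {0<..<l}. u x * deriv \<phi> x) = (LINT x|lborel. ?I x * ((c + prim k x) * deriv \<phi> x))"
   by (rule integral_lebesgue_on_AE) (simp, intro bm, use u in eventually_elim, simp)
  moreover have "(LINT x|lebesgue_on {0<..<l}. g x * \<phi> x) = (LINT x|lborel. ?I x * (k x * \<phi> x))"
   by (rule integral_lebesgue_on_AE) (simp, intro bm, use g in eventually_elim, simp)
  ultimately show "(LINT x|lebesgue_on {0<..<l}. u x * deriv \<phi> x) = - (LINT x|lebesgue_on {0<..<l}. g x * \<phi> x)"
   using weak_derivative_prim[OF l k \<phi>, of c] by simp
 qed
 moreover have "u \<in> L2 {0<..<l}" "g \<in> L2 {0<..<l}"
  unfolding L2_iff[OF Ioo_borel] by (rule bexI[rotated, OF ac_on_sq_int[OF l ac]], rule u', rule bexI[rotated, OF k], rule g)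
 ultimately show "has_L2_deriv 0 l u g" by (simp add: has_L2_deriv_def)
next
 let ?I = "ind l :: real => real"
 assume "has_L2_deriv 0 l u g"
 then obtain h k where h: "h \<in> sqi" "AE x\<in>{0<..<l} in lborel. u x = h x"
  and k: "k \<in> sqi" "AE x\<in>{0<..<l} in lborel. g x = k x" and w: "has_weak_deriv 0 l u g"
  unfolding has_L2_deriv_def L2_iff[OF Ioo_borel] by blast
 have pm: "k \<in> borel_fun" "prim k \<in> borel_fun" "h \<in> borel_fun"
  using h k by (auto simp: sq_int_def prim_measurable)
 have pk: "(\<lambda>x. ?I x * (0 + prim k x)) \<in> sqi"
  using prim_sq1[OF l sq_int_sq1[OF k(1)], of 0] by (simp add: sq1_def)
 define e where "e x = h x - ?I x * (0 + prim k x)" for x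
 have e: "e \<in> sqi" unfolding e_def[abs_def] by (intro sq_int_diff h pk)
 have "(LINT x|lborel. ?I x * (e x * deriv \<phi> x)) = 0" if \<phi>: "\<phi> \<in> test_functions 0 l" for \<phi>
 proof -
  note t = test_function_prim(1)[OF l \<phi>]
  note bm = borel_measurable_times borel_measurable_add borel_measurable_const test_function_prim(4,5)[OF l \<phi>] pm
  have ii: "?I x * (?I x * y) = ?I x * y" for x y by (simp split: split_indicator)
  have i: "integrable lborel (\<lambda>x. ?I x * (h x * deriv \<phi> x))" "integrable lborel (\<lambda>x. ?I x * ((0 + prim k x) * deriv \<phi> x))"
   using sq_int_integrable_mult[OF h(1) t] sq_int_integrable_mult[OF pk t]
   by (simp_all add: mult.assoc mult.left_commute ii)
  have "(LINT x|lborel. ?I x * (e x * deriv \<phi> x)) = (LINT x|lborel. ?I x * (h x * deriv \<phi> x) - ?I x * ((0 + prim k x) * deriv \<phi> x))"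
   by (intro lint_cong) (auto simp: e_def algebra_simps split: split_indicator)
  also have "\<dots> = (LINT x|lborel. ?I x * (h x * deriv \<phi> x)) - (LINT x|lborel. ?I x * ((0 + prim k x) * deriv \<phi> x))"
   by (rule Bochner_Integration.integral_diff[OF i])
  also have "(LINT x|lborel. ?I x * (h x * deriv \<phi> x)) = (LINT x|lebesgue_on {0<..<l}. u x * deriv \<phi> x)"
   by (rule integral_lebesgue_on_AE[symmetric]) (simp, intro bm, use h(2) in eventually_elim, simp)
  also have "\<dots> = - (LINT x|lebesgue_on {0<..<l}. g x * \<phi> x)" using w \<phi> by (simp add: has_weak_deriv_def)
  also have "(LINT x|lebesgue_on {0<..<l}. g x * \<phi> x) = (LINT x|lborel. ?I x * (k x * \<phi> x))"
   by (rule integral_lebesgue_on_AE) (simp, intro bm, use k(2) in eventually_elim, simp)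
  finally show ?thesis using weak_derivative_prim[OF l k(1) \<phi>, of 0] by simp
 qed
 from du_bois_reymond[OF l e this] obtain c where c: "AE x\<in>{0<..<l} in lborel. e x = c" by blast
 have "AE x\<in>{0<..<l} in lborel. u x = c + prim k x" using c h(2) by eventually_elim (auto simp: e_def)
 then have "ac_on l u c k" using k by (simp add: ac_on_def)
 then show "\<exists>c k. ac_on l u c k \<and> (AE x\<in>{0<..<l} in lborel. g x = k x)" using k(2) by blast
qed

lemma ac_on_continuous: "ac_on l u c k ==> continuous_on {0..l} (\<lambda>x. c + prim k x)"
 by (intro continuous_intros continuous_on_subset[OF prim_continuous]) (auto simp: ac_on_def)

lemma ac_on_unique:
 assumes l: "0 < l" and a: "ac_on l u c k" "ac_on l u c' k'"
 shows "c = c'" "AE x\<in>{0<..<l} in lborel. k x = k' x" "x \<in> {0..l} ==> prim k x = prim k' x"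
proof -
 have k: "k \<in> sqi" "k' \<in> sqi" using a by (auto simp: ac_on_def)
 have "AE x\<in>{0<..<l} in lborel. u x = c + prim k x" "AE x\<in>{0<..<l} in lborel. u x = c' + prim k' x"
  using a by (auto simp: ac_on_def)
 then have "AE x\<in>{0<..<l} in lborel. c + prim k x = c' + prim k' x" by eventually_elim simp
 from continuous_AE_eq[OF l ac_on_continuous[OF a(1)] ac_on_continuous[OF a(2)] this]
 have eq: "c + prim k x = c' + prim k' x" if "x \<in> {0..l}" for x using that by blast
 show c: "c = c'" using eq[of 0] l by simp
 show p: "prim k x = prim k' x" if "x \<in> {0..l}" for x using eq[OF that] c by simp
 have "AE x\<in>{0<..<l} in lborel. k x - k' x = 0"
  by (rule prim_zero_imp_zero[OF l sq_int_diff[OF k]]) (simp add: prim_diff k p)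
 then show "AE x\<in>{0<..<l} in lborel. k x = k' x" by eventually_elim simp
qed

lemma H1_iff: "0 < l ==> u \<in> H1 0 l \<longleftrightarrow> (\<exists>c k. ac_on l u c k)"
proof -
 assume "0 < l"
 note iff = has_L2_deriv_iff[OF this]
 have "has_L2_deriv 0 l u k" if "ac_on l u c k" for c k unfolding iff using that by (intro exI conjI) auto
 then show ?thesis unfolding H1_def using iff by blast
qed

text \<open>The choice hidden in \<open>wderiv\<close> is harmless: any two weak derivatives agree
  almost everywhere.\<close>

lemma ac_on_wderiv:
 assumes l: "0 < l" and a: "ac_on l u c k"
 shows "AE x\<in>{0<..<l} in lborel. wderiv 0 l u x = k x"
proof -
 have "has_L2_deriv 0 l u k" using has_L2_deriv_iff[OF l] a by auto
 then have "has_L2_deriv 0 l u (wderiv 0 l u)" unfolding wderiv_def by (rule someI[where P = "has_L2_deriv 0 l u"])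
 then obtain c' k' where a': "ac_on l u c' k'" "AE x\<in>{0<..<l} in lborel. wderiv 0 l u x = k' x"
  using has_L2_deriv_iff[OF l] by blast
 show ?thesis using a'(2) ac_on_unique(2)[OF l a a'(1)] by eventually_elim simp
qed

lemma ac_on_cont_rep:
 assumes l: "0 < l" and a: "ac_on l u c k" and x: "x \<in> {0..l}"
 shows "cont_rep 0 l u x = c + prim k x"
proof -
 let ?w = "cont_rep 0 l u"
 have u: "AE x\<in>{0<..<l} in lborel. u x = c + prim k x" using a by (simp add: ac_on_def)
 have "AE x in lebesgue_on {0<..<l}. c + prim k x = u x"
  unfolding AE_lebesgue_on[OF Ioo_borel] using u by eventually_elim simp
 with ac_on_continuous[OF a]
 have "continuous_on {0..l} ?w \<and> (AE x in lebesgue_on {0<..<l}. ?w x = u x)"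
  unfolding cont_rep_def by (rule_tac someI[where P = "\<lambda>w. continuous_on {0..l} w \<and> (AE x in lebesgue_on {0<..<l}. w x = u x)"]) simp
 then have w: "continuous_on {0..l} ?w" "AE x\<in>{0<..<l} in lborel. ?w x = u x"
  by (auto simp: AE_lebesgue_on)
 have "AE x\<in>{0<..<l} in lborel. ?w x = c + prim k x" using w(2) u by eventually_elim simp
 from continuous_AE_eq[OF l w(1) ac_on_continuous[OF a] this x] show ?thesis .
qed

lemma H1_star_iff: "0 < l ==> u \<in> H1_star l \<longleftrightarrow> (\<exists>k. ac_on l u 0 k)"
 unfolding H1_star_def using ac_on_cont_rep[of l u _ _ 0] by (fastforce simp: H1_iff)

lemma ac_on_cong: "ac_on l u c k ==> AE x\<in>{0<..<l} in lborel. u x = u' x ==> ac_on l u' c k"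
 unfolding ac_on_def by (auto elim!: AE_mp)

lemma ac_on_add_scale:
 assumes "ac_on l u c k" "ac_on l u' c' k'"
 shows "ac_on l (\<lambda>x. u x + s * u' x) (c + s * c') (\<lambda>x. k x + s * k' x)"
proof -
 have k: "k \<in> sqi" "k' \<in> sqi" using assms by (auto simp: ac_on_def)
 have "AE x\<in>{0<..<l} in lborel. u x = c + prim k x" "AE x\<in>{0<..<l} in lborel. u' x = c' + prim k' x"
  using assms by (auto simp: ac_on_def)
 then have "AE x\<in>{0<..<l} in lborel. u x + s * u' x = c + s * c' + prim (\<lambda>x. k x + s * k' x) x"
  by eventually_elim (simp add: prim_add prim_scale sq_int_scale k algebra_simps)
 then show ?thesis unfolding ac_on_def by (intro conjI sq_int_add[OF k(1) sq_int_scale[OF k(2)]])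
qed

text \<open>The constant \<open>- prim m l\<close> encodes the boundary condition at the right end:
  the derivative of \<open>v\<close> is the primitive of \<open>m\<close> taken from
  \<open>l\<close>.\<close>

lemma beam_displacement_iff:
 assumes l: "0 < l"
 shows "v \<in> H2 0 l \<inter> H1_star l \<and> cont_rep 0 l (wderiv 0 l v) l = 0 \<longleftrightarrow>
  (\<exists>k m. ac_on l v 0 k \<and> ac_on l k (- prim m l) m)"
proof
 assume v: "v \<in> H2 0 l \<inter> H1_star l \<and> cont_rep 0 l (wderiv 0 l v) l = 0"
 then obtain k where k: "ac_on l v 0 k" using H1_star_iff[OF l, of v] by auto
 have "wderiv 0 l v \<in> H1 0 l" using v by (simp add: H2_def)
 then obtain e m where m: "ac_on l (wderiv 0 l v) e m" unfolding H1_iff[OF l] by (elim exE)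
 have "e + prim m l = 0" using ac_on_cont_rep[OF l m, of l] v l by simp
 then have "e = - prim m l" by simp
 then show "\<exists>k m. ac_on l v 0 k \<and> ac_on l k (- prim m l) m"
  using k ac_on_cong[OF m ac_on_wderiv[OF l k]] by (intro exI conjI) auto
next
 assume "\<exists>k m. ac_on l v 0 k \<and> ac_on l k (- prim m l) m"
 then obtain k m where k: "ac_on l v 0 k" and m: "ac_on l k (- prim m l) m" by blast
 have "AE x\<in>{0<..<l} in lborel. k x = wderiv 0 l v x" using ac_on_wderiv[OF l k] by eventually_elim simp
 from ac_on_cong[OF m this] have m': "ac_on l (wderiv 0 l v) (- prim m l) m" .
 have "v \<in> H1 0 l" "wderiv 0 l v \<in> H1 0 l" "v \<in> H1_star l"
  unfolding H1_iff[OF l] H1_star_iff[OF l] by (intro exI, rule k m')+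
 then show "v \<in> H2 0 l \<inter> H1_star l \<and> cont_rep 0 l (wderiv 0 l v) l = 0"
  using ac_on_cont_rep[OF l m', of l] l by (simp add: H2_def)
qed

section \<open>Classes of square integrable functions\<close>

definition brep :: "'a::euclidean_space set => ('a => real) => 'a => real" where
 "brep S u = (SOME h. h \<in> sqi \<and> (AE x\<in>S in lborel. u x = h x))"

lemma brep:
 assumes "S \<in> sets borel" "u \<in> L2 S"
 shows "brep S u \<in> sqi" "AE x\<in>S in lborel. u x = brep S u x"
proof -
 obtain h where "h \<in> sqi \<and> (AE x\<in>S in lborel. u x = h x)" using assms L2_iff by blast
 then have "brep S u \<in> sqi \<and> (AE x\<in>S in lborel. u x = brep S u x)"
  unfolding brep_def by (rule someI[where P = "\<lambda>h. h \<in> sqi \<and> (AE x\<in>S in lborel. u x = h x)"])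
 then show "brep S u \<in> sqi" "AE x\<in>S in lborel. u x = brep S u x" by auto
qed

abbreviation rect :: "real => (real \<times> real) set" where "rect L \<equiv> {0<..<L} \<times> {0<..<1}"

lemma rect_borel: "rect L \<in> sets borel" by (intro borel_open open_Times) auto

lemma ind2_rect: "ind2 L p = indicator (rect L) p" by (cases p) (auto simp: ind2_def split: split_indicator)

definition c1 :: "real => (real => real) => l2" where "c1 L u = cls1 L (brep {0<..<L} u)"

definition c2 :: "real => (real \<times> real => real) => l2" where "c2 L z = cls (\<lambda>p. ind2 L p * brep (rect L) z p)"

lemma ind2_mult_sq_int:
 assumes "f \<in> sqi" shows "(\<lambda>p. ind2 L p * f p) \<in> sqi"
 using mul_fun_sq_int[OF ind2_measurable ind2_bound assms, of L] .

lemma c1_iff: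
 assumes u: "u \<in> L2 {0<..<L}" and h: "h \<in> sq1 L"
 shows "c1 L u = cls1 L h \<longleftrightarrow> (AE x\<in>{0<..<L} in lborel. u x = h x)"
proof -
 note b = brep[OF Ioo_borel u]
 have "(AE x\<in>{0<..<L} in lborel. brep {0<..<L} u x = h x) \<longleftrightarrow> (AE x\<in>{0<..<L} in lborel. u x = h x)"
  by (rule eventually_cong[OF b(2)]) auto
 then show ?thesis using cls1_eq_iff[OF sq_int_sq1[OF b(1)] h] by (simp add: c1_def)
qed

lemma c2_iff:
 assumes z: "z \<in> L2 (rect L)" and h: "(\<lambda>p. ind2 L p * h p) \<in> sqi"
 shows "c2 L z = cls (\<lambda>p. ind2 L p * h p) \<longleftrightarrow> (AE p\<in>rect L in lborel. z p = h p)"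
proof -
 note b = brep[OF rect_borel z]
 have "(AE p in lborel. ind2 L p * brep (rect L) z p = ind2 L p * h p) \<longleftrightarrow> (AE p\<in>rect L in lborel. z p = h p)"
  by (rule eventually_cong[OF b(2)]) (auto simp: ind2_rect split: split_indicator)
 then show ?thesis using cls_eq_iff[OF ind2_mult_sq_int[OF b(1)] h] by (simp add: c2_def)
qed

lemma c1_L2: "AE x\<in>{0<..<L} in lborel. u x = h x ==> h \<in> sq1 L ==> u \<in> L2 {0<..<L} \<and> c1 L u = cls1 L h"
proof -
 assume u: "AE x\<in>{0<..<L} in lborel. u x = h x" and h: "h \<in> sq1 L"
 have u': "AE x\<in>{0<..<L} in lborel. u x = ind L x * h x" using u by eventually_elim simp
 have "(\<lambda>x. ind L x * h x) \<in> sqi" using h by (simp add: sq1_def)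
 then have "u \<in> L2 {0<..<L}" unfolding L2_iff[OF Ioo_borel] by (rule bexI[rotated]) (rule u')
 then show ?thesis using c1_iff[OF _ h] u by simp
qed

lemma c2_L2:
 "AE p\<in>rect L in lborel. z p = h p ==> (\<lambda>p. ind2 L p * h p) \<in> sqi ==>
  z \<in> L2 (rect L) \<and> c2 L z = cls (\<lambda>p. ind2 L p * h p)"
proof -
 assume z: "AE p\<in>rect L in lborel. z p = h p" and h: "(\<lambda>p. ind2 L p * h p) \<in> sqi"
 have z': "AE p\<in>rect L in lborel. z p = ind2 L p * h p" using z by eventually_elim (simp add: ind2_rect)
 have "z \<in> L2 (rect L)" unfolding L2_iff[OF rect_borel] by (rule bexI[rotated, OF h]) (rule z')
 then show ?thesis using c2_iff[OF _ h] z by simp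
qed

lemma c1_add_scale:
 assumes "u \<in> L2 {0<..<L}" "u' \<in> L2 {0<..<L}"
 shows "(\<lambda>x. u x + s * u' x) \<in> L2 {0<..<L}" "c1 L (\<lambda>x. u x + s * u' x) = c1 L u + s *\<^sub>R c1 L u'"
proof -
 let ?b = "brep {0<..<L}"
 note b = brep[OF Ioo_borel assms(1)] brep[OF Ioo_borel assms(2)]
 have "AE x\<in>{0<..<L} in lborel. u x + s * u' x = ?b u x + s * ?b u' x" using b(2,4) by eventually_elim simp
 from c1_L2[OF this] show "(\<lambda>x. u x + s * u' x) \<in> L2 {0<..<L}" "c1 L (\<lambda>x. u x + s * u' x) = c1 L u + s *\<^sub>R c1 L u'"
  by (simp_all add: c1_def cls1_add cls1_scale sq1_add sq1_scale sq_int_sq1 b)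
qed

lemma c2_add_scale:
 assumes "u \<in> L2 (rect L)" "u' \<in> L2 (rect L)"
 shows "(\<lambda>x. u x + s * u' x) \<in> L2 (rect L)" "c2 L (\<lambda>x. u x + s * u' x) = c2 L u + s *\<^sub>R c2 L u'"
proof -
 let ?b = "brep (rect L)"
 note b = brep[OF rect_borel assms(1)] brep[OF rect_borel assms(2)]
 have ae: "AE x\<in>rect L in lborel. u x + s * u' x = ?b u x + s * ?b u' x" using b(2,4) by eventually_elim simp
 have i: "(\<lambda>p. ind2 L p * ?b u p) \<in> sqi" "(\<lambda>p. ind2 L p * ?b u' p) \<in> sqi"
  by (intro ind2_mult_sq_int b)+
 have "cls (\<lambda>p. ind2 L p * ?b u p) + s *\<^sub>R cls (\<lambda>p. ind2 L p * ?b u' p) = cls (\<lambda>p. ind2 L p * (?b u p + s * ?b u' p))"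
  unfolding cls_scale[OF i(2)] cls_add[OF i(1) sq_int_scale[OF i(2)]] by (simp add: algebra_simps)
 moreover have "(\<lambda>p. ind2 L p * (?b u p + s * ?b u' p)) \<in> sqi"
  by (intro ind2_mult_sq_int sq_int_add sq_int_scale b)
 ultimately show "(\<lambda>x. u x + s * u' x) \<in> L2 (rect L)" "c2 L (\<lambda>x. u x + s * u' x) = c2 L u + s *\<^sub>R c2 L u'"
  using c2_L2[OF ae] by (simp_all add: c2_def)
qed

lemma c1_inner:
 assumes "u \<in> L2 {0<..<L}" "u' \<in> L2 {0<..<L}"
 shows "(LINT x|lebesgue_on {0<..<L}. u x * u' x) = inner (c1 L u) (c1 L u')"
proof -
 note b = brep[OF Ioo_borel assms(1)] brep[OF Ioo_borel assms(2)]
 have [measurable]: "brep {0<..<L} u \<in> borel_fun" "brep {0<..<L} u' \<in> borel_fun"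
  using b by (simp_all add: sq_int_def)
 show ?thesis unfolding c1_def inner_cls1[OF sq_int_sq1[OF b(1)] sq_int_sq1[OF b(3)]]
  by (rule integral_lebesgue_on_AE) (simp, measurable, use b(2,4) in eventually_elim, simp)
qed

lemma c2_inner:
 assumes "u \<in> L2 (rect L)" "u' \<in> L2 (rect L)"
 shows "(LINT x|lebesgue_on (rect L). u x * u' x) = inner (c2 L u) (c2 L u')"
proof -
 note b = brep[OF rect_borel assms(1)] brep[OF rect_borel assms(2)]
 have [measurable]: "brep (rect L) u \<in> borel_fun" "brep (rect L) u' \<in> borel_fun"
  using b by (simp_all add: sq_int_def)
 have "(LINT x|lebesgue_on (rect L). u x * u' x) = (LINT p|lborel. indicator (rect L) p * (brep (rect L) u p * brep (rect L) u' p))"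
  by (rule integral_lebesgue_on_AE[OF rect_borel]) (measurable, use b(2,4) in eventually_elim, simp)
 also have "\<dots> = (LINT p|lborel. (ind2 L p * brep (rect L) u p) * (ind2 L p * brep (rect L) u' p))"
  by (intro lint_cong) (simp add: ind2_rect split: split_indicator)
 also have "\<dots> = inner (c2 L u) (c2 L u')"
  unfolding c2_def by (rule inner_cls[symmetric]) (intro ind2_mult_sq_int b)+
 finally show ?thesis .
qed

lemma c1_X1: "u \<in> L2 {0<..<L} ==> c1 L u \<in> X1 L"
 unfolding c1_def X1_def using brep(1)[OF Ioo_borel, of u 0 L] by (auto intro: sq_int_sq1)

lemma c2_X2: "z \<in> L2 (rect L) ==> c2 L z \<in> X2 L"
 unfolding c2_def using brep(1)[OF rect_borel, of z L] by (rule cls_ind2_X2)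

subsection \<open>Sections in the delay variable\<close>

lemma rect_AE_sections:
 assumes "AE p\<in>rect L in lborel. P p"
 shows "AE x\<in>{0<..<L} in lborel. (AE r\<in>{0<..<1} in lborel. P (x, r))"
proof -
 have "AE x in lborel. AE r in lborel. (x, r) \<in> rect L --> P (x, r)" by (rule lborel_AE_pair[OF assms])
 then show ?thesis by eventually_elim (auto elim: eventually_mono)
qed

text \<open>For Borel functions the set of disagreement is measurable, so Fubini leads from sections
  to the rectangle. This is why Borel representatives are taken before slicing.\<close>

lemma AE_rectI:
 fixes g h :: "real \<times> real => real"
 assumes [measurable]: "g \<in> borel_fun" "h \<in> borel_fun"
  and ae: "AE x\<in>{0<..<L} in lborel. (AE r\<in>{0<..<1} in lborel. g (x, r) = h (x, r))"
 shows "AE p\<in>rect L in lborel. g p = h p"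
proof -
 have gh: "(\<lambda>p. ind2 L p * (g p - h p)) \<in> borel_fun" by measurable
 have "{p. ind2 L p * (g p - h p) = 0} = (\<lambda>p. ind2 L p * (g p - h p)) -` {0} \<inter> space borel" by auto
 also have "\<dots> \<in> sets borel" by (rule measurable_sets[OF gh]) simp
 finally have m: "{p. ind2 L p * (g p - h p) = 0} \<in> sets borel" .
 have "AE x in lborel. AE r in lborel. ind2 L (x, r) * (g (x, r) - h (x, r)) = 0"
  using ae
 proof eventually_elim
  case (elim x)
  show ?case
  proof (cases "x \<in> {0<..<L}")
   case True
   then have "AE r\<in>{0<..<1} in lborel. g (x, r) = h (x, r)" using elim by blast
   then show ?thesis by eventually_elim (simp add: ind2_def split: split_indicator)
  qed (simp add: ind2_def)
 qed
 then have "AE p in lborel. ind2 L p * (g p - h p) = 0" by (simp only: lborel_AE_pair_iff[OF m])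
 then show ?thesis by eventually_elim (auto simp: ind2_rect indicator_def)
qed

definition delay_primitive :: "(real => real) => (real \<times> real => real) => real \<times> real => real" where
 "delay_primitive c g p = c (fst p) + ind 1 (snd p) * prim (\<lambda>s. g (fst p, s)) (snd p)"

lemma delay_primitive_measurable:
 assumes "c \<in> borel_fun" "g \<in> sqi"
 shows "delay_primitive c g \<in> borel_fun"
proof -
 note [measurable] = assms(1)
 have [measurable]: "(\<lambda>p :: real \<times> real. ind 1 (snd p) * prim (\<lambda>s. g (fst p, s)) (snd p)) \<in> borel_fun"
  using Kr_cls(2)[OF assms(2)] by (simp add: sq_int_def)
 show ?thesis unfolding delay_primitive_def[abs_def] by measurable
qed

lemma delay_primitive_section:
 assumes g: "g \<in> sqi" and z: "AE p\<in>rect L in lborel. z p = delay_primitive c g p"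
 shows "AE x\<in>{0<..<L} in lborel. ac_on 1 (\<lambda>r. z (x, r)) (c x) (\<lambda>r. g (x, r))"
 using rect_AE_sections[OF z] sq_int_slice[OF g]
proof eventually_elim
 case (elim x)
 show ?case
 proof
  assume "x \<in> {0<..<L}"
  then have "AE r\<in>{0<..<1} in lborel. z (x, r) = delay_primitive c g (x, r)" using elim by blast
  then have "AE r\<in>{0<..<1} in lborel. z (x, r) = c x + prim (\<lambda>s. g (x, s)) r"
   by eventually_elim (simp add: delay_primitive_def)
  then show "ac_on 1 (\<lambda>r. z (x, r)) (c x) (\<lambda>r. g (x, r))" using elim by (simp add: ac_on_def)
 qed
qed

text \<open>The definition constrains the sections of \<open>w\<close> itself. For almost every
  \<open>x\<close> they agree almost everywhere with those of a Borel representative, which are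
  square integrable, so primitives may be formed from the latter.\<close>

lemma L2_H1_section:
 assumes w: "has_L2_deriv_r L z w"
 shows "AE x\<in>{0<..<L} in lborel. ac_on 1 (\<lambda>r. z (x, r)) (trace_r z 0 x) (\<lambda>r. brep (rect L) w (x, r))"
proof -
 let ?w = "brep (rect L) w"
 have "w \<in> L2 (rect L)" using w by (simp add: has_L2_deriv_r_def)
 note b = brep[OF rect_borel this]
 have [measurable]: "?w \<in> borel_fun" using b(1) by (simp add: sq_int_def)
 have "AE x\<in>{0<..<L} in lborel. has_L2_deriv 0 1 (\<lambda>r. z (x, r)) (\<lambda>r. w (x, r))"
  using w by (simp add: has_L2_deriv_r_def AE_lebesgue_on)
 then show ?thesis using rect_AE_sections[OF b(2)] sq_int_slice[OF b(1)]
 proof eventually_elim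
  case (elim x)
  show ?case
  proof
   assume x: "x \<in> {0<..<L}"
   from elim(1) x has_L2_deriv_iff[of 1 "\<lambda>r. z (x, r)" "\<lambda>r. w (x, r)"]
   obtain c k where c: "ac_on 1 (\<lambda>r. z (x, r)) c k" and k: "AE r\<in>{0<..<1} in lborel. w (x, r) = k r" by auto
   have "AE r\<in>{0<..<1} in lborel. w (x, r) = ?w (x, r)" using elim(2) x by blast
   with k have eq: "AE r in lborel. 0 < r \<and> r < 1 --> k r = ?w (x, r)" by eventually_elim simp
   have "k \<in> borel_fun" using c by (simp add: ac_on_def sq_int_def)
   from prim_cong_AE[OF this _ eq] have p: "prim k r = prim (\<lambda>r. ?w (x, r)) r" if "r \<le> 1" for r
    using that elim(3) by (auto simp: sq_int_def)
   have "trace_r z 0 x = c" using ac_on_cont_rep[OF _ c, of 0] by (simp add: trace_r_def)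
   moreover have "AE r\<in>{0<..<1} in lborel. z (x, r) = c + prim k r" using c by (simp add: ac_on_def)
   then have "AE r\<in>{0<..<1} in lborel. z (x, r) = c + prim (\<lambda>r. ?w (x, r)) r"
    by eventually_elim (simp add: p)
   ultimately show "ac_on 1 (\<lambda>r. z (x, r)) (trace_r z 0 x) (\<lambda>r. ?w (x, r))" using elim(3) by (simp add: ac_on_def)
  qed
 qed
qed

lemma L2_H1_primitive:
 assumes w: "has_L2_deriv_r L z w" and c: "c \<in> borel_fun"
  and tr: "AE x\<in>{0<..<L} in lborel. c x = trace_r z 0 x"
 shows "AE p\<in>rect L in lborel. z p = delay_primitive c (brep (rect L) w) p"
proof -
 let ?w = "brep (rect L) w" and ?z = "brep (rect L) z"
 have "w \<in> L2 (rect L)" "z \<in> L2 (rect L)" using w by (auto simp: has_L2_deriv_r_def)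
 note b = brep[OF rect_borel this(1)] brep[OF rect_borel this(2)]
 have zm: "?z \<in> borel_fun" using b(3) by (simp add: sq_int_def)
 have "AE p\<in>rect L in lborel. ?z p = delay_primitive c ?w p"
 proof (rule AE_rectI[OF zm delay_primitive_measurable[OF c b(1)]])
  show "AE x\<in>{0<..<L} in lborel. (AE r\<in>{0<..<1} in lborel. ?z (x, r) = delay_primitive c ?w (x, r))"
   using L2_H1_section[OF w] tr rect_AE_sections[OF b(4)]
  proof eventually_elim
   case (elim x)
   show ?case
   proof
    assume x: "x \<in> {0<..<L}"
    then have "AE r\<in>{0<..<1} in lborel. z (x, r) = ?z (x, r)"
     and "AE r\<in>{0<..<1} in lborel. z (x, r) = c x + prim (\<lambda>r. ?w (x, r)) r"
     using elim by (auto simp: ac_on_def)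
    then show "AE r\<in>{0<..<1} in lborel. ?z (x, r) = delay_primitive c ?w (x, r)"
     by eventually_elim (simp add: delay_primitive_def)
   qed
  qed
 qed
 with b(4) show ?thesis by eventually_elim simp
qed

text \<open>The converse of \<open>L2_H1_primitive\<close>: an explicit primitive in
  \<open>r\<close> belongs to the space, and both traces are read off section by section.\<close>

lemma delay_primitive_L2_H1:
 assumes g: "g \<in> sqi" and zL: "z \<in> L2 (rect L)" and z: "AE p\<in>rect L in lborel. z p = delay_primitive c g p"
 shows "z \<in> L2_H1 L" "AE p\<in>rect L in lborel. wderiv_r L z p = g p"
  "AE x\<in>{0<..<L} in lborel. trace_r z 0 x = c x \<and> trace_r z 1 x = c x + prim (\<lambda>s. g (x, s)) 1"
proof -
 note sec = delay_primitive_section[OF g z]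
 have gL: "g \<in> L2 (rect L)" unfolding L2_iff[OF rect_borel] by (rule bexI[OF _ g]) simp
 have "AE x\<in>{0<..<L} in lborel. has_L2_deriv 0 1 (\<lambda>r. z (x, r)) (\<lambda>r. g (x, r))"
  using sec
 proof eventually_elim
  case (elim x)
  show ?case
  proof
   assume "x \<in> {0<..<L}"
   then have "ac_on 1 (\<lambda>r. z (x, r)) (c x) (\<lambda>r. g (x, r))" using elim by blast
   then show "has_L2_deriv 0 1 (\<lambda>r. z (x, r)) (\<lambda>r. g (x, r))" by (subst has_L2_deriv_iff) auto
  qed
 qed
 then have d: "has_L2_deriv_r L z g" using zL gL by (simp add: has_L2_deriv_r_def AE_lebesgue_on)
 then show "z \<in> L2_H1 L" by (auto simp: L2_H1_def)
 have w: "has_L2_deriv_r L z (wderiv_r L z)" unfolding wderiv_r_def by (rule someI[where P = "has_L2_deriv_r L z", OF d])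
 let ?w = "brep (rect L) (wderiv_r L z)"
 have "wderiv_r L z \<in> L2 (rect L)" using w by (simp add: has_L2_deriv_r_def)
 note b = brep[OF rect_borel this]
 have "AE p\<in>rect L in lborel. ?w p = g p"
 proof (rule AE_rectI)
  show "?w \<in> borel_fun" "g \<in> borel_fun" using b g by (auto simp: sq_int_def)
  show "AE x\<in>{0<..<L} in lborel. (AE r\<in>{0<..<1} in lborel. ?w (x, r) = g (x, r))"
   using L2_H1_section[OF w] sec
  proof eventually_elim
   case (elim x)
   show ?case using ac_on_unique(2)[OF zero_less_one, of "\<lambda>r. z (x, r)"] elim by blast
  qed
 qed
 with b(2) show "AE p\<in>rect L in lborel. wderiv_r L z p = g p" by eventually_elim simp
 show "AE x\<in>{0<..<L} in lborel. trace_r z 0 x = c x \<and> trace_r z 1 x = c x + prim (\<lambda>s. g (x, s)) 1"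
  using sec
 proof eventually_elim
  case (elim x)
  show ?case
  proof
   assume "x \<in> {0<..<L}"
   then have a: "ac_on 1 (\<lambda>r. z (x, r)) (c x) (\<lambda>r. g (x, r))" using elim by blast
   show "trace_r z 0 x = c x \<and> trace_r z 1 x = c x + prim (\<lambda>s. g (x, s)) 1"
    using ac_on_cont_rep[OF _ a, of 0] ac_on_cont_rep[OF _ a, of 1] by (simp add: trace_r_def)
  qed
 qed
qed

section \<open>The energy space as a Hilbert space\<close>

lemma c1_eq_iff:
 assumes "u \<in> L2 {0<..<L}" "u' \<in> L2 {0<..<L}"
 shows "c1 L u = c1 L u' \<longleftrightarrow> (AE x\<in>{0<..<L} in lborel. u x = u' x)"
proof -
 note b = brep[OF Ioo_borel assms(2)]
 have "(AE x\<in>{0<..<L} in lborel. u x = brep {0<..<L} u' x) \<longleftrightarrow> (AE x\<in>{0<..<L} in lborel. u x = u' x)"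
  by (rule eventually_cong[OF b(2)]) auto
 then show ?thesis using c1_iff[OF assms(1) sq_int_sq1[OF b(1)]] by (simp add: c1_def)
qed

lemma c2_eq_iff:
 assumes "u \<in> L2 (rect L)" "u' \<in> L2 (rect L)"
 shows "c2 L u = c2 L u' \<longleftrightarrow> (AE p\<in>rect L in lborel. u p = u' p)"
proof -
 note b = brep[OF rect_borel assms(2)]
 have "(AE p\<in>rect L in lborel. u p = brep (rect L) u' p) \<longleftrightarrow> (AE p\<in>rect L in lborel. u p = u' p)"
  by (rule eventually_cong[OF b(2)]) auto
 then show ?thesis using c2_iff[OF assms(1) ind2_mult_sq_int[OF b(1)]] by (simp add: c2_def)
qed

lemma c1_scale: "u \<in> L2 {0<..<L} ==> (\<lambda>x. s * u x) \<in> L2 {0<..<L} \<and> c1 L (\<lambda>x. s * u x) = s *\<^sub>R c1 L u"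
 using c1_add_scale[of u L u "s - 1"] by (simp add: algebra_simps scaleR_left_diff_distrib)

lemma c2_scale: "u \<in> L2 (rect L) ==> (\<lambda>x. s * u x) \<in> L2 (rect L) \<and> c2 L (\<lambda>x. s * u x) = s *\<^sub>R c2 L u"
 using c2_add_scale[of u L u "s - 1"] by (simp add: algebra_simps scaleR_left_diff_distrib)

lemma scaled_c1_iff:
 assumes "u \<in> L2 {0<..<L}" "g \<in> sq1 L"
 shows "s *\<^sub>R c1 L u = cls1 L g \<longleftrightarrow> (AE x\<in>{0<..<L} in lborel. s * u x = g x)"
 using c1_scale[OF assms(1), of s] c1_iff[of "\<lambda>x. s * u x" L g] assms by simp

lemma scaled_c2_iff:
 assumes "z \<in> L2 (rect L)" "(\<lambda>p. ind2 L p * g p) \<in> sqi"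
 shows "s *\<^sub>R c2 L z = cls (\<lambda>p. ind2 L p * g p) \<longleftrightarrow> (AE p\<in>rect L in lborel. s * z p = g p)"
 using c2_scale[OF assms(1), of s] c2_iff[of "\<lambda>x. s * z x" L g] assms by simp

lemma X1_cases:
 assumes "e \<in> X1 L" obtains g where "g \<in> sqi" "e = cls1 L g"
proof -
 obtain g where g: "g \<in> sq1 L" "e = cls1 L g" using assms by (auto simp: X1_def)
 show thesis by (rule that[of "\<lambda>x. ind L x * g x"]) (use g in \<open>simp_all add: sq1_def cls1_ind\<close>)
qed

lemma c1_wderiv:
 assumes "0 < L" "ac_on L v c k"
 shows "wderiv 0 L v \<in> L2 {0<..<L}" "c1 L (wderiv 0 L v) = cls1 L k"
 using c1_L2[OF ac_on_wderiv[OF assms]] assms(2) by (auto simp: ac_on_def sq_int_sq1)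

lemma ac_on_L2: "0 < L ==> ac_on L v c k ==> v \<in> L2 {0<..<L} \<and> c1 L v = cls1 L (\<lambda>x. c + prim k x)"
 by (rule c1_L2) (auto simp: ac_on_def intro: prim_sq1[OF _ sq_int_sq1])

lemma energy_space_cases:
 assumes "0 < L" "(v, f, p, h, z) \<in> energy_space L"
 obtains k n where "ac_on L v 0 k" "ac_on L p 0 n" "f \<in> L2 {0<..<L}" "h \<in> L2 {0<..<L}" "z \<in> L2 (rect L)"
  "wderiv 0 L v \<in> L2 {0<..<L}" "c1 L (wderiv 0 L v) = cls1 L k"
  "wderiv 0 L p \<in> L2 {0<..<L}" "c1 L (wderiv 0 L p) = cls1 L n" "k \<in> sqi" "n \<in> sqi"
proof -
 from assms obtain k n where ac: "ac_on L v 0 k" "ac_on L p 0 n"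
  by (auto simp: energy_space_def H1_star_iff)
 then have k: "k \<in> sqi" "n \<in> sqi" by (auto simp: ac_on_def)
 have fhz: "f \<in> L2 {0<..<L}" "h \<in> L2 {0<..<L}" "z \<in> L2 (rect L)" using assms(2) by (auto simp: energy_space_def)
 show thesis by (rule that[OF ac fhz c1_wderiv[OF assms(1) ac(1)] c1_wderiv[OF assms(1) ac(2)] k])
qed

lemma energy_spaceI:
 assumes "0 < L" "ac_on L v 0 k" "ac_on L p 0 n" "f \<in> L2 {0<..<L}" "h \<in> L2 {0<..<L}" "z \<in> L2 (rect L)"
 shows "(v, f, p, h, z) \<in> energy_space L"
 using assms H1_star_iff[OF assms(1)] by (auto simp: energy_space_def)

locale beam_space =
 fixes L \<rho> \<alpha>1 \<gamma> \<mu> \<beta> :: real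
 assumes L_pos: "0 < L" and rho_pos: "0 < \<rho>" and alpha_pos: "0 < \<alpha>1" and mu_pos: "0 < \<mu>" and beta_pos: "0 < \<beta>"
begin

text \<open>The history carries the same factor \<open>sqrt \<rho>\<close> as the velocity, so the
  matching condition at \<open>r = 0\<close> survives the scaling. Displacements enter through their
  derivatives only; the condition at 0 restores them.\<close>

fun Phi :: "state => est" where
 "Phi (v, f, p, h, z) = (sqrt \<rho> *\<^sub>R c1 L f, sqrt \<mu> *\<^sub>R c1 L h, sqrt \<alpha>1 *\<^sub>R c1 L (wderiv 0 L v),
  sqrt \<beta> *\<^sub>R (\<gamma> *\<^sub>R c1 L (wderiv 0 L v) - c1 L (wderiv 0 L p)), sqrt \<rho> *\<^sub>R c2 L z)"

lemma Phi_add_scale: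
 fixes s :: real
 assumes M: "(v, f, p, h, z) \<in> energy_space L" "(v', f', p', h', z') \<in> energy_space L"
 defines "N \<equiv> (\<lambda>x. v x + s * v' x, \<lambda>x. f x + s * f' x, \<lambda>x. p x + s * p' x, \<lambda>x. h x + s * h' x, \<lambda>x. z x + s * z' x)"
 shows "N \<in> energy_space L \<and> Phi N = Phi (v, f, p, h, z) + s *\<^sub>R Phi (v', f', p', h', z')"
proof -
 obtain k n where a: "ac_on L v 0 k" "ac_on L p 0 n" "f \<in> L2 {0<..<L}" "h \<in> L2 {0<..<L}" "z \<in> L2 (rect L)"
  "c1 L (wderiv 0 L v) = cls1 L k" "c1 L (wderiv 0 L p) = cls1 L n" "k \<in> sqi" "n \<in> sqi"
  using energy_space_cases[OF L_pos M(1)] by blast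
 obtain k' n' where b: "ac_on L v' 0 k'" "ac_on L p' 0 n'" "f' \<in> L2 {0<..<L}" "h' \<in> L2 {0<..<L}" "z' \<in> L2 (rect L)"
  "c1 L (wderiv 0 L v') = cls1 L k'" "c1 L (wderiv 0 L p') = cls1 L n'" "k' \<in> sqi" "n' \<in> sqi"
  using energy_space_cases[OF L_pos M(2)] by blast
 have cv: "ac_on L (\<lambda>x. v x + s * v' x) 0 (\<lambda>x. k x + s * k' x)" and cp: "ac_on L (\<lambda>x. p x + s * p' x) 0 (\<lambda>x. n x + s * n' x)"
  using ac_on_add_scale[OF a(1) b(1), of s] ac_on_add_scale[OF a(2) b(2), of s] by simp_all
 have "N \<in> energy_space L" unfolding N_def
  by (rule energy_spaceI[OF L_pos cv cp]) (intro c1_add_scale(1) c2_add_scale(1) a b)+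
 moreover have "c1 L (wderiv 0 L (\<lambda>x. v x + s * v' x)) = cls1 L k + s *\<^sub>R cls1 L k'"
  "c1 L (wderiv 0 L (\<lambda>x. p x + s * p' x)) = cls1 L n + s *\<^sub>R cls1 L n'"
  using c1_wderiv(2)[OF L_pos cv] c1_wderiv(2)[OF L_pos cp] by (simp_all add: cls1_add cls1_scale sq1_scale sq_int_sq1 a b)
 ultimately show ?thesis unfolding N_def
  by (simp add: a(6,7) b(6,7) c1_add_scale(2)[OF a(3) b(3)] c1_add_scale(2)[OF a(4) b(4)] c2_add_scale(2)[OF a(5) b(5)]
   algebra_simps)
qed

lemma Phi_diff:
 assumes "M \<in> energy_space L" "N \<in> energy_space L"
 shows "M - N \<in> energy_space L" "Phi (M - N) = Phi M - Phi N"
proof -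
 obtain v f p h z where M: "M = (v, f, p, h, z)" by (cases M) auto
 obtain v' f' p' h' z' where N: "N = (v', f', p', h', z')" by (cases N) auto
 have "M - N = (\<lambda>x. v x + - 1 * v' x, \<lambda>x. f x + - 1 * f' x, \<lambda>x. p x + - 1 * p' x, \<lambda>x. h x + - 1 * h' x, \<lambda>x. z x + - 1 * z' x)"
  unfolding M N by (auto simp: fun_eq_iff)
 then show "M - N \<in> energy_space L" "Phi (M - N) = Phi M - Phi N"
  using Phi_add_scale[OF assms[unfolded M N], of "- 1"] unfolding M N by (simp_all only: scaleR_minus1_left diff_conv_add_uminus)
qed

lemma Phi_scale:
 assumes "M \<in> energy_space L"
 shows "state_scale s M \<in> energy_space L" "Phi (state_scale s M) = s *\<^sub>R Phi M"
proof -
 obtain v f p h z where M: "M = (v, f, p, h, z)" by (cases M) auto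
 have "state_scale s M = (\<lambda>x. v x + (s - 1) * v x, \<lambda>x. f x + (s - 1) * f x, \<lambda>x. p x + (s - 1) * p x,
   \<lambda>x. h x + (s - 1) * h x, \<lambda>x. z x + (s - 1) * z x)"
  unfolding M by (auto simp: fun_eq_iff algebra_simps)
 moreover have "Phi M + (s - 1) *\<^sub>R Phi M = s *\<^sub>R Phi M" by (simp add: scaleR_left_diff_distrib)
 ultimately show "state_scale s M \<in> energy_space L" "Phi (state_scale s M) = s *\<^sub>R Phi M"
  using Phi_add_scale[OF assms[unfolded M] assms[unfolded M], of "s - 1"] unfolding M[symmetric] by simp_all
qed

text \<open>Displacements vanish at 0, so they agree almost everywhere exactly when their
  derivatives do.\<close>

lemma state_eq_iff:
 assumes "M \<in> energy_space L" "N \<in> energy_space L"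
 shows "state_eq L M N \<longleftrightarrow> Phi M = Phi N"
proof -
 obtain v f p h z where M: "M = (v, f, p, h, z)" by (cases M) auto
 obtain v' f' p' h' z' where N: "N = (v', f', p', h', z')" by (cases N) auto
 obtain k n where a: "ac_on L v 0 k" "ac_on L p 0 n" "f \<in> L2 {0<..<L}" "h \<in> L2 {0<..<L}" "z \<in> L2 (rect L)"
  "c1 L (wderiv 0 L v) = cls1 L k" "c1 L (wderiv 0 L p) = cls1 L n" "k \<in> sqi" "n \<in> sqi"
  using energy_space_cases[OF L_pos assms(1)[unfolded M]] by blast
 obtain k' n' where b: "ac_on L v' 0 k'" "ac_on L p' 0 n'" "f' \<in> L2 {0<..<L}" "h' \<in> L2 {0<..<L}" "z' \<in> L2 (rect L)"
  "c1 L (wderiv 0 L v') = cls1 L k'" "c1 L (wderiv 0 L p') = cls1 L n'" "k' \<in> sqi" "n' \<in> sqi"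
  using energy_space_cases[OF L_pos assms(2)[unfolded N]] by blast
 have primitive_eq_iff: "(AE x\<in>{0<..<L} in lborel. u x = u' x) \<longleftrightarrow> cls1 L g = cls1 L g'"
  if u: "ac_on L u 0 g" "ac_on L u' 0 g'" for u u' g g'
 proof -
  have g: "g \<in> sqi" "g' \<in> sqi" using u by (auto simp: ac_on_def)
  note eq = cls1_eq_iff[OF sq_int_sq1[OF g(1)] sq_int_sq1[OF g(2)], of L]
  show ?thesis
  proof
   assume "AE x\<in>{0<..<L} in lborel. u x = u' x"
   from ac_on_unique(2)[OF L_pos ac_on_cong[OF u(1) this] u(2)] show "cls1 L g = cls1 L g'" by (simp only: eq)
  next
   assume "cls1 L g = cls1 L g'"
   then have "AE x\<in>{0<..<L} in lborel. g x = g' x" by (simp only: eq)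
   then have "AE x in lborel. 0 < x \<and> x < L --> g x = g' x" by eventually_elim simp
   then have p: "prim g x = prim g' x" if "x \<le> L" for x
    using g that by (intro prim_cong_AE) (auto simp: sq_int_def)
   have "AE x\<in>{0<..<L} in lborel. u x = 0 + prim g x" "AE x\<in>{0<..<L} in lborel. u' x = 0 + prim g' x"
    using u by (auto simp: ac_on_def)
   then show "AE x\<in>{0<..<L} in lborel. u x = u' x" by eventually_elim (simp add: p)
  qed
 qed
 have split: "(AE x in lebesgue_on {0<..<L}. v x = v' x \<and> f x = f' x \<and> p x = p' x \<and> h x = h' x) \<longleftrightarrow>
  (AE x\<in>{0<..<L} in lborel. v x = v' x) \<and> (AE x\<in>{0<..<L} in lborel. f x = f' x) \<and>
  (AE x\<in>{0<..<L} in lborel. p x = p' x) \<and> (AE x\<in>{0<..<L} in lborel. h x = h' x)"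
  unfolding AE_lebesgue_on[OF Ioo_borel] by (simp only: imp_conjR AE_conj_iff)
 have "state_eq L M N \<longleftrightarrow> cls1 L k = cls1 L k' \<and> c1 L f = c1 L f' \<and> cls1 L n = cls1 L n' \<and> c1 L h = c1 L h' \<and> c2 L z = c2 L z'"
  unfolding M N state_eq.simps split AE_lebesgue_on[OF rect_borel] primitive_eq_iff[OF a(1) b(1)] primitive_eq_iff[OF a(2) b(2)]
   c1_eq_iff[OF a(3) b(3)] c1_eq_iff[OF a(4) b(4)] c2_eq_iff[OF a(5) b(5)] by blast
 also have "\<dots> \<longleftrightarrow> Phi M = Phi N"
  unfolding M N Phi.simps a b using rho_pos mu_pos alpha_pos beta_pos by auto
 finally show ?thesis .
qed

text \<open>In the scaled variables the energy inner product at time \<open>t\<close> is the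
  standard one except for the weight \<open>\<xi> t * \<tau> t / \<rho>\<close> on the history. The
  two constants are the square roots of the minimum and the maximum of 1 and this weight.\<close>

lemma energy_norm_equiv:
 assumes "0 < \<xi> t" "0 < \<tau> t"
 shows "\<exists>c>0. \<exists>C>0. \<forall>M\<in>energy_space L. c * norm (Phi M) \<le> energy_norm L \<rho> \<alpha>1 \<gamma> \<mu> \<beta> \<xi> \<tau> t M \<and>
  energy_norm L \<rho> \<alpha>1 \<gamma> \<mu> \<beta> \<xi> \<tau> t M \<le> C * norm (Phi M)"
proof -
 define \<kappa> where "\<kappa> = \<xi> t * \<tau> t / \<rho>"
 have \<kappa>: "0 < \<kappa>" using assms rho_pos by (simp add: \<kappa>_def)
 show ?thesis
 proof (intro exI conjI ballI)
  show "0 < sqrt (min 1 \<kappa>)" "0 < sqrt (max 1 \<kappa>)" using \<kappa> by (simp_all add: less_max_iff_disj)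
  fix M assume "M \<in> energy_space L"
  moreover obtain v f p h z where M: "M = (v, f, p, h, z)" by (cases M) auto
  ultimately have Me: "(v, f, p, h, z) \<in> energy_space L" by simp
  have a: "f \<in> L2 {0<..<L}" "h \<in> L2 {0<..<L}" "z \<in> L2 (rect L)" "wderiv 0 L v \<in> L2 {0<..<L}" "wderiv 0 L p \<in> L2 {0<..<L}"
   using energy_space_cases[OF L_pos Me] by metis+
  let ?s = "\<lambda>x. \<gamma> * wderiv 0 L v x - wderiv 0 L p x"
  have s: "?s \<in> L2 {0<..<L}" "c1 L ?s = \<gamma> *\<^sub>R c1 L (wderiv 0 L v) - c1 L (wderiv 0 L p)"
   using c1_add_scale[OF c1_scale[OF a(4), THEN conjunct1] a(5), of \<gamma> "- 1"] c1_scale[OF a(4), of \<gamma>] by simp_all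
  let ?e = "energy_inner L \<rho> \<alpha>1 \<gamma> \<mu> \<beta> \<xi> \<tau> t M M"
  obtain F H Q S Z where P: "Phi M = (F, H, Q, S, Z)" by (cases "Phi M") auto
  have "?e = \<rho> * (norm (c1 L f))\<^sup>2 + \<mu> * (norm (c1 L h))\<^sup>2 + \<alpha>1 * (norm (c1 L (wderiv 0 L v)))\<^sup>2 +
    \<beta> * (norm (\<gamma> *\<^sub>R c1 L (wderiv 0 L v) - c1 L (wderiv 0 L p)))\<^sup>2 + \<xi> t * \<tau> t * (norm (c2 L z))\<^sup>2"
   unfolding M energy_inner.simps c1_inner[OF a(1,1)] c1_inner[OF a(2,2)] c1_inner[OF a(4,4)] c1_inner[OF s(1,1)] c2_inner[OF a(3,3)] s(2)
   by (simp only: power2_norm_eq_inner)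
  also have "\<dots> = (norm F)\<^sup>2 + (norm H)\<^sup>2 + (norm Q)\<^sup>2 + (norm S)\<^sup>2 + \<kappa> * (norm Z)\<^sup>2"
   using P rho_pos mu_pos alpha_pos beta_pos unfolding M Phi.simps \<kappa>_def by (auto simp: power_mult_distrib)
  finally have e: "?e = (norm F)\<^sup>2 + (norm H)\<^sup>2 + (norm Q)\<^sup>2 + (norm S)\<^sup>2 + \<kappa> * (norm Z)\<^sup>2" .
  have n: "(norm (Phi M))\<^sup>2 = (norm F)\<^sup>2 + (norm H)\<^sup>2 + (norm Q)\<^sup>2 + (norm S)\<^sup>2 + (norm Z)\<^sup>2" unfolding P norm5 ..
  let ?w = "(norm F)\<^sup>2 + (norm H)\<^sup>2 + (norm Q)\<^sup>2 + (norm S)\<^sup>2"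
  have w: "0 \<le> ?w" by (intro add_nonneg_nonneg) simp_all
  have "min 1 \<kappa> * ?w \<le> 1 * ?w" "min 1 \<kappa> * (norm Z)\<^sup>2 \<le> \<kappa> * (norm Z)\<^sup>2"
   "1 * ?w \<le> max 1 \<kappa> * ?w" "\<kappa> * (norm Z)\<^sup>2 \<le> max 1 \<kappa> * (norm Z)\<^sup>2"
   using w by (intro mult_right_mono; simp)+
  from add_mono[OF this(1,2)] add_mono[OF this(3,4)]
  have "min 1 \<kappa> * (norm (Phi M))\<^sup>2 \<le> ?e" "?e \<le> max 1 \<kappa> * (norm (Phi M))\<^sup>2"
   unfolding e n distrib_left[of _ ?w] by (simp_all only: mult_1)
  from real_sqrt_le_mono[OF this(1)] real_sqrt_le_mono[OF this(2)]
  show "sqrt (min 1 \<kappa>) * norm (Phi M) \<le> energy_norm L \<rho> \<alpha>1 \<gamma> \<mu> \<beta> \<xi> \<tau> t M"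
   "energy_norm L \<rho> \<alpha>1 \<gamma> \<mu> \<beta> \<xi> \<tau> t M \<le> sqrt (max 1 \<kappa>) * norm (Phi M)"
   by (simp_all add: energy_norm_def real_sqrt_mult)
 qed
qed

lemma Phi_surj:
 assumes "y \<in> X1 L \<times> X1 L \<times> X1 L \<times> X1 L \<times> X2 L"
 shows "\<exists>M\<in>energy_space L. Phi M = y"
proof -
 obtain F H Q S Z where y: "y = (F, H, Q, S, Z)" by (cases y) auto
 then obtain f h q s where f: "f \<in> sqi" "F = cls1 L f" and h: "h \<in> sqi" "H = cls1 L h"
  and q: "q \<in> sqi" "Q = cls1 L q" and s: "s \<in> sqi" "S = cls1 L s" and Z: "Z \<in> X2 L"
  using assms by (auto elim!: X1_cases)
 \<comment> \<open>The third and fourth scaled variables are solved for \<open>v_x\<close> and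
   \<open>p_x\<close>; the displacements are their primitives from 0.\<close>
 let ?k = "\<lambda>x. (1 / sqrt \<alpha>1) * q x"
 let ?n = "\<lambda>x. \<gamma> * ?k x - (1 / sqrt \<beta>) * s x"
 have k: "?k \<in> sqi" and n: "?n \<in> sqi" by (intro sq_int_diff sq_int_scale q s)+
 have ac: "ac_on L (prim ?k) 0 ?k" "ac_on L (prim ?n) 0 ?n" using k n by (auto simp: ac_on_def)
 have AE_refl: "AE x\<in>A in lborel. u x = u x" for A :: "'a::euclidean_space set" and u :: "'a => real" by simp
 let ?f = "\<lambda>x. (1 / sqrt \<rho>) * f x" and ?h = "\<lambda>x. (1 / sqrt \<mu>) * h x" and ?z = "\<lambda>p. (1 / sqrt \<rho>) * rep Z p"
 have cf: "?f \<in> L2 {0<..<L} \<and> c1 L ?f = cls1 L ?f" "?h \<in> L2 {0<..<L} \<and> c1 L ?h = cls1 L ?h"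
  by (rule c1_L2, simp, intro sq_int_sq1 sq_int_scale f h)+
 have cz: "?z \<in> L2 (rect L) \<and> c2 L ?z = cls (\<lambda>p. ind2 L p * ?z p)"
  by (rule c2_L2, simp, intro ind2_mult_sq_int sq_int_scale rep_sq_int)
 have Zeq: "cls (\<lambda>p. ind2 L p * ?z p) = (1 / sqrt \<rho>) *\<^sub>R Z"
 proof -
  have "(1 / sqrt \<rho>) *\<^sub>R Z = (1 / sqrt \<rho>) *\<^sub>R cls (\<lambda>p. ind2 L p * rep Z p)" using X2_cls[OF Z] by simp
  also have "\<dots> = cls (\<lambda>p. (1 / sqrt \<rho>) * (ind2 L p * rep Z p))" by (rule cls_scale[OF ind2_mult_sq_int[OF rep_sq_int]])
  finally show ?thesis by (simp add: mult.left_commute)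
 qed
 have eq: "cls1 L ?f = (1 / sqrt \<rho>) *\<^sub>R F" "cls1 L ?h = (1 / sqrt \<mu>) *\<^sub>R H" "cls1 L ?k = (1 / sqrt \<alpha>1) *\<^sub>R Q"
  "cls1 L ?n = \<gamma> *\<^sub>R (1 / sqrt \<alpha>1) *\<^sub>R Q - (1 / sqrt \<beta>) *\<^sub>R S"
  unfolding f(2) h(2) q(2) s(2)
  by (simp_all only: cls1_diff cls1_scale sq1_scale sq_int_sq1 f h q s)
 let ?M = "(prim ?k, ?f, prim ?n, ?h, ?z)"
 have "?M \<in> energy_space L" using energy_spaceI[OF L_pos ac] cf cz by blast
 moreover have "Phi ?M = y"
  unfolding Phi.simps y c1_wderiv(2)[OF L_pos ac(1)] c1_wderiv(2)[OF L_pos ac(2)] cf[THEN conjunct2] cz[THEN conjunct2] Zeq eq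
  using rho_pos mu_pos alpha_pos beta_pos by simp
 ultimately show ?thesis by blast
qed

lemma Phi_X: "M \<in> energy_space L ==> Phi M \<in> X1 L \<times> X1 L \<times> X1 L \<times> X1 L \<times> X2 L"
proof -
 assume M: "M \<in> energy_space L"
 obtain v f p h z where M': "M = (v, f, p, h, z)" by (cases M) auto
 have a: "f \<in> L2 {0<..<L}" "h \<in> L2 {0<..<L}" "z \<in> L2 (rect L)" "wderiv 0 L v \<in> L2 {0<..<L}" "wderiv 0 L p \<in> L2 {0<..<L}"
  using energy_space_cases[OF L_pos M[unfolded M']] by metis+
 show ?thesis unfolding M' Phi.simps
  by (intro SigmaI subspace_scale[OF subspace_X1] subspace_scale[OF subspace_X2] subspace_diff[OF subspace_X1] c1_X1 c2_X2 a)
qed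

end

text \<open>The coefficients come from inserting the scaled variables into the beam equations; for
  instance \<open>sqrt \<alpha>1\<close> times \<open>f_x\<close> is
  \<open>sqrt (\<alpha>1 / \<rho>)\<close> times the derivative of
  \<open>sqrt \<rho> * f\<close>.\<close>

locale beam_transfer = beam_space L \<rho> \<alpha>1 \<gamma> \<mu> \<beta> +
 beam L \<rho> "sqrt (\<alpha>1 / \<rho>)" "\<gamma> * sqrt (\<beta> / \<rho>)" "sqrt (\<beta> / \<mu>)" \<tau>0 \<tau>1 d D \<tau> \<tau>' \<delta>1 \<delta>2
 for L \<rho> \<alpha>1 \<gamma> \<mu> \<beta> \<tau>0 \<tau>1 d D \<tau> \<tau>' \<delta>1 \<delta>2 +
 fixes \<alpha> :: real
 assumes alpha_eq: "\<alpha> = \<alpha>1 + \<gamma>\<^sup>2 * \<beta>"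
begin

lemma Phi_mem_X: "M \<in> energy_space L ==> Phi M \<in> X"
 using Phi_X by (simp add: X_def)

lemma Phi_onto_X: "y \<in> X ==> \<exists>M\<in>energy_space L. Phi M = y"
 by (rule Phi_surj) (simp add: X_def)

lemma delay_component:
 assumes k: "k \<in> sqi" and G: "G \<in> sqi" "\<And>p. ind2 L p * G p = G p"
 shows "J0 L (cls1 L k) + Kr (cls G) = cls (\<lambda>p. ind2 L p * delay_primitive (prim k) G p)"
  and "(\<lambda>p. ind2 L p * delay_primitive (prim k) G p) \<in> sqi"
proof -
 have pk: "prim k \<in> sq1 L" using prim_sq1[OF L_pos sq_int_sq1[OF k], of 0] by simp
 have z: "ind2 L p * (ind 1 (snd p) * prim (\<lambda>s. G (fst p, s)) (snd p)) =
   ind 1 (snd p) * prim (\<lambda>s. G (fst p, s)) (snd p)" for p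
 proof (cases "fst p \<in> {0<..<L}")
  case False
  then have "G (fst p, s) = 0" for s using G(2)[of "(fst p, s)"] by (simp add: ind2_def)
  then show ?thesis by (simp add: prim_def)
 qed (simp add: ind2_def split: split_indicator)
 have eq: "ind2 L p * delay_primitive (prim k) G p =
   ind2 L p * prim k (fst p) + ind 1 (snd p) * prim (\<lambda>s. G (fst p, s)) (snd p)" for p
  unfolding delay_primitive_def distrib_left z ..
 show "(\<lambda>p. ind2 L p * delay_primitive (prim k) G p) \<in> sqi"
  unfolding eq by (rule sq_int_add[OF cls1_sq_int[OF pk] Kr_cls(2)[OF G(1)]])
 show "J0 L (cls1 L k) + Kr (cls G) = cls (\<lambda>p. ind2 L p * delay_primitive (prim k) G p)"
  unfolding eq J0_cls1[OF L_pos sq_int_sq1[OF k]] Kr_cls(1)[OF G(1)]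
  by (simp only: cls1_def cls_add[OF cls1_sq_int[OF pk] Kr_cls(2)[OF G(1)]])
qed

lemma JL_cls1': "g \<in> sqi ==> JL L (cls1 L g) = cls1 L (\<lambda>x. - prim g L + prim g x)"
 by (subst JL_cls1[OF L_pos sq_int_sq1]) simp_all

lemma sections_integral:
 assumes "w \<in> X2 L"
 shows "Rr w = cls1 L (\<lambda>x. prim (\<lambda>s. ind2 L (x, s) * rep w (x, s)) 1)"
  and "(\<lambda>x. prim (\<lambda>s. ind2 L (x, s) * rep w (x, s)) 1) \<in> sq1 L"
proof -
 have "prim (\<lambda>s. ind2 L (x, s) * rep w (x, s)) 1 = (LINT s|lborel. ind2 L (x, s) * rep w (x, s))" for x
  unfolding prim_def by (intro lint_cong) (simp add: ind2_def split: split_indicator)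
 then show "Rr w = cls1 L (\<lambda>x. prim (\<lambda>s. ind2 L (x, s) * rep w (x, s)) 1)"
  "(\<lambda>x. prim (\<lambda>s. ind2 L (x, s) * rep w (x, s)) 1) \<in> sq1 L"
  using Rr_X2[OF assms] by simp_all
qed

text \<open>Here \<open>\<alpha> = \<alpha>1 + \<gamma>\<^sup>2 * \<beta>\<close> acts:
  \<open>\<alpha> v_xx - \<gamma> \<beta> p_xx = \<alpha>1 v_xx + \<gamma> \<beta> (\<gamma> v_xx -
  p_xx)\<close>. The letters \<open>r\<close>, \<open>k\<close>, \<open>e\<close> stand for the
  square roots of \<open>\<rho>\<close>, \<open>\<alpha>1\<close>, \<open>\<beta>\<close>.\<close>

lemma beam_op_first_component_algebra:
 fixes r k e g q s P t a1 a2 :: real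
 assumes "0 < r" "0 < k" "0 < e"
 shows "r * ((k\<^sup>2 + g\<^sup>2 * e\<^sup>2) / r\<^sup>2 * ((1 / k) * q) - g * e\<^sup>2 / r\<^sup>2 * (g * ((1 / k) * q) - (1 / e) * s)
   - a1 / r\<^sup>2 * ((1 / r) * P) - a2 / r\<^sup>2 * ((1 / r) * P + (1 / r) * t)) =
  (k / r) * q + (g * (e / r)) * s - (a1 / r\<^sup>2) * P - (a2 / r\<^sup>2) * (P + t)"
proof -
 have "r * ((k\<^sup>2 + g\<^sup>2 * e\<^sup>2) / r\<^sup>2 * ((1 / k) * q) - g * e\<^sup>2 / r\<^sup>2 * (g * ((1 / k) * q) - (1 / e) * s)) = (k / r) * q + (g * (e / r)) * s"
  using assms by (simp add: field_simps power2_eq_square)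
 moreover have "r * (a1 / r\<^sup>2 * ((1 / r) * P)) = (a1 / r\<^sup>2) * P"
  "r * (a2 / r\<^sup>2 * ((1 / r) * P + (1 / r) * t)) = (a2 / r\<^sup>2) * (P + t)"
  using assms by (simp_all add: field_simps)
 ultimately show ?thesis unfolding right_diff_distrib by linarith
qed

text \<open>Comparing components of \<open>Phi M = Bop y\<close> exhibits velocities, strains and
  history as explicit primitives; regularity, boundary and trace conditions follow, and so do all
  derivatives in \<open>beam_op\<close>. With \<open>range_of_domain\<close> this identifies the
  domain with the range of \<open>Bop\<close> and the generator with \<open>Cop t\<close>.\<close>

lemma domain_of_range:
 assumes M: "M \<in> energy_space L" and y: "y \<in> X" and eq: "Phi M = Bop y" and t: "t \<ge> 0"
 shows "M \<in> beam_domain L" "beam_op L \<rho> \<alpha> \<gamma> \<mu> \<beta> \<delta>1 \<delta>2 \<tau> \<tau>' t M \<in> energy_space L"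
  "Phi (beam_op L \<rho> \<alpha> \<gamma> \<mu> \<beta> \<delta>1 \<delta>2 \<tau> \<tau>' t M) = Cop t y"
proof -
 define r where "r = sqrt \<rho>"
 define k where "k = sqrt \<alpha>1"
 define e where "e = sqrt \<beta>"
 define u where "u = sqrt \<mu>"
 have pos: "0 < r" "0 < k" "0 < e" "0 < u" and sq: "\<rho> = r\<^sup>2" "\<alpha>1 = k\<^sup>2" "\<beta> = e\<^sup>2" "\<mu> = u\<^sup>2"
  using rho_pos alpha_pos beta_pos mu_pos by (simp_all add: r_def k_def e_def u_def)
 have roots: "sqrt (\<alpha>1 / \<rho>) = k / r" "sqrt (\<beta> / \<rho>) = e / r" "sqrt (\<beta> / \<mu>) = e / u"
  by (simp_all add: real_sqrt_divide r_def k_def e_def u_def)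
 obtain v f p h z where Me: "M = (v, f, p, h, z)" by (cases M) auto
 obtain F H Q S w where ye: "y = (F, H, Q, S, w)" by (cases y) auto
 have w: "w \<in> X2 L" using y by (simp add: ye X_def)
 obtain f' where f': "f' \<in> sqi" "F = cls1 L f'" using y X1_cases[of F L] by (auto simp: ye X_def)
 obtain h' where h': "h' \<in> sqi" "H = cls1 L h'" using y X1_cases[of H L] by (auto simp: ye X_def)
 obtain q' where q': "q' \<in> sqi" "Q = cls1 L q'" using y X1_cases[of Q L] by (auto simp: ye X_def)
 obtain s' where s': "s' \<in> sqi" "S = cls1 L s'" using y X1_cases[of S L] by (auto simp: ye X_def)
 define G where "G p = ind2 L p * rep w p" for p
 have G: "G \<in> sqi" "ind2 L p * G p = G p" "w = cls G" for p
  using X2_cls[OF w] ind2_mult_sq_int[OF rep_sq_int[of w], of L] by (simp_all add: G_def[abs_def] ind2_idem)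
 note dc = delay_component[OF f'(1) G(1,2)]
 have pr: "prim g \<in> sq1 L" "(\<lambda>x. c + prim g x) \<in> sq1 L" if "g \<in> sqi" for g c
  using prim_sq1[OF L_pos sq_int_sq1[OF that], of 0] prim_sq1[OF L_pos sq_int_sq1[OF that], of c] by simp_all
 obtain kv kp where a: "ac_on L v 0 kv" "ac_on L p 0 kp" "f \<in> L2 {0<..<L}" "h \<in> L2 {0<..<L}" "z \<in> L2 (rect L)"
  "wderiv 0 L v \<in> L2 {0<..<L}" "wderiv 0 L p \<in> L2 {0<..<L}"
  using energy_space_cases[OF L_pos M[unfolded Me]] by metis
 have e1: "r *\<^sub>R c1 L f = cls1 L (prim f')" "u *\<^sub>R c1 L h = cls1 L (prim h')"
  "k *\<^sub>R c1 L (wderiv 0 L v) = cls1 L (\<lambda>x. - prim q' L + prim q' x)"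
  "e *\<^sub>R (\<gamma> *\<^sub>R c1 L (wderiv 0 L v) - c1 L (wderiv 0 L p)) = cls1 L (\<lambda>x. - prim s' L + prim s' x)"
  "r *\<^sub>R c2 L z = cls (\<lambda>p. ind2 L p * delay_primitive (prim f') G p)"
  using eq unfolding Me ye Phi.simps Bop.simps f' h' q' s' G(3) dc(1) JL_cls1'[OF q'(1)] JL_cls1'[OF s'(1)]
   J0_cls1[OF L_pos sq_int_sq1[OF f'(1)]] J0_cls1[OF L_pos sq_int_sq1[OF h'(1)]] r_def k_def e_def u_def
   dc(1)[unfolded J0_cls1[OF L_pos sq_int_sq1[OF f'(1)]]] by auto
 let ?kf = "\<lambda>x. (1 / r) * f' x" and ?kh = "\<lambda>x. (1 / u) * h' x" and ?m = "\<lambda>x. (1 / k) * q' x"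
 let ?n = "\<lambda>x. \<gamma> * ?m x - (1 / e) * s' x"
 have sqn: "?kf \<in> sqi" "?kh \<in> sqi" "?m \<in> sqi" "?n \<in> sqi"
  by (intro sq_int_diff sq_int_scale f' h' q' s')+
 have "AE x\<in>{0<..<L} in lborel. r * f x = prim f' x" using e1(1) scaled_c1_iff[OF a(3) pr(1)[OF f'(1)]] by simp
 then have "AE x\<in>{0<..<L} in lborel. f x = 0 + prim ?kf x"
  unfolding prim_scale by eventually_elim (use pos in \<open>auto simp: field_simps\<close>)
 then have acf: "ac_on L f 0 ?kf" using sqn by (simp add: ac_on_def)
 have "AE x\<in>{0<..<L} in lborel. u * h x = prim h' x" using e1(2) scaled_c1_iff[OF a(4) pr(1)[OF h'(1)]] by simp
 then have "AE x\<in>{0<..<L} in lborel. h x = 0 + prim ?kh x"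
  unfolding prim_scale by eventually_elim (use pos in \<open>auto simp: field_simps\<close>)
 then have ach: "ac_on L h 0 ?kh" using sqn by (simp add: ac_on_def)
 have vx: "AE x\<in>{0<..<L} in lborel. k * wderiv 0 L v x = - prim q' L + prim q' x"
  by (rule scaled_c1_iff[OF a(6) pr(2)[OF q'(1)], THEN iffD1, OF e1(3)])
 \<comment> \<open>The constant is minus the value of the primitive at \<open>L\<close>, so the
   continuous representative of \<open>v_x\<close> vanishes there.\<close>
 then have "AE x\<in>{0<..<L} in lborel. wderiv 0 L v x = - prim ?m L + prim ?m x"
  unfolding prim_scale by eventually_elim (use pos in \<open>auto simp: field_simps\<close>)
 then have acvx: "ac_on L (wderiv 0 L v) (- prim ?m L) ?m" using sqn by (simp add: ac_on_def)
 let ?s = "\<lambda>x. \<gamma> * wderiv 0 L v x - wderiv 0 L p x"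
 have s: "?s \<in> L2 {0<..<L}" "c1 L ?s = \<gamma> *\<^sub>R c1 L (wderiv 0 L v) - c1 L (wderiv 0 L p)"
  using c1_add_scale[OF c1_scale[OF a(6), THEN conjunct1] a(7), of \<gamma> "- 1"] c1_scale[OF a(6), of \<gamma>] by simp_all
 have "AE x\<in>{0<..<L} in lborel. e * (\<gamma> * wderiv 0 L v x - wderiv 0 L p x) = - prim s' L + prim s' x"
  by (rule scaled_c1_iff[OF s(1) pr(2)[OF s'(1)], unfolded s(2), THEN iffD1, OF e1(4)])
 then have "AE x\<in>{0<..<L} in lborel. wderiv 0 L p x = - prim ?n L + prim ?n x"
  using vx
 proof eventually_elim
  case (elim x)
  have pn: "prim ?n y = \<gamma> * ((1 / k) * prim q' y) - (1 / e) * prim s' y" for y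
   by (subst prim_diff) (intro sq_int_scale q' s', intro sq_int_scale s', simp only: prim_scale)
  show ?case
  proof
   assume x: "x \<in> {0<..<L}"
   have "wderiv 0 L v x = (1 / k) * (- prim q' L + prim q' x)"
    "\<gamma> * wderiv 0 L v x - wderiv 0 L p x = (1 / e) * (- prim s' L + prim s' x)"
    using elim x pos by (auto simp: field_simps)
   then have "wderiv 0 L p x = \<gamma> * ((1 / k) * (- prim q' L + prim q' x)) - (1 / e) * (- prim s' L + prim s' x)" by simp
   then show "wderiv 0 L p x = - prim ?n L + prim ?n x" unfolding pn by (simp add: algebra_simps)
  qed
 qed
 then have acpx: "ac_on L (wderiv 0 L p) (- prim ?n L) ?n" using sqn by (simp add: ac_on_def)
 let ?g = "\<lambda>p. (1 / r) * G p"
 have g: "?g \<in> sqi" by (intro sq_int_scale G)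
 have "AE p\<in>rect L in lborel. r * z p = delay_primitive (prim f') G p"
  using e1(5) scaled_c2_iff[OF a(5) dc(2)] by simp
 then have z: "AE p\<in>rect L in lborel. z p = delay_primitive (prim ?kf) ?g p"
 proof eventually_elim
  case (elim p)
  have "delay_primitive (prim ?kf) ?g p = (1 / r) * delay_primitive (prim f') G p"
   by (simp only: delay_primitive_def prim_scale distrib_left mult.left_commute)
  then show ?case using elim pos by (simp only:) (auto simp: field_simps)
 qed
 note zd = delay_primitive_L2_H1[OF g a(5) z]
 have tr0: "AE x in lebesgue_on {0<..<L}. f x = trace_r z 0 x"
  unfolding AE_lebesgue_on[OF Ioo_borel] using zd(3) acf[unfolded ac_on_def, THEN conjunct2] by eventually_elim simp
 have kv: "AE x\<in>{0<..<L} in lborel. wderiv 0 L v x = kv x" "AE x\<in>{0<..<L} in lborel. wderiv 0 L p x = kp x"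
  using ac_on_wderiv[OF L_pos] a by blast+
 have "v \<in> H2 0 L \<inter> H1_star L \<and> cont_rep 0 L (wderiv 0 L v) L = 0"
  unfolding beam_displacement_iff[OF L_pos] using a(1) ac_on_cong[OF acvx kv(1)] by (intro exI conjI)
 moreover have "p \<in> H2 0 L \<inter> H1_star L \<and> cont_rep 0 L (wderiv 0 L p) L = 0"
  unfolding beam_displacement_iff[OF L_pos] using a(2) ac_on_cong[OF acpx kv(2)] by (intro exI conjI)
 moreover have "f \<in> H1_star L" "h \<in> H1_star L" unfolding H1_star_iff[OF L_pos] by (rule exI, rule acf, rule exI, rule ach)
 ultimately show "M \<in> beam_domain L" unfolding Me beam_domain_def using zd(1) tr0 by simp
 have vxx: "AE x\<in>{0<..<L} in lborel. wderiv 0 L (wderiv 0 L v) x = ?m x"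
  and pxx: "AE x\<in>{0<..<L} in lborel. wderiv 0 L (wderiv 0 L p) x = ?n x"
  by (rule ac_on_wderiv[OF L_pos acvx], rule ac_on_wderiv[OF L_pos acpx])
 define tt where "tt x = prim (\<lambda>s. G (x, s)) 1" for x
 have tt: "tt \<in> sq1 L" "Rr w = cls1 L tt" using sections_integral[OF w] by (simp_all add: tt_def[abs_def] G_def)
 define fo where "fo x = \<alpha> / \<rho> * ?m x - \<gamma> * \<beta> / \<rho> * ?n x - \<delta>1 t / \<rho> * ((1 / r) * prim f' x) -
  \<delta>2 t / \<rho> * ((1 / r) * prim f' x + (1 / r) * tt x)" for x
 define ho where "ho x = - (\<gamma> * \<beta> / \<mu>) * ?m x + \<beta> / \<mu> * ?n x" for x
 define zo where "zo p = (\<tau>' t * snd p - 1) / \<tau> t * ?g p" for p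
 obtain f1 h1 z1 where bo: "beam_op L \<rho> \<alpha> \<gamma> \<mu> \<beta> \<delta>1 \<delta>2 \<tau> \<tau>' t M = (f, f1, h, h1, z1)"
  and f1: "f1 = (\<lambda>x. \<alpha> / \<rho> * wderiv 0 L (wderiv 0 L v) x - \<gamma> * \<beta> / \<rho> * wderiv 0 L (wderiv 0 L p) x - \<delta>1 t / \<rho> * f x - \<delta>2 t / \<rho> * trace_r z 1 x)"
  and h1: "h1 = (\<lambda>x. - (\<gamma> * \<beta> / \<mu>) * wderiv 0 L (wderiv 0 L v) x + \<beta> / \<mu> * wderiv 0 L (wderiv 0 L p) x)"
  and z1: "z1 = (\<lambda>(x, r). (\<tau>' t * r - 1) / \<tau> t * wderiv_r L z (x, r))"
  by (simp add: Me Let_def)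
 have fo: "fo \<in> sq1 L" "ho \<in> sq1 L" unfolding fo_def[abs_def] ho_def[abs_def]
  by (intro sq1_add sq1_diff sq1_scale tt(1) pr(1) sq_int_sq1 f'(1) q'(1) s'(1))+
 have zo: "ind2 L p * zo p = (1 / r) * (Mt t p * G p)" for p
 proof (cases "snd p \<in> {0<..<1}")
  case True
  then have M: "Mt t p = (\<tau>' t * snd p - 1) / \<tau> t" by (simp add: Mt_def diff_divide_distrib)
  have "zo p = (1 / r) * (Mt t p * G p)" unfolding zo_def M by (simp only: mult_ac)
  then have "ind2 L p * zo p = (1 / r) * (Mt t p * (ind2 L p * G p))" by (simp only: mult_ac)
  then show ?thesis by (simp only: G(2))
 qed (simp add: ind2_def Mt_def)
 have MtG: "(\<lambda>p. Mt t p * G p) \<in> sqi" and MtG': "mul_op (Mt t) w = cls (\<lambda>p. Mt t p * G p)"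
  unfolding G(3) by (rule mul_fun_sq_int[OF Mt_measurable Mt_bound G(1)], rule mul_op_cls[OF Mt_measurable Mt_bound G(1)])
 have zsq: "(\<lambda>p. ind2 L p * zo p) \<in> sqi" unfolding zo by (rule sq_int_scale[OF MtG])
 have f1L: "f1 \<in> L2 {0<..<L} \<and> c1 L f1 = cls1 L fo"
 proof (rule c1_L2[OF _ fo(1)])
  show "AE x\<in>{0<..<L} in lborel. f1 x = fo x"
   using vxx pxx zd(3)[unfolded prim_scale] acf[unfolded ac_on_def prim_scale, THEN conjunct2]
  proof eventually_elim
   case (elim x)
   show ?case
   proof
    assume "x \<in> {0<..<L}"
    with elim have "wderiv 0 L (wderiv 0 L v) x = ?m x" "wderiv 0 L (wderiv 0 L p) x = ?n x"
     "f x = (1 / r) * prim f' x" "trace_r z 1 x = (1 / r) * prim f' x + (1 / r) * tt x" by (auto simp: tt_def)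
    then show "f1 x = fo x" by (simp only: f1 fo_def)
   qed
  qed
 qed
 have h1L: "h1 \<in> L2 {0<..<L} \<and> c1 L h1 = cls1 L ho"
  by (rule c1_L2[OF _ fo(2)]) (use vxx pxx in \<open>eventually_elim, auto simp: h1 ho_def\<close>)
 have z1L: "z1 \<in> L2 (rect L) \<and> c2 L z1 = cls (\<lambda>p. ind2 L p * zo p)"
  by (rule c2_L2[OF _ zsq]) (use zd(2) in \<open>eventually_elim, auto simp: z1 zo_def\<close>)
 show "beam_op L \<rho> \<alpha> \<gamma> \<mu> \<beta> \<delta>1 \<delta>2 \<tau> \<tau>' t M \<in> energy_space L"
  unfolding bo using energy_spaceI[OF L_pos acf ach] f1L h1L z1L by blast
 note S1 = sq1_add sq1_diff sq1_scale tt(1) pr(1)[OF f'(1)] sq_int_sq1[OF f'(1)] sq_int_sq1[OF h'(1)] sq_int_sq1[OF q'(1)] sq_int_sq1[OF s'(1)]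
 have lin: "r *\<^sub>R cls1 L fo = (k / r) *\<^sub>R cls1 L q' + (\<gamma> * (e / r)) *\<^sub>R cls1 L s' - (\<delta>1 t / \<rho>) *\<^sub>R cls1 L (prim f') -
   (\<delta>2 t / \<rho>) *\<^sub>R (cls1 L (prim f') + cls1 L tt)"
 proof -
  have "r *\<^sub>R cls1 L fo = cls1 L (\<lambda>x. r * fo x)" by (simp only: cls1_scale[OF fo(1)])
  also have "(\<lambda>x. r * fo x) = (\<lambda>x. (k / r) * q' x + (\<gamma> * (e / r)) * s' x - (\<delta>1 t / \<rho>) * prim f' x - (\<delta>2 t / \<rho>) * (prim f' x + tt x))"
   unfolding fo_def alpha_eq sq beam_op_first_component_algebra[OF pos(1-3)] ..
  finally show ?thesis by (simp only: S1 cls1_add cls1_diff cls1_scale)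
 qed
 have lin2: "u *\<^sub>R cls1 L ho = - (e / u) *\<^sub>R cls1 L s'"
 proof -
  have "u *\<^sub>R cls1 L ho = cls1 L (\<lambda>x. u * ho x)" by (simp only: cls1_scale[OF fo(2)])
  also have "(\<lambda>x. u * ho x) = (\<lambda>x. - (e / u) * s' x)"
   unfolding ho_def sq using pos by (simp add: fun_eq_iff field_simps power2_eq_square)
  finally show ?thesis by (simp only: S1 cls1_scale)
 qed
 have lin3: "k *\<^sub>R cls1 L ?kf = (k / r) *\<^sub>R cls1 L f'"
  "e *\<^sub>R (\<gamma> *\<^sub>R cls1 L ?kf - cls1 L ?kh) = (\<gamma> * (e / r)) *\<^sub>R cls1 L f' - (e / u) *\<^sub>R cls1 L h'"
  unfolding cls1_scale[OF sq_int_sq1[OF f'(1)]] cls1_scale[OF sq_int_sq1[OF h'(1)]]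
  by (simp_all add: scaleR_diff_right mult.commute)
 have lin4: "r *\<^sub>R cls (\<lambda>p. ind2 L p * zo p) = cls (\<lambda>p. Mt t p * G p)"
  unfolding zo cls_scale[OF MtG, symmetric] using pos by simp
 show "Phi (beam_op L \<rho> \<alpha> \<gamma> \<mu> \<beta> \<delta>1 \<delta>2 \<tau> \<tau>' t M) = Cop t y"
  unfolding bo Phi.simps ye Cop.simps
  unfolding f1L[THEN conjunct2] h1L[THEN conjunct2] z1L[THEN conjunct2]
   c1_wderiv(2)[OF L_pos acf] c1_wderiv(2)[OF L_pos ach] r_def[symmetric] k_def[symmetric] e_def[symmetric] u_def[symmetric]
   lin lin2 lin3 lin4 roots MtG' tt(2) f'(2) h'(2) q'(2) s'(2) J0_cls1[OF L_pos sq_int_sq1[OF f'(1)]] ..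
qed

text \<open>The coordinates are the scaled second derivatives of the displacements, first
  derivatives of the velocities and the derivative of the history; the trace condition makes the
  history start from the velocity, as \<open>Bop\<close> requires.\<close>

lemma range_of_domain:
 assumes M: "M \<in> beam_domain L"
 shows "M \<in> energy_space L" "\<exists>y\<in>X. Phi M = Bop y"
proof -
 obtain v f p h z where Me: "M = (v, f, p, h, z)" by (cases M) auto
 have D: "v \<in> H2 0 L \<inter> H1_star L \<and> cont_rep 0 L (wderiv 0 L v) L = 0" "p \<in> H2 0 L \<inter> H1_star L \<and> cont_rep 0 L (wderiv 0 L p) L = 0"
  "f \<in> H1_star L" "h \<in> H1_star L" "z \<in> L2_H1 L" and tr: "AE x in lebesgue_on {0<..<L}. f x = trace_r z 0 x"
  using M unfolding Me beam_domain_def by auto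
 obtain kv m where v: "ac_on L v 0 kv" "ac_on L kv (- prim m L) m" using D(1) unfolding beam_displacement_iff[OF L_pos] by (elim exE conjE)
 obtain kp n where p: "ac_on L p 0 kp" "ac_on L kp (- prim n L) n" using D(2) unfolding beam_displacement_iff[OF L_pos] by (elim exE conjE)
 obtain kf where f: "ac_on L f 0 kf" using D(3) unfolding H1_star_iff[OF L_pos] by (elim exE)
 obtain kh where h: "ac_on L h 0 kh" using D(4) unfolding H1_star_iff[OF L_pos] by (elim exE)
 obtain w where w: "has_L2_deriv_r L z w" using D(5) by (auto simp: L2_H1_def)
 have sqn: "m \<in> sqi" "n \<in> sqi" "kf \<in> sqi" "kh \<in> sqi"
  using v p f h by (auto simp: ac_on_def)
 have zL: "z \<in> L2 (rect L)" "w \<in> L2 (rect L)" using w by (auto simp: has_L2_deriv_r_def)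
 note b = brep[OF rect_borel zL(2)]
 have L2fh: "f \<in> L2 {0<..<L} \<and> c1 L f = cls1 L (prim kf)" "h \<in> L2 {0<..<L} \<and> c1 L h = cls1 L (prim kh)"
  using ac_on_L2[OF L_pos f] ac_on_L2[OF L_pos h] by simp_all
 show "M \<in> energy_space L" unfolding Me using energy_spaceI[OF L_pos v(1) p(1)] L2fh zL by blast
 define G where "G p = ind2 L p * brep (rect L) w p" for p
 have G: "G \<in> sqi" "ind2 L p * G p = G p" "cls G \<in> X2 L" for p
  using ind2_mult_sq_int[OF b(1), of L] cls_ind2_X2[OF b(1), of L] by (simp_all add: G_def[abs_def] ind2_idem)
 have "AE p\<in>rect L in lborel. z p = delay_primitive (prim kf) (brep (rect L) w) p"
 proof (rule L2_H1_primitive[OF w prim_measurable[OF sqn(3)]])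
  show "AE x\<in>{0<..<L} in lborel. prim kf x = trace_r z 0 x"
   using tr[unfolded AE_lebesgue_on[OF Ioo_borel]] f[unfolded ac_on_def, THEN conjunct2] by eventually_elim simp
 qed
 then have z: "AE p\<in>rect L in lborel. z p = delay_primitive (prim kf) G p"
 proof eventually_elim
  case (elim q)
  have "prim (\<lambda>s. G (fst q, s)) (snd q) = prim (\<lambda>s. brep (rect L) w (fst q, s)) (snd q)" if "q \<in> rect L"
   unfolding prim_def using that by (intro lint_cong) (auto simp: G_def ind2_def split: split_indicator)
  then show ?case using elim by (simp add: delay_primitive_def)
 qed
 note dc = delay_component[OF sqn(3) G(1,2)]
 have cz: "c2 L z = J0 L (cls1 L kf) + Kr (cls G)" unfolding dc(1) by (rule c2_L2[OF z dc(2), THEN conjunct2])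
 have vx: "c1 L (wderiv 0 L v) = JL L (cls1 L m)" "c1 L (wderiv 0 L p) = JL L (cls1 L n)"
 proof -
  have "c1 L (wderiv 0 L v) = cls1 L kv" "c1 L (wderiv 0 L p) = cls1 L kp" by (rule c1_wderiv(2)[OF L_pos] v p)+
  moreover have "cls1 L g = cls1 L (\<lambda>x. c + prim g' x)" if "ac_on L g c g'" "g \<in> sqi" for g c g'
   using that cls1_eq_iff[OF sq_int_sq1[OF that(2)] prim_sq1[OF L_pos sq_int_sq1, of g']] by (auto simp: ac_on_def)
  from this[OF v(2)] this[OF p(2)]
  have "cls1 L kv = cls1 L (\<lambda>x. - prim m L + prim m x)" "cls1 L kp = cls1 L (\<lambda>x. - prim n L + prim n x)"
   using v(1) p(1) by (simp_all add: ac_on_def)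
  ultimately show "c1 L (wderiv 0 L v) = JL L (cls1 L m)" "c1 L (wderiv 0 L p) = JL L (cls1 L n)"
   using JL_cls1' sqn by simp_all
 qed
 let ?y = "(sqrt \<rho> *\<^sub>R cls1 L kf, sqrt \<mu> *\<^sub>R cls1 L kh, sqrt \<alpha>1 *\<^sub>R cls1 L m,
  sqrt \<beta> *\<^sub>R (\<gamma> *\<^sub>R cls1 L m - cls1 L n), sqrt \<rho> *\<^sub>R cls G)"
 have X1: "cls1 L g \<in> X1 L" if "g \<in> sqi" for g using sq_int_sq1[OF that] by (auto simp: X1_def)
 have "?y \<in> X" unfolding X_def
  by (intro SigmaI subspace_scale[OF subspace_X1] subspace_scale[OF subspace_X2] subspace_diff[OF subspace_X1] X1 sqn G)
 moreover have "Phi M = Bop ?y"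
 proof -
  note lin = bounded_linear_ops[OF L_pos, THEN bounded_linear.linear]
  have J0f: "c1 L f = J0 L (cls1 L kf)" "c1 L h = J0 L (cls1 L kh)"
   using L2fh J0_cls1[OF L_pos sq_int_sq1] sqn by simp_all
  show ?thesis unfolding Me Phi.simps Bop.simps cz vx J0f
   by (simp add: lin(1,2,3)[THEN linear_scale] lin(2)[THEN linear_diff] scaleR_add_right scaleR_diff_right)
 qed
 ultimately show "\<exists>y\<in>X. Phi M = Bop y" by blast
qed

end

section \<open>Well-posedness\<close>

context beam_transfer
begin

abbreviation "E_space \<equiv> energy_space L"
abbreviation "A_op \<equiv> beam_op L \<rho> \<alpha> \<gamma> \<mu> \<beta> \<delta>1 \<delta>2 \<tau> \<tau>'"

text \<open>The energy norms at the various times are all of this kind, so quantifying over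
  \<open>N\<close> last lets a single curve serve for every one of them.\<close>

definition equivalent_norm :: "(state => real) => bool" where
 "equivalent_norm N \<longleftrightarrow> (\<exists>c>0. \<exists>C>0. \<forall>M\<in>E_space. c * norm (Phi M) \<le> N M \<and> N M \<le> C * norm (Phi M))"

lemma norm_tendsto_zero_iff:
 assumes N: "equivalent_norm N" and M: "\<forall>\<^sub>F s in F. M s \<in> E_space"
 shows "((\<lambda>s. N (M s)) \<longlongrightarrow> 0) F \<longleftrightarrow> ((\<lambda>s. Phi (M s)) \<longlongrightarrow> 0) F"
proof -
 obtain c C where c: "0 < c" "0 < C" "\<And>M. M \<in> E_space ==> c * norm (Phi M) \<le> N M" "\<And>M. M \<in> E_space ==> N M \<le> C * norm (Phi M)"
  using N unfolding equivalent_norm_def by auto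
 have nn: "0 \<le> N M" if "M \<in> E_space" for M
  using c(3)[OF that] mult_nonneg_nonneg[OF less_imp_le[OF c(1)] norm_ge_zero[of "Phi M"]] by linarith
 show ?thesis
 proof
  assume "((\<lambda>s. N (M s)) \<longlongrightarrow> 0) F"
  then have l: "((\<lambda>s. (1 / c) * N (M s)) \<longlongrightarrow> 0) F" by (rule tendsto_mult_right_zero)
  show "((\<lambda>s. Phi (M s)) \<longlongrightarrow> 0) F"
  proof (rule Lim_null_comparison[OF _ l])
   show "\<forall>\<^sub>F s in F. norm (Phi (M s)) \<le> (1 / c) * N (M s)" using M
   proof eventually_elim
    case (elim s)
    show ?case using c(1) c(3)[OF elim] by (simp add: field_simps)
   qed
  qed
 next
  assume "((\<lambda>s. Phi (M s)) \<longlongrightarrow> 0) F"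
  then have l: "((\<lambda>s. C * norm (Phi (M s))) \<longlongrightarrow> 0) F" by (intro tendsto_mult_right_zero tendsto_norm_zero)
  show "((\<lambda>s. N (M s)) \<longlongrightarrow> 0) F"
  proof (rule Lim_null_comparison[OF _ l])
   show "\<forall>\<^sub>F s in F. norm (N (M s)) \<le> C * norm (Phi (M s))" using M
   proof eventually_elim
    case (elim s)
    show ?case using nn[OF elim] c(4)[OF elim] by simp
   qed
  qed
 qed
qed

lemma eventually_nonneg: "\<forall>\<^sub>F s in at0 t. (0 :: real) \<le> s"
 by (simp add: eventually_at_filter)

lemma C_curve_iff:
 assumes N: "equivalent_norm N"
 shows "C_curve E_space N U \<longleftrightarrow> (\<forall>t\<ge>0. U t \<in> E_space) \<and> continuous_on {0..} (\<lambda>t. Phi (U t))"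
proof -
 have "((\<lambda>s. N (U s - U t)) \<longlongrightarrow> 0) (at0 t) \<longleftrightarrow> ((\<lambda>s. Phi (U s)) \<longlongrightarrow> Phi (U t)) (at0 t)"
  if U: "\<forall>t\<ge>0. U t \<in> E_space" and t: "t \<ge> 0" for t
 proof -
  have ev: "\<forall>\<^sub>F s in at0 t. U s - U t \<in> E_space \<and> Phi (U s - U t) = Phi (U s) - Phi (U t)"
   using eventually_nonneg by eventually_elim (use U t Phi_diff in simp)
  have "((\<lambda>s. N (U s - U t)) \<longlongrightarrow> 0) (at0 t) \<longleftrightarrow> ((\<lambda>s. Phi (U s - U t)) \<longlongrightarrow> 0) (at0 t)"
   by (rule norm_tendsto_zero_iff[OF N eventually_mono[OF ev]]) simp
  also have "\<dots> \<longleftrightarrow> ((\<lambda>s. Phi (U s) - Phi (U t)) \<longlongrightarrow> 0) (at0 t)"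
   by (rule tendsto_cong) (use ev in eventually_elim, simp)
  finally show ?thesis by (simp only: LIM_zero_iff)
 qed
 then show ?thesis unfolding C_curve_def continuous_on_def by (auto simp: Ball_def)
qed

lemma has_curve_deriv_iff:
 assumes N: "equivalent_norm N" and U: "\<forall>t\<ge>0. U t \<in> E_space" and W: "W \<in> E_space" and t: "t \<ge> 0"
 shows "has_curve_deriv N U W t \<longleftrightarrow> ((\<lambda>t. Phi (U t)) has_vector_derivative Phi W) (at0 t)"
proof -
 let ?q = "\<lambda>s. state_scale (1 / (s - t)) (U s - U t)"
 have ev: "\<forall>\<^sub>F s in at0 t. ?q s - W \<in> E_space \<and> Phi (?q s - W) = (1 / (s - t)) *\<^sub>R (Phi (U s) - Phi (U t)) - Phi W"
  using eventually_nonneg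
 proof eventually_elim
  case (elim s)
  then have d: "U s - U t \<in> E_space" "Phi (U s - U t) = Phi (U s) - Phi (U t)" using U t by (auto intro!: Phi_diff)
  show ?case using Phi_diff[OF Phi_scale(1)[OF d(1)] W] Phi_scale(2)[OF d(1)] d(2) by simp
 qed
 have "has_curve_deriv N U W t \<longleftrightarrow> ((\<lambda>s. Phi (?q s - W)) \<longlongrightarrow> 0) (at0 t)"
  unfolding has_curve_deriv_def by (rule norm_tendsto_zero_iff[OF N eventually_mono[OF ev]]) simp
 also have "\<dots> \<longleftrightarrow> ((\<lambda>s. (1 / (s - t)) *\<^sub>R (Phi (U s) - Phi (U t)) - Phi W) \<longlongrightarrow> 0) (at0 t)"
  by (rule tendsto_cong) (use ev in eventually_elim, simp)
 finally show ?thesis by (simp only: LIM_zero_iff has_vector_derivative_iff_quotient)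
qed

lemma classical_solutionI:
 assumes N: "equivalent_norm N" and y: "classical y" and U: "\<And>t. t \<ge> 0 ==> U t \<in> E_space \<and> Phi (U t) = Bop (y t)"
  and M: "M \<in> E_space" "Phi M = Bop (y 0)"
 shows "classical_solution L N A_op M U"
proof -
 have yX: "y t \<in> X" if "t \<ge> 0" for t using y that by (simp add: classical_def)
 have By: "Phi (U t) = Bop (y t)" and UE: "U t \<in> E_space" if "t \<ge> 0" for t using U[OF that] by auto
 note dr = domain_of_range[OF UE yX By]
 have "continuous_on {0..} (\<lambda>t. Phi (U t))"
  using y by (subst continuous_on_cong[OF refl By]) (auto simp: classical_def)
 then have "C_curve E_space N U" using UE by (simp add: C_curve_iff[OF N])
 moreover have "has_curve_deriv N U (A_op t (U t)) t" if t: "t > 0" for t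
 proof -
  have t0: "t \<ge> 0" using t by simp
  have "((\<lambda>t. Bop (y t)) has_vector_derivative Cop t (y t)) (at0 t)"
   using y t by (auto simp: classical_def intro: has_vector_derivative_at_within)
  then have "((\<lambda>t. Phi (U t)) has_vector_derivative Cop t (y t)) (at0 t)"
   by (rule has_vector_derivative_transform[rotated 2]) (use t By in auto)
  then show ?thesis using dr(2,3)[OF t0 t0 t0 t0] UE t0
   by (subst has_curve_deriv_iff[OF N]) auto
 qed
 moreover have "state_eq L (U 0) M" using UE[of 0] By[of 0] M by (simp add: state_eq_iff)
 ultimately show ?thesis unfolding classical_solution_def using dr(1) by auto
qed

text \<open>The coordinates \<open>y t\<close> are chosen separately for each time, without any
  continuity; this is why \<open>classical\<close> asks for continuity of the states only.\<close>

lemma classical_solutionD: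
 assumes N: "equivalent_norm N" and U: "classical_solution L N A_op M U" and M: "M \<in> E_space"
 shows "\<exists>y. classical y \<and> (\<forall>t\<ge>0. U t \<in> E_space \<and> Phi (U t) = Bop (y t)) \<and> Phi M = Bop (y 0)"
proof -
 have UE: "U t \<in> E_space" and UD: "U t \<in> beam_domain L" if "t \<ge> 0" for t
  using U that by (auto simp: classical_solution_def C_curve_def)
 have "\<exists>y\<in>X. Phi (U t) = Bop y" if "t \<ge> 0" for t by (rule range_of_domain(2)[OF UD[OF that]])
 then obtain y where y: "\<And>t. t \<ge> 0 ==> y t \<in> X" "\<And>t. t \<ge> 0 ==> Phi (U t) = Bop (y t)" by metis
 have "classical y" unfolding classical_def
 proof (intro conjI allI impI)
  show "y t \<in> X" if "0 \<le> t" for t by (rule y(1)[OF that])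
  have "continuous_on {0..} (\<lambda>t. Phi (U t))"
   using U C_curve_iff[OF N] by (auto simp: classical_solution_def)
  then show "continuous_on {0..} (\<lambda>t. Bop (y t))" by (subst continuous_on_cong[OF refl y(2)[symmetric]]) auto
  fix t :: real assume t: "0 < t"
  then have t0: "0 \<le> t" by simp
  note dr = domain_of_range[OF UE[OF t0] y(1)[OF t0] y(2)[OF t0] t0]
  have "has_curve_deriv N U (A_op t (U t)) t" using U t by (simp add: classical_solution_def)
  then have "((\<lambda>t. Phi (U t)) has_vector_derivative Cop t (y t)) (at0 t)"
   using UE dr t0 by (subst (asm) has_curve_deriv_iff[OF N]) auto
  then have "((\<lambda>t. Bop (y t)) has_vector_derivative Cop t (y t)) (at0 t)"
   by (rule has_vector_derivative_transform[rotated 2]) (use t y(2) in auto)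
  then show "((\<lambda>t. Bop (y t)) has_vector_derivative Cop t (y t)) (at t)" using t by (simp only: at_within_nonneg)
 qed
 moreover have "state_eq L (U 0) M" using U by (simp add: classical_solution_def)
 then have "Phi M = Bop (y 0)" using state_eq_iff[OF UE[of 0] M] y(2)[of 0] by simp
 ultimately show ?thesis using UE y(2) by blast
qed

lemma mild_solutionD:
 assumes N: "equivalent_norm N" and V: "mild_solution L N A_op M V" and M: "M \<in> E_space"
 shows "(\<forall>t\<ge>0. V t \<in> E_space) \<and> (\<exists>z. (\<forall>n. classical (z n)) \<and> (\<lambda>n. Bop (z n 0)) \<longlonglongrightarrow> Phi M \<and>
  (\<forall>t\<ge>0. (\<lambda>n. Bop (z n t)) \<longlonglongrightarrow> Phi (V t)))"
proof -
 have VE: "V t \<in> E_space" if "t \<ge> 0" for t using V that by (auto simp: mild_solution_def C_curve_def)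
 obtain V0 Vn where Vn: "\<And>n. V0 n \<in> beam_domain L" "\<And>n. classical_solution L N A_op (V0 n) (Vn n)"
  and V0: "(\<lambda>n. N (V0 n - M)) \<longlonglongrightarrow> 0" and lim: "\<And>T. T > 0 ==> uniform_limit {0..T} (\<lambda>n t. N (Vn n t - V t)) (\<lambda>_. 0) sequentially"
  using V unfolding mild_solution_def by blast
 have V0E: "V0 n \<in> E_space" for n by (rule range_of_domain(1)[OF Vn(1)])
 have "\<exists>z. classical z \<and> (\<forall>t\<ge>0. Vn n t \<in> E_space \<and> Phi (Vn n t) = Bop (z t)) \<and> Phi (V0 n) = Bop (z 0)" for n
  by (rule classical_solutionD[OF N Vn(2) V0E])
 then obtain z where z: "\<And>n. classical (z n)" "\<And>n t. t \<ge> 0 ==> Vn n t \<in> E_space" "\<And>n t. t \<ge> 0 ==> Phi (Vn n t) = Bop (z n t)"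
  "\<And>n. Phi (V0 n) = Bop (z n 0)" by metis
 have "(\<lambda>n. Phi (V0 n - M)) \<longlonglongrightarrow> 0"
  using V0 by (subst (asm) norm_tendsto_zero_iff[OF N]) (auto intro!: always_eventually Phi_diff V0E M)
 then have z0: "(\<lambda>n. Bop (z n 0)) \<longlonglongrightarrow> Phi M" by (simp add: Phi_diff V0E M z(4) LIM_zero_iff)
 have "(\<lambda>n. Bop (z n t)) \<longlonglongrightarrow> Phi (V t)" if t: "t \<ge> 0" for t
 proof -
  have "(\<lambda>n. N (Vn n t - V t)) \<longlonglongrightarrow> 0"
   using tendsto_uniform_limitI[OF lim[of "t + 1"], of t] t by simp
  then have "(\<lambda>n. Phi (Vn n t - V t)) \<longlonglongrightarrow> 0"
   by (subst (asm) norm_tendsto_zero_iff[OF N]) (auto intro!: always_eventually Phi_diff z(2) VE t)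
  then show ?thesis by (simp add: Phi_diff z(2)[OF t] VE[OF t] z(3)[OF t] LIM_zero_iff)
 qed
 then show ?thesis using VE z(1) z0 by blast
qed

lemma mild_solution_unique:
 assumes N: "equivalent_norm N" and M: "M \<in> E_space"
  and U: "mild_solution L N A_op M U" and V: "mild_solution L N A_op M V" and t: "t \<ge> 0"
 shows "state_eq L (V t) (U t)"
proof -
 obtain y where y: "\<forall>n. classical (y n)" "(\<lambda>n. Bop (y n 0)) \<longlonglongrightarrow> Phi M" "\<forall>t\<ge>0. (\<lambda>n. Bop (y n t)) \<longlonglongrightarrow> Phi (U t)"
  using mild_solutionD[OF N U M] by auto
 obtain z where z: "\<forall>n. classical (z n)" "(\<lambda>n. Bop (z n 0)) \<longlonglongrightarrow> Phi M" "\<forall>t\<ge>0. (\<lambda>n. Bop (z n t)) \<longlonglongrightarrow> Phi (V t)"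
  using mild_solutionD[OF N V M] by auto
 have "Phi (V t) = Phi (U t)"
  by (rule classical_unique[of z y "Phi M" t]) (use y z t in auto)
 then show ?thesis using mild_solutionD[OF N U M] mild_solutionD[OF N V M] t by (simp add: state_eq_iff)
qed

text \<open>The curve is built as a limit of states. For a datum in the domain, uniqueness
  identifies it with the strong solution, whose continuous coordinates give continuity in the graph
  norm and of the time derivative.\<close>

theorem well_posed:
 assumes M: "M \<in> E_space"
 shows "\<exists>U. \<forall>N. equivalent_norm N -->
  mild_solution L N A_op M U \<and> (\<forall>V. mild_solution L N A_op M V --> (\<forall>t\<ge>0. state_eq L (V t) (U t))) \<and>
  (M \<in> beam_domain L --> classical_solution L N A_op M U \<and> C_curve (beam_domain L) (graph_norm N (A_op 0)) U \<and>
   C1_curve E_space N U)"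
proof -
 obtain u y where y: "\<forall>n. strong (y n)" "(\<lambda>n. Bop (y n 0)) \<longlonglongrightarrow> Phi M" and u: "continuous_on {0..} u" "\<forall>t\<ge>0. u t \<in> X" "u 0 = Phi M"
  and lim: "\<forall>T\<ge>0. uniform_limit {0..T} (\<lambda>n t. Bop (y n t)) u sequentially"
  using mild_exists[OF strong_data_dense range_dense[OF Phi_mem_X[OF M]]] by blast
 \<comment> \<open>States are functions and not classes, so one state is selected for each element
   of the Hilbert space; another selection changes it only within \<open>state_eq\<close>.\<close>
 define \<Psi> where "\<Psi> e = (SOME M. M \<in> E_space \<and> Phi M = e)" for e
 have \<Psi>: "\<Psi> e \<in> E_space" "Phi (\<Psi> e) = e" if "e \<in> X" for e
  using someI_ex[of "\<lambda>M. M \<in> E_space \<and> Phi M = e"] Phi_onto_X[OF that] unfolding \<Psi>_def by blast+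
 define U where "U t = \<Psi> (u t)" for t
 define V where "V n t = \<Psi> (Bop (y n t))" for n t
 have U: "U t \<in> E_space" "Phi (U t) = u t" if "t \<ge> 0" for t using \<Psi>[of "u t"] u(2) that by (simp_all add: U_def)
 have yX: "y n t \<in> X" if "t \<ge> 0" for n t using y(1) that by (simp add: strong_def)
 have V: "V n t \<in> E_space" "Phi (V n t) = Bop (y n t)" if "t \<ge> 0" for n t
  using \<Psi>[OF Bop_X[OF yX[OF that]]] by (simp_all add: V_def)
 have cl: "classical (y n)" for n using y(1) strong_classical by blast
 show ?thesis
 proof (intro exI[of _ U] allI impI conjI)
  fix N assume N: "equivalent_norm N"
  obtain c C where c: "0 < c" "0 < C" "\<And>M. M \<in> E_space ==> c * norm (Phi M) \<le> N M" "\<And>M. M \<in> E_space ==> N M \<le> C * norm (Phi M)"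
   using N unfolding equivalent_norm_def by auto
  have nn: "0 \<le> N M" if "M \<in> E_space" for M
   using c(3)[OF that] mult_nonneg_nonneg[OF less_imp_le[OF c(1)] norm_ge_zero[of "Phi M"]] by linarith
  have Uc: "C_curve E_space N U"
   unfolding C_curve_iff[OF N] using U u(1) by (auto intro: continuous_on_eq)
  show mild: "mild_solution L N A_op M U" unfolding mild_solution_def
  proof (intro conjI exI[of _ "\<lambda>n. V n 0"] exI[of _ V] allI impI)
   show "C_curve E_space N U" by (rule Uc)
   show "state_eq L (U 0) M" using U[of 0] u(3) M by (simp add: state_eq_iff)
   show "V n 0 \<in> beam_domain L" for n by (rule domain_of_range(1)[OF V(1)[of 0 n] yX[of 0 n] V(2)[of 0 n], of 0]) simp_all
   show "classical_solution L N A_op (V n 0) (V n)" for n by (rule classical_solutionI[OF N cl]) (use V in auto)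
   have "(\<lambda>n. Phi (V n 0 - M)) \<longlonglongrightarrow> 0" using y(2) V M by (simp add: Phi_diff LIM_zero_iff)
   then show "(\<lambda>n. N (V n 0 - M)) \<longlonglongrightarrow> 0"
    using V M by (subst norm_tendsto_zero_iff[OF N]) (auto intro!: always_eventually Phi_diff)
   fix T :: real assume T: "0 < T"
   show "uniform_limit {0..T} (\<lambda>n t. N (V n t - U t)) (\<lambda>_. 0) sequentially"
    unfolding uniform_limit_iff
   proof (intro allI impI)
    fix e :: real assume e: "0 < e"
    have "\<forall>\<^sub>F n in sequentially. \<forall>t\<in>{0..T}. dist (Bop (y n t)) (u t) < e / C"
     using lim T e c(2) unfolding uniform_limit_iff by simp
    then show "\<forall>\<^sub>F n in sequentially. \<forall>t\<in>{0..T}. dist (N (V n t - U t)) 0 < e"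
    proof eventually_elim
     case (elim n)
     show ?case
     proof
      fix t assume t: "t \<in> {0..T}"
      then have t0: "0 \<le> t" by simp
      have d: "V n t - U t \<in> E_space" "Phi (V n t - U t) = Bop (y n t) - u t" using Phi_diff[OF V(1)[OF t0] U(1)[OF t0]] V(2)[OF t0] U(2)[OF t0] by simp_all
      have "N (V n t - U t) \<le> C * dist (Bop (y n t)) (u t)" using c(4)[OF d(1)] by (simp add: d(2) dist_norm)
      also have "\<dots> < C * (e / C)" using elim t c(2) by (intro mult_strict_left_mono) auto
      finally show "dist (N (V n t - U t)) 0 < e" using nn[OF d(1)] c(2) by simp
     qed
    qed
   qed
  qed
  show "state_eq L (W t) (U t)" if "mild_solution L N A_op M W" "0 \<le> t" for W t
   by (rule mild_solution_unique[OF N M mild that])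
  assume "M \<in> beam_domain L"
  then obtain y0 where y0: "y0 \<in> X" "Phi M = Bop y0" using range_of_domain(2) by blast
  then obtain x where x: "strong x" "x 0 = y0" using strong_exists[OF strong_data_dense] by blast
  have xX: "x t \<in> X" if "t \<ge> 0" for t using x that by (simp add: strong_def)
  have ux: "Phi (U t) = Bop (x t)" if t: "t \<ge> 0" for t
  proof -
   have "(\<lambda>n. Bop (y n t)) \<longlonglongrightarrow> u t"
    using tendsto_uniform_limitI[OF lim[rule_format, of t], of t] t by simp
   then have "u t = Bop (x t)"
    using classical_unique[of y "\<lambda>_. x" "Phi M" t "u t" "Bop (x t)"] cl strong_classical[OF x(1)] y(2) y0(2) x(2) t by simp
   then show ?thesis using U(2)[OF t] by simp
  qed
  note dr = domain_of_range[OF U(1) xX ux]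
  show "classical_solution L N A_op M U"
   by (rule classical_solutionI[OF N strong_classical[OF x(1)]]) (use U ux M y0 x in auto)
  have xc: "continuous_on {0..} x" using x(1) by (simp add: strong_def)
  show "C_curve (beam_domain L) (graph_norm N (A_op 0)) U" unfolding C_curve_def
  proof (intro allI impI conjI)
   fix t :: real assume t: "0 \<le> t"
   show "U t \<in> beam_domain L" using dr(1)[OF t t t t] .
   \<comment> \<open>\<open>U s - U t\<close> is itself in the range of \<open>Bop\<close>, with
     coordinates \<open>x s - x t\<close>, so \<open>domain_of_range\<close> at time 0 turns the
     generator part of the graph norm into continuity of \<open>x\<close>.\<close>
   have "\<forall>\<^sub>F s in at0 t. A_op 0 (U s - U t) \<in> E_space \<and> Phi (A_op 0 (U s - U t)) = Cop 0 (x s) - Cop 0 (x t)"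
    using eventually_nonneg
   proof eventually_elim
    case (elim s)
    have "Phi (U s - U t) = Bop (x s - x t)"
     using Phi_diff(2)[OF U(1)[OF elim] U(1)[OF t]] ux[OF elim] ux[OF t] by (simp add: B.diff)
    from domain_of_range(2,3)[OF Phi_diff(1)[OF U(1)[OF elim] U(1)[OF t]] subspace_diff[OF subspace_X xX[OF elim] xX[OF t]] this order_refl]
    show ?case by (simp add: C_diff)
   qed
   note ev = this
   have "((\<lambda>s. Cop 0 (x s) - Cop 0 (x t)) \<longlongrightarrow> 0) (at0 t)"
    using xc t by (intro LIM_zero bounded_linear.tendsto[OF bounded_linear_Cop]) (simp add: continuous_on_def)
   then have "((\<lambda>s. Phi (A_op 0 (U s - U t))) \<longlongrightarrow> 0) (at0 t)"
    by (rule Lim_transform_eventually) (use ev in eventually_elim, simp)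
   then have "((\<lambda>s. N (A_op 0 (U s - U t))) \<longlongrightarrow> 0) (at0 t)"
    using eventually_mono[OF ev] by (subst norm_tendsto_zero_iff[OF N]) auto
   moreover have "((\<lambda>s. N (U s - U t)) \<longlongrightarrow> 0) (at0 t)" using Uc t by (simp add: C_curve_def)
   ultimately show "((\<lambda>s. graph_norm N (A_op 0) (U s - U t)) \<longlongrightarrow> 0) (at0 t)"
    unfolding graph_norm_def by (rule tendsto_add_zero[rotated])
  qed
  have WE: "A_op t (U t) \<in> E_space" "Phi (A_op t (U t)) = Cop t (x t)" if "t \<ge> 0" for t using dr(2,3)[OF that that that that] .
  show "C1_curve E_space N U" unfolding C1_curve_def
  proof (intro conjI exI[of _ "\<lambda>t. A_op t (U t)"] allI impI)
   show "C_curve E_space N U" by (rule Uc)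
   have "continuous_on {0..} (\<lambda>t. Cop t (x t))" using continuous_generator[of x] xX xc by blast
   then have "continuous_on {0..} (\<lambda>t. Phi (A_op t (U t)))" by (rule continuous_on_eq) (simp add: WE)
   then show "C_curve E_space N (\<lambda>t. A_op t (U t))" using WE by (simp add: C_curve_iff[OF N])
   fix t :: real assume t: "0 \<le> t"
   have "((\<lambda>t. Bop (x t)) has_vector_derivative Cop t (x t)) (at0 t)" using x(1) t by (simp add: strong_def)
   then have "((\<lambda>t. Phi (U t)) has_vector_derivative Cop t (x t)) (at0 t)"
    by (rule has_vector_derivative_transform[rotated 2]) (use t ux in auto)
   then show "has_curve_deriv N U (A_op t (U t)) t" using U WE t by (subst has_curve_deriv_iff[OF N]) auto
  qed
 qed
qed

end

section \<open>Lipschitz bounds from the regularity of the delay and the weights\<close>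

lemma Linf_L2: "u \<in> Linf 0 T ==> u \<in> L2 {0<..<T}"
proof -
 assume "u \<in> Linf 0 T"
 then obtain C where u: "u \<in> borel_measurable (lebesgue_on {0<..<T})" and C: "AE x in lebesgue_on {0<..<T}. \<bar>u x\<bar> \<le> C"
  by (auto simp: Linf_def)
 have "finite_measure (lebesgue_on {0<..<T})"
  using emeasure_bounded_finite[of "{0<..<T}"] by (intro finite_measureI) (simp add: emeasure_restrict_space)
 then have "integrable (lebesgue_on {0<..<T}) (\<lambda>x. (u x)\<^sup>2)"
 proof (rule finite_measure.integrable_const_bound[where B = "C\<^sup>2"])
  show "AE x in lebesgue_on {0<..<T}. norm ((u x)\<^sup>2) \<le> C\<^sup>2"
   using C by eventually_elim (use power_mono[of "\<bar>u _\<bar>" C 2] in auto)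
  show "(\<lambda>x. (u x)\<^sup>2) \<in> borel_measurable (lebesgue_on {0<..<T})" using u by measurable
 qed
 then show ?thesis using u by (simp add: L2_def)
qed

lemma prim_lipschitz:
 assumes m: "m \<in> sqi" and C: "AE x\<in>{0<..<T} in lborel. \<bar>m x\<bar> \<le> C" and st: "s \<in> {0..T}" "t \<in> {0..T}"
 shows "\<bar>prim m s - prim m t\<bar> \<le> C * \<bar>s - t\<bar>"
proof -
 have *: "\<bar>prim m y - prim m x\<bar> \<le> C * (y - x)" if "0 \<le> x" "x \<le> y" "y \<le> T" for x y
 proof -
  have "\<bar>prim m y - prim m x\<bar> \<le> (LINT s|lborel. \<bar>indicator {x<..<y} s * m s\<bar>)"
   using prim_increment[OF m that(1,2)] by (simp add: integral_abs_bound)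
  also have "\<dots> \<le> (LINT s|lborel. C * indicator {x<..<y} s)"
  proof (rule integral_mono_AE)
   show "integrable lborel (\<lambda>s. \<bar>indicator {x<..<y} s * m s\<bar>)" by (intro integrable_abs ind_mult_integrable m)
   show "integrable lborel (\<lambda>s. C * indicator {x<..<y} s)"
    using emeasure_bounded_finite[of "{x<..<y}"] by (intro integrable_mult_right integrable_real_indicator) auto
   show "AE s in lborel. \<bar>indicator {x<..<y} s * m s\<bar> \<le> C * indicator {x<..<y} s"
    using C by eventually_elim (use that in \<open>auto split: split_indicator\<close>)
  qed
  finally show ?thesis using that by simp
 qed
 show ?thesis using *[of s t] *[of t s] st by (cases s t rule: linorder_le_cases) (auto simp: abs_minus_commute)
qed

text \<open>The first weak derivative has a representative \<open>G\<close> that is a primitive of a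
  bounded function, hence Lipschitz. As \<open>u\<close> is a primitive of \<open>G\<close>, its
  classical derivative is \<open>G\<close>, one-sided at the end points.\<close>

lemma W2inf_derivative_lipschitz:
 assumes T: "0 < T" and u: "u \<in> W2inf T" and d: "\<And>t. t \<in> {0..T} ==> (u has_real_derivative u' t) (at t within {0..T})"
 shows "\<exists>K\<ge>0. \<forall>s\<in>{0..T}. \<forall>t\<in>{0..T}. \<bar>u' s - u' t\<bar> \<le> K * \<bar>s - t\<bar>"
proof -
 from u obtain g h where g: "g \<in> Linf 0 T" and h: "h \<in> Linf 0 T" and w: "has_weak_deriv 0 T u g" "has_weak_deriv 0 T g h"
  and uL: "u \<in> Linf 0 T" by (auto simp: W2inf_def)
 have "has_L2_deriv 0 T u g" "has_L2_deriv 0 T g h" using w Linf_L2 g h uL by (simp_all add: has_L2_deriv_def)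
 then obtain c k e m where k: "ac_on T u c k" "AE x\<in>{0<..<T} in lborel. g x = k x"
  and m: "ac_on T g e m" "AE x\<in>{0<..<T} in lborel. h x = m x"
  unfolding has_L2_deriv_iff[OF T] by (elim exE conjE)
 have sqn: "k \<in> sqi" "m \<in> sqi" using k m by (auto simp: ac_on_def)
 define G where "G x = e + prim m x" for x
 have Gc: "continuous_on {0..T} G" unfolding G_def[abs_def] by (rule ac_on_continuous[OF m(1)])
 have Gm: "G \<in> borel_fun" unfolding G_def[abs_def] using prim_measurable[OF sqn(2)] by measurable
 have uc: "continuous_on {0..T} u" using d by (intro DERIV_continuous_on)
 have u_eq: "u x = c + prim k x" if "x \<in> {0..T}" for x
  by (rule continuous_AE_eq[OF T uc ac_on_continuous[OF k(1)] _ that]) (use k(1) in \<open>simp add: ac_on_def\<close>)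
 have kG: "AE x in lborel. 0 < x \<and> x < T --> k x = G x"
  using k(2) m(1)[unfolded ac_on_def, THEN conjunct2] by eventually_elim (simp add: G_def)
 \<comment> \<open>The integral of the continuous \<open>G\<close> is an antiderivative on the
   closed interval, to which the Lebesgue primitive \<open>prim k\<close> is then compared.\<close>
 define P where "P x = integral {0..x} G" for x
 have P: "(P has_real_derivative G x) (at x within {0..T})" if "x \<in> {0..T}" for x
  unfolding P_def by (rule integral_has_real_derivative[OF Gc that])
 have Pc: "continuous_on {0..T} P" using P by (intro DERIV_continuous_on)
 obtain B where B: "\<And>x. x \<in> {0..T} ==> \<bar>G x\<bar> \<le> B"
  using continuous_abs_bounded[OF Gc] by blast
 have "prim k x = P x - P 0" if x: "x \<in> {0..T}" for x
 proof -
  have "prim k x = prim G x" by (rule prim_cong_AE[OF _ Gm kG]) (use sqn x in \<open>auto simp: sq_int_def\<close>)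
  also have "\<dots> = P x - P 0" unfolding prim_def
  proof (rule lborel_integral_ftc[where S = "{}"])
   show "continuous_on {0..x} P" by (rule continuous_on_subset[OF Pc]) (use x in auto)
   show "(P has_real_derivative G s) (at s)" if "s \<in> {0<..<x} - {}" for s
    using P[of s] at_within_interior[of s "{0..T}"] that x by auto
   show "\<bar>G s\<bar> \<le> B" if "s \<in> {0<..<x}" for s using B[of s] that x by simp
  qed (use x Gm in auto)
  finally show ?thesis .
 qed
 then have u_P: "u x = c - P 0 + P x" if "x \<in> {0..T}" for x using u_eq[OF that] that by simp
 have "u' x = G x" if x: "x \<in> {0..T}" for x
 proof -
  have "((\<lambda>x. c - P 0 + P x) has_real_derivative G x) (at x within {0..T})"
   by (auto intro!: derivative_eq_intros P[OF x])
  then have "(u has_real_derivative G x) (at x within {0..T})"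
   unfolding has_real_derivative_iff_has_vector_derivative
   by (rule has_vector_derivative_transform[rotated 2]) (use x u_P in auto)
  then show ?thesis using d[OF x] vector_derivative_unique_within_closed_interval[of 0 T x u "u' x" "G x"] T x
   by (simp add: has_real_derivative_iff_has_vector_derivative)
 qed
 moreover obtain C where "AE x in lebesgue_on {0<..<T}. \<bar>h x\<bar> \<le> C" using h by (auto simp: Linf_def)
 then have "AE x\<in>{0<..<T} in lborel. \<bar>h x\<bar> \<le> C" by (simp add: AE_lebesgue_on)
 with m(2) have "AE x\<in>{0<..<T} in lborel. \<bar>m x\<bar> \<le> max C 0" by eventually_elim auto
 from prim_lipschitz[OF sqn(2) this] have "\<bar>G s - G t\<bar> \<le> max C 0 * \<bar>s - t\<bar>" if "s \<in> {0..T}" "t \<in> {0..T}" for s t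
  using that by (simp add: G_def)
 ultimately show ?thesis by (intro exI[of _ "max C 0"]) auto
qed

lemma lipschitz_from_deriv:
 fixes f f' :: "real => real"
 assumes d: "\<And>t. t \<ge> 0 ==> (f has_real_derivative f' t) (at0 t)"
  and B: "\<And>t. t \<in> {0..T} ==> \<bar>f' t\<bar> \<le> B" and st: "s \<in> {0..T}" "t \<in> {0..T}"
 shows "\<bar>f s - f t\<bar> \<le> B * \<bar>s - t\<bar>"
 using field_differentiable_bound[of "{0..T}" f f' B s t] d B st has_field_derivative_subset[of f _ _ "{0..}" "{0..T}"] by auto

theorem theorem3p1:
  fixes L \<rho> \<alpha> \<alpha>\<^sub>1 \<gamma> \<mu> \<beta> \<tau>\<^sub>0 \<tau>_bar d M\<^sub>1 \<delta>\<^sub>0 \<beta>\<^sub>0 M\<^sub>2 \<xi>_bar :: real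
    and \<tau> \<tau>' \<delta>\<^sub>1 \<delta>\<^sub>1' \<delta>\<^sub>2 \<delta>\<^sub>2' :: "real \<Rightarrow> real"
    and v\<^sub>0 v\<^sub>1 p\<^sub>0 p\<^sub>1 :: "real \<Rightarrow> real"
    and g\<^sub>0 :: "real \<Rightarrow> real \<Rightarrow> real"
    and U\<^sub>0 :: state
  assumes "L > 0" "\<rho> > 0" "\<alpha> > 0" "\<alpha>\<^sub>1 > 0" "\<gamma> > 0" "\<mu> > 0" "\<beta> > 0"
    and "\<alpha> = \<alpha>\<^sub>1 + \<gamma>\<^sup>2 * \<beta>"
    and delay_bounds: "\<tau>\<^sub>0 > 0" "\<tau>_bar > 0" "\<forall>t>0. \<tau>\<^sub>0 \<le> \<tau> t \<and> \<tau> t \<le> \<tau>_bar"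
    and delay_deriv: "\<forall>t\<ge>0. (\<tau> has_real_derivative \<tau>' t) (at t within {0..})"
      "d < 1" "\<forall>t>0. \<tau>' t \<le> d"
    and delay_regular: "\<forall>T>0. \<tau> \<in> W2inf T"
    and weight1_C1: "\<forall>t\<ge>0. (\<delta>\<^sub>1 has_real_derivative \<delta>\<^sub>1' t) (at t within {0..})"
      "continuous_on {0..} \<delta>\<^sub>1'"
    and weight1_noninc: "antimono_on {0..} \<delta>\<^sub>1"
    and weight1_bounds: "M\<^sub>1 > 0" "\<delta>\<^sub>0 > 0" "\<forall>t\<ge>0. \<bar>\<delta>\<^sub>1' t / \<delta>\<^sub>1 t\<bar> \<le> M\<^sub>1 \<and> \<delta>\<^sub>0 \<le> \<delta>\<^sub>1 t"
    and weight2_C1: "\<forall>t\<ge>0. (\<delta>\<^sub>2 has_real_derivative \<delta>\<^sub>2' t) (at t within {0..})"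
      "continuous_on {0..} \<delta>\<^sub>2'"
    and weight2_bounds: "0 < \<beta>\<^sub>0" "\<beta>\<^sub>0 < sqrt (1 - d)" "M\<^sub>2 > 0"
      "\<forall>t\<ge>0. \<bar>\<delta>\<^sub>2 t\<bar> \<le> \<beta>\<^sub>0 * \<delta>\<^sub>1 t \<and> \<bar>\<delta>\<^sub>2' t\<bar> \<le> M\<^sub>2 * \<delta>\<^sub>1 t"
    and xi_bounds: "\<beta>\<^sub>0 / sqrt (1 - d) < \<xi>_bar" "\<xi>_bar < 2 - \<beta>\<^sub>0 / sqrt (1 - d)"
    and initial: "U\<^sub>0 = (v\<^sub>0, v\<^sub>1, p\<^sub>0, p\<^sub>1, \<lambda>(x, r). g\<^sub>0 x (- r * \<tau> 0))"
      "U\<^sub>0 \<in> energy_space L"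
  shows "\<exists>U. \<forall>s\<ge>0.
    (let N = energy_norm L \<rho> \<alpha>\<^sub>1 \<gamma> \<mu> \<beta> (\<lambda>t. \<xi>_bar * \<delta>\<^sub>1 t) \<tau> s;
         A = beam_op L \<rho> \<alpha> \<gamma> \<mu> \<beta> \<delta>\<^sub>1 \<delta>\<^sub>2 \<tau> \<tau>'
     in mild_solution L N A U\<^sub>0 U \<and>
        (\<forall>V. mild_solution L N A U\<^sub>0 V \<longrightarrow> (\<forall>t\<ge>0. state_eq L (V t) (U t))) \<and>
        (U\<^sub>0 \<in> beam_domain L \<longrightarrow>
           classical_solution L N A U\<^sub>0 U \<and>
           C_curve (beam_domain L) (graph_norm N (A 0)) U \<and>
           C1_curve (energy_space L) N U))"
proof -
 have lip: "\<exists>K\<ge>0. \<forall>s\<in>{0..T}. \<forall>t\<in>{0..T}. \<bar>\<tau>' s - \<tau>' t\<bar> \<le> K * \<bar>s - t\<bar>" if "T > 0" for T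
  by (rule W2inf_derivative_lipschitz[OF that delay_regular[rule_format, OF that]])
   (use delay_deriv(1) has_field_derivative_subset[of \<tau> _ _ "{0..}" "{0..T}"] in auto)
 have \<tau>c: "continuous_on {0..} \<tau>" by (rule DERIV_continuous_on) (use delay_deriv(1) in auto)
 have cl: "closure {0<..} = {0 :: real..}" by simp
 \<comment> \<open>The bounds are assumed for positive times and extend to 0 by continuity.\<close>
 have \<tau>_bounds: "\<tau>\<^sub>0 \<le> \<tau> t \<and> \<tau> t \<le> \<tau>_bar" if "t \<ge> 0" for t
  using continuous_ge_on_closure[of "{0<..}" \<tau> t \<tau>\<^sub>0] continuous_le_on_closure[of "{0<..}" \<tau> t \<tau>_bar] \<tau>c delay_bounds(3) that
  unfolding cl by auto
 \<comment> \<open>At time 0 this is again a limit; continuity of \<open>\<tau>'\<close> comes from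
   its Lipschitz bound.\<close>
 have \<tau>'_le: "\<tau>' t \<le> d" if "t \<ge> 0" for t
 proof (cases "t = 0")
  case True
  obtain K where K: "K \<ge> 0" "\<And>s t. s \<in> {0..1} ==> t \<in> {0..1} ==> \<bar>\<tau>' s - \<tau>' t\<bar> \<le> K * \<bar>s - t\<bar>" using lip[of 1] by auto
  have "continuous_on {0..1} \<tau>'"
   by (rule lipschitz_on_continuous_on[of K]) (auto simp: lipschitz_on_def dist_real_def K)
  then show ?thesis
   using continuous_le_on_closure[of "{0<..<1}" \<tau>' 0 d] delay_deriv(3) True by auto
 qed (use that delay_deriv(3) in auto)
 define A where "A = \<delta>\<^sub>1 0"
 have \<delta>1: "0 < \<delta>\<^sub>1 t" "\<delta>\<^sub>1 t \<le> A" if "t \<ge> 0" for t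
  using weight1_bounds(2,3) that monotone_onD[OF weight1_noninc, of 0 t] by (auto simp: A_def intro: less_le_trans)
 have \<delta>1': "\<bar>\<delta>\<^sub>1' t\<bar> \<le> M\<^sub>1 * A" if "t \<ge> 0" for t
 proof -
  have "\<bar>\<delta>\<^sub>1' t\<bar> / \<delta>\<^sub>1 t \<le> M\<^sub>1" using weight1_bounds(3) \<delta>1(1)[OF that] that by (auto simp: abs_divide)
  then have "\<bar>\<delta>\<^sub>1' t\<bar> \<le> M\<^sub>1 * \<delta>\<^sub>1 t" using \<delta>1(1)[OF that] by (simp add: pos_divide_le_eq)
  also have "\<dots> \<le> M\<^sub>1 * A" using \<delta>1(2)[OF that] weight1_bounds(1) by (intro mult_left_mono) auto
  finally show ?thesis .
 qed
 have \<delta>2: "\<bar>\<delta>\<^sub>2 t\<bar> \<le> \<beta>\<^sub>0 * A" "\<bar>\<delta>\<^sub>2' t\<bar> \<le> M\<^sub>2 * A" if "t \<ge> 0" for t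
  using weight2_bounds(4) that mult_left_mono[OF \<delta>1(2)[OF that], of \<beta>\<^sub>0] mult_left_mono[OF \<delta>1(2)[OF that], of M\<^sub>2] weight2_bounds(1,3)
  by (auto intro: order_trans)
 have A: "0 < A" using \<delta>1(1)[of 0] by (simp add: A_def)
 \<comment> \<open>A common bound for both weights: the first does not exceed its initial value
   \<open>A\<close>, and \<open>\<beta>\<^sub>0\<close> times the first dominates the
   second.\<close>
 define D where "D = A + \<beta>\<^sub>0 * A"
 have xi: "0 < \<xi>_bar"
 proof -
  have "0 \<le> \<beta>\<^sub>0 / sqrt (1 - d)" using weight2_bounds(1) delay_deriv(2) by simp
  then show ?thesis using xi_bounds(1) by linarith
 qed
 have \<tau>\<^sub>0_pos: "0 < \<tau>\<^sub>0" by (rule delay_bounds(1))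
 interpret beam_transfer L \<rho> \<alpha>\<^sub>1 \<gamma> \<mu> \<beta> \<tau>\<^sub>0 \<tau>_bar d D \<tau> \<tau>' \<delta>\<^sub>1 \<delta>\<^sub>2 \<alpha>
 proof (unfold_locales, goal_cases)
  \<comment> \<open>Goals 11, 13 and 14 are the differentiability of the delay, the bound on the
    weights and the local Lipschitz condition.\<close>
  case (11 t) then show ?case using delay_deriv(1) by simp
 next
  case (13 t) then show ?case using \<delta>1[of t] \<delta>2[of t] A weight2_bounds(1) by (auto simp: D_def intro: add_increasing add_increasing2)
 next
  case (14 T)
  \<comment> \<open>The horizon may be 0, whereas the Sobolev hypothesis speaks of positive
    lengths.\<close>
  then have T: "0 < T + 1" by simp
  obtain K where K: "K \<ge> 0" "\<And>s t. s \<in> {0..T+1} ==> t \<in> {0..T+1} ==> \<bar>\<tau>' s - \<tau>' t\<bar> \<le> K * \<bar>s - t\<bar>"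
   using lip[OF T] by auto
  define B where "B = \<bar>\<tau>' 0\<bar> + K * (T + 1)"
  have \<tau>': "\<bar>\<tau>' t\<bar> \<le> B" if "t \<in> {0..T}" for t
   using K(2)[of t 0] mult_left_mono[OF _ K(1), of t "T + 1"] that 14 by (auto simp: B_def)
  \<comment> \<open>One constant for four functions: derivative bounds for \<open>\<tau>\<close> and
    both weights, and the Lipschitz constant of \<open>\<tau>'\<close>.\<close>
  define K' where "K' = B + K + M\<^sub>1 * A + M\<^sub>2 * A"
  have B: "0 \<le> B" using K(1) 14 by (simp add: B_def)
  have M: "0 \<le> M\<^sub>1 * A" "0 \<le> M\<^sub>2 * A" using A weight1_bounds(1) weight2_bounds(3) by simp_all
  have K'_ge: "B \<le> K'" "K \<le> K'" "M\<^sub>1 * A \<le> K'" "M\<^sub>2 * A \<le> K'" "0 \<le> K'" using B M K(1) unfolding K'_def by linarith+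
  show ?case
  proof (rule exI[of _ K'], intro conjI ballI)
   fix s t assume st: "s \<in> {0..T}" "t \<in> {0..T}"
   have up: "x \<le> K' * \<bar>s - t\<bar>" if "x \<le> k * \<bar>s - t\<bar>" "k \<le> K'" for x k
    using that mult_right_mono[OF that(2), of "\<bar>s - t\<bar>"] by linarith
   show "\<bar>\<tau> s - \<tau> t\<bar> \<le> K' * \<bar>s - t\<bar>"
    by (rule up[OF lipschitz_from_deriv[where f' = \<tau>' and T = T] K'_ge(1)]) (use delay_deriv(1) \<tau>' st in auto)
   show "\<bar>\<tau>' s - \<tau>' t\<bar> \<le> K' * \<bar>s - t\<bar>" by (rule up[OF K(2) K'_ge(2)]) (use st in auto)
   show "\<bar>\<delta>\<^sub>1 s - \<delta>\<^sub>1 t\<bar> \<le> K' * \<bar>s - t\<bar>"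
    by (rule up[OF lipschitz_from_deriv[where f' = \<delta>\<^sub>1' and T = T] K'_ge(3)]) (use weight1_C1(1) \<delta>1' st in auto)
   show "\<bar>\<delta>\<^sub>2 s - \<delta>\<^sub>2 t\<bar> \<le> K' * \<bar>s - t\<bar>"
    by (rule up[OF lipschitz_from_deriv[where f' = \<delta>\<^sub>2' and T = T] K'_ge(4)]) (use weight2_C1(1) \<delta>2 st in auto)
  qed (rule K'_ge)
 qed (use assms \<tau>_bounds \<tau>'_le in auto)
 have "equivalent_norm (energy_norm L \<rho> \<alpha>\<^sub>1 \<gamma> \<mu> \<beta> (\<lambda>t. \<xi>_bar * \<delta>\<^sub>1 t) \<tau> s)" if "s \<ge> 0" for s
  unfolding equivalent_norm_def
  by (rule energy_norm_equiv) (use xi \<delta>1(1)[OF that] \<tau>_bounds[OF that] \<tau>\<^sub>0_pos in auto)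
 moreover obtain U where "\<forall>N. equivalent_norm N -->
  mild_solution L N A_op U\<^sub>0 U \<and> (\<forall>V. mild_solution L N A_op U\<^sub>0 V --> (\<forall>t\<ge>0. state_eq L (V t) (U t))) \<and>
  (U\<^sub>0 \<in> beam_domain L --> classical_solution L N A_op U\<^sub>0 U \<and> C_curve (beam_domain L) (graph_norm N (A_op 0)) U \<and>
   C1_curve E_space N U)"
  using well_posed[OF initial(2)] by auto
 ultimately show ?thesis unfolding Let_def by (intro exI[of _ U]) blast
qed

end
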